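(* Let $e\ge 0$ and let $(X_e,\mathcal{O}_{X_e}(h))$, with $h=aC_0+bf$ very ample, be a polarized Hirzebruch surface. (1) Let $\delta,\tau$ be non-negative integers and $\gamma$ a positive integer with $\delta+\tau>\gamma$, and let $$\phi:\mathcal{O}_{X_e}(a-1,b-e-1)^{\gamma}\to \mathcal{O}_{X_e}(a-1,b-e)^{\delta}\oplus\mathcal{O}_{X_e}(a,b-1)^{\tau}$$ be an injective map. Put $r=\delta+\tau-\gamma$ and let $E$ be the cokernel of $\phi$; in particular $c_1(E)=\alpha C_0+\beta f$ with $\alpha=\tau+r(a-1)$ and $\beta=r(b-1)+\delta-e(r-\tau)$. If $c_1(E)\cdot h=\frac r2(3h^2+h\cdot K_{X_e})$, then $E$ is an Ulrich bundle with respect to $h$ if and only if $H^2(X_e,E(-2h))=0$. (2) Let $\lambda,\mu$ be non-negative integers and $\nu$ a positive integer with $\lambda+\mu>\nu$, and let $$\psi:\mathcal{O}_{X_e}(2a-1,2b-2)^{\lambda}\oplus\mathcal{O}_{X_e}(2a-2,2b-1-e)^{\mu}\to\mathcal{O}_{X_e}(2a-1,2b-1)^{\nu}$$ be a surjective map. Put $r=\lambda+\mu-\nu$ and let $E$ be the kernel of $\psi$; in particular $c_1(E)=\alpha C_0+\beta f$ with $\alpha=r(2a-1)-\mu$ and $\beta=r(2b-1-e)-\lambda-e(\mu-r)$. If $c_1(E)\cdot h=\frac r2(3h^2+h\cdot K_{X_e})$, then $E$ is an Ulrich bundle with respect to $h$ if and only if $H^0(X_e,E(-h))=0$.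
   Context: The base field $k$ is algebraically closed of characteristic $0$. For $e\ge 0$, $X_e=\mathbb{P}(\mathcal{O}_{\mathbb{P}^1}\oplus\mathcal{O}_{\mathbb{P}^1}(-e))$ with projection $\pi:X_e\to\mathbb{P}^1$ is the Hirzebruch surface with invariant $e$. $\operatorname{Pic}(X_e)$ is freely generated by the class $C_0$ of a section and the class $f$ of a fibre, with $C_0^2=-e$, $C_0f=1$, $f^2=0$; the canonical divisor is $K_{X_e}=-2C_0-(2+e)f$. One writes $\mathcal{O}_{X_e}(s,t)=\mathcal{O}_{X_e}(sC_0+tf)$. A divisor $aC_0+bf$ is very ample iff $a>0$ and $b>ae$; a polarization is such a very ample divisor. For a line bundle $L$, $L^n$ denotes the direct sum of $n$ copies of $L$. A vector bundle $E$ on $X_e$ is Ulrich with respect to $h$ if $H^0(E(-h))=H^1(E(-h))=H^1(E(-2h))=H^2(E(-2h))=0$. *)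

theory Defs
  imports
    "HOL-Library.Product_Plus"
    "HOL-Computational_Algebra.Polynomial"
    "HOL-Algebra.Module"
begin

section \<open>The Hirzebruch surface as a variety\<close>

text \<open>
  The bundle P(O + O(-e)) over the projective line is obtained from the two copies
  x0 = 1 and x1 = 1 of (affine line) x (projective line with coordinates y0 : y1) by the gluing
  (y0 : y1) = (y0 : (x1/x0)^e y1).  In other words it is the quotient of
  (k^2 - 0) x (k^2 - 0) by the action of (k - 0) x (k - 0) below.  A point of the surface is an
  orbit, i.e. a set of quadruples (x0, x1, y0, y1); an open set is a set of orbits.
\<close>

type_synonym 'k cox = "'k \<times> 'k \<times> 'k \<times> 'k"
type_synonym 'k pointset = "'k cox set set"

definition torus_orbit :: "nat \<Rightarrow> 'k::field cox \<Rightarrow> 'k cox set" where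
  "torus_orbit e = (\<lambda>(x0, x1, y0, y1).
     {(l * x0, l * x1, m * y0, l ^ e * m * y1) | l m. l \<noteq> 0 \<and> m \<noteq> 0})"

definition hirzebruch :: "nat \<Rightarrow> 'k::field pointset" where
  "hirzebruch e =
     torus_orbit e ` {(x0, x1, y0, y1). (x0, x1) \<noteq> (0, 0) \<and> (y0, y1) \<noteq> (0, 0)}"

text \<open>
  A divisor class s C0 + t f is written as the pair (s, t).  The fibre f is the divisor x0 = 0,
  the section C0 is y0 = 0, and y1 = 0 is a section linearly equivalent to C0 + e f, disjoint
  from C0.  Hence x0, x1 have degree (0, 1), y0 has degree (1, 0) and y1 has degree (1, e).
  As k is infinite, polynomials are identified with polynomial functions.
\<close>

type_synonym divclass = "int \<times> int"

definition cox_form :: "nat \<Rightarrow> divclass \<Rightarrow> ('k::field cox \<Rightarrow> 'k) \<Rightarrow> bool" where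
  "cox_form e D F \<longleftrightarrow> (\<exists>c :: nat \<times> nat \<times> nat \<times> nat \<Rightarrow> 'k.
     F = (\<lambda>(x0, x1, y0, y1).
       \<Sum>(i, j, k, l) \<in> {(i, j, k, l). int k + int l = fst D \<and>
                                 int i + int j + int e * int l = snd D}.
         c (i, j, k, l) * x0 ^ i * x1 ^ j * y0 ^ k * y1 ^ l))"

definition zopen :: "nat \<Rightarrow> 'k::field pointset \<Rightarrow> bool" where
  "zopen e U \<longleftrightarrow> (\<exists>S. (\<forall>F\<in>S. \<exists>D. cox_form e D F) \<and>
     U = {P \<in> hirzebruch e. \<exists>F\<in>S. \<forall>p\<in>P. F p \<noteq> 0})"

definition intersection :: "nat \<Rightarrow> divclass \<Rightarrow> divclass \<Rightarrow> int" where
  "intersection e = (\<lambda>(s, t) (s', t'). - int e * s * s' + s * t' + t * s')"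

definition canonical :: "nat \<Rightarrow> divclass" where
  "canonical e = (- 2, - (2 + int e))"


section \<open>Sheaves of modules\<close>

text \<open>
  The sections of O(s, t) over U are the functions on the cone over U which are locally quotients
  of forms, of total degree (s, t); the rational function G/H corresponds to
  (G/H) / (y0^s x0^t).  Functions are extended by 0 outside the cone.
\<close>

definition line_sections :: "nat \<Rightarrow> divclass \<Rightarrow> 'k::field pointset \<Rightarrow> ('k cox \<Rightarrow> 'k) set" where
  "line_sections e D U = {F. (\<forall>p. p \<notin> \<Union>U \<longrightarrow> F p = 0) \<and>
     (\<forall>P\<in>U. \<exists>V D' G H. zopen e V \<and> P \<in> V \<and> V \<subseteq> U \<and> cox_form e (D + D') G \<and> cox_form e D' H \<and>
        (\<forall>p\<in>\<Union>V. H p \<noteq> 0 \<and> F p = G p / H p))}"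

text \<open>
  The fields \<open>mult\<close> and \<open>one\<close> of the library record for modules are meaningless, except
  for the structure sheaf O(0, 0), which also serves as sheaf of rings.
\<close>

record ('k, 'm) msheaf =
  sect :: "'k pointset \<Rightarrow> ('k cox \<Rightarrow> 'k, 'm) module"
  rest :: "'k pointset \<Rightarrow> 'k pointset \<Rightarrow> 'm \<Rightarrow> 'm"

definition OX :: "nat \<Rightarrow> divclass \<Rightarrow> ('k::field, 'k cox \<Rightarrow> 'k) msheaf" where
  "OX e D =
    \<lparr> sect = (\<lambda>U.
        \<lparr> carrier = line_sections e D U,
          mult = (\<lambda>F G p. F p * G p),
          one = (\<lambda>p. if p \<in> \<Union>U then 1 else 0),
          zero = (\<lambda>p. 0),
          add = (\<lambda>F G p. F p + G p),
          smult = (\<lambda>F G p. F p * G p) \<rparr>),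
      rest = (\<lambda>U V F p. if p \<in> \<Union>V then F p else 0) \<rparr>"

definition is_msheaf :: "nat \<Rightarrow> ('k::field, 'm) msheaf \<Rightarrow> bool" where
  "is_msheaf e F \<longleftrightarrow>
     (\<forall>U. zopen e U \<longrightarrow> Module.module (sect (OX e 0) U) (sect F U)) \<and>
     (\<forall>U V. zopen e U \<and> zopen e V \<and> V \<subseteq> U \<longrightarrow>
        (\<forall>s \<in> carrier (sect F U). rest F U V s \<in> carrier (sect F V)) \<and>
        (\<forall>s \<in> carrier (sect F U). \<forall>t \<in> carrier (sect F U).
           rest F U V (s \<oplus>\<^bsub>sect F U\<^esub> t) = rest F U V s \<oplus>\<^bsub>sect F V\<^esub> rest F U V t) \<and>
        (\<forall>f \<in> carrier (sect (OX e 0) U). \<forall>s \<in> carrier (sect F U).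
           rest F U V (f \<odot>\<^bsub>sect F U\<^esub> s) = rest (OX e 0) U V f \<odot>\<^bsub>sect F V\<^esub> rest F U V s)) \<and>
     (\<forall>U. zopen e U \<longrightarrow> (\<forall>s \<in> carrier (sect F U). rest F U U s = s)) \<and>
     (\<forall>U V W. zopen e U \<and> zopen e V \<and> zopen e W \<and> W \<subseteq> V \<and> V \<subseteq> U \<longrightarrow>
        (\<forall>s \<in> carrier (sect F U). rest F V W (rest F U V s) = rest F U W s)) \<and>
     (\<forall>\<V> s. (\<forall>V\<in>\<V>. zopen e V \<and> s V \<in> carrier (sect F V)) \<and>
        (\<forall>V\<in>\<V>. \<forall>W\<in>\<V>. rest F V (V \<inter> W) (s V) = rest F W (V \<inter> W) (s W)) \<longrightarrow>
        (\<exists>!t. t \<in> carrier (sect F (\<Union>\<V>)) \<and> (\<forall>V\<in>\<V>. rest F (\<Union>\<V>) V t = s V)))"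

type_synonym ('k, 'm, 'n) mor = "'k pointset \<Rightarrow> 'm \<Rightarrow> 'n"

definition is_mor_on ::
  "nat \<Rightarrow> 'k::field pointset \<Rightarrow> ('k, 'm) msheaf \<Rightarrow> ('k, 'n) msheaf \<Rightarrow> ('k, 'm, 'n) mor \<Rightarrow> bool" where
  "is_mor_on e U F G \<phi> \<longleftrightarrow>
     (\<forall>V. zopen e V \<and> V \<subseteq> U \<longrightarrow>
        (\<forall>s \<in> carrier (sect F V). \<phi> V s \<in> carrier (sect G V)) \<and>
        (\<forall>s \<in> carrier (sect F V). \<forall>t \<in> carrier (sect F V).
           \<phi> V (s \<oplus>\<^bsub>sect F V\<^esub> t) = \<phi> V s \<oplus>\<^bsub>sect G V\<^esub> \<phi> V t) \<and>
        (\<forall>f \<in> carrier (sect (OX e 0) V). \<forall>s \<in> carrier (sect F V).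
           \<phi> V (f \<odot>\<^bsub>sect F V\<^esub> s) = f \<odot>\<^bsub>sect G V\<^esub> \<phi> V s)) \<and>
     (\<forall>V W. zopen e V \<and> zopen e W \<and> W \<subseteq> V \<and> V \<subseteq> U \<longrightarrow>
        (\<forall>s \<in> carrier (sect F V). \<phi> W (rest F V W s) = rest G V W (\<phi> V s)))"

abbreviation is_mor ::
  "nat \<Rightarrow> ('k::field, 'm) msheaf \<Rightarrow> ('k, 'n) msheaf \<Rightarrow> ('k, 'm, 'n) mor \<Rightarrow> bool" where
  "is_mor e \<equiv> is_mor_on e (hirzebruch e)"

definition injective_mor :: "nat \<Rightarrow> ('k::field, 'm) msheaf \<Rightarrow> ('k, 'm, 'n) mor \<Rightarrow> bool" where
  "injective_mor e F \<phi> \<longleftrightarrow> (\<forall>U. zopen e U \<longrightarrow> inj_on (\<phi> U) (carrier (sect F U)))"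

definition locally_in_image ::
  "nat \<Rightarrow> ('k::field, 'm) msheaf \<Rightarrow> ('k, 'n) msheaf \<Rightarrow> ('k, 'm, 'n) mor \<Rightarrow> 'k pointset \<Rightarrow> 'n \<Rightarrow> bool"
where
  "locally_in_image e F G \<phi> U t \<longleftrightarrow> (\<forall>P\<in>U. \<exists>V. zopen e V \<and> P \<in> V \<and> V \<subseteq> U \<and>
     (\<exists>s \<in> carrier (sect F V). \<phi> V s = rest G U V t))"

definition surjective_mor ::
  "nat \<Rightarrow> ('k::field, 'm) msheaf \<Rightarrow> ('k, 'n) msheaf \<Rightarrow> ('k, 'm, 'n) mor \<Rightarrow> bool" where
  "surjective_mor e F G \<phi> \<longleftrightarrow>
     (\<forall>U. zopen e U \<longrightarrow> (\<forall>t \<in> carrier (sect G U). locally_in_image e F G \<phi> U t))"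

definition is_cokernel ::
  "nat \<Rightarrow> ('k::field, 'm) msheaf \<Rightarrow> ('k, 'n) msheaf \<Rightarrow> ('k, 'm, 'n) mor
     \<Rightarrow> ('k, 'l) msheaf \<Rightarrow> ('k, 'n, 'l) mor \<Rightarrow> bool" where
  "is_cokernel e F G \<phi> E q \<longleftrightarrow> is_msheaf e E \<and> is_mor e G E q \<and> surjective_mor e G E q \<and>
     (\<forall>U. zopen e U \<longrightarrow> (\<forall>t \<in> carrier (sect G U).
        q U t = \<zero>\<^bsub>sect E U\<^esub> \<longleftrightarrow> locally_in_image e F G \<phi> U t))"

definition is_kernel ::
  "nat \<Rightarrow> ('k::field, 'm) msheaf \<Rightarrow> ('k, 'n) msheaf \<Rightarrow> ('k, 'm, 'n) mor
     \<Rightarrow> ('k, 'l) msheaf \<Rightarrow> ('k, 'l, 'm) mor \<Rightarrow> bool" where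
  "is_kernel e F G \<psi> E j \<longleftrightarrow> is_msheaf e E \<and> is_mor e E F j \<and> injective_mor e E j \<and>
     (\<forall>U. zopen e U \<longrightarrow> (\<forall>s \<in> carrier (sect F U).
        \<psi> U s = \<zero>\<^bsub>sect G U\<^esub> \<longleftrightarrow> s \<in> j U ` carrier (sect E U)))"

definition dsum :: "('k::field, 'm) msheaf list \<Rightarrow> ('k, nat \<Rightarrow> 'm) msheaf" where
  "dsum Fs =
    \<lparr> sect = (\<lambda>U.
        \<lparr> carrier = (\<Pi>\<^sub>E i\<in>{..<length Fs}. carrier (sect (Fs ! i) U)),
          mult = undefined,
          one = undefined,
          zero = (\<lambda>i\<in>{..<length Fs}. \<zero>\<^bsub>sect (Fs ! i) U\<^esub>),
          add = (\<lambda>s t. \<lambda>i\<in>{..<length Fs}. s i \<oplus>\<^bsub>sect (Fs ! i) U\<^esub> t i),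
          smult = (\<lambda>f s. \<lambda>i\<in>{..<length Fs}. f \<odot>\<^bsub>sect (Fs ! i) U\<^esub> s i) \<rparr>),
      rest = (\<lambda>U V s. \<lambda>i\<in>{..<length Fs}. rest (Fs ! i) U V (s i)) \<rparr>"

abbreviation split_bundle :: "nat \<Rightarrow> divclass list \<Rightarrow> ('k::field, nat \<Rightarrow> 'k cox \<Rightarrow> 'k) msheaf" where
  "split_bundle e Ds \<equiv> dsum (map (OX e) Ds)"

definition vector_bundle :: "nat \<Rightarrow> ('k::field, 'm) msheaf \<Rightarrow> bool" where
  "vector_bundle e E \<longleftrightarrow> is_msheaf e E \<and>
     (\<exists>n. \<forall>P \<in> hirzebruch e. \<exists>U \<phi>. zopen e U \<and> P \<in> U \<and>
        is_mor_on e U (split_bundle e (replicate n 0)) E \<phi> \<and>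
        (\<forall>V. zopen e V \<and> V \<subseteq> U \<longrightarrow>
           bij_betw (\<phi> V) (carrier (sect (split_bundle e (replicate n 0)) V)) (carrier (sect E V))))"

text \<open>
  The internal Hom sheaf: a section over U is a morphism from F restricted to U to G restricted
  to U, made extensional in both arguments.
\<close>

definition sheaf_Hom ::
  "nat \<Rightarrow> ('k::field, 'm) msheaf \<Rightarrow> ('k, 'n) msheaf \<Rightarrow> ('k, ('k, 'm, 'n) mor) msheaf" where
  "sheaf_Hom e F G =
    (let dom = (\<lambda>U V s. zopen e V \<and> V \<subseteq> U \<and> s \<in> carrier (sect F V)) in
    \<lparr> sect = (\<lambda>U.
        \<lparr> carrier = {\<phi>. is_mor_on e U F G \<phi> \<and> (\<forall>V s. \<not> dom U V s \<longrightarrow> \<phi> V s = undefined)},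
          mult = undefined,
          one = undefined,
          zero = (\<lambda>V s. if dom U V s then \<zero>\<^bsub>sect G V\<^esub> else undefined),
          add = (\<lambda>\<phi> \<psi> V s. if dom U V s then \<phi> V s \<oplus>\<^bsub>sect G V\<^esub> \<psi> V s else undefined),
          smult = (\<lambda>f \<phi> V s. if dom U V s
                    then rest (OX e 0) U V f \<odot>\<^bsub>sect G V\<^esub> \<phi> V s else undefined) \<rparr>),
      rest = (\<lambda>U W \<phi> V s. if dom W V s then \<phi> V s else undefined) \<rparr>)"

text \<open>
  The twist E(D), i.e. E tensored with the invertible sheaf O(D), is realised as
  Hom(O(-D), E); this is the tensor product with the dual of O(-D).
\<close>

definition twist ::
  "nat \<Rightarrow> divclass \<Rightarrow> ('k::field, 'm) msheaf \<Rightarrow> ('k, ('k, 'k cox \<Rightarrow> 'k, 'm) mor) msheaf" where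
  "twist e D E = sheaf_Hom e (OX e (- D)) E"


section \<open>Cohomology\<close>

text \<open>
  Cech cohomology of the space, in the sense of Serre (Faisceaux algebriques coherents): the direct
  limit over all open coverings, ordered by refinement, of the cohomology of the coverings.  For
  coherent sheaves it agrees with derived functor cohomology.  A covering is a set of open sets
  (indexed by itself), and a q-cochain is a function on lists of q + 1 members of the covering.
\<close>

definition open_cover :: "nat \<Rightarrow> 'k::field pointset set \<Rightarrow> bool" where
  "open_cover e \<U> \<longleftrightarrow> (\<forall>U\<in>\<U>. zopen e U) \<and> \<Union>\<U> = hirzebruch e"

definition simplices :: "nat \<Rightarrow> 'k pointset set \<Rightarrow> 'k pointset list set" where
  "simplices q \<U> = {\<sigma>. length \<sigma> = Suc q \<and> set \<sigma> \<subseteq> \<U>}"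

definition cochains ::
  "('k::field, 'm) msheaf \<Rightarrow> 'k pointset set \<Rightarrow> nat \<Rightarrow> ('k pointset list \<Rightarrow> 'm) set" where
  "cochains F \<U> q = {c. \<forall>\<sigma> \<in> simplices q \<U>. c \<sigma> \<in> carrier (sect F (\<Inter>(set \<sigma>)))}"

definition face :: "nat \<Rightarrow> 'a list \<Rightarrow> 'a list" where
  "face j \<sigma> = take j \<sigma> @ drop (Suc j) \<sigma>"

definition cech_d ::
  "('k::field, 'm) msheaf \<Rightarrow> ('k pointset list \<Rightarrow> 'm) \<Rightarrow> 'k pointset list \<Rightarrow> 'm" where
  "cech_d F c \<sigma> =
     (\<Oplus>\<^bsub>sect F (\<Inter>(set \<sigma>))\<^esub> j \<in> {..<length \<sigma>}.
        (let x = rest F (\<Inter>(set (face j \<sigma>))) (\<Inter>(set \<sigma>)) (c (face j \<sigma>))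
         in if even j then x else \<ominus>\<^bsub>sect F (\<Inter>(set \<sigma>))\<^esub> x))"

definition cocycles ::
  "('k::field, 'm) msheaf \<Rightarrow> 'k pointset set \<Rightarrow> nat \<Rightarrow> ('k pointset list \<Rightarrow> 'm) set" where
  "cocycles F \<U> q = {c \<in> cochains F \<U> q.
     \<forall>\<sigma> \<in> simplices (Suc q) \<U>. cech_d F c \<sigma> = \<zero>\<^bsub>sect F (\<Inter>(set \<sigma>))\<^esub>}"

fun coboundaries ::
  "('k::field, 'm) msheaf \<Rightarrow> 'k pointset set \<Rightarrow> nat \<Rightarrow> ('k pointset list \<Rightarrow> 'm) set" where
  "coboundaries F \<U> 0 = {c. \<forall>\<sigma> \<in> simplices 0 \<U>. c \<sigma> = \<zero>\<^bsub>sect F (\<Inter>(set \<sigma>))\<^esub>}"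
| "coboundaries F \<U> (Suc q) =
     {c. \<exists>b \<in> cochains F \<U> q. \<forall>\<sigma> \<in> simplices (Suc q) \<U>. c \<sigma> = cech_d F b \<sigma>}"

definition refines_by ::
  "'k pointset set \<Rightarrow> 'k pointset set \<Rightarrow> ('k pointset \<Rightarrow> 'k pointset) \<Rightarrow> bool" where
  "refines_by \<V> \<U> \<rho> \<longleftrightarrow> (\<forall>V\<in>\<V>. \<rho> V \<in> \<U> \<and> V \<subseteq> \<rho> V)"

definition pull ::
  "('k::field, 'm) msheaf \<Rightarrow> ('k pointset \<Rightarrow> 'k pointset) \<Rightarrow> ('k pointset list \<Rightarrow> 'm)
     \<Rightarrow> 'k pointset list \<Rightarrow> 'm" where
  "pull F \<rho> c \<sigma> = rest F (\<Inter>(set (map \<rho> \<sigma>))) (\<Inter>(set \<sigma>)) (c (map \<rho> \<sigma>))"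

text \<open>
  The q-th cohomology group vanishes: every class of every covering dies in the direct limit.
\<close>

definition cohomology_zero :: "nat \<Rightarrow> nat \<Rightarrow> ('k::field, 'm) msheaf \<Rightarrow> bool" where
  "cohomology_zero e q F \<longleftrightarrow>
     (\<forall>\<U>. open_cover e \<U> \<longrightarrow> (\<forall>c \<in> cocycles F \<U> q.
        \<exists>\<V> \<rho>. open_cover e \<V> \<and> refines_by \<V> \<U> \<rho> \<and> pull F \<rho> c \<in> coboundaries F \<V> q))"


section \<open>Very ample divisors, Ulrich bundles, Chern classes\<close>

definition proj_form :: "nat \<Rightarrow> nat \<Rightarrow> ((nat \<Rightarrow> 'k::field) \<Rightarrow> 'k) \<Rightarrow> bool" where
  "proj_form N d G \<longleftrightarrow> (\<exists>c. G = (\<lambda>z.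
     \<Sum>m \<in> {m :: nat \<Rightarrow> nat. (\<forall>i>N. m i = 0) \<and> (\<Sum>i\<le>N. m i) = d}. c m * (\<Prod>i\<le>N. z i ^ m i)))"

text \<open>
  O(h) is very ample iff it has global sections s_0, ..., s_N defining a closed immersion into
  projective N-space: they have no common zero, the map is injective with closed image, it is a
  homeomorphism onto its image, and regular functions on the surface are locally restrictions of
  regular functions on projective space.
\<close>

definition very_ample :: "'k::field itself \<Rightarrow> nat \<Rightarrow> divclass \<Rightarrow> bool" where
  "very_ample T e h \<longleftrightarrow> (\<exists>(N::nat) (s :: nat \<Rightarrow> 'k cox \<Rightarrow> 'k).
     (\<forall>i\<le>N. s i \<in> line_sections e h (hirzebruch e)) \<and>
     (\<forall>p \<in> \<Union>(hirzebruch e). \<exists>i\<le>N. s i p \<noteq> 0) \<and>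
     (\<forall>P \<in> hirzebruch e. \<forall>Q \<in> hirzebruch e.
        (\<exists>p\<in>P. \<exists>q\<in>Q. \<exists>c. c \<noteq> 0 \<and> (\<forall>i\<le>N. s i p = c * s i q)) \<longrightarrow> P = Q) \<and>
     (\<exists>S. (\<forall>G\<in>S. \<exists>d. proj_form N d G) \<and>
        (\<forall>z. (\<exists>i\<le>N. z i \<noteq> 0) \<longrightarrow>
           ((\<forall>G\<in>S. G z = 0) \<longleftrightarrow>
            (\<exists>p \<in> \<Union>(hirzebruch e). \<exists>c. c \<noteq> 0 \<and> (\<forall>i\<le>N. z i = c * s i p))))) \<and>
     (\<forall>U. zopen e U \<longrightarrow> (\<exists>S. (\<forall>G\<in>S. \<exists>d. proj_form N d G) \<and>
        U = {P \<in> hirzebruch e. \<exists>G\<in>S. \<forall>p\<in>P. G (\<lambda>i. s i p) \<noteq> 0})) \<and>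
     (\<forall>U. zopen e U \<longrightarrow> (\<forall>f \<in> line_sections e 0 U. \<forall>P\<in>U.
        \<exists>V d G H. zopen e V \<and> P \<in> V \<and> V \<subseteq> U \<and> proj_form N d G \<and> proj_form N d H \<and>
          (\<forall>p\<in>\<Union>V. H (\<lambda>i. s i p) \<noteq> 0 \<and> f p = G (\<lambda>i. s i p) / H (\<lambda>i. s i p)))))"

definition ulrich :: "nat \<Rightarrow> divclass \<Rightarrow> ('k::field, 'm) msheaf \<Rightarrow> bool" where
  "ulrich e h E \<longleftrightarrow> vector_bundle e E \<and>
     cohomology_zero e 0 (twist e (- h) E) \<and>
     cohomology_zero e 1 (twist e (- h) E) \<and>
     cohomology_zero e 1 (twist e (- (h + h)) E) \<and>
     cohomology_zero e 2 (twist e (- (h + h)) E)"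

text \<open>
  The first Chern class of a direct sum of line bundles is the sum of their classes, and it is
  additive on short exact sequences.  This determines it for a coherent sheaf that is the cokernel
  of an injective map, or the kernel of a surjective map, between direct sums of line bundles.
\<close>

definition has_c1 :: "nat \<Rightarrow> ('k::field, 'm) msheaf \<Rightarrow> divclass \<Rightarrow> bool" where
  "has_c1 e E c \<longleftrightarrow> (\<exists>As Bs.
     (\<exists>\<phi> q. is_mor e (split_bundle e As) (split_bundle e Bs) \<phi> \<and>
        injective_mor e (split_bundle e As) \<phi> \<and>
        is_cokernel e (split_bundle e As) (split_bundle e Bs) \<phi> E q \<and>
        c = sum_list Bs - sum_list As) \<or>
     (\<exists>\<psi> j. is_mor e (split_bundle e As) (split_bundle e Bs) \<psi> \<and>
        surjective_mor e (split_bundle e As) (split_bundle e Bs) \<psi> \<and>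
        is_kernel e (split_bundle e As) (split_bundle e Bs) \<psi> E j \<and>
        c = sum_list As - sum_list Bs))"

end

theory Submission
  imports Defs
begin

text \<open>
  X is the quotient by a torus of the cone of Cox coordinates (x0, x1, y0, y1), so sections of O(D) are homogeneous
  functions of degree D on the cone, and the cohomology of O(D) for the four standard charts is read off Laurent
  monomials; a residue pairing makes H2(D) dual to the forms of degree K - D.  Both maps are matrices of
  forms.  In (1) the transposed matrix maps forms to forms, dually to H2 of phi(-2h), and by the condition on
  c1 the two spaces have the same dimension.  H2(E(-2h)) = 0 makes this map injective, hence bijective.  Surjectivity
  yields H1(E(-2h)) = 0, and also splits phi over each chart, so E is a vector bundle; the remaining groups
  vanish because those of the line bundles do.  In (2), H0(E(-h)) = 0 likewise makes psi(-h) bijective on global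
  sections, whence H1(E(-h)) = 0.
\<close>

text \<open>Cohomology is a limit over all coverings, while monomials compute it only for the four
  charts. A refinement to finitely many principal open sets, each inside a chart, makes the two
  comparable: on a chart every cocycle is split by a partition of unity, which a Nullstellensatz in
  two variables supplies, and the ambiguities live on overlaps of charts, where regular functions
  are Laurent polynomials. In degree two no map from cocycles to Laurent polynomials is built; the
  relation \<open>RR\<close> links them, and vanishing is transported along it both ways.

  A section of the twisted kernel is one vector annihilated by the matrix. A section of the twisted
  cokernel has a vector only locally, up to the image of the matrix, until splittings over the
  charts are available. Hence H2(E(-2h)) = 0 is exploited before the other groups are treated.

  After duality in (1) and after the twist by -h in (2) the forms have the same degrees, (a-1, b-2),
  (a-2, b-1-e) and (a-1, b-1), so one count of monomials turns the condition on c1 into the equality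
  of dimensions in both parts.\<close>

section \<open>A Nullstellensatz in two variables\<close>

definition ev2 :: "'k::comm_ring_1 poly poly => 'k => 'k => 'k" where
 "ev2 P u v = poly (poly P [:v:]) u"

text \<open>The outer variable v survives: fixing the inner variable restricts a polynomial in u and
  v to a line u = a, where division with remainder is available.\<close>

definition spec :: "'k::comm_ring_1 => 'k poly poly => 'k poly" where
 "spec u P = map_poly (%c. poly c u) P"

lemma coeff_spec [simp]: "coeff (spec u P) n = poly (coeff P n) u"
 by (simp add: spec_def coeff_map_poly)

lemma spec_add [simp]: "spec u (P + Q) = spec u P + spec u Q"
 and spec_diff [simp]: "spec u (P - Q) = spec u P - spec u Q"
 and spec_mult [simp]: "spec u (P * Q) = spec u P * spec u Q"
 and spec_0 [simp]: "spec u 0 = 0"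
 and spec_1 [simp]: "spec u 1 = 1"
 and spec_const [simp]: "spec u [:c:] = [:poly c u:]"
 and spec_pCons: "spec u (pCons c P) = pCons (poly c u) (spec u P)"
 by (auto intro!: poly_eqI simp: coeff_mult poly_sum coeff_pCons split: nat.split)

lemma spec_power [simp]: "spec u (P ^ n) = spec u P ^ n"
 by (induction n) auto

lemma spec_smult [simp]: "spec u (Polynomial.smult c P) = Polynomial.smult (poly c u) (spec u P)"
 by (auto intro!: poly_eqI)

lemma ev2_spec: "ev2 P u v = poly (spec u P) v"
 by (induction P) (auto simp: ev2_def spec_pCons)

lemma ev2_simps [simp]:
 "ev2 (P + Q) u v = ev2 P u v + ev2 Q u v" "ev2 (P - Q) u v = ev2 P u v - ev2 Q u v"
 "ev2 (P * Q) u v = ev2 P u v * ev2 Q u v" "ev2 0 u v = 0" "ev2 1 u v = 1"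
 "ev2 (P ^ n) u v = ev2 P u v ^ n"
 by (simp_all add: ev2_def)

lemma ev2_sum: "ev2 (SUM i:A. P i) u v = (SUM i:A. ev2 (P i) u v)"
 by (simp add: ev2_def poly_sum)

lemma spec_lift: "spec u (map_poly (%c. [:c:]) p) = p"
 by (auto intro!: poly_eqI simp: coeff_map_poly)

text \<open>Every coefficient vanishes at a, so the factor u - a can be taken out coefficient by
  coefficient.\<close>

lemma spec_eq_0_dvd:
 fixes P :: "'k::field poly poly"
 assumes "spec a P = 0"
 obtains w where "P = [:[:-a, 1:]:] * w"
proof -
 have "poly (coeff P n) a = 0" for n
  using assms coeff_spec[of a P n] by simp
 hence d: "[:-a, 1:] dvd coeff P n" for n by (simp add: poly_eq_0_iff_dvd)
 have "P = [:[:-a, 1:]:] * map_poly (%c. c div [:-a, 1:]) P"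
 proof (rule poly_eqI)
  fix n
  have "coeff P n = [:-a, 1:] * (coeff P n div [:-a, 1:])" using d[of n] by (metis dvd_mult_div_cancel)
  also have "... = coeff (Polynomial.smult [:-a, 1:] (map_poly (%c. c div [:-a, 1:]) P)) n"
   by (simp only: coeff_map_poly coeff_smult div_0)
  finally show "coeff P n = coeff ([:[:-a, 1:]:] * map_poly (%c. c div [:-a, 1:]) P) n"
   by (simp only: mult_pCons_left mult_zero_left pCons_0_0 add_0_right)
 qed
 thus ?thesis using that by blast
qed

text \<open>The Nullstellensatz in one variable with an explicit exponent: each root of p, counted
  with multiplicity, contributes one linear factor, and every such factor divides q.\<close>

lemma dvd_power_degree_of_roots:
 fixes p q :: "'k::alg_closed_field poly"
 assumes "p ~= 0" "!!x. poly p x = 0 ==> poly q x = 0"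
 shows "p dvd q ^ degree p"
 using assms
proof (induction "degree p" arbitrary: p)
 case 0
 then show ?case by (simp add: is_unit_iff_degree)
next
 case (Suc n)
 obtain x where x: "poly p x = 0"
  using alg_closed_imp_poly_has_root[of p] Suc.hyps(2) by auto
 then obtain p' where p': "p = [:-x, 1:] * p'" by (auto simp: poly_eq_0_iff_dvd)
 have nz: "p' ~= 0" using Suc.prems p' by auto
 have deg: "degree p = Suc (degree p')"
  unfolding p' using nz by (subst degree_mult_eq) auto
 have "p' dvd q ^ degree p'"
  using Suc.hyps(1)[of p'] Suc.hyps(2) deg nz Suc.prems(2) p' by (auto simp del: mult_pCons_left)
 moreover have "[:-x, 1:] dvd q" using Suc.prems(2)[OF x] by (simp add: poly_eq_0_iff_dvd)
 ultimately show ?case unfolding deg unfolding p' power_Suc by (intro mult_dvd_mono)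
qed

lemma avoid_roots:
 fixes p :: "'k::field_char_0 poly"
 assumes "p ~= 0"
 obtains u where "poly p u ~= 0"
proof -
 have "finite {x. poly p x = 0}" using assms by (rule poly_roots_finite)
 hence "{x. poly p x = 0} ~= UNIV" using infinite_UNIV_char_0 by metis
 thus ?thesis using that by auto
qed

lemma ev2_eq_0:
 fixes P :: "'k::field_char_0 poly poly"
 assumes "!!u v. ev2 P u v = 0"
 shows "P = 0"
proof (rule ccontr)
 assume "P ~= 0"
 hence "lead_coeff P ~= 0" by simp
 then obtain u where u: "poly (lead_coeff P) u ~= 0" by (rule avoid_roots)
 hence "spec u P ~= 0" using coeff_spec[of u P "degree P"] by (metis coeff_0)
 then obtain v where "poly (spec u P) v ~= 0" by (rule avoid_roots)
 thus False using assms by (simp add: ev2_spec)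
qed

text \<open>J is an ideal of k[u][v]. Pseudo-division eliminates v and puts a nonzero polynomial in
  u alone into the saturation of J by h; this polynomial is then split into linear factors, and each
  line u = a is treated by the theory in one variable.\<close>

theorem nullstellensatz2:
 fixes J :: "'k::{alg_closed_field, field_char_0} poly poly set"
 assumes add: "!!f g. f : J ==> g : J ==> f + g : J"
  and mul: "!!r f. f : J ==> r * f : J"
  and ne: "0 : J"
  and van: "!!u v. (!!f. f : J ==> ev2 f u v = 0) ==> ev2 h u v = 0"
 shows "EX N. h ^ N : J"
proof -
 \<comment> \<open>The saturation of J by h: factors h may be cancelled in I, and a power of h in I
   yields one in J.\<close>
 define I where "I = {g. EX N. h ^ N * g : J}"
 have JI: "J <= I" unfolding I_def by (auto intro: exI[of _ 0])
 have I_add: "f + g : I" if fg: "f : I" "g : I" for f g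
 proof -
  obtain N M where "h ^ N * f : J" "h ^ M * g : J" using fg unfolding I_def by auto
  hence "h ^ M * (h ^ N * f) + h ^ N * (h ^ M * g) : J" by (intro add[OF mul mul])
  hence "h ^ (N + M) * (f + g) : J" by (simp add: algebra_simps power_add)
  thus ?thesis unfolding I_def by blast
 qed
 have I_mul: "r * f : I" if f: "f : I" for r f
 proof -
  obtain N where "h ^ N * f : J" using f unfolding I_def by auto
  hence "r * (h ^ N * f) : J" by (rule mul)
  hence "h ^ N * (r * f) : J" by (simp add: algebra_simps)
  thus ?thesis unfolding I_def by blast
 qed
 have I_sub: "f - g : I" if "f : I" "g : I" for f g
  using I_add[OF that(1) I_mul[OF that(2), of "-1"]] by simp
 have I_sat: "f : I" if f: "h ^ N * f : I" for N f
 proof -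
  obtain M where "h ^ M * (h ^ N * f) : J" using f unfolding I_def by auto
  hence "h ^ (M + N) * f : J" by (simp add: algebra_simps power_add)
  thus ?thesis unfolding I_def by blast
 qed
 show ?thesis
 proof (cases "J <= {0}")
  case True
  hence "h = 0" by (intro ev2_eq_0 van) auto
  thus ?thesis using ne by (auto intro: exI[of _ 1])
 next
  case False
  then obtain f0 where f0: "f0 : I" "f0 ~= 0" using JI by auto
  \<comment> \<open>An element of least degree in v acts as a generator over the rational functions
    in u; dividing by it costs only powers of its leading coefficient l.\<close>
  obtain d where d: "d : I" "d ~= 0" and dmin: "!!f. f : I ==> f ~= 0 ==> degree d <= degree f"
   using ex_has_least_nat[of "%f. f : I & f ~= 0" f0 degree] f0 by auto
  define l where "l = lead_coeff d"
  have l0: "l ~= 0" using d by (simp add: l_def)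
  have div: "EX k q r. Polynomial.smult (l ^ k) f = d * q + r & (r = 0 | degree r < degree d)" for f
   using pseudo_divmod[OF d(2), of f] unfolding l_def by (metis surj_pair)
  \<comment> \<open>If the degree in v were positive, pseudo-division of h^n by d would be exact;
    cancelling h^n would put a power of l, of degree 0 in v, into I.\<close>
  have degd: "degree d = 0"
  proof (rule ccontr)
   assume pos: "degree d ~= 0"
   define n where "n = degree d"
   obtain k q r where kq: "Polynomial.smult (l ^ k) (h ^ n) = d * q + r" and r: "r = 0 | degree r < degree d"
    using div by blast
   have "r = 0"
   proof (rule ccontr)
    assume r0: "r ~= 0"
    hence "l * lead_coeff r ~= 0" using l0 by simp
    \<comment> \<open>At such u neither d nor the remainder r drops in degree, while all roots of d
      on the line are common zeros of J and hence zeros of h.\<close>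
    then obtain u where "poly (l * lead_coeff r) u ~= 0" by (rule avoid_roots)
    hence u: "poly l u ~= 0" "poly (lead_coeff r) u ~= 0" by auto
    have sd: "spec u d ~= 0" "degree (spec u d) = n"
    proof -
     have c: "coeff (spec u d) n ~= 0" using u(1) by (simp add: l_def n_def)
     thus "spec u d ~= 0" by (metis coeff_0)
     have "degree (spec u d) <= n" unfolding n_def by (rule degree_le) (simp add: coeff_eq_0)
     thus "degree (spec u d) = n" using c by (simp add: antisym le_degree)
    qed
    have rt: "poly (spec u h) v = 0" if v: "poly (spec u d) v = 0" for v
    proof -
     have "ev2 f u v = 0" if "f : J" for f
     proof -
      obtain k q r' where f: "Polynomial.smult (l ^ k) f = d * q + r'" and r': "r' = 0 | degree r' < degree d"
       using div by blast
      have "r' = [:l ^ k:] * f - q * d" using f by (simp add: algebra_simps)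
      hence "r' : I" using d JI that by (simp only:) (intro I_sub I_mul, auto)
      hence "r' = 0" using r' dmin[of r'] by force
      hence "ev2 (Polynomial.smult (l ^ k) f) u v = 0" using f v by (simp add: ev2_spec)
      thus ?thesis using u by (simp add: ev2_spec)
     qed
     hence "ev2 h u v = 0" by (rule van)
     thus ?thesis by (simp add: ev2_spec)
    qed
    have "spec u d dvd spec u h ^ n"
     using dvd_power_degree_of_roots[OF sd(1) rt] sd(2) by simp
    moreover have "Polynomial.smult (poly l u ^ k) (spec u h ^ n) = spec u d * spec u q + spec u r"
     using arg_cong[OF kq, of "spec u"] by simp
    ultimately have "spec u d dvd spec u r"
     by (metis dvd_add_right_iff dvd_smult dvd_triv_left)
    moreover have "spec u r ~= 0" using u(2) coeff_spec[of u r "degree r"] by (metis coeff_0)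
    moreover have "degree (spec u r) < n"
    proof -
     have "degree (spec u r) <= degree r" by (rule degree_le) (simp add: coeff_eq_0)
     thus ?thesis using r r0 by (simp add: n_def)
    qed
    ultimately show False using sd(2) dvd_imp_degree_le by fastforce
   qed
   hence "h ^ n * [:l ^ k:] = q * d" using kq by (simp add: mult.commute)
   hence "[:l ^ k:] : I" using I_sat[of n "[:l ^ k:]"] I_mul[OF d(1), of q] by simp
   hence "degree d <= degree [:l ^ k:]" by (rule dmin) (use l0 in simp)
   thus False using pos by simp
  qed
  then obtain r where r: "d = [:r:]" by (metis degree_eq_zeroE)
  have r0: "r ~= 0" using d r by auto
  \<comment> \<open>Q A says that some power of h lies in I + (A). This is multiplicative in A, so
    for the polynomial r found in I it suffices to treat constants and linear factors.\<close>
  define Q where "Q A \<longleftrightarrow> (EX N w. h ^ N - [:A:] * w : I)" for A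
  have Q_mult: "Q (A * B)" if AB: "Q A" "Q B" for A B
  proof -
   obtain N w M w' where *: "h ^ N - [:A:] * w : I" "h ^ M - [:B:] * w' : I"
    using AB unfolding Q_def by blast
   have "h ^ M * (h ^ N - [:A:] * w) + ([:A:] * w) * (h ^ M - [:B:] * w') : I"
    by (intro I_add I_mul *)
   moreover have "h ^ M * (h ^ N - [:A:] * w) + ([:A:] * w) * (h ^ M - [:B:] * w')
    = h ^ (N + M) - [:A * B:] * (w * w')"
    by (simp add: algebra_simps power_add smult_smult)
   ultimately show ?thesis unfolding Q_def by metis
  qed
  \<comment> \<open>Either I vanishes on the line u = a, and then h does as well; or the
    restrictions of I to the line are multiples of one of least degree, whose roots are common zeros
    of J.\<close>
  have Q_lin: "Q [:-a, 1:]" for a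
  proof (cases "ALL f:I. spec a f = 0")
   case True
   hence "ev2 h a v = 0" for v using JI by (intro van) (auto simp: ev2_spec)
   hence "spec a h = 0" using avoid_roots[of "spec a h"] by (auto simp: ev2_spec)
   then obtain w where "h = [:[:-a, 1:]:] * w" by (rule spec_eq_0_dvd)
   hence "h ^ 1 - [:[:-a, 1:]:] * w : I" using JI ne by auto
   thus ?thesis unfolding Q_def by blast
  next
   case False
   then obtain g0 where g0: "g0 : I" "spec a g0 ~= 0" by auto
   obtain g where g: "g : I" "spec a g ~= 0"
    and gmin: "!!f. f : I ==> spec a f ~= 0 ==> degree (spec a g) <= degree (spec a f)"
    using ex_has_least_nat[of "%f. f : I & spec a f ~= 0" g0 "%f. degree (spec a f)"] g0 by auto
   have gdvd: "spec a g dvd spec a f" if f: "f : I" for f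
   proof -
    define f' where "f' = f - map_poly (%c. [:c:]) (spec a f div spec a g) * g"
    have "f' : I" unfolding f'_def by (intro I_sub I_mul f g)
    moreover have s: "spec a f' = spec a f mod spec a g"
     by (simp add: f'_def spec_lift minus_div_mult_eq_mod)
    ultimately have "spec a f mod spec a g = 0"
     using gmin[of f'] degree_mod_less[of "spec a g" "spec a f"] g(2) by force
    thus ?thesis by (simp add: dvd_eq_mod_eq_0)
   qed
   define n where "n = degree (spec a g)"
   have "spec a g dvd spec a h ^ n" unfolding n_def
   proof (rule dvd_power_degree_of_roots[OF g(2)])
    fix v assume "poly (spec a g) v = 0"
    hence "ev2 f a v = 0" if "f : J" for f
     using gdvd[of f] subsetD[OF JI that] by (auto simp: ev2_spec dvd_def)
    hence "ev2 h a v = 0" by (rule van)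
    thus "poly (spec a h) v = 0" by (simp add: ev2_spec)
   qed
   then obtain p where p: "spec a h ^ n = spec a g * p" by (auto simp: dvd_def)
   have "spec a (h ^ n - map_poly (%c. [:c:]) p * g) = 0" using p by (simp add: spec_lift)
   then obtain w where w: "h ^ n - map_poly (%c. [:c:]) p * g = [:[:-a, 1:]:] * w"
    by (rule spec_eq_0_dvd)
   hence "h ^ n - [:[:-a, 1:]:] * w = map_poly (%c. [:c:]) p * g" by (simp add: algebra_simps)
   hence "h ^ n - [:[:-a, 1:]:] * w : I" using I_mul[OF g(1)] by metis
   thus ?thesis unfolding Q_def by blast
  qed
  have Q_const: "Q [:c:]" if "c ~= 0" for c
  proof -
   have "h ^ 0 - [:[:c:]:] * [:[:1/c:]:] = 0" using that by (simp add: one_pCons)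
   thus ?thesis unfolding Q_def using JI ne by (metis subsetD)
  qed
  have "p ~= 0 ==> Q p" for p
  proof (induction "degree p" arbitrary: p)
   case 0
   then obtain c where "p = [:c:]" by (metis degree_eq_zeroE)
   then show ?case using Q_const 0 by auto
  next
   case (Suc n)
   obtain x where x: "poly p x = 0"
    using alg_closed_imp_poly_has_root[of p] Suc.hyps(2) by auto
   then obtain p' where p': "p = [:-x, 1:] * p'" by (auto simp: poly_eq_0_iff_dvd)
   have nz: "p' ~= 0" using Suc.prems p' by auto
   have "degree p = Suc (degree p')"
    unfolding p' using nz by (subst degree_mult_eq) auto
   hence "Q p'" using Suc nz by auto
   thus ?case unfolding p' using Q_mult Q_lin by blast
  qed
  from this[OF r0] obtain N w where "h ^ N - [:r:] * w : I" unfolding Q_def by blast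
  hence "(h ^ N - [:r:] * w) + w * d : I" by (intro I_add I_mul d)
  hence "h ^ N * 1 : I" by (simp add: r mult.commute)
  hence "h ^ N : I" by simp
  then obtain M where "h ^ M * h ^ N : J" unfolding I_def by blast
  thus ?thesis by (metis power_add)
 qed
qed

section \<open>Cox coordinates, Laurent monomials and forms\<close>

definition cc :: "'k cox => nat => 'k" where
 "cc p i = (case p of (x0, x1, y0, y1) =>
   if i = 0 then x0 else if i = 1 then x1 else if i = 2 then y0 else y1)"

text \<open>The complement of the irrelevant locus: the quadruples whose torus orbits are the points
  of the surface.\<close>

definition cone :: "'k::zero cox set" where
 "cone = {p. (cc p 0 ~= 0 | cc p 1 ~= 0) & (cc p 2 ~= 0 | cc p 3 ~= 0)}"

text \<open>The Laurent monomial of degree D and exponent m has exponent fst m in x1 and snd m in y1; xp lists its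
 exponents in x0, x1, y0, y1.\<close>

definition xp :: "nat => divclass => int \<times> int => nat => int" where
 "xp e D m i = (if i = 0 then snd D - int e * snd m - fst m else if i = 1 then fst m
   else if i = 2 then fst D - snd m else snd m)"

definition mon :: "nat => divclass => int \<times> int => 'k::field cox => 'k" where
 "mon e D m p = cc p 0 powi xp e D m 0 * cc p 1 powi xp e D m 1 *
   cc p 2 powi xp e D m 2 * cc p 3 powi xp e D m 3"

text \<open>Poles are allowed only along the coordinates in T. Thus T = {} gives the monomial basis
  of the forms of degree D, and a larger T the Laurent monomials regular on
  \<open>UT T\<close>.\<close>

definition exps :: "nat => divclass => nat set => (int \<times> int) set" where
 "exps e D T = {m. ALL i<4. i ~: T --> 0 <= xp e D m i}"

definition UT :: "nat set => 'k::zero cox set" where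
 "UT T = {p : cone. ALL i:T. cc p i ~= 0}"

lemma all4: "(ALL i<4. P i) \<longleftrightarrow> P (0::nat) & P 1 & P 2 & P 3"
proof -
 have "i < 4 \<longleftrightarrow> i = 0 | i = 1 | i = 2 | i = 3" for i :: nat by auto
 thus ?thesis by auto
qed

lemma xp_simps: "xp e D m 0 = snd D - int e * snd m - fst m" "xp e D m 1 = fst m"
 "xp e D m (Suc 0) = fst m"
 "xp e D m 2 = fst D - snd m" "xp e D m 3 = snd m"
 by (simp_all add: xp_def)

lemma cc_simps [simp]: "cc (x0, x1, y0, y1) 0 = x0" "cc (x0, x1, y0, y1) (Suc 0) = x1"
 "cc (x0, x1, y0, y1) 2 = y0" "cc (x0, x1, y0, y1) 3 = y1"
 by (simp_all add: cc_def)

lemma finite_exps [simp]: "finite (exps e D {})"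
proof (rule finite_subset)
 show "exps e D {} <= {0..snd D} \<times> {0..fst D}"
 proof
  fix m assume "m : exps e D {}"
  hence m: "0 <= snd D - int e * snd m - fst m" "0 <= fst m" "0 <= fst D - snd m" "0 <= snd m"
   by (simp_all add: exps_def all4 xp_simps)
  have "0 <= int e * snd m" using m by simp
  hence "fst m <= snd D" using m by linarith
  thus "m : {0..snd D} \<times> {0..fst D}" using m by (cases m) auto
 qed
qed auto

text \<open>Once the degree is fixed, a monomial is determined by its exponents in x1 and y1; this
  reindexes the defining sum over quadruples.\<close>

lemma cox_form_iff:
 "cox_form e D F \<longleftrightarrow> (EX c. F = (%p. SUM m:exps e D {}. c m * mon e D m p))"
proof -
 define Q where "Q = {(i, j, k, l). int k + int l = fst D & int i + int j + int e * int l = snd D}"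
 define h :: "nat \<times> nat \<times> nat \<times> nat => int \<times> int" where "h = (%(i, j, k, l). (int j, int l))"
 have bij: "bij_betw h Q (exps e D {})"
  unfolding bij_betw_def
 proof
  show "inj_on h Q" by (auto simp: inj_on_def h_def Q_def)
  show "h ` Q = exps e D {}"
  proof (intro equalityI subsetI)
   fix m assume m: "m : exps e D {}"
   have "m = h (nat (xp e D m 0), nat (xp e D m 1), nat (xp e D m 2), nat (xp e D m 3))"
    using m by (auto simp: h_def exps_def all4 xp_simps prod_eq_iff)
   moreover have "(nat (xp e D m 0), nat (xp e D m 1), nat (xp e D m 2), nat (xp e D m 3)) : Q"
    using m by (auto simp: Q_def exps_def all4 xp_simps)
   ultimately show "m : h ` Q" by blast
  qed (auto simp: h_def Q_def exps_def all4 xp_simps)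
 qed
 have mon: "mon e D (h (i, j, k, l)) (x0, x1, y0, y1) = x0 ^ i * x1 ^ j * y0 ^ k * y1 ^ l"
  if "(i, j, k, l) : Q" for i j k l and x0 x1 y0 y1 :: 'a
 proof -
  have "xp e D (h (i, j, k, l)) 0 = int i" "xp e D (h (i, j, k, l)) 1 = int j"
   "xp e D (h (i, j, k, l)) 2 = int k" "xp e D (h (i, j, k, l)) 3 = int l"
   using that by (auto simp: Q_def h_def xp_simps)
  thus ?thesis unfolding mon_def by simp
 qed
 have eq: "(SUM (i, j, k, l):Q. c (i, j, k, l) * x0 ^ i * x1 ^ j * y0 ^ k * y1 ^ l) =
   (SUM m:exps e D {}. c (inv_into Q h m) * mon e D m (x0, x1, y0, y1))" for c and x0 x1 y0 y1 :: 'a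
 proof -
  have "(SUM m:exps e D {}. c (inv_into Q h m) * mon e D m (x0, x1, y0, y1)) =
   (SUM q:Q. c (inv_into Q h (h q)) * mon e D (h q) (x0, x1, y0, y1))"
   by (rule sum.reindex_bij_betw[OF bij, symmetric])
  also have "... = (SUM (i, j, k, l):Q. c (i, j, k, l) * x0 ^ i * x1 ^ j * y0 ^ k * y1 ^ l)"
  proof (rule sum.cong[OF refl])
   fix q assume q: "q : Q"
   have "inv_into Q h (h q) = q" using q bij by (simp add: bij_betw_def)
   thus "c (inv_into Q h (h q)) * mon e D (h q) (x0, x1, y0, y1) =
     (case q of (i, j, k, l) => c (i, j, k, l) * x0 ^ i * x1 ^ j * y0 ^ k * y1 ^ l)"
    using q by (cases q) (simp add: mon mult.assoc)
  qed
  finally show ?thesis by simp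
 qed
 show ?thesis
 proof
  assume "cox_form e D F"
  then obtain c where "F = (%(x0, x1, y0, y1). SUM (i, j, k, l):Q.
   c (i, j, k, l) * x0 ^ i * x1 ^ j * y0 ^ k * y1 ^ l)" unfolding cox_form_def Q_def by blast
  hence "F = (%p. SUM m:exps e D {}. c (inv_into Q h m) * mon e D m p)"
   by (auto simp: fun_eq_iff eq)
  thus "EX c. F = (%p. SUM m:exps e D {}. c m * mon e D m p)"
   by (rule exI[of _ "%m. c (inv_into Q h m)"])
 next
  assume "EX c. F = (%p. SUM m:exps e D {}. c m * mon e D m p)"
  then obtain c where c: "F = (%p. SUM m:exps e D {}. c m * mon e D m p)" by blast
  have "(SUM (i, j, k, l):Q. (c \<circ> h) (i, j, k, l) * x0 ^ i * x1 ^ j * y0 ^ k * y1 ^ l)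
   = F (x0, x1, y0, y1)" for x0 x1 y0 y1
   unfolding eq c
  proof (rule sum.cong[OF refl])
   fix m assume "m : exps e D {}"
   hence "h (inv_into Q h m) = m" using bij by (simp add: bij_betw_def f_inv_into_f)
   thus "(c \<circ> h) (inv_into Q h m) * mon e D m (x0, x1, y0, y1) = c m * mon e D m (x0, x1, y0, y1)"
    by simp
  qed
  hence "F = (%(x0, x1, y0, y1). SUM (i, j, k, l):Q.
   (c \<circ> h) (i, j, k, l) * x0 ^ i * x1 ^ j * y0 ^ k * y1 ^ l)" by (auto simp: fun_eq_iff)
  thus "cox_form e D F" unfolding cox_form_def Q_def by blast
 qed
qed

lemma powi_add_nonneg:
 fixes x :: "'k::field"
 assumes "x ~= 0 | (0 <= a & 0 <= b)"
 shows "x powi (a + b) = x powi a * x powi b"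
 using assms by (cases "x = 0") (auto simp: power_int_add power_int_0_left_if)

lemma xp_add: "xp e (D + D') (m + m') i = xp e D m i + xp e D' m' i"
 by (simp add: xp_def algebra_simps)

lemma mon_mult:
 assumes "p : UT T" "m : exps e D T" "m' : exps e D' T"
 shows "mon e D m p * mon e D' m' p = mon e (D + D') (m + m') p"
proof -
 have "cc p i ~= 0 | (0 <= xp e D m i & 0 <= xp e D' m' i)" if "i < 4" for i
  using assms that unfolding UT_def exps_def by auto
 hence "cc p i powi (xp e (D + D') (m + m') i) = cc p i powi xp e D m i * cc p i powi xp e D' m' i"
  if "i < 4" for i unfolding xp_add using that by (intro powi_add_nonneg) blast
 thus ?thesis unfolding mon_def by (simp add: algebra_simps)
qed

lemma exps_add: "m : exps e D T ==> m' : exps e D' T ==> m + m' : exps e (D + D') T"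
 unfolding exps_def by (auto simp: xp_add)

lemma exps_mono: "T <= T' ==> exps e D T <= exps e D T'"
 unfolding exps_def by auto

lemma UT_anti: "T <= T' ==> UT T' <= UT T"
 unfolding UT_def by auto

lemma UT_cone: "UT T <= cone"
 unfolding UT_def by auto

definition evl :: "nat => divclass => (int \<times> int => 'k::field) => 'k cox => 'k" where
 "evl e D c p = (SUM m:{m. c m ~= 0}. c m * mon e D m p)"

text \<open>Coefficients are one function of the exponent with finite support, so representations
  over different T can be compared; f is constrained only on \<open>UT T\<close>.\<close>

definition lau :: "nat => divclass => nat set => ('k::field cox => 'k) => bool" where
 "lau e D T f \<longleftrightarrow> (EX c. finite {m. c m ~= 0} & {m. c m ~= 0} <= exps e D T &
   (ALL p:UT T. f p = evl e D c p))"

lemma evl_superset: "finite A ==> {m. c m ~= 0} <= A ==> evl e D c p = (SUM m:A. c m * mon e D m p)"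
 unfolding evl_def by (rule sum.mono_neutral_left) auto

lemma lau_cong: "lau e D T f ==> (!!p. p : UT T ==> g p = f p) ==> lau e D T g"
proof -
 assume "lau e D T f" and eq: "!!p. p : UT T ==> g p = f p"
 then obtain c where "finite {m. c m ~= 0}" "{m. c m ~= 0} <= exps e D T" "ALL p:UT T. f p = evl e D c p"
  unfolding lau_def by blast
 thus ?thesis unfolding lau_def using eq by (intro exI[of _ c]) auto
qed

lemma lau_add:
 assumes "lau e D T f" "lau e D T g"
 shows "lau e D T (%p. f p + g p)"
proof -
 obtain c c' where c: "finite {m. c m ~= 0}" "{m. c m ~= 0} <= exps e D T" "ALL p:UT T. f p = evl e D c p"
  and c': "finite {m. c' m ~= 0}" "{m. c' m ~= 0} <= exps e D T" "ALL p:UT T. g p = evl e D c' p"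
  using assms unfolding lau_def by blast
 define A where "A = {m. c m ~= 0} \<union> {m. c' m ~= 0}"
 have A: "finite A" "{m. c m + c' m ~= 0} <= A" "{m. c m ~= 0} <= A" "{m. c' m ~= 0} <= A"
  "A <= exps e D T"
  using c c' by (auto simp: A_def)
 have "evl e D (%m. c m + c' m) p = evl e D c p + evl e D c' p" for p
  using A by (simp add: evl_superset[of A] sum.distrib ring_distribs)
 thus ?thesis unfolding lau_def using c(3) c'(3) A finite_subset[OF A(2,1)]
  by (intro exI[of _ "%m. c m + c' m"]) auto
qed

lemma lau_mono: "m : exps e D T ==> lau e D T (%p. a * mon e D m p)"
proof -
 assume m: "m : exps e D T"
 have "evl e D (%m'. if m' = m then a else 0) p = a * mon e D m p" for p
  by (subst evl_superset[of "{m}"]) auto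
 thus ?thesis unfolding lau_def using m by (intro exI[of _ "%m'. if m' = m then a else 0"]) auto
qed

lemma lau_0: "lau e D T (%p. 0)"
 unfolding lau_def evl_def by (intro exI[of _ "%_. 0"]) auto

lemma lau_sum: "(!!k. k : K ==> lau e D T (f k)) ==> lau e D T (%p. SUM k:K. f k p)"
 by (induction K rule: infinite_finite_induct) (auto intro: lau_0 lau_add)

lemma lau_evl:
 assumes "finite A" "A <= exps e D T"
 shows "lau e D T (%p. SUM m:A. c m * mon e D m p)"
 using assms by (intro lau_sum lau_mono) auto

lemma lau_mult:
 assumes "lau e D T f" "lau e D' T g"
 shows "lau e (D + D') T (%p. f p * g p)"
proof -
 obtain c c' where c: "finite {m. c m ~= 0}" "{m. c m ~= 0} <= exps e D T" "ALL p:UT T. f p = evl e D c p"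
  and c': "finite {m. c' m ~= 0}" "{m. c' m ~= 0} <= exps e D' T" "ALL p:UT T. g p = evl e D' c' p"
  using assms unfolding lau_def by blast
 have "lau e (D + D') T (%p. SUM m:{m. c m ~= 0}. SUM m':{m. c' m ~= 0}. (c m * c' m') * mon e (D + D') (m + m') p)"
  using c(2) c'(2) by (intro lau_sum lau_mono exps_add) auto
 thus ?thesis
 proof (rule lau_cong)
  fix p :: "'a cox" assume p: "p : UT T"
  have "f p * g p = (SUM m:{m. c m ~= 0}. SUM m':{m. c' m ~= 0}. (c m * mon e D m p) * (c' m' * mon e D' m' p))"
   using p c(3) c'(3) unfolding evl_def by (simp add: sum_product)
  also have "... = (SUM m:{m. c m ~= 0}. SUM m':{m. c' m ~= 0}. (c m * c' m') * mon e (D + D') (m + m') p)"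
  proof (intro sum.cong refl)
   fix m m' assume "m : {m. c m ~= 0}" "m' : {m. c' m ~= 0}"
   hence "m : exps e D T" "m' : exps e D' T" using c(2) c'(2) by blast+
   from mon_mult[OF p this] show "(c m * mon e D m p) * (c' m' * mon e D' m' p) = (c m * c' m') * mon e (D + D') (m + m') p"
    by (simp add: algebra_simps)
  qed
  finally show "f p * g p = (SUM m:{m. c m ~= 0}. SUM m':{m. c' m ~= 0}. (c m * c' m') * mon e (D + D') (m + m') p)" .
 qed
qed

lemma lau_const: "lau e 0 T (%p. a)"
proof -
 have "(0, 0) : exps e 0 T" by (auto simp: exps_def xp_def)
 from lau_mono[OF this, of a] show ?thesis
  by (rule lau_cong) (simp add: mon_def xp_simps)
qed

lemma lau_smult: "lau e D T f ==> lau e D T (%p. a * f p)"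
 using lau_mult[OF lau_const, of e D T f a] by simp

lemma lau_prod:
 "(!!k. k : K ==> lau e (d k) T (f k)) ==> lau e (SUM k:K. d k) T (%p. PROD k:K. f k p)"
 by (induction K rule: infinite_finite_induct) (auto intro: lau_const lau_mult)

definition nd :: "nat => divclass => divclass" where
 "nd N D = (int N * fst D, int N * snd D)"

lemma nd_simps [simp]: "nd 0 D = 0" "nd (Suc n) D = D + nd n D"
 by (auto simp: nd_def zero_prod_def algebra_simps plus_prod_def)

lemma nd_add: "nd (n + m) D = nd n D + nd m D"
 by (induction n) (auto simp: add.assoc)

lemma lau_power: "lau e D T f ==> lau e (nd n D) T (%p. f p ^ n)"
 by (induction n) (auto intro: lau_const lau_mult)

lemma lau_subset: "lau e D T f ==> T <= T' ==> lau e D T' f"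
 unfolding lau_def using UT_anti[of T T'] exps_mono[of T T' e D] by (meson subset_trans subsetD)

lemma UT_empty: "UT {} = cone" unfolding UT_def by simp

lemma cox_form_lau: "cox_form e D F ==> lau e D T F"
proof -
 assume "cox_form e D F"
 then obtain c where "F = (%p. SUM m:exps e D {}. c m * mon e D m p)" unfolding cox_form_iff by blast
 thus ?thesis using exps_mono[of "{}" T e D] by (auto intro!: lau_evl)
qed

lemma lau_empty_cox_form:
 assumes "lau e D {} f"
 obtains F where "cox_form e D F" "!!p. p : cone ==> f p = F p"
proof -
 obtain c where c: "finite {m. c m ~= 0}" "{m. c m ~= 0} <= exps e D {}" "ALL p:UT {}. f p = evl e D c p"
  using assms unfolding lau_def by blast
 have "!!p. p : cone ==> f p = (SUM m:exps e D {}. c m * mon e D m p)"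
  using c by (simp add: evl_superset[of "exps e D {}"] UT_empty)
 thus ?thesis by (intro that) (auto simp: cox_form_iff)
qed

lemma cox_form_mon: "m : exps e D {} ==> cox_form e D (%p. a * mon e D m p)"
 unfolding cox_form_iff
 by (intro exI[of _ "%m'. if m' = m then a else 0"])
   (simp add: fun_eq_iff if_distribR sum.delta' if_distrib[of "%x. x * _"] cong: if_cong)

lemma cox_form_add: "cox_form e D F ==> cox_form e D G ==> cox_form e D (%p. F p + G p)"
proof -
 assume "cox_form e D F" "cox_form e D G"
 then obtain c c' where "F = (%p. SUM m:exps e D {}. c m * mon e D m p)"
  "G = (%p. SUM m:exps e D {}. c' m * mon e D m p)" unfolding cox_form_iff by blast
 thus ?thesis unfolding cox_form_iff
  by (intro exI[of _ "%m. c m + c' m"]) (simp add: sum.distrib ring_distribs)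
qed

lemma cox_form_0: "cox_form e D (%p. 0)"
 unfolding cox_form_iff by (intro exI[of _ "%_. 0"]) auto

lemma cox_form_sum: "(!!k. k : K ==> cox_form e D (f k)) ==> cox_form e D (%p. SUM k:K. f k p)"
 by (induction K rule: infinite_finite_induct) (auto intro: cox_form_0 cox_form_add)

text \<open>Complements \<open>mon_mult\<close>: forms are equal as functions on all quadruples, so
  products have to be computed off the cone as well.\<close>

lemma mon_mult_nonneg:
 assumes "m : exps e D {}" "m' : exps e D' {}"
 shows "mon e D m p * mon e D' m' p = mon e (D + D') (m + m') p"
proof -
 have "cc p i powi (xp e (D + D') (m + m') i) = cc p i powi xp e D m i * cc p i powi xp e D' m' i"
  if "i < 4" for i unfolding xp_add using assms that by (intro powi_add_nonneg) (auto simp: exps_def)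
 thus ?thesis unfolding mon_def by (simp add: algebra_simps)
qed

lemma cox_form_mult:
 assumes "cox_form e D F" "cox_form e D' G"
 shows "cox_form e (D + D') (%p. F p * G p)"
proof -
 obtain c c' where c: "F = (%p. SUM m:exps e D {}. c m * mon e D m p)"
  "G = (%p. SUM m:exps e D' {}. c' m * mon e D' m p)" using assms unfolding cox_form_iff by blast
 have "(%p. F p * G p) = (%p. SUM m:exps e D {}. SUM m':exps e D' {}.
   (c m * c' m') * mon e (D + D') (m + m') p)"
 proof
  fix p
  have "F p * G p = (SUM m:exps e D {}. SUM m':exps e D' {}. (c m * mon e D m p) * (c' m' * mon e D' m' p))"
   unfolding c by (simp add: sum_product)
  also have "... = (SUM m:exps e D {}. SUM m':exps e D' {}. (c m * c' m') * mon e (D + D') (m + m') p)"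
  proof (intro sum.cong refl)
   fix m m' assume "m : exps e D {}" "m' : exps e D' {}"
   from mon_mult_nonneg[OF this, of p]
   show "(c m * mon e D m p) * (c' m' * mon e D' m' p) = (c m * c' m') * mon e (D + D') (m + m') p"
    by (simp add: algebra_simps)
  qed
  finally show "F p * G p = (SUM m:exps e D {}. SUM m':exps e D' {}. (c m * c' m') * mon e (D + D') (m + m') p)" .
 qed
 thus ?thesis by (simp add: cox_form_sum cox_form_mon exps_add)
qed

lemma cox_form_const: "cox_form e 0 (%p. a)"
proof -
 have "(0, 0) : exps e 0 {}" by (auto simp: exps_def xp_def)
 from cox_form_mon[OF this, of a] show ?thesis by (simp add: mon_def xp_simps)
qed

lemma cox_form_power: "cox_form e D F ==> cox_form e (nd n D) (%p. F p ^ n)"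
 by (induction n) (auto intro: cox_form_const cox_form_mult)

lemma cox_form_prod:
 "(!!k. k : K ==> cox_form e (d k) (f k)) ==> cox_form e (SUM k:K. d k) (%p. PROD k:K. f k p)"
 by (induction K rule: infinite_finite_induct) (auto intro: cox_form_const cox_form_mult)

definition dg :: "nat => nat => divclass" where
 "dg e i = (if i = 0 | i = 1 then (0, 1) else if i = 2 then (1, 0) else (1, int e))"

lemma cox_form_cc: 
 assumes "i < 4"
 shows "cox_form e (dg e i) (%p. cc p i)"
proof -
 have *: "i = 0 | i = 1 | i = 2 | i = 3" using assms by auto
 define m :: "int \<times> int" where "m = (if i = 1 then 1 else 0, if i = 3 then 1 else 0)"
 have "m : exps e (dg e i) {}" using * by (auto simp: exps_def all4 xp_simps dg_def m_def)
 from cox_form_mon[OF this, of 1] show ?thesis 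
  using * by (auto simp: mon_def xp_simps dg_def m_def)
qed

section \<open>Open subsets of the cone and regular functions\<close>

definition opn :: "nat => 'k::field cox set => bool" where
 "opn e A \<longleftrightarrow> A <= cone & (ALL p:A. EX D H. cox_form e D H & H p ~= 0 & (ALL q:cone. H q ~= 0 --> q : A))"

text \<open>Openness of A is built in: around each point the fraction is valid on the whole locus
  where its denominator is nonzero. Smaller neighbourhoods are reached by expanding the fraction by
  a form.\<close>

definition reg :: "nat => divclass => 'k::field cox set => ('k cox => 'k) => bool" where
 "reg e D A f \<longleftrightarrow> A <= cone & (ALL p:A. EX D' G H. cox_form e D' H & cox_form e (D + D') G & H p ~= 0 &
   (ALL q:cone. H q ~= 0 --> q : A & f q = G q / H q))"

lemma regE:
 assumes "reg e D A f" "p : A"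
 obtains D' G H where "cox_form e D' H" "cox_form e (D + D') G" "H p ~= 0"
  "!!q. q : cone ==> H q ~= 0 ==> q : A & f q = G q / H q"
 using assms unfolding reg_def by blast

lemma opnE:
 assumes "opn e A" "p : A"
 obtains D H where "cox_form e D H" "H p ~= 0" "!!q. q : cone ==> H q ~= 0 ==> q : A"
 using assms unfolding opn_def by blast

lemma regI:
 assumes "A <= cone" "!!p. p : A ==> EX D' G H. cox_form e D' H & cox_form e (D + D') G & H p ~= 0 &
   (ALL q:cone. H q ~= 0 --> q : A & f q = G q / H q)"
 shows "reg e D A f"
 using assms unfolding reg_def by blast

lemma reg_cone: "reg e D A f ==> A <= cone" by (simp add: reg_def)
lemma opn_cone: "opn e A ==> A <= cone" by (simp add: opn_def)

lemma reg_opn: "reg e D A f ==> opn e A"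
 unfolding reg_def opn_def by meson

lemma opn_UN:
 assumes "!!i. i : I ==> opn e (A i)"
 shows "opn e (UN i:I. A i)"
 unfolding opn_def
proof (intro conjI ballI)
 show "(UN i:I. A i) <= cone" using assms opn_cone by blast
 fix p assume "p : (UN i:I. A i)"
 then obtain i where i: "i : I" "p : A i" by blast
 show "EX D H. cox_form e D H & H p ~= 0 & (ALL q:cone. H q ~= 0 --> q : (UN i:I. A i))"
  by (rule opnE[OF assms[OF i(1)] i(2)]) (use i in blast)
qed

lemma opn_Int: 
 assumes "opn e A" "opn e B"
 shows "opn e (A Int B)"
 unfolding opn_def
proof (intro conjI ballI)
 show "A Int B <= cone" using assms opn_cone by blast
 fix p assume p: "p : A Int B"
 obtain D H where 1: "cox_form e D H" "H p ~= 0" "!!q. q : cone ==> H q ~= 0 ==> q : A"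
  using assms p by (auto elim: opnE)
 obtain D' H' where 2: "cox_form e D' H'" "H' p ~= 0" "!!q. q : cone ==> H' q ~= 0 ==> q : B"
  using assms p by (auto elim: opnE)
 show "EX D H. cox_form e D H & H p ~= 0 & (ALL q:cone. H q ~= 0 --> q : A Int B)"
  using cox_form_mult[OF 1(1) 2(1)] 1 2
  by (intro exI[of _ "D + D'"] exI[of _ "%q. H q * H' q"]) auto
qed

lemma opn_form: "cox_form e D F ==> opn e {p : cone. F p ~= 0}"
 unfolding opn_def by (intro conjI ballI exI[of _ D] exI[of _ F]) auto

lemma opn_cone' [simp]: "opn e cone"
 using opn_form[OF cox_form_const[of e 1]] by simp

lemma opn_empty [simp]: "opn e {}" by (simp add: opn_def)

lemma UT_eq: "finite T ==> UT T = {p : cone. (PROD i:T. cc p i) ~= (0::'k::field)}"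
 unfolding UT_def by auto

definition UTdeg :: "nat => nat set => divclass" where "UTdeg e T = (SUM i:T. dg e i)"

lemma UT_form: "T <= {..<4} ==> cox_form e (UTdeg e T) (%p. PROD i:T. cc p i)"
 unfolding UTdeg_def by (intro cox_form_prod cox_form_cc) auto

lemma opn_UT: "T <= {..<4} ==> opn e (UT T)"
 by (subst UT_eq) (auto intro: finite_subset opn_form[OF UT_form])

lemma reg_cong:
 assumes "reg e D A f" "!!p. p : A ==> g p = f p"
 shows "reg e D A g"
proof (rule regI)
 show "A <= cone" using assms reg_cone by blast
 fix p assume p: "p : A"
 obtain D' G H where "cox_form e D' H" "cox_form e (D + D') G" "H p ~= 0"
  "!!q. q : cone ==> H q ~= 0 ==> q : A & f q = G q / H q"
  using assms p by (auto elim: regE)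
 thus "EX D' G H. cox_form e D' H & cox_form e (D + D') G & H p ~= 0 &
   (ALL q:cone. H q ~= 0 --> q : A & g q = G q / H q)"
  using assms(2) by (intro exI[of _ D'] exI[of _ G] exI[of _ H]) simp
qed

lemma reg_local:
 assumes "!!p. p : A ==> EX B. p : B & B <= A & reg e D B f"
 shows "reg e D A f"
proof (rule regI)
 show "A <= cone" using assms reg_cone by blast
 fix p assume "p : A"
 then obtain B where B: "p : B" "B <= A" "reg e D B f" using assms by blast
 show "EX D' G H. cox_form e D' H & cox_form e (D + D') G & H p ~= 0 &
   (ALL q:cone. H q ~= 0 --> q : A & f q = G q / H q)"
  by (rule regE[OF B(3,1)]) (use B(2) in blast)
qed

lemma reg_subset:
 assumes "reg e D A f" "opn e B" "B <= A"
 shows "reg e D B f"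
proof (rule regI)
 show "B <= cone" using assms opn_cone by blast
 fix p assume p: "p : B"
 obtain D' G H where 1: "cox_form e D' H" "cox_form e (D + D') G" "H p ~= 0"
  "!!q. q : cone ==> H q ~= 0 ==> q : A & f q = G q / H q"
  using assms p by (auto elim: regE)
 obtain D1 K where 2: "cox_form e D1 K" "K p ~= 0" "!!q. q : cone ==> K q ~= 0 ==> q : B"
  using assms p by (auto elim: opnE)
 show "EX D' G H. cox_form e D' H & cox_form e (D + D') G & H p ~= 0 &
   (ALL q:cone. H q ~= 0 --> q : B & f q = G q / H q)"
  using cox_form_mult[OF 1(1) 2(1)] cox_form_mult[OF 1(2) 2(1)] 1 2
  by (intro exI[of _ "D' + D1"] exI[of _ "%q. G q * K q"] exI[of _ "%q. H q * K q"]) (auto simp: add.assoc)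
qed

lemma reg_form: "cox_form e D F ==> opn e A ==> reg e D A F"
proof (rule reg_subset[of _ _ cone])
 assume "cox_form e D F"
 thus "reg e D cone F" using cox_form_const[of e 1]
  by (intro regI exI[of _ 0] exI[of _ F] exI[of _ "%_. 1"]) auto
qed (auto simp: opn_def)

lemma reg_const: "opn e A ==> reg e 0 A (%p. a)"
 by (rule reg_form[OF cox_form_const])

lemma reg_0: "opn e A ==> reg e D A (%p. 0)"
 by (rule reg_form[OF cox_form_0])

lemma reg_mult:
 assumes "reg e D A f" "reg e D' A g"
 shows "reg e (D + D') A (%p. f p * g p)"
proof (rule regI)
 show "A <= cone" using assms reg_cone by blast
 fix p assume p: "p : A"
 obtain D1 G H where 1: "cox_form e D1 H" "cox_form e (D + D1) G" "H p ~= 0"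
  "!!q. q : cone ==> H q ~= 0 ==> q : A & f q = G q / H q"
  using assms p by (auto elim: regE)
 obtain D2 G' H' where 2: "cox_form e D2 H'" "cox_form e (D' + D2) G'" "H' p ~= 0"
  "!!q. q : cone ==> H' q ~= 0 ==> q : A & g q = G' q / H' q"
  using assms p by (auto elim: regE)
 have d: "(D + D1) + (D' + D2) = D + D' + (D1 + D2)" by (simp add: algebra_simps)
 show "EX D1 G H. cox_form e D1 H & cox_form e (D + D' + D1) G & H p ~= 0 &
   (ALL q:cone. H q ~= 0 --> q : A & f q * g q = G q / H q)"
  using cox_form_mult[OF 1(1) 2(1)] cox_form_mult[OF 1(2) 2(2), unfolded d] 1 2
  by (intro exI[of _ "D1 + D2"] exI[of _ "%q. G q * G' q"] exI[of _ "%q. H q * H' q"]) auto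
qed

lemma reg_add:
 assumes "reg e D A f" "reg e D A g"
 shows "reg e D A (%p. f p + g p)"
proof (rule regI)
 show "A <= cone" using assms reg_cone by blast
 fix p assume p: "p : A"
 obtain D1 G H where 1: "cox_form e D1 H" "cox_form e (D + D1) G" "H p ~= 0"
  "!!q. q : cone ==> H q ~= 0 ==> q : A & f q = G q / H q"
  using assms p by (auto elim: regE)
 obtain D2 G' H' where 2: "cox_form e D2 H'" "cox_form e (D + D2) G'" "H' p ~= 0"
  "!!q. q : cone ==> H' q ~= 0 ==> q : A & g q = G' q / H' q"
  using assms p by (auto elim: regE)
 have d: "(D + D1) + D2 = D + (D1 + D2)" "(D + D2) + D1 = D + (D1 + D2)" by (simp_all add: algebra_simps)
 have "cox_form e (D + (D1 + D2)) (%q. G q * H' q + G' q * H q)"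
  using cox_form_mult[OF 1(2) 2(1)] cox_form_mult[OF 2(2) 1(1)] unfolding d by (rule cox_form_add)
 thus "EX D1 G H. cox_form e D1 H & cox_form e (D + D1) G & H p ~= 0 &
   (ALL q:cone. H q ~= 0 --> q : A & f q + g q = G q / H q)"
  using cox_form_mult[OF 1(1) 2(1)] 1 2
  by (intro exI[of _ "D1 + D2"] exI[of _ "%q. G q * H' q + G' q * H q"] exI[of _ "%q. H q * H' q"])
    (auto simp: add_frac_eq)
qed

lemma reg_smult: "reg e D A f ==> reg e D A (%p. a * f p)"
 using reg_mult[OF reg_const[OF reg_opn], of e D A f D f a] by simp

lemma reg_diff: "reg e D A f ==> reg e D A g ==> reg e D A (%p. f p - g p)"
 using reg_add[OF _ reg_smult[of e D A g "-1"], of f] by simp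

lemma reg_uminus: "reg e D A f ==> reg e D A (%p. - f p)"
 using reg_smult[of e D A f "-1"] by simp

lemma reg_sum: "opn e A ==> (!!k. k : K ==> reg e D A (f k)) ==> reg e D A (%p. SUM k:K. f k p)"
 by (induction K rule: infinite_finite_induct) (auto intro: reg_0 reg_add)

lemma reg_prod:
 "opn e A ==> (!!k. k : K ==> reg e (d k) A (f k)) ==> reg e (SUM k:K. d k) A (%p. PROD k:K. f k p)"
 by (induction K rule: infinite_finite_induct) (auto intro: reg_const reg_mult)

lemma reg_power: "reg e D A f ==> reg e (nd n D) A (%p. f p ^ n)"
 by (induction n) (auto intro: reg_const reg_mult reg_opn)

lemma reg_inverse:
 assumes "reg e D A f" "!!p. p : A ==> f p ~= 0"
 shows "reg e (- D) A (%p. 1 / f p)"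
proof (rule regI)
 show "A <= cone" using assms reg_cone by blast
 fix p assume p: "p : A"
 obtain D1 G H where 1: "cox_form e D1 H" "cox_form e (D + D1) G" "H p ~= 0"
  "!!q. q : cone ==> H q ~= 0 ==> q : A & f q = G q / H q"
  using assms p by (auto elim: regE)
 have "p : cone" using p assms(1) reg_cone by blast
 hence "G p ~= 0" using 1(4)[OF _ 1(3)] assms(2)[OF p] by auto
 moreover have "cox_form e (- D + (D + D1 + D1)) (%q. H q * H q)"
  using cox_form_mult[OF 1(1) 1(1)] by simp
 ultimately show "EX D1 G H. cox_form e D1 H & cox_form e (- D + D1) G & H p ~= 0 &
   (ALL q:cone. H q ~= 0 --> q : A & 1 / f q = G q / H q)"
  using 1 cox_form_mult[OF 1(2) 1(1)]
  by (intro exI[of _ "D + D1 + D1"] exI[of _ "%q. H q * H q"] exI[of _ "%q. G q * H q"]) auto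
qed

lemma reg_divide:
 assumes "reg e D A f" "reg e D' A g" "!!p. p : A ==> g p ~= 0"
 shows "reg e (D - D') A (%p. f p / g p)"
 using reg_mult[OF assms(1) reg_inverse[OF assms(2,3)]] by simp

lemma reg_powi:
 assumes "reg e D A f" "!!p. p : A ==> f p ~= 0"
 shows "reg e (n * fst D, n * snd D) A (%p. f p powi n)"
proof (cases "0 <= n")
 case True
 then obtain k where "n = int k" using zero_le_imp_eq_int by blast
 thus ?thesis using reg_power[OF assms(1), of k] by (simp add: nd_def)
next
 case False
 define k where "k = nat (- n)"
 have n: "n = - int k" using False by (simp add: k_def)
 have "reg e (- nd k D) A (%p. 1 / f p ^ k)"
  by (rule reg_inverse[OF reg_power[OF assms(1)]]) (use assms(2) in auto)
 thus ?thesis by (simp add: n nd_def power_int_minus_divide)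
qed

text \<open>The quotient representation is arranged so that numerators vanish with their denominators.\<close>

lemma regE':
 assumes "reg e D A f" "p : A"
 obtains D' G H where "cox_form e D' H" "cox_form e (D + D') G" "H p ~= 0"
  "!!q. q : cone ==> H q ~= 0 ==> q : A" "!!q. q : A ==> f q * H q = G q"
proof -
 obtain D1 G H where 1: "cox_form e D1 H" "cox_form e (D + D1) G" "H p ~= 0"
  "!!q. q : cone ==> H q ~= 0 ==> q : A & f q = G q / H q"
  using assms by (auto elim: regE)
 have "f q * (H q * H q) = G q * H q" if "q : A" for q
  using 1(4)[of q] that reg_cone[OF assms(1)] by (cases "H q = 0") auto
 thus ?thesis using that[of "D1 + D1" "%q. H q * H q" "%q. G q * H q"] 1
   cox_form_mult[OF 1(1,1)] cox_form_mult[OF 1(2,1)] by (simp add: add.assoc)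
qed

lemma reg_mon:
 assumes "m : exps e D T" "T <= {..<4}"
 shows "reg e D (UT T) (%p. a * mon e D m p)"
proof -
 have o: "opn e (UT T)" by (rule opn_UT[OF assms(2)])
 have 1: "reg e (xp e D m i * fst (dg e i), xp e D m i * snd (dg e i)) (UT T) (%p. cc p i powi xp e D m i)"
  if i: "i < 4" for i
 proof (cases "i : T")
  case True
  thus ?thesis using i by (intro reg_powi reg_form[OF cox_form_cc o]) (auto simp: UT_def)
 next
  case False
  hence "0 <= xp e D m i" using assms i by (auto simp: exps_def)
  then obtain k where k: "xp e D m i = int k" using zero_le_imp_eq_int by blast
  show ?thesis using reg_power[OF reg_form[OF cox_form_cc[OF i] o], of k] by (simp add: nd_def k)
 qed
 have "reg e (SUM i<4. (xp e D m i * fst (dg e i), xp e D m i * snd (dg e i))) (UT T)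
   (%p. PROD i<4. cc p i powi xp e D m i)" using 1 by (intro reg_prod o) auto
 moreover have "{..<4::nat} = {0, 1, 2, 3}" by auto
 ultimately show ?thesis
  using reg_smult[of e D "UT T" "%p. mon e D m p" a]
  by (simp add: mon_def xp_simps dg_def mult.assoc algebra_simps)
qed

lemma lau_reg: "lau e D T f ==> T <= {..<4} ==> reg e D (UT T) f"
proof -
 assume "lau e D T f" and T: "T <= {..<4}"
 then obtain c where "finite {m. c m ~= 0}" "{m. c m ~= 0} <= exps e D T" "ALL p:UT T. f p = evl e D c p"
  unfolding lau_def by blast
 thus ?thesis unfolding evl_def
  by (intro reg_cong[OF reg_sum[OF opn_UT[OF T] reg_mon[OF _ T]]]) auto
qed

section \<open>Affine charts and the structure of regular functions\<close>

definition chart :: "nat => nat => bool" where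
 "chart i j \<longleftrightarrow> (i = 0 | i = 1) & (j = 2 | j = 3)"

text \<open>On the chart where the coordinates i and j are nonzero, tr is a generator of O(D) and uu, vv are affine coordinates.\<close>

definition tr :: "nat => nat => nat => divclass => 'k::field cox => 'k" where
 "tr e i j D p = cc p i powi (if j = 2 then snd D else snd D - int e * fst D) * cc p j powi fst D"

definition uu :: "nat => 'k::field cox => 'k" where
 "uu i p = cc p (1 - i) / cc p i"

definition vv :: "nat => nat => nat => 'k::field cox => 'k" where
 "vv e i j p = (if j = 2 then cc p 3 / (cc p i ^ e * cc p 2) else cc p 2 * cc p i ^ e / cc p 3)"

lemma tr_nonzero: "p : UT {i, j} ==> tr e i j D p ~= 0"
 by (simp add: tr_def UT_def)

lemma tr_add: "p : UT {i, j} ==> tr e i j (D + D') p = tr e i j D p * tr e i j D' p"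
 by (simp add: tr_def UT_def algebra_simps power_int_add power_int_diff)

lemma tr_0: "tr e i j 0 p = 1" by (simp add: tr_def)

lemma tr_nd: "p : UT {i, j} ==> tr e i j (nd n D) p = tr e i j D p ^ n"
 by (induction n) (auto simp: tr_add tr_0)

lemma tr_diff: "p : UT {i, j} ==> tr e i j (D - D') p = tr e i j D p / tr e i j D' p"
 using tr_add[of p i j e "D - D'" D'] tr_nonzero[of p i j e D'] by (simp add: field_simps)

text \<open>Dividing by the generator \<open>tr\<close> leaves the exponents of the two coordinates
  that may vanish on the chart; 1 - i and 5 - j are the indices complementary to i and j.\<close>

lemma mon_chart:
 assumes "chart i j" "p : UT {i, j}"
 shows "mon e D m p = tr e i j D p * uu i p powi xp e D m (1 - i) * vv e i j p powi xp e D m (5 - j)"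
proof -
 obtain x0 x1 y0 y1 where p: "p = (x0, x1, y0, y1)" by (cases p) auto
 obtain s t where D: "D = (s, t)" by (cases D) auto
 obtain a b where m: "m = (a, b)" by (cases m) auto
 have "i = 0 & j = 2 | i = 0 & j = 3 | i = 1 & j = 2 | i = 1 & j = 3"
  using assms(1) by (auto simp: chart_def)
 moreover have "cc p i ~= 0" "cc p j ~= 0" using assms(2) by (auto simp: UT_def)
 ultimately show ?thesis
  by (elim disjE conjE)
    (simp_all add: p D m mon_def tr_def uu_def vv_def xp_simps power_int_divide_distrib
     power_int_mult_distrib power_int_power power_int_diff power_int_add field_simps)
qed

lemma ev2_monom: "ev2 (monom (monom c a) b) u v = c * u ^ a * v ^ b"
 by (simp add: ev2_spec spec_def map_poly_monom poly_monom)

lemma ev2_altdef: "ev2 P u v = (SUM b<=degree P. SUM a<=degree (coeff P b). coeff (coeff P b) a * u ^ a * v ^ b)"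
proof -
 have "ev2 P u v = (SUM b<=degree P. poly (coeff P b) u * v ^ b)"
  unfolding ev2_def by (subst poly_altdef[of P]) (simp add: poly_sum)
 also have "... = (SUM b<=degree P. SUM a<=degree (coeff P b). coeff (coeff P b) a * u ^ a * v ^ b)"
  by (intro sum.cong refl) (simp add: poly_altdef[of _ u] sum_distrib_right)
 finally show ?thesis .
qed

lemma exps_chart:
 assumes "chart i j"
 shows "m : exps e D {i, j} \<longleftrightarrow> 0 <= xp e D m (1 - i) & 0 <= xp e D m (5 - j)"
 using assms by (auto simp: chart_def exps_def all4)

lemma ex_exp:
 assumes "chart i j"
 shows "EX m. xp e D m (1 - i) = a & xp e D m (5 - j) = b"
proof -
 define l where "l = (if j = 2 then b else fst D - b)"
 define h where "h = (if i = 0 then a else snd D - int e * l - a)"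
 show ?thesis using assms
  by (intro exI[of _ "(h, l)"]) (auto simp: chart_def xp_simps l_def h_def)
qed

text \<open>Trivialising by \<open>tr\<close> identifies Laurent polynomials on a chart with
  k[u, v], so that questions about forms become questions about polynomials in two
  variables.\<close>

lemma lau_chart:
 assumes "chart i j"
 shows "lau e D {i, j} f \<longleftrightarrow> (EX P. ALL p:UT {i, j}. f p = tr e i j D p * ev2 P (uu i p) (vv e i j p))"
proof
 assume "lau e D {i, j} f"
 then obtain c where c: "finite {m. c m ~= 0}" "{m. c m ~= 0} <= exps e D {i, j}"
  "ALL p:UT {i, j}. f p = evl e D c p" unfolding lau_def by blast
 define P where "P = (SUM m:{m. c m ~= 0}. monom (monom (c m) (nat (xp e D m (1 - i)))) (nat (xp e D m (5 - j))))"
 have "f p = tr e i j D p * ev2 P (uu i p) (vv e i j p)" if p: "p : UT {i, j}" for p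
 proof -
  have "f p = (SUM m:{m. c m ~= 0}. c m * mon e D m p)" using c p by (simp add: evl_def)
  also have "... = (SUM m:{m. c m ~= 0}. tr e i j D p * ev2 (monom (monom (c m)
    (nat (xp e D m (1 - i)))) (nat (xp e D m (5 - j)))) (uu i p) (vv e i j p))"
  proof (rule sum.cong[OF refl])
   fix m assume "m : {m. c m ~= 0}"
   hence "0 <= xp e D m (1 - i)" "0 <= xp e D m (5 - j)" using c(2) exps_chart[OF assms] by blast+
   then obtain a b where ab: "xp e D m (1 - i) = int a" "xp e D m (5 - j) = int b"
    by (metis zero_le_imp_eq_int)
   show "c m * mon e D m p = tr e i j D p * ev2 (monom (monom (c m)
    (nat (xp e D m (1 - i)))) (nat (xp e D m (5 - j)))) (uu i p) (vv e i j p)"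
    unfolding mon_chart[OF assms p] ev2_monom ab by simp
  qed
  finally show ?thesis by (simp add: P_def ev2_sum sum_distrib_left)
 qed
 thus "EX P. ALL p:UT {i, j}. f p = tr e i j D p * ev2 P (uu i p) (vv e i j p)" by blast
next
 assume "EX P. ALL p:UT {i, j}. f p = tr e i j D p * ev2 P (uu i p) (vv e i j p)"
 then obtain P where P: "!!p. p : UT {i, j} ==> f p = tr e i j D p * ev2 P (uu i p) (vv e i j p)" by blast
 define M where "M a b = (SOME m. xp e D m (1 - i) = int a & xp e D m (5 - j) = int b)" for a b
 have M: "xp e D (M a b) (1 - i) = int a & xp e D (M a b) (5 - j) = int b" for a b
  unfolding M_def by (rule someI_ex, rule ex_exp[OF assms])
 have "lau e D {i, j} (%p. SUM b<=degree P. SUM a<=degree (coeff P b). coeff (coeff P b) a * mon e D (M a b) p)"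
  by (intro lau_sum lau_mono) (simp only: exps_chart[OF assms] M of_nat_0_le_iff)
 thus "lau e D {i, j} f"
 proof (rule lau_cong)
  fix p :: "'a cox" assume p: "p : UT {i, j}"
  have "mon e D (M a b) p = tr e i j D p * (uu i p ^ a * vv e i j p ^ b)" for a b
   unfolding mon_chart[OF assms p] M[THEN conjunct1] M[THEN conjunct2] by simp
  thus "f p = (SUM b<=degree P. SUM a<=degree (coeff P b). coeff (coeff P b) a * mon e D (M a b) p)"
   by (simp add: P[OF p] ev2_altdef sum_distrib_left algebra_simps)
 qed
qed

lemma chart_point:
 assumes "chart i j"
 shows "EX p:UT {i, j}. uu i p = u & vv e i j p = v"
proof -
 define p where "p = (if i = 0 then 1 else u, if i = 0 then u else 1,
  if j = 2 then 1 else v, if j = 2 then v else 1)"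
 show ?thesis using assms
  by (intro bexI[of _ p]) (auto simp: chart_def p_def uu_def vv_def UT_def cone_def)
qed

text \<open>After dehomogenising, the common zeros of the ideal generated by the H k are zeros of F.
  As only finitely many H k occur in the expression, the lemma yields quasi-compactness of charts
  along with partitions of unity.\<close>

lemma chart_nullstellensatz:
 fixes F :: "'k::{alg_closed_field, field_char_0} cox => 'k"
 assumes ch: "chart i j" and F: "cox_form e D F" and H: "!!k. k : K ==> cox_form e (d k) (H k)"
  and cov: "!!p. p : UT {i, j} ==> F p ~= 0 ==> EX k:K. H k p ~= 0"
 shows "EX N K0 g. finite K0 & K0 <= K & (ALL k:K0. lau e (nd N D - d k) {i, j} (g k)) &
   (ALL p:UT {i, j}. F p ^ N = (SUM k:K0. g k p * H k p))"
proof -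
 have "EX P. ALL p:UT {i, j}. G p = tr e i j D p * ev2 P (uu i p) (vv e i j p)"
  if "cox_form e D G" for G :: "'k cox => 'k" and D
  using cox_form_lau[OF that] lau_chart[OF ch] by blast
 note * = this
 obtain Q where Q: "!!p. p : UT {i, j} ==> F p = tr e i j D p * ev2 Q (uu i p) (vv e i j p)"
  using *[OF F] by blast
 have "ALL k:K. EX P. ALL p:UT {i, j}. H k p = tr e i j (d k) p * ev2 P (uu i p) (vv e i j p)"
  using *[OF H] by blast
 then obtain P where P: "!!k p. k : K ==> p : UT {i, j} ==>
   H k p = tr e i j (d k) p * ev2 (P k) (uu i p) (vv e i j p)" by metis
 define J where "J = {s. EX K0 r. finite K0 & K0 <= K & s = (SUM k:K0. r k * P k)}"
 have "EX N. Q ^ N : J"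
 proof (rule nullstellensatz2)
  fix f g assume "f : J" "g : J"
  then obtain K0 r K1 r' where f: "finite K0" "K0 <= K" "f = (SUM k:K0. r k * P k)"
   and g: "finite K1" "K1 <= K" "g = (SUM k:K1. r' k * P k)" unfolding J_def by blast
  have "f = (SUM k:K0 \<union> K1. (if k : K0 then r k else 0) * P k)"
   unfolding f(3) using f(1) g(1) by (intro sum.mono_neutral_cong_left) auto
  moreover have "g = (SUM k:K0 \<union> K1. (if k : K1 then r' k else 0) * P k)"
   unfolding g(3) using f(1) g(1) by (intro sum.mono_neutral_cong_left) auto
  ultimately have "f + g = (SUM k:K0 \<union> K1. ((if k : K0 then r k else 0) + (if k : K1 then r' k else 0)) * P k)"
   by (simp add: sum.distrib ring_distribs)
  thus "f + g : J" unfolding J_def using f g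
   by (intro CollectI exI[of _ "K0 \<union> K1"]
      exI[of _ "%k. (if k : K0 then r k else 0) + (if k : K1 then r' k else 0)"]) simp
 next
  fix s f assume "f : J"
  then obtain K0 r where f: "finite K0" "K0 <= K" "f = (SUM k:K0. r k * P k)" unfolding J_def by blast
  have "s * f = (SUM k:K0. (s * r k) * P k)" unfolding f(3) by (simp add: sum_distrib_left mult.assoc)
  thus "s * f : J" unfolding J_def using f
   by (intro CollectI exI[of _ "K0"] exI[of _ "%k. s * r k"]) blast
 next
  show "0 : J" unfolding J_def by (intro CollectI exI[of _ "{}"]) auto
 next
  fix u v assume z: "!!f. f : J ==> ev2 f u v = 0"
  obtain p where p: "p : UT {i, j}" "uu i p = u" "vv e i j p = v" using chart_point[OF ch] by blast
  have "H k p = 0" if k: "k : K" for k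
  proof -
   have "P k = (SUM k:{k}. 1 * P k)" by simp
   hence "P k : J" unfolding J_def using k by (intro CollectI exI[of _ "{k}"] exI[of _ "%_. 1"]) blast
   from z[OF this] show ?thesis using P[OF k p(1)] p by simp
  qed
  hence "F p = 0" using cov[OF p(1)] by blast
  thus "ev2 Q u v = 0" using Q[OF p(1)] tr_nonzero[OF p(1)] p by simp
 qed
 then obtain N K0 r where K0: "finite K0" "K0 <= K" "Q ^ N = (SUM k:K0. r k * P k)" unfolding J_def by blast
 define g where "g k p = tr e i j (nd N D - d k) p * ev2 (r k) (uu i p) (vv e i j p)" for k p
 have "lau e (nd N D - d k) {i, j} (g k)" for k
  unfolding lau_chart[OF ch] g_def by blast
 moreover have "F p ^ N = (SUM k:K0. g k p * H k p)" if p: "p : UT {i, j}" for p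
 proof -
  have "F p ^ N = tr e i j (nd N D) p * ev2 (Q ^ N) (uu i p) (vv e i j p)"
   by (simp add: Q[OF p] tr_nd[OF p] power_mult_distrib)
  also have "... = (SUM k:K0. tr e i j (nd N D) p * (ev2 (r k) (uu i p) (vv e i j p) * ev2 (P k) (uu i p) (vv e i j p)))"
   unfolding K0(3) ev2_sum by (simp add: sum_distrib_left)
  also have "... = (SUM k:K0. g k p * H k p)"
   using K0(2) P[OF _ p] tr_nonzero[OF p]
   by (intro sum.cong refl) (auto simp: g_def tr_diff[OF p] field_simps)
  finally show ?thesis .
 qed
 ultimately show ?thesis using K0 by blast
qed

lemma nd_distrib: "nd n (D + D') = nd n D + nd n D'"
 by (simp add: nd_def algebra_simps)

text \<open>By \<open>regE'\<close> the local equations f * H k = G k hold on the whole set.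
  Multiplying F^N = SUM g k * H k by f replaces each H k by G k, and no denominator is left.\<close>

lemma reg_denominator:
 fixes f :: "'k::{alg_closed_field, field_char_0} cox => 'k"
 assumes ch: "chart i j" and F: "cox_form e D1 F" and f: "reg e D (UT {i, j} Int {p. F p ~= 0}) f"
 shows "EX N g. lau e (nd N D1 + D) {i, j} g & (ALL p:UT {i, j}. F p ~= 0 --> F p ^ N * f p = g p)"
proof -
 define A where "A = UT {i, j} Int {p. F p ~= 0}"
 have "ALL p:A. EX D' G H. cox_form e D' H & cox_form e (D + D') G & H p ~= 0 &
  (ALL q:A. f q * H q = G q)"
 proof
  fix p assume p: "p : A"
  show "EX D' G H. cox_form e D' H & cox_form e (D + D') G & H p ~= 0 &
   (ALL q:A. f q * H q = G q)"
   by (rule regE'[OF f[folded A_def] p]) blast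
 qed
 then obtain d G H where GH: "!!k. k : A ==> cox_form e (d k) (H k)" "!!k. k : A ==> cox_form e (D + d k) (G k)"
  "!!k. k : A ==> H k k ~= 0" "!!k q. k : A ==> q : A ==> f q * H k q = G k q"
  by metis
 have "!!p. p : UT {i, j} ==> F p ~= 0 ==> EX k:A. H k p ~= 0"
 proof -
  fix p assume "p : UT {i, j}" "F p ~= 0"
  hence "p : A" by (simp add: A_def)
  thus "EX k:A. H k p ~= 0" by (intro bexI[of _ p] GH(3))
 qed
 from chart_nullstellensatz[of i j e D1 F A d H, OF ch F GH(1) this]
 obtain N K0 g where N: "finite K0" "K0 <= A" "!!k. k : K0 ==> lau e (nd N D1 - d k) {i, j} (g k)"
   "!!p. p : UT {i, j} ==> F p ^ N = (SUM k:K0. g k p * H k p)" by blast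
 have "lau e (nd N D1 + D) {i, j} (%p. SUM k:K0. g k p * G k p)"
 proof (rule lau_sum)
  fix k assume k: "k : K0"
  have "lau e ((nd N D1 - d k) + (D + d k)) {i, j} (%p. g k p * G k p)"
   using k N(2) by (intro lau_mult N(3) cox_form_lau GH(2)) auto
  thus "lau e (nd N D1 + D) {i, j} (%p. g k p * G k p)" by (simp add: algebra_simps)
 qed
 moreover have "F p ^ N * f p = (SUM k:K0. g k p * G k p)" if "p : UT {i, j}" "F p ~= 0" for p
  unfolding N(4)[OF that(1)] sum_distrib_right
 proof (rule sum.cong[OF refl])
  fix k assume "k : K0"
  hence "k : A" using N(2) by blast
  moreover have "p : A" using that by (simp add: A_def)
  ultimately have "f p * H k p = G k p" by (rule GH(4))
  thus "g k p * H k p * f p = g k p * G k p" by (simp add: mult.assoc mult.commute[of "f p"])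
 qed
 ultimately show ?thesis by blast
qed

lemma lau_inverse_cc:
 assumes "i < 4" "i : T"
 shows "lau e (- dg e i) T (%p. 1 / cc p i)"
proof -
 have *: "i = 0 | i = 1 | i = 2 | i = 3" using assms by auto
 define m :: "int \<times> int" where "m = (if i = 1 then -1 else 0, if i = 3 then -1 else 0)"
 have "m : exps e (- dg e i) {i}" using * by (auto simp: exps_def all4 xp_simps dg_def m_def)
 hence "lau e (- dg e i) T (%p. 1 * mon e (- dg e i) m p)"
  using assms(2) exps_mono[of "{i}" T e "- dg e i"] by (intro lau_mono) auto
 thus ?thesis
  by (rule lau_cong) (use * in \<open>auto simp: mon_def xp_simps dg_def m_def power_int_minus_divide\<close>)
qed

text \<open>Take F in \<open>reg_denominator\<close> to be the product of the coordinates in T;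
  dividing by its N-th power is multiplication by a Laurent monomial.\<close>

lemma reg_lau:
 fixes f :: "'k::{alg_closed_field, field_char_0} cox => 'k"
 assumes ch: "chart i j" and T: "{i, j} <= T" "T <= {..<4}" and f: "reg e D (UT T) f"
 shows "lau e D T f"
proof -
 have fT: "finite T" using T(2) finite_subset by blast
 define w :: "'k cox => 'k" where "w p = (PROD i:T. cc p i)" for p
 have eq: "UT T = UT {i, j} Int {p. w p ~= 0}"
  using T(1) fT by (auto simp: UT_def w_def)
 obtain N g where g: "lau e (nd N (UTdeg e T) + D) {i, j} g"
   "!!p. p : UT T ==> w p ^ N * f p = g p"
  using reg_denominator[OF ch UT_form[OF T(2)] f[unfolded eq w_def]] unfolding eq w_def by blast
 have "lau e (- UTdeg e T) T (%p. PROD i:T. 1 / cc p i)"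
  using lau_prod[of T e "%i. - dg e i" T "%i p. 1 / cc p i"] T(2) lau_inverse_cc[of _ T e]
  by (force simp: UTdeg_def sum_negf)
 hence "lau e (nd N (- UTdeg e T)) T (%p. (PROD i:T. 1 / cc p i) ^ N)" by (rule lau_power)
 from lau_mult[OF this lau_subset[OF g(1) T(1)]]
 have "lau e D T (%p. (PROD i:T. 1 / cc p i) ^ N * g p)" by (simp add: nd_def plus_prod_def)
 thus ?thesis
 proof (rule lau_cong)
  fix p :: "'k cox" assume p: "p : UT T"
  have "w p ~= 0" using p eq by blast
  moreover have "(PROD i:T. 1 / cc p i) ^ N = 1 / w p ^ N" by (simp add: w_def prod_dividef power_one_over)
  ultimately show "f p = (PROD i:T. 1 / cc p i) ^ N * g p"
   by (simp add: g(2)[OF p, symmetric])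
 qed
qed

text \<open>A pole along F1 = 0 is removed by a power of F1. The form F0 cuts down the set on which
  the extension is wanted; in applications it belongs to another member of the covering.\<close>

lemma reg_extend:
 fixes f :: "'k::{alg_closed_field, field_char_0} cox => 'k"
 assumes ch: "chart i j" and T: "{i, j} <= T" "T <= {..<4}"
  and F0: "cox_form e D0 F0" and F1: "cox_form e D1 F1"
  and f: "reg e D (UT T Int {p. F0 p ~= 0} Int {p. F1 p ~= 0}) f"
 shows "EX N. ALL n>N. reg e (nd n D1 + D) (UT T Int {p. F0 p ~= 0}) (%p. F1 p ^ n * f p)"
proof -
 have fT: "finite T" using T(2) finite_subset by blast
 define w :: "'k cox => 'k" where "w p = (PROD i:T. cc p i)" for p
 define A where "A = UT T Int {p. F0 p ~= 0}"
 have w: "cox_form e (UTdeg e T) w" using UT_form[OF T(2), of e] by (simp add: w_def[abs_def])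
 note wF0 = cox_form_mult[OF w F0]
 note F = cox_form_mult[OF wF0 F1]
 have opnA: "opn e A"
 proof -
  have "A = UT T Int {p : cone. F0 p ~= 0}" using UT_cone by (auto simp: A_def)
  thus ?thesis using opn_Int[OF opn_UT[OF T(2)] opn_form[OF F0]] by simp
 qed
 have eq: "UT T Int {p. F0 p ~= 0} Int {p. F1 p ~= 0} = UT {i, j} Int {p. w p * F0 p * F1 p ~= 0}"
  using T(1) fT by (auto simp: UT_def w_def)
 obtain N g where g: "lau e (nd N (UTdeg e T + D0 + D1) + D) {i, j} g"
   "!!p. p : UT {i, j} ==> w p * F0 p * F1 p ~= 0 ==> (w p * F0 p * F1 p) ^ N * f p = g p"
  using reg_denominator[OF ch F f[unfolded eq]] by blast
 have sub: "A <= UT {i, j}" using UT_anti[OF T(1)] by (auto simp: A_def)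
 have wF0nz: "w p * F0 p ~= 0" if "p : A" for p
  using that fT by (auto simp: A_def w_def UT_def)
 \<comment> \<open>The strict inequality leaves a factor F1 over, so the product is 0 where F1
   vanishes, whatever value f has there.\<close>
 have "reg e (nd n D1 + D) A (%p. F1 p ^ n * f p)" if n: "n > N" for n
 proof -
  have "{i, j} <= {..<4}" using T by blast
  hence "reg e (nd N (UTdeg e T + D0 + D1) + D) A g"
   using reg_subset[OF lau_reg[OF g(1)] opnA sub] by blast
  moreover have "reg e (nd (n - N) D1) A (%p. F1 p ^ (n - N))"
   by (intro reg_power reg_form[OF F1 opnA])
  moreover have "reg e (nd N (UTdeg e T + D0)) A (%p. (w p * F0 p) ^ N)"
   by (intro reg_power reg_form[OF wF0 opnA])
  ultimately have R: "reg e (nd (n - N) D1 + (nd N (UTdeg e T + D0 + D1) + D) - nd N (UTdeg e T + D0)) A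
    (%p. F1 p ^ (n - N) * g p / (w p * F0 p) ^ N)"
   using wF0nz by (intro reg_divide reg_mult) auto
  have dq: "nd (n - N) D1 + (nd N (UTdeg e T + D0 + D1) + D) - nd N (UTdeg e T + D0) = nd n D1 + D"
   using nd_add[of "n - N" N D1] n by (simp add: nd_distrib algebra_simps)
  show ?thesis
  proof (rule reg_cong[OF R[unfolded dq]])
   fix p assume p: "p : A"
   show "F1 p ^ n * f p = F1 p ^ (n - N) * g p / (w p * F0 p) ^ N"
   proof (cases "F1 p = 0")
    case True thus ?thesis using n by (simp add: zero_power)
   next
    case False
    have "F1 p ^ n = F1 p ^ (n - N) * F1 p ^ N" using n by (simp flip: power_add)
    moreover have "g p = (w p * F0 p) ^ N * F1 p ^ N * f p"
     using g(2)[of p] wF0nz[OF p] False p sub by (auto simp: power_mult_distrib)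
    ultimately show ?thesis using wF0nz[OF p] by simp
   qed
  qed
 qed
 thus ?thesis unfolding A_def by blast
qed

lemma ev2_eq_0_imp:
 fixes P :: "'k::field_char_0 poly poly"
 assumes "!!u v. u ~= 0 ==> v ~= 0 ==> ev2 P u v = 0" shows "P = 0"
proof -
 have "ev2 (P * monom (monom 1 1) 1) u v = 0" for u v
  using assms[of u v] by (auto simp: ev2_monom)
 hence "P * monom (monom 1 1) 1 = 0" by (rule ev2_eq_0)
 thus ?thesis by simp
qed

text \<open>Multiplication by a high monomial turns the Laurent polynomial into a polynomial in the
  affine coordinates that vanishes off the axes, hence identically.\<close>

lemma evl_eq_0_imp:
 fixes c :: "int \<times> int => 'k::field_char_0"
 assumes fin: "finite {m. c m ~= 0}" and z: "!!p. p : UT {0, 1, 2, 3} ==> evl e D c p = 0"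
 shows "c m = 0"
proof -
 define S where "S = {m. c m ~= 0}"
 have ch: "chart 0 2" by (simp add: chart_def)
 \<comment> \<open>Large enough to make every exponent in the support nonnegative after a shift by
   N.\<close>
 define N where "N = nat (SUM m:S. \<bar>fst m\<bar> + \<bar>snd m\<bar>)"
 have N: "0 <= fst m + int N" "0 <= snd m + int N" if "m : S" for m
 proof -
  have "\<bar>fst m\<bar> + \<bar>snd m\<bar> <= (SUM m:S. \<bar>fst m\<bar> + \<bar>snd m\<bar>)"
   using fin that by (intro member_le_sum) (auto simp: S_def)
  thus "0 <= fst m + int N" "0 <= snd m + int N" by (auto simp: N_def)
 qed
 define P where "P = (SUM m:S. monom (monom (c m) (nat (fst m + int N))) (nat (snd m + int N)))"
 have "P = 0"
 proof (rule ev2_eq_0_imp)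
  fix u v :: 'k assume uv: "u ~= 0" "v ~= 0"
  obtain p where p: "p : UT {0, 2}" "uu 0 p = u" "vv e 0 2 p = v" using chart_point[OF ch] by blast
  have "p : UT {0, 1, 2, 3}" using p uv by (auto simp: UT_def uu_def vv_def)
  hence "0 = (SUM m:S. c m * mon e D m p)" using z by (simp add: evl_def S_def)
  also have "... = (SUM m:S. tr e 0 2 D p * (c m * u powi fst m * v powi snd m))"
   using mon_chart[OF ch p(1), of e D] p by (simp add: xp_simps algebra_simps)
  also have "... = tr e 0 2 D p * (SUM m:S. c m * u powi fst m * v powi snd m)" by (simp add: sum_distrib_left)
  finally have "(SUM m:S. c m * u powi fst m * v powi snd m) = 0" using tr_nonzero[OF p(1)] by simp
  hence "0 = u ^ N * v ^ N * (SUM m:S. c m * u powi fst m * v powi snd m)" by simp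
  also have "... = (SUM m:S. c m * (u powi fst m * u powi int N) * (v powi snd m * v powi int N))"
   by (simp add: sum_distrib_left algebra_simps)
  also have "... = (SUM m:S. c m * u ^ nat (fst m + int N) * v ^ nat (snd m + int N))"
  proof (rule sum.cong[OF refl])
   fix m assume "m : S"
   thus "c m * (u powi fst m * u powi int N) * (v powi snd m * v powi int N) =
    c m * u ^ nat (fst m + int N) * v ^ nat (snd m + int N)"
    using N[of m] uv by (simp add: power_int_nonneg_exp[symmetric] power_int_add)
  qed
  also have "... = ev2 P u v" by (simp add: P_def ev2_sum ev2_monom)
  finally show "ev2 P u v = 0" by simp
 qed
 show "c m = 0"
 proof (rule ccontr)
  assume "c m ~= 0"
  hence m: "m : S" by (simp add: S_def)
  have "0 = coeff (coeff P (nat (snd m + int N))) (nat (fst m + int N))" using \<open>P = 0\<close> by simp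
  also have "... = (SUM m':S. if m' = m then c m' else 0)"
   unfolding P_def coeff_sum
  proof (rule sum.cong[OF refl])
   fix m' assume m': "m' : S"
   have "nat (snd m' + int N) = nat (snd m + int N) & nat (fst m' + int N) = nat (fst m + int N) \<longleftrightarrow> m' = m"
    using N[OF m] N[OF m'] by (auto simp: prod_eq_iff eq_nat_nat_iff)
   thus "coeff (coeff (monom (monom (c m') (nat (fst m' + int N))) (nat (snd m' + int N))) (nat (snd m + int N)))
     (nat (fst m + int N)) = (if m' = m then c m' else 0)"
    by (auto simp: coeff_monom)
  qed
  also have "... = c m" using m fin by (simp add: S_def)
  finally show False using \<open>c m ~= 0\<close> by simp
 qed
qed

section \<open>Finite principal coverings and partitions of unity\<close>

text \<open>Members are principal, so that partitions of unity can be written with powers of the f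
  i. The labels \<open>ci\<close> and \<open>cj\<close> choose a chart containing each member; they
  decide later which of the data given chart by chart is used on it.\<close>

locale basic_cover =
 fixes e :: nat and I :: "'i set" and f :: "'i => 'k::{alg_closed_field, field_char_0} cox => 'k"
  and d :: "'i => divclass" and ci cj :: "'i => nat"
 assumes fin: "finite I"
  and form: "!!i. i : I ==> cox_form e (d i) (f i)"
  and ch: "!!i. i : I ==> chart (ci i) (cj i)"
  and sub: "!!i. i : I ==> {p : cone. f i p ~= 0} <= UT {ci i, cj i}"
  and cov: "!!p. p : cone ==> EX i:I. f i p ~= 0"
begin

definition A :: "'i => 'k cox set" where "A i = {p : cone. f i p ~= 0}"

lemma opn_A: "i : I ==> opn e (A i)"
 unfolding A_def by (rule opn_form[OF form])

lemma A_sub: "i : I ==> A i <= UT {ci i, cj i}"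
 unfolding A_def by (rule sub)

lemma A_cone: "A i <= cone" unfolding A_def by auto

lemma A_cov: "p : cone ==> EX i:I. p : A i"
 using cov unfolding A_def by auto

text \<open>Since the f i have no common zero on the chart, 1 = SUM rr i * f i ^ n. The exponent n
  is common to all i and s and so large that f i ^ n * c i s extends; rr i has the opposite degree
  of f i ^ n.\<close>

lemma partition:
 fixes c :: "'i => 's => 'k cox => 'k"
 assumes c0: "chart a b" and T: "{a, b} <= T" "T <= {..<4}" and S: "finite S"
  and F: "!!s. s : S ==> cox_form e (dF s) (F s)"
  and c: "!!i s. i : I ==> s : S ==> reg e D (UT T Int {p. F s p ~= 0} Int {p. f i p ~= 0}) (c i s)"
 shows "EX \<pi>. (ALL p:UT T. (SUM i:I. \<pi> i p) = 1) & (ALL i p. f i p = 0 --> \<pi> i p = 0) &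
  (ALL s:S. reg e D (UT T Int {p. F s p ~= 0}) (%p. SUM i:I. \<pi> i p * c i s p))"
proof -
 have fT: "finite T" using T(2) finite_subset by blast
 define N where "N i s = (SOME N. ALL n>N. reg e (nd n (d i) + D) (UT T Int {p. F s p ~= 0}) (%p. f i p ^ n * c i s p))" for i s
 have N: "ALL n>N i s. reg e (nd n (d i) + D) (UT T Int {p. F s p ~= 0}) (%p. f i p ^ n * c i s p)"
  if "i : I" "s : S" for i s
  unfolding N_def by (rule someI_ex, rule reg_extend[OF c0 T F[OF that(2)] form[OF that(1)] c[OF that]])
 \<comment> \<open>\<open>Suc\<close> keeps n strictly above every bound and makes f i ^ n vanish
   with f i.\<close>
 define n where "n = Suc (SUM i:I. SUM s:S. N i s)"
 have n: "n > N i s" if "i : I" "s : S" for i s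
 proof -
  have "N i s <= (SUM s:S. N i s)" using that S by (intro member_le_sum) auto
  also have "... <= (SUM i:I. SUM s:S. N i s)" using that fin by (intro member_le_sum) auto
  finally show ?thesis by (simp add: n_def)
 qed
 define w :: "'k cox => 'k" where "w p = (PROD i:T. cc p i)" for p
 have w: "cox_form e (UTdeg e T) w" using UT_form[OF T(2), of e] by (simp add: w_def[abs_def])
 have wnz: "w p ~= 0" if "p : UT T" for p using that fT by (auto simp: w_def UT_def)
 have "EX i:I. f i p ^ n ~= 0" if p: "p : UT {a, b}" for p
 proof -
  have "p : cone" using p UT_cone by blast
  thus ?thesis using cov[of p] by auto
 qed
 from chart_nullstellensatz[OF c0 w cox_form_power[OF form, of _ n] this]
 obtain M K g where M: "finite K" "K <= I" "!!k. k : K ==> lau e (nd M (UTdeg e T) - nd n (d k)) {a, b} (g k)"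
   "!!p. p : UT {a, b} ==> w p ^ M = (SUM k:K. g k p * f k p ^ n)" by blast
 define rr where "rr i p = (if i : K then g i p / w p ^ M else 0)" for i p
 have ab: "{a, b} <= {..<4}" using T by blast
 have rr: "reg e (- nd n (d i)) (UT T) (rr i)" if i: "i : I" for i
 proof (cases "i : K")
  case True
  have "reg e ((nd M (UTdeg e T) - nd n (d i)) - nd M (UTdeg e T)) (UT T) (%p. g i p / w p ^ M)"
   using wnz by (intro reg_divide reg_subset[OF lau_reg[OF M(3)[OF True] ab] opn_UT[OF T(2)] UT_anti[OF T(1)]]
     reg_power reg_form[OF w opn_UT[OF T(2)]]) auto
  thus ?thesis using True by (simp add: rr_def[abs_def])
 qed (simp add: rr_def[abs_def] reg_0[OF opn_UT[OF T(2)]])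
 define \<pi> where "\<pi> i p = rr i p * f i p ^ n" for i p
 have 1: "(SUM i:I. \<pi> i p) = 1" if p: "p : UT T" for p
 proof -
  have "(SUM i:I. \<pi> i p) = (SUM k:K. g k p * f k p ^ n / w p ^ M)"
   using M(2) fin by (intro sum.mono_neutral_cong_right) (auto simp: \<pi>_def rr_def)
  also have "... = (SUM k:K. g k p * f k p ^ n) / w p ^ M" by (simp add: sum_divide_distrib)
  also have "... = 1" using M(4)[of p] UT_anti[OF T(1)] p wnz[OF p] by auto
  finally show ?thesis .
 qed
 moreover have "\<pi> i p = 0" if "f i p = 0" for i p using that by (simp add: \<pi>_def n_def)
 moreover have "reg e D (UT T Int {p. F s p ~= 0}) (%p. SUM i:I. \<pi> i p * c i s p)" if s: "s : S" for s
 proof -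
  have eq: "UT T Int {p. F s p ~= 0} = UT T Int {p : cone. F s p ~= 0}" using UT_cone by auto
  have o: "opn e (UT T Int {p. F s p ~= 0})"
   unfolding eq by (rule opn_Int[OF opn_UT[OF T(2)] opn_form[OF F[OF s]]])
  show ?thesis
  proof (rule reg_sum[OF o])
   fix i assume i: "i : I"
   have "reg e (- nd n (d i) + (nd n (d i) + D)) (UT T Int {p. F s p ~= 0}) (%p. rr i p * (f i p ^ n * c i s p))"
    by (intro reg_mult N[OF i s, rule_format, OF n[OF i s]] reg_subset[OF rr[OF i] o]) auto
   thus "reg e D (UT T Int {p. F s p ~= 0}) (%p. \<pi> i p * c i s p)"
    by (simp add: \<pi>_def mult.assoc)
  qed
 qed
 ultimately show ?thesis by blast
qed

text \<open>The standard homotopy b j = SUM i. \<pi> i * c i j: the cocycle identity turns b k - b j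
  into c j k times the sum of the \<pi> i, which is 1.\<close>

lemma affine_H1:
 assumes c0: "chart a b" and T: "{a, b} <= T" "T <= {..<4}"
  and c: "!!i j. i : I ==> j : I ==> reg e D (A i Int A j Int UT T) (c i j)"
  and coc: "!!i j k p. [|i : I; j : I; k : I; p : A i; p : A j; p : A k; p : UT T|] ==>
    c j k p - c i k p + c i j p = 0"
 shows "EX b. (ALL j:I. reg e D (A j Int UT T) (b j)) &
   (ALL j:I. ALL k:I. ALL p:A j Int A k Int UT T. c j k p = b k p - b j p)"
proof -
 have "reg e D (UT T Int {p. f j p ~= 0} Int {p. f i p ~= 0}) (c i j)" if "i : I" "j : I" for i j
 proof -
  have "A i Int A j Int UT T = UT T Int {p. f j p ~= 0} Int {p. f i p ~= 0}"
   using UT_cone by (auto simp: A_def)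
  thus ?thesis using c[OF that] by simp
 qed
 from partition[where F = f and dF = d and c = c, OF c0 T fin form this]
 obtain \<pi> where \<pi>: "!!p. p : UT T ==> (SUM i:I. \<pi> i p) = 1" "!!i p. f i p = 0 ==> \<pi> i p = 0"
  "!!j. j : I ==> reg e D (UT T Int {p. f j p ~= 0}) (%p. SUM i:I. \<pi> i p * c i j p)" by blast
 define b where "b j p = (SUM i:I. \<pi> i p * c i j p)" for j p
 have "reg e D (A j Int UT T) (b j)" if "j : I" for j
 proof -
  have "A j Int UT T = UT T Int {p. f j p ~= 0}" using UT_cone by (auto simp: A_def)
  thus ?thesis using \<pi>(3)[OF that] by (simp add: b_def[abs_def])
 qed
 moreover have "c j k p = b k p - b j p" if jk: "j : I" "k : I" and p: "p : A j Int A k Int UT T" for j k p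
 proof -
  have "b k p - b j p = (SUM i:I. \<pi> i p * (c i k p - c i j p))"
   by (simp add: b_def sum_subtractf algebra_simps)
  also have "... = (SUM i:I. \<pi> i p * c j k p)"
  proof (rule sum.cong[OF refl])
   fix i assume i: "i : I"
   show "\<pi> i p * (c i k p - c i j p) = \<pi> i p * c j k p"
   proof (cases "f i p = 0")
    case False
    hence "p : A i" using p by (auto simp: A_def)
    hence "c j k p - c i k p + c i j p = 0" using i jk p by (intro coc) auto
    hence "c i k p - c i j p = c j k p" by (simp add: algebra_simps)
    thus ?thesis by simp
   qed (simp add: \<pi>(2))
  qed
  also have "... = c j k p" using \<pi>(1)[of p] p by (simp flip: sum_distrib_right)
  finally show ?thesis by simp
 qed
 ultimately show ?thesis by blast
qed

text \<open>The same homotopy one degree higher. The functions to be extended now belong to double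
  intersections, hence the index set I \<times> I in \<open>partition\<close>.\<close>

lemma affine_H2:
 assumes c0: "chart a b" and T: "{a, b} <= T" "T <= {..<4}"
  and c: "!!i j k. i : I ==> j : I ==> k : I ==> reg e D (A i Int A j Int A k Int UT T) (c i j k)"
  and coc: "!!i j k l p. [|i : I; j : I; k : I; l : I; p : A i; p : A j; p : A k; p : A l; p : UT T|] ==>
    c j k l p - c i k l p + c i j l p - c i j k p = 0"
 shows "EX b. (ALL j:I. ALL k:I. reg e D (A j Int A k Int UT T) (b j k)) &
   (ALL j:I. ALL k:I. ALL l:I. ALL p:A j Int A k Int A l Int UT T. c j k l p = b k l p - b j l p + b j k p)"
proof -
 have F: "cox_form e (d (fst s) + d (snd s)) (%p. f (fst s) p * f (snd s) p)" if "s : I \<times> I" for s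
  using that by (intro cox_form_mult form) auto
 have "reg e D (UT T Int {p. f (fst s) p * f (snd s) p ~= 0} Int {p. f i p ~= 0}) (c i (fst s) (snd s))"
  if "i : I" "s : I \<times> I" for i s
 proof -
  have "A i Int A (fst s) Int A (snd s) Int UT T = UT T Int {p. f (fst s) p * f (snd s) p ~= 0} Int {p. f i p ~= 0}"
   using UT_cone by (auto simp: A_def)
  thus ?thesis using c[of i "fst s" "snd s"] that by (simp add: mem_Times_iff)
 qed
 from partition[where c = "%i s. c i (fst s) (snd s)", OF c0 T finite_cartesian_product[OF fin fin] F this]
 obtain \<pi> where \<pi>: "!!p. p : UT T ==> (SUM i:I. \<pi> i p) = 1" "!!i p. f i p = 0 ==> \<pi> i p = 0"
  "!!s. s : I \<times> I ==> reg e D (UT T Int {p. f (fst s) p * f (snd s) p ~= 0}) (%p. SUM i:I. \<pi> i p * c i (fst s) (snd s) p)"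
  by blast
 define b where "b j k p = (SUM i:I. \<pi> i p * c i j k p)" for j k p
 have "reg e D (A j Int A k Int UT T) (b j k)" if "j : I" "k : I" for j k
 proof -
  have "A j Int A k Int UT T = UT T Int {p. f j p * f k p ~= 0}" using UT_cone by (auto simp: A_def)
  thus ?thesis using \<pi>(3)[of "(j, k)"] that by (simp add: b_def[abs_def])
 qed
 moreover have "c j k l p = b k l p - b j l p + b j k p"
  if jk: "j : I" "k : I" "l : I" and p: "p : A j Int A k Int A l Int UT T" for j k l p
 proof -
  have "b k l p - b j l p + b j k p = (SUM i:I. \<pi> i p * (c i k l p - c i j l p + c i j k p))"
   by (simp add: b_def sum_subtractf sum.distrib algebra_simps)
  also have "... = (SUM i:I. \<pi> i p * c j k l p)"
  proof (rule sum.cong[OF refl])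
   fix i assume i: "i : I"
   show "\<pi> i p * (c i k l p - c i j l p + c i j k p) = \<pi> i p * c j k l p"
   proof (cases "f i p = 0")
    case False
    hence "p : A i" using p by (auto simp: A_def)
    hence "c j k l p - c i k l p + c i j l p - c i j k p = 0" using i jk p by (intro coc) auto
    hence "c i k l p - c i j l p + c i j k p = c j k l p" by (simp add: algebra_simps)
    thus ?thesis by simp
   qed (simp add: \<pi>(2))
  qed
  also have "... = c j k l p" using \<pi>(1)[of p] p by (simp flip: sum_distrib_right)
  finally show ?thesis by simp
 qed
 ultimately show ?thesis by blast
qed

lemma glue:
 assumes W: "opn e W" and m: "!!i. i : I ==> reg e D (A i Int W) (m i)"
  and eq: "!!i j p. [|i : I; j : I; p : A i; p : A j; p : W|] ==> m i p = m j p"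
 shows "EX g. reg e D W g & (ALL i:I. ALL p:A i Int W. g p = m i p)"
proof -
 define g where "g p = m (SOME i. i : I & p : A i) p" for p
 have g: "g p = m i p" if "i : I" "p : A i Int W" for i p
 proof -
  have "(SOME i. i : I & p : A i) : I & p : A (SOME i. i : I & p : A i)"
   by (rule someI[of _ i]) (use that in auto)
  thus ?thesis unfolding g_def using that by (intro eq) auto
 qed
 have "reg e D W g"
 proof (rule reg_local)
  fix p assume p: "p : W"
  hence "p : cone" using opn_cone[OF W] by blast
  then obtain i where i: "i : I" "p : A i" using A_cov by blast
  have "reg e D (A i Int W) g" by (rule reg_cong[OF m[OF i(1)] g[OF i(1)]])
  thus "EX B. p : B & B <= W & reg e D B g"
   using i(2) p by (intro exI[of _ "A i Int W"]) blast
 qed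
 thus ?thesis using g by blast
qed

end

section \<open>The four standard charts and first cohomology\<close>

abbreviation "torus == {0, 1, 2, 3::nat}"

lemma UT_insert: "p : UT (insert i T) \<longleftrightarrow> p : UT T & cc p i ~= 0"
 by (auto simp: UT_def)

lemma cone_chart:
 assumes "p : cone" obtains a b where "chart a b" "p : UT {a, b}"
proof -
 have "cc p 0 ~= 0 | cc p 1 ~= 0" "cc p 2 ~= 0 | cc p 3 ~= 0" using assms by (auto simp: cone_def)
 thus ?thesis using assms that by (auto simp: UT_def chart_def)
qed

lemma lau_coeffs:
 assumes "lau e D T f"
 obtains c where "finite {m. c m ~= 0}" "!!m. c m ~= 0 ==> m : exps e D T"
  "!!p. p : UT T ==> f p = evl e D c p"
 using assms unfolding lau_def by blast

lemma lauI:
 assumes "finite {m. c m ~= 0}" "!!m. c m ~= 0 ==> m : exps e D T" "!!p. p : UT T ==> f p = evl e D c p"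
 shows "lau e D T f"
 using assms unfolding lau_def by (intro exI[of _ c]) blast

lemma evl_finite: "finite A ==> (!!m. m ~: A ==> c m = 0) ==> evl e D c p = (SUM m:A. c m * mon e D m p)"
 by (rule evl_superset) auto

lemma evl_add_diff:
 assumes "finite {m. c m ~= 0}" "finite {m. c' m ~= 0}"
 shows "finite {m. c m + c' m ~= (0::'k::field)}" "finite {m. c m - c' m ~= 0}"
  "evl e D (%m. c m + c' m) p = evl e D c p + evl e D c' p"
  "evl e D (%m. c m - c' m) p = evl e D c p - evl e D c' p"
proof -
 let ?S = "{m. c m ~= 0} \<union> {m. c' m ~= 0}"
 have S: "finite ?S" using assms by simp
 show "finite {m. c m + c' m ~= 0}" "finite {m. c m - c' m ~= 0}" by (rule finite_subset[OF _ S]; auto)+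
 show "evl e D (%m. c m + c' m) p = evl e D c p + evl e D c' p" "evl e D (%m. c m - c' m) p = evl e D c p - evl e D c' p"
  using evl_finite[OF S, of c e D p] evl_finite[OF S, of c' e D p] evl_finite[OF S, of "%m. c m + c' m" e D p]
   evl_finite[OF S, of "%m. c m - c' m" e D p] by (simp_all add: ring_distribs sum.distrib sum_subtractf)
qed

lemma evl_unique:
 fixes c :: "int \<times> int => 'k::field_char_0"
 assumes "finite {m. c m ~= 0}" "finite {m. c' m ~= 0}" "!!p. p : UT torus ==> evl e D c p = evl e D c' p"
 shows "c = c'"
proof
 fix m
 have "c m - c' m = 0"
  by (rule evl_eq_0_imp[of "%m. c m - c' m"]) (use assms evl_add_diff[OF assms(1,2)] in auto)
 thus "c m = c' m" by simp
qed

text \<open>Well defined by \<open>evl_unique\<close>. It depends only on the values on the torus,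
  so the expansions of one function on different charts have the same coefficients.\<close>

definition coef :: "nat => divclass => ('k::field_char_0 cox => 'k) => int \<times> int => 'k" where
 "coef e D g = (THE c. finite {m. c m ~= 0} & (ALL p:UT torus. g p = evl e D c p))"

lemma coef_eqI:
 assumes "finite {m. c m ~= 0}" "!!p. p : UT torus ==> g p = evl e D c p"
 shows "coef e D g = c"
 unfolding coef_def using assms by (intro the_equality conjI ballI evl_unique[of _ c e D]) auto

lemma UT_anti': "T <= torus ==> UT torus <= UT T"
 by (rule UT_anti)

lemma lau_coef:
 assumes "lau e D T g" "T <= torus"
 shows "finite {m. coef e D g m ~= 0}" "coef e D g m ~= 0 ==> m : exps e D T"
  "p : UT T ==> g p = evl e D (coef e D g) p"
proof -
 obtain c where c: "finite {m. c m ~= 0}" "!!m. c m ~= 0 ==> m : exps e D T" "!!p. p : UT T ==> g p = evl e D c p"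
  by (rule lau_coeffs[OF assms(1)]) (rule that, assumption+)
 have "coef e D g = c" by (rule coef_eqI[OF c(1) c(3)]) (use UT_anti'[OF assms(2)] in blast)
 thus "finite {m. coef e D g m ~= 0}" "coef e D g m ~= 0 ==> m : exps e D T" "p : UT T ==> g p = evl e D (coef e D g) p"
  using c by simp_all
qed

lemma exps_iff: "m : exps e D T \<longleftrightarrow> (0 : T | 0 <= xp e D m 0) & (1 : T | 0 <= xp e D m 1) &
  (2 : T | 0 <= xp e D m 2) & (3 : T | 0 <= xp e D m 3)"
 unfolding exps_def all4[of "%i. i ~: T --> 0 <= xp e D m i", simplified] by (auto simp: all4)

text \<open>The intersections of neighbouring charts are the sets where all coordinates but one, of index t, are invertible.\<close>

definition edge :: "nat => nat => nat => nat => nat => bool" where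
 "edge t x y x' y' \<longleftrightarrow> (t, x, y, x', y') : {(0, 1, 2, 1, 3), (1, 0, 2, 0, 3), (2, 0, 3, 1, 3), (3, 0, 2, 1, 2)}"

abbreviation UE :: "nat => 'k::zero cox set" where "UE t == UT (torus - {t})"

lemma edge:
 assumes "edge t x y x' y'"
 shows "chart x y" "chart x' y'" "t < 4" "torus - {t} = {x, y} \<union> {x', y'}" "UE t <= UT {x, y}" "UE t <= UT {x', y'}"
proof -
 show "chart x y" "chart x' y'" "t < 4" using assms by (auto simp: edge_def chart_def)
 show *: "torus - {t} = {x, y} \<union> {x', y'}" using assms by (auto simp: edge_def)
 show "UE t <= UT {x, y}" "UE t <= UT {x', y'}" by (rule UT_anti, simp only: *, blast)+
qed

lemma edge_ex: "t < 4 ==> EX x y x' y'. edge t x y x' y'"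
 using less_Suc_eq by (auto simp: edge_def numeral_eq_Suc)

lemma UE_torus: "UT torus <= UE t"
 by (rule UT_anti) auto

lemma sub4: "torus - {t} <= {..<4}" "chart x y ==> {x, y} <= {..<4}" "torus <= {..<4}"
 by (auto simp: chart_def)

text \<open>Neighbouring charts agree by assumption. Opposite charts meet only in the torus, where a
  chart next to both is available.\<close>

lemma chart_agree:
 assumes "!!t x y x' y'. edge t x y x' y' ==> p : UE t ==> M x y = M x' y'"
  and "chart x y" "chart x' y'" "p : UT {x, y}" "p : UT {x', y'}"
 shows "M x y = M x' y'"
proof -
 have "UE 0 = UT {1, 2, 3}" "UE 1 = UT {0, 2, 3}" "UE 2 = UT {0, 1, 3}" "UE 3 = UT {0, 1, 2}"
  by (rule arg_cong[of _ _ UT]; auto)+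
 moreover have "edge 0 1 2 1 3" "edge 1 0 2 0 3" "edge 2 0 3 1 3" "edge 3 0 2 1 2" by (simp_all add: edge_def)
 ultimately have "p : UT {1, 2, 3} ==> M 1 2 = M 1 3" "p : UT {0, 2, 3} ==> M 0 2 = M 0 3"
  "p : UT {0, 1, 3} ==> M 0 3 = M 1 3" "p : UT {0, 1, 2} ==> M 0 2 = M 1 2" using assms(1) by metis+
 thus ?thesis using assms(2-5) unfolding chart_def by (elim disjE conjE; simp add: UT_insert)
qed

text \<open>No Laurent monomial of degree D contributes to the first cohomology of the covering by the four charts.\<close>

definition noH1 :: "nat => divclass => bool" where
 "noH1 e D \<longleftrightarrow> (ALL m. ~ (0 <= xp e D m 0 & 0 <= xp e D m 1 & xp e D m 2 < 0 & xp e D m 3 < 0) &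
   ~ (xp e D m 0 < 0 & xp e D m 1 < 0 & 0 <= xp e D m 2 & 0 <= xp e D m 3))"

text \<open>P t stands for a nonnegative exponent of coordinate t in a fixed monomial. The monomial
  is regular on chart (x, y) when P holds at 1 - x and 5 - y, and on \<open>UE t\<close> when P t
  holds. The charts form a square with sides \<open>UE t\<close>; \<open>rel\<close> closes it up,
  so v exists and is unique up to a constant. The patterns excluded by \<open>no\<close> are those
  in which no chart admits the monomial although \<open>rel\<close> permits a nonzero side.\<close>

lemma edge_system:
 fixes a :: "nat => 'k::field"
 assumes P: "!!t. t < 4 ==> ~ P t ==> a t = 0" and rel: "a 1 + a 2 = a 0 + a 3"
  and no: "~ (P 0 & P 1 & ~ P 2 & ~ P 3)" "~ (~ P 0 & ~ P 1 & P 2 & P 3)"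
 shows "EX v. (ALL x y. chart x y --> v x y ~= 0 --> P (1 - x) & P (5 - y)) &
  (ALL t x y x' y'. edge t x y x' y' --> a t = v x y - v x' y') & ((ALL t<4. a t = 0) --> (ALL x y. v x y = 0))"
proof -
 \<comment> \<open>The value at chart (0, 2); the others follow along the sides. The branches force
   the value 0 at the first inadmissible chart in the order (0, 2), (0, 3), (1, 2), and otherwise at
   (1, 3).\<close>
 define u where "u = (if ~ (P 1 & P 3) then 0 else if ~ (P 1 & P 2) then a 1 else if ~ (P 0 & P 3) then a 3 else a 1 + a 2)"
 define v where "v x y = (if x = (0::nat) then if y = (2::nat) then u else u - a 1 else if y = 2 then u - a 3 else u - a 1 - a 2)" for x y
 have z: "P 0 | a 0 = 0" "P 1 | a 1 = 0" "P 2 | a 2 = 0" "P 3 | a 3 = 0" using P[of 0] P[of 1] P[of 2] P[of 3] by auto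
 have a0: "a 0 = a 1 + a 2 - a 3" using rel by simp
 have "(u ~= 0 --> P 1 & P 3) & (u - a 1 ~= 0 --> P 1 & P 2) & (u - a 3 ~= 0 --> P 0 & P 3) & (u - a 1 - a 2 ~= 0 --> P 0 & P 2)"
  using z no unfolding u_def a0 by (cases "P 0"; cases "P 1"; cases "P 2"; cases "P 3"; simp; (simp add: algebra_simps minus_unique)?)
 hence "ALL x y. chart x y --> v x y ~= 0 --> P (1 - x) & P (5 - y)" by (auto simp: v_def chart_def)
 moreover have "ALL t x y x' y'. edge t x y x' y' --> a t = v x y - v x' y'" by (auto simp: edge_def v_def a0)
 moreover have "(ALL t<4. a t = 0) --> (ALL x y. v x y = 0)" by (auto simp: v_def u_def)
 ultimately show ?thesis by blast
qed

text \<open>The problem splits into one copy of \<open>edge_system\<close> for each exponent. Its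
  last clause, that v vanishes when all sides do, keeps the support of the reassembled functions
  finite.\<close>

lemma standard_H1:
 fixes h :: "nat => 'k::field_char_0 cox => 'k"
 assumes no: "noH1 e D" and h: "!!t. t < 4 ==> lau e D (torus - {t}) (h t)"
  and rel: "!!p. p : UT torus ==> h 1 p + h 2 p = h 0 p + h 3 p"
 shows "EX n. (ALL x y. chart x y --> lau e D {x, y} (n x y)) &
  (ALL t x y x' y' p. edge t x y x' y' --> p : UE t --> h t p = n x y p - n x' y' p)"
proof -
 define a where "a t = coef e D (h t)" for t
 have a: "finite {m. a t m ~= 0}" "!!m. a t m ~= 0 ==> m : exps e D (torus - {t})" "!!p. p : UE t ==> h t p = evl e D (a t) p"
  if "t < 4" for t using lau_coef[OF h[OF that] Diff_subset] unfolding a_def by blast+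
 have "(%m. a 1 m + a 2 m) = (%m. a 0 m + a 3 m)"
 proof (rule evl_unique)
  fix p :: "'k cox" assume p: "p : UT torus"
  have "h t p = evl e D (a t) p" if "t < 4" for t using a(3)[OF that] p UE_torus by blast
  thus "evl e D (%m. a 1 m + a 2 m) p = evl e D (%m. a 0 m + a 3 m) p"
   using rel[OF p] by (simp add: evl_add_diff(3) a(1))
 qed (simp_all add: evl_add_diff a(1))
 hence rel': "a 1 m + a 2 m = a 0 m + a 3 m" for m by metis
 define Q where "Q m v \<longleftrightarrow> (ALL x y. chart x y --> v x y ~= 0 --> 0 <= xp e D m (1 - x) & 0 <= xp e D m (5 - y)) &
  (ALL t x y x' y'. edge t x y x' y' --> a t m = v x y - v x' y') & ((ALL t<4. a t m = 0) --> (ALL x y. v x y = 0))" for m and v :: "nat => nat => 'k"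
 have "EX v. Q m v" for m
  unfolding Q_def
 proof (rule edge_system)
  show "a t m = 0" if "t < 4" "~ 0 <= xp e D m t" for t
   using a(2)[OF that(1), of m] that unfolding exps_def by blast
 qed (use rel' no[unfolded noH1_def, rule_format, of m] in \<open>auto simp: not_le\<close>)
 hence "EX v. ALL m. Q m (v m)" by (intro choice) simp
 then obtain v where "ALL m. Q m (v m)" ..
 hence v: "!!x y. chart x y ==> v m x y ~= 0 ==> 0 <= xp e D m (1 - x) & 0 <= xp e D m (5 - y)"
   "!!t x y x' y'. edge t x y x' y' ==> a t m = v m x y - v m x' y'" "(ALL t<4. a t m = 0) --> (ALL x y. v m x y = 0)" for m
  unfolding Q_def by blast+
 have fin: "finite {m. v m x y ~= 0}" for x y
 proof (rule finite_subset)
  show "{m. v m x y ~= 0} <= (UN t<4. {m. a t m ~= 0})" using v(3) by fast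
 qed (use a(1) in auto)
 show ?thesis
 proof (intro exI[of _ "%x y. evl e D (%m. v m x y)"] conjI allI impI)
  fix x y assume ch: "chart x y"
  show "lau e D {x, y} (evl e D (%m. v m x y))"
  proof (rule lauI[OF fin _ refl])
   fix m assume "v m x y ~= 0"
   hence "0 <= xp e D m (1 - x)" "0 <= xp e D m (5 - y)" using v(1)[OF ch] by blast+
   thus "m : exps e D {x, y}" using ch by (auto simp: exps_iff chart_def)
  qed
 next
  fix t x y x' y' and p :: "'k cox" assume ed: "edge t x y x' y'" and p: "p : UE t"
  have "a t = (%m. v m x y - v m x' y')" using v(2)[OF ed] by blast
  thus "h t p = evl e D (%m. v m x y) p - evl e D (%m. v m x' y') p"
   using a(3)[OF edge(3)[OF ed] p] evl_add_diff(4)[OF fin fin] by simp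
 qed
qed

context basic_cover begin

lemma glue_lau:
 assumes "chart a b" "{a, b} <= T" "T <= {..<4}" and m: "!!i. i : I ==> reg e D (A i Int UT T) (m i)"
  and eq: "!!i j p. [|i : I; j : I; p : A i; p : A j; p : UT T|] ==> m i p = m j p"
 shows "EX g. lau e D T g & (ALL i:I. ALL p:A i Int UT T. g p = m i p)"
 using glue[where m = m, OF opn_UT[OF assms(3)] m eq] reg_lau[OF assms(1-3)] by blast

lemma opn_AT: "i : I ==> T <= {..<4} ==> opn e (A i Int UT T)"
 by (intro opn_Int opn_A opn_UT)

lemma opn_AAT: "i : I ==> j : I ==> T <= {..<4} ==> opn e (A i Int A j Int UT T)"
 by (intro opn_Int opn_A opn_UT)

lemma chart_H1:
 assumes ch: "chart x y" and c: "!!i j. i : I ==> j : I ==> reg e D (A i Int A j Int UT {x, y}) (c i j)"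
  and coc: "!!i j k p. [|i : I; j : I; k : I; p : A i; p : A j; p : A k; p : UT {x, y}|] ==> c j k p - c i k p + c i j p = 0"
 shows "EX b. (ALL j:I. reg e D (A j Int UT {x, y}) (b j)) & (ALL j:I. ALL k:I. ALL p:A j Int A k Int UT {x, y}. c j k p = b k p - b j p)"
 by (rule affine_H1[OF ch order_refl sub4(2)[OF ch] c coc])

text \<open>Differences of local potentials on neighbouring charts glue to Laurent polynomials.\<close>

lemma edge_glue:
 assumes ed: "edge t x y x' y'" and u: "!!i. i : I ==> reg e D (A i Int UE t) (u i)"
  and n: "!!x y i. chart x y ==> i : I ==> reg e D (A i Int UT {x, y}) (n x y i)"
  and eq: "!!i j p. [|i : I; j : I; p : A i; p : A j; p : UE t|] ==>
    u j p - u i p = (n x y j p - n x y i p) - (n x' y' j p - n x' y' i p)"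
 shows "EX g. lau e D (torus - {t}) g & (ALL i:I. ALL p:A i Int UE t. g p = n x y i p - n x' y' i p - u i p)"
proof (rule glue_lau[OF edge(1)[OF ed] _ sub4(1)])
 show "{x, y} <= torus - {t}" unfolding edge(4)[OF ed] by blast
 fix i assume i: "i : I"
 show "reg e D (A i Int UE t) (%p. n x y i p - n x' y' i p - u i p)"
  using edge(5,6)[OF ed] by (intro reg_diff u i reg_subset[OF n[OF edge(1)[OF ed] i] opn_AT[OF i sub4(1)]]
   reg_subset[OF n[OF edge(2)[OF ed] i] opn_AT[OF i sub4(1)]]) blast+
next
 show "n x y i p - n x' y' i p - u i p = n x y j p - n x' y' j p - u j p"
  if "i : I" "j : I" "p : A i" "p : A j" "p : UE t" for i j p
  using eq[OF that] by (simp add: algebra_simps)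
qed

text \<open>Comparison of the covering with the four charts. On each chart c is the coboundary of
  some n; across \<open>UE t\<close> the differences of n do not depend on the member and glue to a
  Laurent polynomial. \<open>standard_H1\<close> splits these polynomials, and subtracting the
  pieces makes the potentials agree on overlaps of charts.\<close>

theorem H1_zero:
 assumes no: "noH1 e D"
  and c: "!!i j. i : I ==> j : I ==> reg e D (A i Int A j) (c i j)"
  and coc: "!!i j k p. [|i : I; j : I; k : I; p : A i; p : A j; p : A k|] ==>
    c j k p - c i k p + c i j p = 0"
 shows "EX b. (ALL j:I. reg e D (A j) (b j)) &
   (ALL j:I. ALL k:I. ALL p:A j Int A k. c j k p = b k p - b j p)"
proof -
 have "EX b. (ALL j:I. reg e D (A j Int UT {x, y}) (b j)) &
   (ALL j:I. ALL k:I. ALL p:A j Int A k Int UT {x, y}. c j k p = b k p - b j p)" if ch: "chart x y" for x y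
  by (rule chart_H1[OF ch reg_subset[OF c opn_AAT[OF _ _ sub4(2)[OF ch]]] coc]) auto
 then obtain n where n: "!!x y j. chart x y ==> j : I ==> reg e D (A j Int UT {x, y}) (n x y j)"
  "!!x y j k p. chart x y ==> j : I ==> k : I ==> p : A j ==> p : A k ==> p : UT {x, y} ==>
    c j k p = n x y k p - n x y j p" 
  by (simp only: Int_iff Ball_def) metis
 define Q where "Q t g \<longleftrightarrow> lau e D (torus - {t}) g &
  (ALL x y x' y'. edge t x y x' y' --> (ALL i:I. ALL p:A i Int UE t. g p = n x y i p - n x' y' i p))" for t g
 have "EX g. Q t g" if t: "t < 4" for t
 proof -
  obtain x y x' y' where ed: "edge t x y x' y'" using edge_ex[OF t] by blast
  have "EX g. lau e D (torus - {t}) g & (ALL i:I. ALL p:A i Int UE t. g p = n x y i p - n x' y' i p - 0)"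
  proof (rule edge_glue[OF ed, where u = "%i p. 0" and n = n])
   fix i j p assume i: "i : I" "j : I" "p : A i" "p : A j" and p: "p : UE t"
   show "0 - 0 = (n x y j p - n x y i p) - (n x' y' j p - n x' y' i p)"
    using n(2)[OF edge(1)[OF ed] i] n(2)[OF edge(2)[OF ed] i] edge(5,6)[OF ed] p by fastforce
  next
   show "reg e D (A i Int UE t) (%p. 0)" if "i : I" for i by (rule reg_0[OF opn_AT[OF that sub4(1)]])
  qed (rule n(1))
  thus ?thesis unfolding Q_def using ed by (auto simp: edge_def)
 qed
 hence "EX g. ALL t:{..<4}. Q t (g t)" by (intro bchoice) simp
 then obtain g where g0: "ALL t:{..<4}. Q t (g t)" ..
 hence g: "Q t (g t)" if "t < 4" for t using that by simp
 have "EX v. (ALL x y. chart x y --> lau e D {x, y} (v x y)) &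
  (ALL t x y x' y' p. edge t x y x' y' --> p : UE t --> g t p = v x y p - v x' y' p)"
 proof (rule standard_H1[OF no])
  show "lau e D (torus - {t}) (g t)" if "t < 4" for t using g[OF that] unfolding Q_def by blast
  fix p :: "'k cox" assume p: "p : UT torus"
  hence "p : cone" using UT_cone by blast
  then obtain i where i: "i : I" "p : A i" using A_cov by blast
  have pE: "p : UE t" for t using p UE_torus by blast
  have "g t p = n x y i p - n x' y' i p" if "edge t x y x' y'" for t x y x' y'
   using g[OF edge(3)[OF that]] that i pE unfolding Q_def by blast
  from this[of 0 1 2 1 3] this[of 1 0 2 0 3] this[of 2 0 3 1 3] this[of 3 0 2 1 2]
  show "g 1 p + g 2 p = g 0 p + g 3 p" by (simp add: edge_def)
 qed
 then obtain v where v: "!!x y. chart x y ==> lau e D {x, y} (v x y)"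
  "!!t x y x' y' p. edge t x y x' y' ==> p : UE t ==> g t p = v x y p - v x' y' p" by blast
 define M where "M x y i p = n x y i p - v x y p" for x y i p
 have M_reg: "reg e D (A i Int UT {x, y}) (M x y i)" if ch: "chart x y" and i: "i : I" for x y i
  unfolding M_def by (intro reg_diff n(1)[OF that] reg_subset[OF lau_reg[OF v(1)[OF ch] sub4(2)[OF ch]] opn_AT[OF i sub4(2)[OF ch]]]) blast
 have agree: "M x y i p = M x' y' i p"
  if "chart x y" "chart x' y'" "i : I" "p : A i" "p : UT {x, y}" "p : UT {x', y'}" for x y x' y' i p
 proof (rule chart_agree[where M = "%x y. M x y i p", OF _ that(1,2,5,6)])
  fix t x y x' y' assume ed: "edge t x y x' y'" and p: "p : UE t"
  have "g t p = n x y i p - n x' y' i p" using g[OF edge(3)[OF ed]] ed that(3,4) p unfolding Q_def by blast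
  thus "M x y i p = M x' y' i p" using v(2)[OF ed p] by (simp add: M_def algebra_simps)
 qed
 \<comment> \<open>The corrected potentials no longer depend on the chart, so on member i the chart
   chosen for i may be used.\<close>
 define b where "b i = M (ci i) (cj i) i" for i
 have "reg e D (A i) (b i)" if i: "i : I" for i
 proof -
  have "A i Int UT {ci i, cj i} = A i" using A_sub[OF i] by auto
  thus ?thesis using M_reg[OF ch[OF i] i] by (simp add: b_def)
 qed
 moreover have "c j k p = b k p - b j p" if jk: "j : I" "k : I" and p: "p : A j Int A k" for j k p
 proof -
  have pj: "p : UT {ci j, cj j}" "p : UT {ci k, cj k}" using A_sub[OF jk(1)] A_sub[OF jk(2)] p by auto
  have "b k p = M (ci j) (cj j) k p" unfolding b_def
   using p by (intro agree ch jk pj) auto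
  thus ?thesis using n(2)[OF ch[OF jk(1)] jk] p pj by (auto simp: b_def M_def)
 qed
 ultimately show ?thesis by blast
qed

end

section \<open>Second cohomology and Laurent polynomials\<close>

text \<open>The coboundaries for the four charts: the second cohomology of O(D) consists of the Laurent polynomials
 modulo inZ, with the monomials of negative exponents as a basis.\<close>

definition inZ :: "nat => divclass => ('k::field cox => 'k) => bool" where
 "inZ e D g \<longleftrightarrow> (EX h. (ALL t<4. lau e D (torus - {t}) (h t)) & (ALL p:UT torus. g p = h 1 p - h 0 p - h 3 p + h 2 p))"

definition negexp :: "nat => divclass => int \<times> int => bool" where
 "negexp e D m \<longleftrightarrow> (ALL t<4. xp e D m t < 0)"

lemma evl_alternating:
 assumes "!!t. t < 4 ==> finite {m. a t m ~= (0::'k::field)}"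
 shows "finite {m. a 1 m - a 0 m - a 3 m + a 2 m ~= 0}"
  "evl e D (%m. a 1 m - a 0 m - a 3 m + a 2 m) p = evl e D (a 1) p - evl e D (a 0) p - evl e D (a 3) p + evl e D (a (2::nat)) p"
 by (simp_all only: evl_add_diff assms numeral_less_iff zero_less_numeral one_less_numeral_iff semiring_norm not_False_eq_True)

text \<open>On \<open>UE t\<close> the coordinate t must have a nonnegative exponent; a monomial
  with four negative exponents therefore occurs in none of the h t.\<close>

lemma inZ_coeff:
 fixes c :: "int \<times> int => 'k::field_char_0"
 assumes "inZ e D g" "finite {m. c m ~= 0}" "!!p. p : UT torus ==> g p = evl e D c p" "negexp e D m"
 shows "c m = 0"
proof -
 obtain h where h: "!!t. t < 4 ==> lau e D (torus - {t}) (h t)"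
  "!!p. p : UT torus ==> g p = h 1 p - h 0 p - h 3 p + h 2 p" using assms(1) unfolding inZ_def by blast
 define a where "a t = coef e D (h t)" for t
 have a: "finite {m. a t m ~= 0}" "!!m. a t m ~= 0 ==> m : exps e D (torus - {t})" "!!p. p : UE t ==> h t p = evl e D (a t) p"
  if "t < 4" for t using lau_coef[OF h(1)[OF that] Diff_subset] unfolding a_def by blast+
 have "c = (%m. a 1 m - a 0 m - a 3 m + a 2 m)"
 proof (rule evl_unique[OF assms(2) evl_alternating(1)[OF a(1)]])
  fix p :: "'k cox" assume p: "p : UT torus"
  have "h t p = evl e D (a t) p" if "t < 4" for t using a(3)[OF that] p UE_torus by blast
  moreover have "evl e D (%m. a 1 m - a 0 m - a 3 m + a 2 m) p = evl e D (a 1) p - evl e D (a 0) p - evl e D (a 3) p + evl e D (a 2) p"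
   by (rule evl_alternating(2)) (rule a(1))
  ultimately show "evl e D c p = evl e D (%m. a 1 m - a 0 m - a 3 m + a 2 m) p"
   using h(2)[OF p] assms(3)[OF p] by simp
 qed
 moreover have "a t m = 0" if "t < 4" for t
  using a(2)[OF that, of m] assms(4) that unfolding exps_def negexp_def by force
 ultimately show ?thesis by simp
qed

text \<open>A monomial with a nonnegative exponent at t is regular on \<open>UE t\<close>; each
  monomial is assigned to the least such t.\<close>

lemma coeff_inZ:
 fixes c :: "int \<times> int => 'k::field_char_0"
 assumes fc: "finite {m. c m ~= 0}" and g: "!!p. p : UT torus ==> g p = evl e D c p"
  and neg: "!!m. negexp e D m ==> c m = 0"
 shows "inZ e D g"
proof -
 define s where "s m = (LEAST t. 0 <= xp e D m t)" for m
 have s: "s m < 4 & 0 <= xp e D m (s m)" if c: "c m ~= 0" for m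
 proof -
  obtain t where t: "t < 4" "0 <= xp e D m t" using neg[of m] c unfolding negexp_def by (meson not_le)
  from LeastI[of "%t. 0 <= xp e D m t", OF t(2)] Least_le[of "%t. 0 <= xp e D m t", OF t(2)] t(1)
  show ?thesis unfolding s_def by simp
 qed
 \<comment> \<open>The signs are those of the alternating sum in \<open>inZ\<close>, negative at 0
   and 3.\<close>
 define a where "a t m = (if s m ~= t then 0 else if t = 0 | t = 3 then - c m else c m)" for t m
 have f: "finite {m. a t m ~= 0}" for t by (rule finite_subset[OF _ fc]) (auto simp: a_def)
 have eq: "c = (%m. a 1 m - a 0 m - a 3 m + a 2 m)"
 proof
  show "c m = a 1 m - a 0 m - a 3 m + a 2 m" for m
   using s[of m] by (cases "c m = 0") (auto simp: a_def less_Suc_eq numeral_eq_Suc)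
 qed
 show ?thesis
  unfolding inZ_def
 proof (intro exI[of _ "%t. evl e D (a t)"] conjI allI impI ballI)
  show "lau e D (torus - {t}) (evl e D (a t))" if "t < 4" for t
  proof (rule lauI[OF f _ refl])
   fix m assume "a t m ~= 0"
   hence "s m = t" "c m ~= 0" by (auto simp: a_def split: if_splits)
   with s[of m] show "m : exps e D (torus - {t})" by (auto simp: exps_def less_Suc_eq numeral_eq_Suc)
  qed
  show "g p = evl e D (a 1) p - evl e D (a 0) p - evl e D (a 3) p + evl e D (a 2) p" if "p : UT torus" for p
   unfolding evl_alternating(2)[of a, OF f, symmetric] eq[symmetric] by (rule g[OF that])
 qed
qed

lemma inZ_uminus: "inZ e D (%p. - g p) ==> inZ e D g"
proof -
 assume "inZ e D (%p. - g p)"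
 then obtain h where h: "!!t. t < 4 ==> lau e D (torus - {t}) (h t)"
  "!!p. p : UT torus ==> - g p = h 1 p - h 0 p - h 3 p + h 2 p" unfolding inZ_def by blast
 have "g p = -1 * h 1 p - -1 * h 0 p - -1 * h 3 p + -1 * h 2 p" if "p : UT torus" for p
  using h(2)[OF that] by (simp add: algebra_simps)
 thus ?thesis unfolding inZ_def using lau_smult[OF h(1), of _ "-1"] by (intro exI[of _ "%t p. -1 * h t p"]) blast
qed

context basic_cover begin

text \<open>The 2-cocycle c of the covering A and the Laurent polynomial g, a class for the four charts, are linked
 by b and m in the double complex of the two coverings.\<close>

definition R :: "divclass => ('i => 'i => 'i => 'k cox => 'k) => ('k cox => 'k) =>
  (nat => nat => 'i => 'i => 'k cox => 'k) => (nat => 'i => 'k cox => 'k) => bool" where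
 "R D c g b m \<longleftrightarrow>
   (ALL x y i j. chart x y --> i : I --> j : I --> reg e D (A i Int A j Int UT {x, y}) (b x y i j)) &
   (ALL x y i j k p. chart x y --> i : I --> j : I --> k : I --> p : A i --> p : A j --> p : A k --> p : UT {x, y} -->
    c i j k p = b x y j k p - b x y i k p + b x y i j p) &
   (ALL t i. t < 4 --> i : I --> reg e D (A i Int UE t) (m t i)) &
   (ALL t x y x' y' i j p. edge t x y x' y' --> i : I --> j : I --> p : A i --> p : A j --> p : UE t -->
    m t j p - m t i p = b x y i j p - b x' y' i j p) &
   (ALL i p. i : I --> p : A i --> p : UT torus --> g p = m 1 i p - m 0 i p - m 3 i p + m 2 i p)"

lemma RE:
 assumes "R D c g b m"
 shows "!!x y i j. chart x y ==> i : I ==> j : I ==> reg e D (A i Int A j Int UT {x, y}) (b x y i j)"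
  and "!!x y i j k p. [|chart x y; i : I; j : I; k : I; p : A i; p : A j; p : A k; p : UT {x, y}|] ==>
    c i j k p = b x y j k p - b x y i k p + b x y i j p"
  and "!!t i. t < 4 ==> i : I ==> reg e D (A i Int UE t) (m t i)"
  and "!!t x y x' y' i j p. [|edge t x y x' y'; i : I; j : I; p : A i; p : A j; p : UE t|] ==>
    m t j p - m t i p = b x y i j p - b x' y' i j p"
  and "!!i p. i : I ==> p : A i ==> p : UT torus ==> g p = m 1 i p - m 0 i p - m 3 i p + m 2 i p"
 using assms unfolding R_def by (simp_all only:)

definition RR :: "divclass => ('i => 'i => 'i => 'k cox => 'k) => ('k cox => 'k) => bool" where
 "RR D c g \<longleftrightarrow> (EX b m. R D c g b m)"

text \<open>A zigzag in the double complex: \<open>affine_H2\<close> splits c on each chart, which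
  gives b; across \<open>UE t\<close> the differences of b are 1-cocycles, which
  \<open>affine_H1\<close> splits, which gives m; the alternating sum of m over the four sides is
  the Laurent polynomial.\<close>

theorem RR_exists:
 assumes c: "!!i j k. i : I ==> j : I ==> k : I ==> reg e D (A i Int A j Int A k) (c i j k)"
  and coc: "!!i j k l p. [|i : I; j : I; k : I; l : I; p : A i; p : A j; p : A k; p : A l|] ==>
    c j k l p - c i k l p + c i j l p - c i j k p = 0"
 shows "EX g. lau e D torus g & RR D c g"
proof -
 define Q where "Q x y b \<longleftrightarrow> (ALL j:I. ALL k:I. reg e D (A j Int A k Int UT {x, y}) (b j k)) &
   (ALL j:I. ALL k:I. ALL l:I. ALL p:A j Int A k Int A l Int UT {x, y}. c j k l p = b k l p - b j l p + b j k p)"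
  for x y b
 have ex: "EX b. Q x y b" if ch: "chart x y" for x y
  unfolding Q_def
 proof (rule affine_H2[OF ch order_refl sub4(2)[OF ch]])
  show "reg e D (A i Int A j Int A k Int UT {x, y}) (c i j k)" if "i : I" "j : I" "k : I" for i j k
   by (rule reg_subset[OF c[OF that]]) (auto intro!: opn_Int opn_A opn_UT sub4(2)[OF ch] that simp del: insert_subset)
 qed (use coc in auto)
 define b where "b x y = (SOME b. Q x y b)" for x y
 have "Q x y (b x y)" if "chart x y" for x y
  unfolding b_def by (rule someI_ex[of "Q x y"], rule ex[OF that])
 hence b: "!!x y i j. chart x y ==> i : I ==> j : I ==> reg e D (A i Int A j Int UT {x, y}) (b x y i j)"
  and cb: "!!x y i j k p. [|chart x y; i : I; j : I; k : I; p : A i; p : A j; p : A k; p : UT {x, y}|] ==>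
    c i j k p = b x y j k p - b x y i k p + b x y i j p"
  unfolding Q_def by blast+
 define P where "P t m \<longleftrightarrow> (ALL i:I. reg e D (A i Int UE t) (m i)) & (ALL x y x' y'. edge t x y x' y' -->
  (ALL i:I. ALL j:I. ALL p:A i Int A j Int UE t. b x y i j p - b x' y' i j p = m j p - m i p))" for t m
 have "EX m. P t m" if t: "t < 4" for t
 proof -
  obtain x y x' y' where ed: "edge t x y x' y'" using edge_ex[OF t] by blast
  have "EX m. (ALL j:I. reg e D (A j Int UE t) (m j)) &
    (ALL j:I. ALL k:I. ALL p:A j Int A k Int UE t. b x y j k p - b x' y' j k p = m k p - m j p)"
  proof (rule affine_H1[OF edge(1)[OF ed] _ sub4(1)])
   show "{x, y} <= torus - {t}" unfolding edge(4)[OF ed] by blast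
   show "reg e D (A i Int A j Int UE t) (%p. b x y i j p - b x' y' i j p)" if "i : I" "j : I" for i j
    using edge(5,6)[OF ed] by (intro reg_diff reg_subset[OF b[OF edge(1)[OF ed] that] opn_AAT[OF that sub4(1)]]
     reg_subset[OF b[OF edge(2)[OF ed] that] opn_AAT[OF that sub4(1)]]) blast+
   fix i j k p assume i: "i : I" "j : I" "k : I" "p : A i" "p : A j" "p : A k" and "p : UE t"
   hence "p : UT {x, y}" "p : UT {x', y'}" using edge(5,6)[OF ed] by blast+
   from cb[OF edge(1)[OF ed] i this(1)] cb[OF edge(2)[OF ed] i this(2)]
   show "(b x y j k p - b x' y' j k p) - (b x y i k p - b x' y' i k p) + (b x y i j p - b x' y' i j p) = 0"
    by (simp add: algebra_simps)
  qed
  moreover have "(t, z) = (t, w) \<longleftrightarrow> z = w" for z w :: "nat \<times> nat \<times> nat \<times> nat" by simp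
  have "edge t u v u' v' ==> u = x & v = y & u' = x' & v' = y'" for u v u' v' using ed by (auto simp: edge_def)
  ultimately show ?thesis unfolding P_def by metis
 qed
 hence "EX m. ALL t:{..<4}. P t (m t)" by (intro bchoice) simp
 then obtain m where m0: "ALL t:{..<4}. P t (m t)" ..
 hence m: "t < 4 ==> i : I ==> reg e D (A i Int UE t) (m t i)" for t i unfolding P_def by simp
 have mb: "m t j p - m t i p = b x y i j p - b x' y' i j p"
  if "edge t x y x' y'" "i : I" "j : I" "p : A i" "p : A j" "p : UE t" for t x y x' y' i j p
  using m0 edge(3)[OF that(1)] that unfolding P_def by (metis IntI lessThan_iff)
 \<comment> \<open>Replacing i by j changes each m t by a difference of b along a side, and around
   the square these differences cancel; hence G glues.\<close>
 define G where "G i p = m 1 i p - m 0 i p - m 3 i p + m 2 i p" for i p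
 have T: "torus <= {..<4}" "{0, 2} <= torus" "chart 0 2" by (auto simp: chart_def)
 have "EX g. lau e D torus g & (ALL i:I. ALL p:A i Int UT torus. g p = G i p)"
 proof (rule glue_lau[OF T(3,2,1)])
  fix i assume i: "i : I"
  have "reg e D (A i Int UT torus) (m t i)" if "t < 4" for t
   by (rule reg_subset[OF m[OF that i] opn_AT[OF i T(1)]]) (use UE_torus in blast)
  thus "reg e D (A i Int UT torus) (G i)" unfolding G_def by (intro reg_add reg_diff) simp_all
 next
  fix i j and p :: "'k cox" assume ij: "i : I" "j : I" "p : A i" "p : A j" and p: "p : UT torus"
  have "p : UE t" for t using p UE_torus by blast
  note E = mb[OF _ ij this]
  have "m 1 j p - m 1 i p - (m 0 j p - m 0 i p) - (m 3 j p - m 3 i p) + (m 2 j p - m 2 i p) = 0"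
   using E[of 0 1 2 1 3] E[of 1 0 2 0 3] E[of 2 0 3 1 3] E[of 3 0 2 1 2] by (simp add: edge_def)
  thus "G i p = G j p" unfolding G_def by (simp add: algebra_simps)
 qed
 then obtain g where g: "lau e D torus g" "!!i p. i : I ==> p : A i ==> p : UT torus ==> g p = G i p" by blast
 have "R D c g b m" unfolding R_def by (intro conjI allI impI b cb m mb g(2)[unfolded G_def])
 thus ?thesis using g(1) unfolding RR_def by blast
qed

text \<open>The label of the chosen chart as an element of k, separately for the x- and the
  y-coordinates. Different labels on two members force both coordinates of that kind to be
  invertible on the overlap, which keeps expressions with these coefficients regular.\<close>

definition cX :: "'i => 'k" where "cX i = (if ci i = 0 then 0 else 1)"
definition cY :: "'i => 'k" where "cY i = (if cj i = 2 then 0 else 1)"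

lemma reg_cmult: "opn e W ==> a = 0 | W <= V ==> reg e D V u ==> reg e D W (%p. a * u p)"
 using reg_0[of e W D] by (cases "a = 0") (auto intro!: reg_smult reg_subset[of e D V u W])

text \<open>Subtract the splitting h of g from m. The rest sums to zero around the square, so it is
  the difference along the sides of a cochain N on the charts; correcting b by the coboundary of N
  makes it independent of the chart.\<close>

lemma RR_inZ_coboundary:
 assumes RR: "RR D c g" and Z: "inZ e D g"
 shows "EX b. (ALL i:I. ALL j:I. reg e D (A i Int A j) (b i j)) &
   (ALL i:I. ALL j:I. ALL k:I. ALL p:A i Int A j Int A k. c i j k p = b j k p - b i k p + b i j p)"
proof -
 obtain b m where R: "R D c g b m" using RR unfolding RR_def by blast
 note r = RE[OF R]
 obtain h where h: "!!t. t < 4 ==> lau e D (torus - {t}) (h t)"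
  "!!p. p : UT torus ==> g p = h 1 p - h 0 p - h 3 p + h 2 p" using Z unfolding inZ_def by blast
 define m' where "m' t i p = m t i p - h t p" for t i p
 have m': "reg e D (A i Int UE t) (m' t i)" if "t < 4" "i : I" for t i
  unfolding m'_def by (intro reg_diff r(3)[OF that] reg_subset[OF lau_reg[OF h(1)[OF that(1)] sub4(1)] opn_AT[OF that(2) sub4(1)]]) blast
 have Z0: "m' 1 i p - m' 0 i p - m' 3 i p + m' 2 i p = 0" if "i : I" "p : A i" "p : UT torus" for i p
  using r(5)[OF that] h(2)[OF that(3)] by (simp add: m'_def algebra_simps)
 \<comment> \<open>The sum of m' along the path from the chosen chart (ci i, cj i) through (x, cj i)
   to (x, y). A coefficient is 0 when the corresponding step is trivial and 1 or -1 otherwise; in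
   the latter case the overlap lies in the side that is crossed.\<close>
 define N where "N x y i p = (cX i - (if x = 0 then 0 else 1)) * m' (5 - cj i) i p + (cY i - (if y = 2 then 0 else 1)) * m' (1 - x) i p"
  for x y :: nat and i p
 have cij: "ci i = 0 | ci i = 1" "cj i = 2 | cj i = 3" if "i : I" for i
  using ch[OF that] by (auto simp: chart_def)
 have sub: "p : cone" "cc p (ci i) ~= 0" "cc p (cj i) ~= 0" if "i : I" "p : A i" for i p
  using A_sub[OF that(1)] that(2) by (auto simp: UT_def)
 have N_reg: "reg e D (A i Int UT {x, y}) (N x y i)" if ch': "chart x y" and i: "i : I" for x y i
  unfolding N_def
 proof (rule reg_add; rule reg_cmult[OF opn_AT[OF i sub4(2)[OF ch']] _ m'[OF _ i]])
  show "cX i - (if x = 0 then 0 else 1) = 0 | A i Int UT {x, y} <= A i Int UE (5 - cj i)"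
   "cY i - (if y = 2 then 0 else 1) = 0 | A i Int UT {x, y} <= A i Int UE (1 - x)"
   using cij[OF i] sub[OF i] ch' by (auto simp: UT_def cX_def cY_def chart_def)
 qed (use cij[OF i] in auto)
 \<comment> \<open>Because m' sums to zero around the square, the path through the other corner
   gives the same result.\<close>
 have E: "m' t i p = N x y i p - N x' y' i p" if "edge t x y x' y'" and i: "i : I" "p : A i" "p : UE t" for t x y x' y' i p
 proof -
  have "m' 3 i p = m' 2 i p + m' 1 i p - m' 0 i p" if "p : UT torus" using Z0[OF i(1,2) that] by (simp add: algebra_simps)
  moreover have "p : UT torus" if "5 - cj i ~= t" "t = 2 | t = 3"
   using i(3) that sub[OF i(1,2)] cij[OF i(1)] by (auto simp: UT_def)
  ultimately show ?thesis using \<open>edge t x y x' y'\<close> cij[OF i(1)]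
   by (auto simp: edge_def N_def cY_def cX_def algebra_simps)
 qed
 define B where "B x y i j p = b x y i j p - (N x y j p - N x y i p)" for x y i j p
 have agree: "B x y i j p = B x' y' i j p"
  if "chart x y" "chart x' y'" "i : I" "j : I" "p : A i" "p : A j" "p : UT {x, y}" "p : UT {x', y'}" for x y x' y' i j p
 proof (rule chart_agree[where M = "%x y. B x y i j p", OF _ that(1,2,7,8)])
  fix t x y x' y' assume ed: "edge t x y x' y'" and p: "p : UE t"
  have "(m t j p - m t i p) - (N x y j p - N x' y' j p) + (N x y i p - N x' y' i p) = 0"
   unfolding E[OF ed that(3,5) p, symmetric] E[OF ed that(4,6) p, symmetric] by (simp add: m'_def)
  thus "B x y i j p = B x' y' i j p" unfolding r(4)[OF ed that(3-6) p] B_def by (simp add: algebra_simps)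
 qed
 define b' where "b' i j = B (ci i) (cj i) i j" for i j
 have "reg e D (A i Int A j) (b' i j)" if i: "i : I" "j : I" for i j
 proof -
  have eq: "A i Int A j Int UT {ci i, cj i} = A i Int A j" using A_sub[OF i(1)] by auto
  have o: "opn e (A i Int A j)" by (intro opn_Int opn_A i)
  have "A i Int A j <= A i Int UT {ci i, cj i}" "A i Int A j <= A j Int UT {ci i, cj i}" using A_sub[OF i(1)] by auto
  thus ?thesis
   using r(1)[OF ch[OF i(1)] i] reg_subset[OF N_reg[OF ch[OF i(1)] i(1)] o] reg_subset[OF N_reg[OF ch[OF i(1)] i(2)] o]
   unfolding b'_def B_def eq by (intro reg_diff) auto
 qed
 moreover have "c i j k p = b' j k p - b' i k p + b' i j p"
  if i: "i : I" "j : I" "k : I" and p: "p : A i Int A j Int A k" for i j k p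
 proof -
  have pi: "p : UT {ci i, cj i}" "p : UT {ci j, cj j}" using A_sub[OF i(1)] A_sub[OF i(2)] p by auto
  have "b' j k p = B (ci i) (cj i) j k p" unfolding b'_def
   using p by (intro agree ch i pi) auto
  thus ?thesis using r(2)[OF ch[OF i(1)] i] p pi by (simp add: b'_def B_def)
 qed
 ultimately show ?thesis by blast
qed

text \<open>The reverse zigzag: on each chart b - b0 is a 1-cocycle with a potential n. Across
  \<open>UE t\<close> the difference of n minus m does not depend on the member and glues to h; in
  the alternating sum n cancels and -g remains.\<close>

lemma RR_coboundary_inZ:
 assumes RR: "RR D c g"
  and b0: "!!i j. i : I ==> j : I ==> reg e D (A i Int A j) (b0 i j)"
  and c: "!!i j k p. [|i : I; j : I; k : I; p : A i; p : A j; p : A k|] ==>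
    c i j k p = b0 j k p - b0 i k p + b0 i j p"
 shows "inZ e D g"
proof -
 obtain b m where R: "R D c g b m" using RR unfolding RR_def by blast
 note r = RE[OF R]
 have "EX n. (ALL j:I. reg e D (A j Int UT {x, y}) (n j)) &
   (ALL j:I. ALL k:I. ALL p:A j Int A k Int UT {x, y}. b x y j k p - b0 j k p = n k p - n j p)" if ch': "chart x y" for x y
 proof (rule chart_H1[OF ch'])
  show "reg e D (A i Int A j Int UT {x, y}) (%p. b x y i j p - b0 i j p)" if "i : I" "j : I" for i j
   by (intro reg_diff r(1)[OF ch' that] reg_subset[OF b0[OF that] opn_AAT[OF that sub4(2)[OF ch']]]) auto
  show "b x y j k p - b0 j k p - (b x y i k p - b0 i k p) + (b x y i j p - b0 i j p) = 0"
   if "i : I" "j : I" "k : I" "p : A i" "p : A j" "p : A k" "p : UT {x, y}" for i j k p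
   using r(2)[OF ch' that] c[OF that(1-6)] by (simp add: algebra_simps)
 qed
 then obtain n where n: "!!x y j. chart x y ==> j : I ==> reg e D (A j Int UT {x, y}) (n x y j)"
  "!!x y j k p. chart x y ==> j : I ==> k : I ==> p : A j ==> p : A k ==> p : UT {x, y} ==>
    b x y j k p - b0 j k p = n x y k p - n x y j p"
  by (simp only: Int_iff Ball_def) metis
 define P where "P t h \<longleftrightarrow> lau e D (torus - {t}) h &
  (ALL x y x' y'. edge t x y x' y' --> (ALL i:I. ALL p:A i Int UE t. h p = n x y i p - n x' y' i p - m t i p))" for t h
 have "EX h. P t h" if t: "t < 4" for t
 proof -
  obtain x y x' y' where ed: "edge t x y x' y'" using edge_ex[OF t] by blast
  have "EX g. lau e D (torus - {t}) g & (ALL i:I. ALL p:A i Int UE t. g p = n x y i p - n x' y' i p - m t i p)"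
  proof (rule edge_glue[OF ed r(3)[OF t] n(1)])
   fix i j p assume i: "i : I" "j : I" "p : A i" "p : A j" and p: "p : UE t"
   have "p : UT {x, y}" "p : UT {x', y'}" using p edge(5,6)[OF ed] by blast+
   from n(2)[OF edge(1)[OF ed] i this(1)] n(2)[OF edge(2)[OF ed] i this(2)]
   show "m t j p - m t i p = (n x y j p - n x y i p) - (n x' y' j p - n x' y' i p)"
    unfolding r(4)[OF ed i p] by (simp add: algebra_simps)
  qed
  thus ?thesis unfolding P_def using ed by (auto simp: edge_def)
 qed
 hence "EX h. ALL t:{..<4}. P t (h t)" by (intro bchoice) simp
 then obtain h where h0: "ALL t:{..<4}. P t (h t)" ..
 hence h: "lau e D (torus - {t}) (h t)" if "t < 4" for t using that unfolding P_def by simp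
 have "inZ e D (%p. - g p)"
  unfolding inZ_def
 proof (intro exI[of _ h] conjI allI impI ballI h)
  fix p :: "'k cox" assume p: "p : UT torus"
  hence "p : cone" using UT_cone by blast
  then obtain i where i: "i : I" "p : A i" using A_cov by blast
  have pE: "p : UE t" for t using p UE_torus by blast
  have "h t p = n x y i p - n x' y' i p - m t i p" if "edge t x y x' y'" for t x y x' y'
   using bspec[OF h0, of t] edge(3)[OF that] that i pE[of t] unfolding P_def by simp
  from this[of 0 1 2 1 3] this[of 1 0 2 0 3] this[of 2 0 3 1 3] this[of 3 0 2 1 2]
  show "- g p = h 1 p - h 0 p - h 3 p + h 2 p" using r(5)[OF i p] by (simp add: edge_def)
 qed
 thus ?thesis by (rule inZ_uminus)
qed

text \<open>All links in \<open>R\<close> are additive identities and survive multiplication by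
  forms. This makes the relation compatible with rows of matrices of forms.\<close>

lemma RR_sum:
 assumes K: "finite K" and RR: "!!k. k : K ==> RR (Dk k) (c k) (g k)"
  and F: "!!k. k : K ==> cox_form e (D - Dk k) (F k)"
 shows "RR D (%i j l p. SUM k:K. F k p * c k i j l p) (%p. SUM k:K. F k p * g k p)"
proof -
 have "EX b m. ALL k:K. R (Dk k) (c k) (g k) (b k) (m k)"
  using RR unfolding RR_def by metis
 then obtain b m where "!!k. k : K ==> R (Dk k) (c k) (g k) (b k) (m k)" by blast
 note r = RE[OF this]
 have FR: "reg e D W (%p. SUM k:K. F k p * f k p)" if W: "opn e W" "!!k. k : K ==> reg e (Dk k) W (f k)" for W f
 proof (rule reg_sum[OF W(1)])
  fix k assume k: "k : K"
  show "reg e D W (%p. F k p * f k p)"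
   using reg_mult[OF reg_form[OF F[OF k] W(1)] W(2)[OF k]] by simp
 qed
 note lin = sum_subtractf[symmetric] sum.distrib[symmetric] right_diff_distrib[symmetric] distrib_left[symmetric]
 have "R D (%i j l p. SUM k:K. F k p * c k i j l p) (%p. SUM k:K. F k p * g k p)
  (%x y i j p. SUM k:K. F k p * b k x y i j p) (%t i p. SUM k:K. F k p * m k t i p)"
  unfolding R_def lin
  by (intro conjI allI impI FR opn_AAT opn_AT sub4 r(1,3) sum.cong[OF refl] arg_cong2[of _ _ _ _ "(*)"] refl; (rule r(2,4,5))?; assumption)
 thus ?thesis unfolding RR_def by blast
qed

text \<open>The cup product of the cocycles of the two coverings by x0, x1 and by y0, y1.\<close>

definition std :: "('k cox => 'k) => 'i => 'i => 'i => 'k cox => 'k" where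
 "std g i j k p = (cX j - cX i) * (cY k - cY j) * g p"

lemma std_reg:
 assumes g: "lau e D torus g" and i: "i : I" "j : I" "k : I"
 shows "reg e D (A i Int A j Int A k) (std g i j k)"
 unfolding std_def
proof (rule reg_cmult[OF _ _ lau_reg[OF g sub4(3)]])
 have "A i Int A j Int A k <= UT torus" if "~ (cX i = cX j | cY j = cY k)"
  using that ch[OF i(1)] ch[OF i(2)] ch[OF i(3)] A_sub[OF i(1)] A_sub[OF i(2)] A_sub[OF i(3)]
  by (auto simp: cX_def cY_def chart_def UT_def split: if_splits)
 thus "(cX j - cX i) * (cY k - cY j) = 0 | A i Int A j Int A k <= UT torus" by auto
qed (intro opn_Int opn_A i)

text \<open>The witnesses contract the cup product: b uses the x-label of the chart in place of that
  of a member, m does the same with the y-labels. The sign comes from the alternating sum -cY i * g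
  + (cY i - 1) * g.\<close>

lemma RR_std:
 assumes g: "lau e D torus g"
 shows "RR D (std g) (%p. - g p)"
proof -
 define b where "b x y i j = (%p. ((cX i - (if x = 0 then 0 else 1)) * (cY j - cY i)) * g p)" for x y :: nat and i j
 \<comment> \<open>On \<open>UE 3\<close> the coefficient is nonzero only if y1 is invertible on the
   member, and on \<open>UE 2\<close> only if y0 is; so g is used on the torus alone.\<close>
 define m where "m t i p = (if t = 3 then cY i else if t = 2 then cY i - 1 else 0) * g p" for t :: nat and i p
 have "R D (std g) (%p. - g p) b m"
  unfolding R_def
 proof (intro conjI allI impI)
  fix x y i j assume c: "chart x y" and ij: "i : I" "j : I"
  show "reg e D (A i Int A j Int UT {x, y}) (b x y i j)"
   unfolding b_def
  proof (rule reg_cmult[OF opn_AAT[OF ij sub4(2)[OF c]] _ lau_reg[OF g sub4(3)]])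
   show "(cX i - (if x = 0 then 0 else 1)) * (cY j - cY i) = 0 | A i Int A j Int UT {x, y} <= UT torus"
    using c ch[OF ij(1)] ch[OF ij(2)] A_sub[OF ij(1)] A_sub[OF ij(2)]
    by (auto simp: cX_def cY_def chart_def UT_def split: if_splits)
  qed
 next
  fix t i assume t: "t < (4::nat)" and i: "i : I"
  show "reg e D (A i Int UE t) (m t i)"
   unfolding m_def
  proof (rule reg_cmult[OF opn_AT[OF i sub4(1)] _ lau_reg[OF g sub4(3)]])
   show "(if t = 3 then cY i else if t = 2 then cY i - 1 else 0) = 0 | A i Int UE t <= UT torus"
    using ch[OF i] A_sub[OF i] by (auto simp: cY_def chart_def UT_def split: if_splits)
  qed
 qed (auto simp: b_def m_def std_def edge_def algebra_simps)
 thus ?thesis unfolding RR_def by blast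
qed

theorem H2_zero:
 assumes no: "!!m. ~ negexp e D m"
  and c: "!!i j k. i : I ==> j : I ==> k : I ==> reg e D (A i Int A j Int A k) (c i j k)"
  and coc: "!!i j k l p. [|i : I; j : I; k : I; l : I; p : A i; p : A j; p : A k; p : A l|] ==>
    c j k l p - c i k l p + c i j l p - c i j k p = 0"
 shows "EX b. (ALL i:I. ALL j:I. reg e D (A i Int A j) (b i j)) &
   (ALL i:I. ALL j:I. ALL k:I. ALL p:A i Int A j Int A k. c i j k p = b j k p - b i k p + b i j p)"
proof -
 obtain g where g: "lau e D torus g" "RR D c g" using RR_exists[OF c coc] by blast
 have "inZ e D g" using no lau_coef(1,3)[OF g(1) order_refl] by (intro coeff_inZ[of "coef e D g"]) blast+
 thus ?thesis by (rule RR_inZ_coboundary[OF g(2)])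
qed

end



section \<open>Torus orbits: between the cone and the surface\<close>

definition act :: "nat => 'k::field => 'k => 'k cox => 'k cox" where
 "act e l m p = (l * cc p 0, l * cc p 1, m * cc p 2, l ^ e * m * cc p 3)"

lemma cc_act: "cc (act e l m p) 0 = l * cc p 0" "cc (act e l m p) 1 = l * cc p 1"
 "cc (act e l m p) (Suc 0) = l * cc p 1"
 "cc (act e l m p) 2 = m * cc p 2" "cc (act e l m p) 3 = l ^ e * m * cc p 3"
 by (simp_all add: act_def)

lemma cox_eq_iff: "p = q \<longleftrightarrow> cc p 0 = cc q 0 & cc p 1 = cc q 1 & cc p 2 = cc q 2 & cc p 3 = cc q 3"
 by (cases p; cases q) auto

lemma torus_orbit_eq: "torus_orbit e p = {act e l m p | l m. l ~= 0 & m ~= 0}"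
 by (cases p) (simp add: torus_orbit_def act_def mult.assoc)

lemma hirzebruch_eq: "hirzebruch e = torus_orbit e ` cone"
proof -
 have "{(x0, x1, y0, y1). (x0, x1) ~= (0, 0) & (y0, y1) ~= (0, 0)} = (cone :: 'a cox set)"
  by (auto simp: cone_def)
 thus ?thesis by (simp add: hirzebruch_def)
qed

lemma act_act: "act e l m (act e l' m' p) = act e (l * l') (m * m') p"
 by (simp add: act_def algebra_simps power_mult_distrib)

lemma act_1: "act e 1 1 p = p"
 by (simp add: act_def cox_eq_iff)

lemma orbit_self: "p : torus_orbit e p"
 unfolding torus_orbit_eq using act_1[of e p] by (metis (mono_tags, lifting) mem_Collect_eq one_neq_zero)

lemma orbit_act: "l ~= 0 ==> m ~= 0 ==> torus_orbit e (act e l m p) = torus_orbit e p"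
proof (intro equalityI subsetI)
 assume lm: "l ~= 0" "m ~= 0"
 fix q assume "q : torus_orbit e (act e l m p)"
 then obtain l' m' where "l' ~= 0" "m' ~= 0" "q = act e l' m' (act e l m p)" unfolding torus_orbit_eq by blast
 thus "q : torus_orbit e p" unfolding torus_orbit_eq act_act using lm by fastforce
next
 assume lm: "l ~= 0" "m ~= 0"
 fix q assume "q : torus_orbit e p"
 then obtain l' m' where q: "l' ~= 0" "m' ~= 0" "q = act e l' m' p" unfolding torus_orbit_eq by blast
 have "q = act e (l' / l) (m' / m) (act e l m p)" unfolding act_act q using lm by simp
 moreover have "l' / l ~= 0" "m' / m ~= 0" using q lm by simp_all
 ultimately show "q : torus_orbit e (act e l m p)" unfolding torus_orbit_eq by blast
qed

lemma orbitE:
 assumes "q : torus_orbit e p" obtains l m where "l ~= 0" "m ~= 0" "q = act e l m p"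
 using assms unfolding torus_orbit_eq by blast

lemma orbit_eqI:
 assumes "q : torus_orbit e p" shows "torus_orbit e q = torus_orbit e p"
 using assms by (rule orbitE) (simp add: orbit_act)

lemma hirz_orbit:
 assumes "P : hirzebruch e" "p : P" shows "P = torus_orbit e p"
proof -
 obtain q where "P = torus_orbit e q" using assms(1) unfolding hirzebruch_eq by blast
 thus ?thesis using orbit_eqI assms(2) by metis
qed

lemma hirz_unique: "P : hirzebruch e ==> Q : hirzebruch e ==> p : P ==> p : Q ==> P = Q"
 using hirz_orbit by metis

lemma orbit_cone:
 assumes "p : cone" shows "torus_orbit e p <= cone"
proof
 fix q assume "q : torus_orbit e p"
 thus "q : cone" by (rule orbitE) (use assms in \<open>simp add: cone_def cc_act del: One_nat_def\<close>)
qed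

lemma Union_hirz: "\<Union>(hirzebruch e) = cone"
 unfolding hirzebruch_eq using orbit_cone orbit_self by blast

lemma hirz_ne: "P : hirzebruch e ==> EX p:cone. p : P"
 unfolding hirzebruch_eq using orbit_self by blast

lemma hirz_cone: "P : hirzebruch e ==> P <= cone"
 using Union_hirz by blast

text \<open>Homogeneity makes the nonvanishing of a form a property of the whole orbit, so principal
  open subsets of the cone are unions of orbits.\<close>

lemma cox_form_act:
 assumes F: "cox_form e D F" and lm: "l ~= 0" "m ~= 0"
 shows "F (act e l m p) = l powi snd D * m powi fst D * F p"
proof -
 obtain c where c: "F = (%p. SUM m:exps e D {}. c m * mon e D m p)" using F unfolding cox_form_iff by blast
 have "mon e D x (act e l m p) = l powi snd D * m powi fst D * mon e D x p" for x
 proof -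
  have 1: "l powi snd D = l powi xp e D x 0 * l powi xp e D x 1 * (l ^ e) powi xp e D x 3"
   using lm by (simp add: power_int_power flip: power_int_add) (simp add: xp_simps)
  have 2: "m powi fst D = m powi xp e D x 2 * m powi xp e D x 3"
   using lm by (simp flip: power_int_add) (simp add: xp_simps)
  show ?thesis unfolding mon_def cc_act power_int_mult_distrib 1 2 by (simp add: algebra_simps)
 qed
 thus ?thesis unfolding c by (simp add: sum_distrib_left algebra_simps)
qed

lemma cox_form_orbit:
 assumes "cox_form e D F" "P : hirzebruch e" "p : P" "q : P" "F p ~= 0"
 shows "F q ~= 0"
proof -
 have "q : torus_orbit e p" using assms(4) hirz_orbit[OF assms(2,3)] by simp
 then obtain l m where "l ~= 0" "m ~= 0" "q = act e l m p" by (rule orbitE)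
 thus ?thesis using cox_form_act[OF assms(1)] assms(5) by simp
qed

text \<open>Inverse to taking unions: through \<open>Up_zopen\<close> and \<open>Up_Union\<close>,
  open sets of the surface correspond to open sets of the cone.\<close>

definition Up :: "nat => 'k::field cox set => 'k pointset" where
 "Up e A = {P : hirzebruch e. P <= A}"

lemma zopen_hirz: "zopen e U ==> U <= hirzebruch e"
 unfolding zopen_def by auto

lemma zopen_opn:
 assumes "zopen e U" shows "opn e (\<Union>U)"
proof -
 obtain S where S: "ALL F:S. EX D. cox_form e D F" "U = {P : hirzebruch e. EX F:S. ALL p:P. F p ~= 0}"
  using assms unfolding zopen_def by blast
 have "\<Union>U = (UN F:S. {p:cone. F p ~= 0})"
 proof (intro equalityI subsetI)
  fix p assume "p : \<Union>U"
  thus "p : (UN F:S. {p:cone. F p ~= 0})" unfolding S(2) using hirz_cone by blast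
 next
  fix p assume "p : (UN F:S. {p:cone. F p ~= 0})"
  then obtain F where F: "F : S" "p : cone" "F p ~= 0" by blast
  obtain P where P: "P : hirzebruch e" "p : P" using F(2) Union_hirz[of e] by blast
  obtain D where D: "cox_form e D F" using S(1) F(1) by blast
  have "ALL q:P. F q ~= 0" using cox_form_orbit[OF D P] F(3) by blast
  thus "p : \<Union>U" unfolding S(2) using P F(1) by blast
 qed
 moreover have "opn e {p:cone. F p ~= 0}" if "F : S" for F
  using S(1) that opn_form by blast
 ultimately show ?thesis by (simp add: opn_UN)
qed

lemma Up_form:
 assumes "cox_form e D F"
 shows "zopen e (Up e {p:cone. F p ~= 0})" "\<Union>(Up e {p:cone. F p ~= 0}) = {p:cone. F p ~= 0}"
proof -
 have *: "Up e {p:cone. F p ~= 0} = {P : hirzebruch e. EX G:{F}. ALL p:P. G p ~= 0}"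
  unfolding Up_def using hirz_cone by blast
 show "zopen e (Up e {p:cone. F p ~= 0})"
  unfolding zopen_def * using assms by blast
 show "\<Union>(Up e {p:cone. F p ~= 0}) = {p:cone. F p ~= 0}"
 proof (intro equalityI subsetI)
  fix p assume "p : {p:cone. F p ~= 0}"
  hence p: "p : cone" "F p ~= 0" by auto
  obtain P where P: "P : hirzebruch e" "p : P" using p(1) Union_hirz[of e] by blast
  have "P <= {p:cone. F p ~= 0}" using cox_form_orbit[OF assms P] p(2) hirz_cone[OF P(1)] by blast
  thus "p : \<Union>(Up e {p:cone. F p ~= 0})" unfolding Up_def using P by blast
 qed (auto simp: Up_def)
qed

lemma zopen_UN:
 fixes S :: "'k::field pointset set"
 assumes "!!U. U : S ==> zopen e U" shows "zopen e (\<Union>S)"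
proof -
 define Z where "Z U = (SOME S. (ALL F:S. EX D. cox_form e D F) &
   U = {P : hirzebruch e. EX F:S. ALL p:P. F p ~= 0})" for U :: "'k pointset"
 have Z: "(ALL F:Z U. EX D. cox_form e D F) & U = {P : hirzebruch e. EX F:Z U. ALL p:P. F p ~= 0}" if "U : S" for U
  unfolding Z_def by (rule someI_ex) (use assms[OF that] in \<open>simp add: zopen_def\<close>)
 have "\<Union>S = {P : hirzebruch e. EX F:(UN U:S. Z U). ALL p:P. F p ~= 0}"
 proof (intro equalityI subsetI)
  fix P assume "P : \<Union>S"
  then obtain U where U: "U : S" "P : U" by blast
  have "P : {P : hirzebruch e. EX F:Z U. ALL p:P. F p ~= 0}" using Z[OF U(1)] U(2) by blast
  thus "P : {P : hirzebruch e. EX F:(UN U:S. Z U). ALL p:P. F p ~= 0}" using U(1) by blast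
 next
  fix P assume P: "P : {P : hirzebruch e. EX F:(UN U:S. Z U). ALL p:P. F p ~= 0}"
  then obtain U where U: "U : S" "P : {P : hirzebruch e. EX F:Z U. ALL p:P. F p ~= 0}" by blast
  thus "P : \<Union>S" using Z[OF U(1)] by blast
 qed
 moreover have "ALL F:(UN U:S. Z U). EX D. cox_form e D F" using Z by blast
 ultimately show ?thesis unfolding zopen_def by blast
qed

lemma Up_zopen:
 assumes "opn e A" shows "zopen e (Up e A)" "\<Union>(Up e A) = A"
proof -
 define S where "S = {Up e {p:cone. F p ~= 0} | D F. cox_form e D F & {p:cone. F p ~= 0} <= A}"
 have 1: "zopen e (\<Union>S)" by (rule zopen_UN) (use Up_form(1) in \<open>auto simp: S_def\<close>)
 have pt: "EX D F. cox_form e D F & F p ~= 0 & {p:cone. F p ~= 0} <= A" if p: "p : A" for p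
  by (rule opnE[OF assms p]) blast
 have "Up e A = \<Union>S"
 proof (intro equalityI subsetI)
  fix P assume P: "P : Up e A"
  hence PH: "P : hirzebruch e" "P <= A" by (auto simp: Up_def)
  then obtain p where p: "p : P" "p : A" using hirz_ne by blast
  obtain D F where F: "cox_form e D F" "F p ~= 0" "{p:cone. F p ~= 0} <= A" using pt[OF p(2)] by blast
  have "P : Up e {p:cone. F p ~= 0}"
   using cox_form_orbit[OF F(1) PH(1) p(1)] F(2) hirz_cone[OF PH(1)] PH(1) unfolding Up_def by blast
  thus "P : \<Union>S" unfolding S_def using F by blast
 qed (auto simp: S_def Up_def)
 thus "zopen e (Up e A)" using 1 by simp
 show "\<Union>(Up e A) = A"
 proof (intro equalityI subsetI)
  fix p assume p: "p : A"
  obtain D F where F: "cox_form e D F" "F p ~= 0" "{p:cone. F p ~= 0} <= A" using pt[OF p] by blast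
  have "p : cone" using p opn_cone[OF assms] by blast
  hence "p : \<Union>(Up e {p:cone. F p ~= 0})" using Up_form(2)[OF F(1)] F(2) by blast
  thus "p : \<Union>(Up e A)" using F(3) unfolding Up_def by blast
 qed (auto simp: Up_def)
qed

lemma Up_Union: "zopen e U ==> Up e (\<Union>U) = U"
proof (intro equalityI subsetI)
 assume U: "zopen e U"
 fix P assume "P : Up e (\<Union>U)"
 hence P: "P : hirzebruch e" "P <= \<Union>U" by (auto simp: Up_def)
 then obtain p Q where "p : P" "p : Q" "Q : U" using hirz_ne by blast
 thus "P : U" using hirz_unique[OF P(1)] zopen_hirz[OF U] by blast
qed (auto simp: Up_def dest: zopen_hirz)

lemma Union_Int:
 assumes "U <= hirzebruch e" "V <= hirzebruch e"
 shows "\<Union>(U Int V) = \<Union>U Int \<Union>V"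
proof (intro equalityI subsetI)
 fix p assume "p : \<Union>U Int \<Union>V"
 then obtain P Q where "P : U" "Q : V" "p : P" "p : Q" by blast
 moreover hence "P = Q" using assms hirz_unique by blast
 ultimately show "p : \<Union>(U Int V)" by blast
qed blast

lemma zopen_Int:
 assumes "zopen e U" "zopen e V" shows "zopen e (U Int V)"
proof -
 have *: "\<Union>(U Int V) = \<Union>U Int \<Union>V" by (rule Union_Int) (use assms zopen_hirz in auto)
 have "opn e (\<Union>U Int \<Union>V)" by (intro opn_Int zopen_opn assms)
 from Up_zopen(1)[OF this] have "zopen e (Up e (\<Union>(U Int V)))" by (simp add: *)
 moreover have "Up e (\<Union>(U Int V)) = U Int V"
  unfolding * using Up_Union[OF assms(1)] Up_Union[OF assms(2)] by (auto simp: Up_def)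
 ultimately show ?thesis by simp
qed

lemma zopen_Union_Int: "zopen e U ==> zopen e V ==> \<Union>(U Int V) = \<Union>U Int \<Union>V"
 by (rule Union_Int) (auto dest: zopen_hirz)

lemma zopen_hirzebruch: "zopen e (hirzebruch e)"
proof -
 have "Up e cone = (hirzebruch e :: 'a pointset)" unfolding Up_def using hirz_cone by blast
 thus ?thesis using Up_zopen(1)[OF opn_cone'] by metis
qed

lemma zopen_subset_iff: "zopen e U ==> zopen e V ==> U <= V \<longleftrightarrow> \<Union>U <= \<Union>V"
proof
 assume UV: "zopen e U" "zopen e V" "\<Union>U <= \<Union>V"
 hence "Up e (\<Union>U) <= Up e (\<Union>V)" by (auto simp: Up_def)
 thus "U <= V" using Up_Union UV by metis
qed blast

text \<open>A neighbourhood on which G / H is valid contains a principal one, given by a form K.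
  Expanding the fraction by K moves the locus of nonzero denominator into that neighbourhood, as
  \<open>reg\<close> demands.\<close>

lemma line_sections_iff:
 assumes U: "zopen e U"
 shows "F : line_sections e D U \<longleftrightarrow> reg e D (\<Union>U) F & (ALL p. p ~: \<Union>U --> F p = 0)"
proof
 assume F: "F : line_sections e D U"
 have "reg e D (\<Union>U) F"
 proof (rule regI)
  show "\<Union>U <= cone" using zopen_opn[OF U] opn_cone by blast
  fix p assume "p : \<Union>U"
  then obtain P where P: "P : U" "p : P" by blast
  have "EX V D' G H. zopen e V & P : V & V <= U & cox_form e (D + D') G & cox_form e D' H &
    (ALL p:\<Union>V. H p ~= 0 & F p = G p / H p)" using F P(1) unfolding line_sections_def by blast
  then obtain V D' G H where V: "zopen e V" "P : V" "V <= U" "cox_form e (D + D') G" "cox_form e D' H"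
   "ALL p:\<Union>V. H p ~= 0 & F p = G p / H p" by blast
  have "p : \<Union>V" using V(2) P(2) by blast
  then obtain D1 K where K: "cox_form e D1 K" "K p ~= 0" "!!q. q : cone ==> K q ~= 0 ==> q : \<Union>V"
   using zopen_opn[OF V(1)] by (metis opnE)
  have "F q = (G q * K q) / (H q * K q) & q : \<Union>U" if "q : cone" "H q * K q ~= 0" for q
  proof -
   have "K q ~= 0" using that by simp
   hence "q : \<Union>V" using K(3) that by blast
   thus ?thesis using V(3,6) \<open>K q ~= 0\<close> by auto
  qed
  moreover have "H p ~= 0" using V(6) \<open>p : \<Union>V\<close> by blast
  ultimately show "EX D' G H. cox_form e D' H & cox_form e (D + D') G & H p ~= 0 &
   (ALL q:cone. H q ~= 0 --> q : \<Union>U & F q = G q / H q)"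
   using cox_form_mult[OF V(5) K(1)] cox_form_mult[OF V(4) K(1)] K(2)
   by (rule_tac x = "D' + D1" in exI, rule_tac x = "%q. G q * K q" in exI,
     rule_tac x = "%q. H q * K q" in exI) (simp add: add.assoc)
 qed
 thus "reg e D (\<Union>U) F & (ALL p. p ~: \<Union>U --> F p = 0)" using F unfolding line_sections_def by blast
next
 assume F: "reg e D (\<Union>U) F & (ALL p. p ~: \<Union>U --> F p = 0)"
 have "EX V D' G H. zopen e V & P : V & V <= U & cox_form e (D + D') G & cox_form e D' H &
    (ALL p:\<Union>V. H p ~= 0 & F p = G p / H p)" if P: "P : U" for P
 proof -
  have PH: "P : hirzebruch e" using P zopen_hirz[OF U] by blast
  then obtain p where p: "p : P" using hirz_ne by blast
  have pU: "p : \<Union>U" using p P by blast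
  obtain D' G H where H: "cox_form e D' H" "cox_form e (D + D') G" "H p ~= 0"
   "!!q. q : cone ==> H q ~= 0 ==> q : \<Union>U & F q = G q / H q" by (rule regE[OF conjunct1[OF F] pU]) (rule that, assumption+)
  define V where "V = Up e {p:cone. H p ~= 0}"
  have V: "zopen e V" "\<Union>V = {p:cone. H p ~= 0}" unfolding V_def using Up_form[OF H(1)] by auto
  have "P : V" unfolding V_def Up_def using cox_form_orbit[OF H(1) PH p] H(3) hirz_cone[OF PH] PH by blast
  moreover have "V <= U" unfolding zopen_subset_iff[OF V(1) U] V(2) using H(4) by blast
  ultimately show ?thesis using V H by blast
 qed
 thus "F : line_sections e D U" using F unfolding line_sections_def by blast
qed

section \<open>Sections of split bundles as vectors, morphisms as matrices\<close>

definition ext :: "'k::field pointset => ('k cox => 'k) => 'k cox => 'k" where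
 "ext U f = (%p. if p : \<Union>U then f p else 0)"

text \<open>Sections of a direct sum are extensional in the index and zero off the cone over U. With
  this normalisation any functions v may serve as representatives, and equality of sections becomes
  \<open>tup_eq\<close>.\<close>

definition tup :: "nat => 'k::field pointset => (nat => 'k cox => 'k) => nat => 'k cox => 'k" where
 "tup n U v = (\<lambda>k\<in>{..<n}. ext U (v k))"

lemma OX_simps:
 "carrier (sect (OX e D) U) = line_sections e D U"
 "F \<oplus>\<^bsub>sect (OX e D) U\<^esub> G = (%p. F p + G p)"
 "\<zero>\<^bsub>sect (OX e D) U\<^esub> = (%p. 0)"
 "F \<odot>\<^bsub>sect (OX e D) U\<^esub> G = (%p. F p * G p)"
 "rest (OX e D) U V F = ext V F"
 by (simp_all add: OX_def ext_def)

lemma ext_in: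
 assumes "zopen e U" "reg e D (\<Union>U) f" shows "ext U f : line_sections e D U"
 unfolding line_sections_iff[OF assms(1)]
 by (rule conjI, rule reg_cong[OF assms(2)]) (simp_all add: ext_def del: Union_iff)

lemma line_sectionsD:
 assumes "zopen e U" "F : line_sections e D U"
 shows "reg e D (\<Union>U) F" "F = ext U F"
 using assms(2) unfolding line_sections_iff[OF assms(1)] by (auto simp: ext_def fun_eq_iff)

lemma tup_in:
 assumes "zopen e U" "!!k. k < length Ds ==> reg e (Ds ! k) (\<Union>U) (v k)"
 shows "tup (length Ds) U v : carrier (sect (split_bundle e Ds) U)"
 by (auto simp: dsum_def tup_def Pi_iff OX_simps intro!: ext_in assms)

lemma tup_ex:
 assumes U: "zopen e U" and t: "t : carrier (sect (split_bundle e Ds) U)"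
 obtains v where "!!k. k < length Ds ==> reg e (Ds ! k) (\<Union>U) (v k)" "t = tup (length Ds) U v"
proof -
 have c: "t : (\<Pi>\<^sub>E i\<in>{..<length Ds}. carrier (sect (OX e (Ds ! i)) U))"
 proof -
  have "t : (\<Pi>\<^sub>E i\<in>{..<length Ds}. carrier (sect (map (OX e) Ds ! i) U))"
   using t by (simp add: dsum_def)
  also have "... = (\<Pi>\<^sub>E i\<in>{..<length Ds}. carrier (sect (OX e (Ds ! i)) U))"
   by (rule PiE_cong) simp
  finally show ?thesis .
 qed
 hence "t k : line_sections e (Ds ! k) U" if "k < length Ds" for k
  using that by (auto simp: PiE_iff OX_simps)
 note * = line_sectionsD[OF U this]
 have "t = tup (length Ds) U t"
 proof
  fix k show "t k = tup (length Ds) U t k"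
  proof (cases "k < length Ds")
   case True thus ?thesis using *(2)[OF True] by (simp add: tup_def)
  next
   case False
   hence "t k = undefined" by (intro PiE_arb[OF c]) simp
   thus ?thesis using False by (simp add: tup_def)
  qed
 qed
 thus ?thesis using that[of t] *(1) by blast
qed

lemma tup_add: "tup (length Ds) U v \<oplus>\<^bsub>sect (split_bundle e Ds) U\<^esub> tup (length Ds) U w =
  tup (length Ds) U (%k p. v k p + w k p)"
 by (auto simp: dsum_def tup_def OX_simps ext_def fun_eq_iff restrict_def)

lemma tup_smult: "f \<odot>\<^bsub>sect (split_bundle e Ds) U\<^esub> tup (length Ds) U v =
  tup (length Ds) U (%k p. f p * v k p)"
 by (auto simp: dsum_def tup_def OX_simps ext_def fun_eq_iff restrict_def)

lemma tup_zero: "\<zero>\<^bsub>sect (split_bundle e Ds) U\<^esub> = tup (length Ds) U (%k p. 0)"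
 by (auto simp: dsum_def tup_def OX_simps ext_def fun_eq_iff restrict_def)

lemma tup_rest: "V <= U ==> rest (split_bundle e Ds) U V (tup (length Ds) U v) = tup (length Ds) V v"
proof -
 assume "V <= U"
 hence "p : \<Union>V ==> p : \<Union>U" for p by blast
 thus ?thesis
  by (auto simp: dsum_def tup_def OX_simps ext_def fun_eq_iff restrict_def simp del: Union_iff)
qed

lemma tup_eq: "tup n U v = tup n U w \<longleftrightarrow> (ALL k<n. ALL p:\<Union>U. v k p = w k p)"
proof
 assume *: "tup n U v = tup n U w"
 show "ALL k<n. ALL p:\<Union>U. v k p = w k p"
 proof (intro allI impI ballI)
  fix k p assume "k < n" "p : \<Union>U"
  thus "v k p = w k p" using fun_cong[OF fun_cong[OF *, of k], of p] by (simp add: tup_def ext_def)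
 qed
next
 assume *: "ALL k<n. ALL p:\<Union>U. v k p = w k p"
 show "tup n U v = tup n U w"
  unfolding tup_def
 proof (rule restrict_ext)
  fix k assume k: "k : {..<n}"
  show "ext U (v k) = ext U (w k)"
  proof
   fix p show "ext U (v k) p = ext U (w k) p" using * k by (cases "p : \<Union>U") (simp_all add: ext_def del: Union_iff, blast)
  qed
 qed
qed

lemma tup_cong: "(!!k p. k < n ==> p : \<Union>U ==> v k p = w k p) ==> tup n U v = tup n U w"
 unfolding tup_eq by blast

definition Ch :: "nat => nat => nat => 'k::field pointset" where
 "Ch e i j = Up e (UT {i, j})"

lemma Ch:
 assumes "chart i j" shows "zopen e (Ch e i j :: 'k::field pointset)" "\<Union>(Ch e i j) = (UT {i, j} :: 'k::field cox set)"
proof -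
 have "opn e (UT {i, j} :: 'k cox set)" using assms by (intro opn_UT) (auto simp: chart_def)
 from Up_zopen[OF this] show "zopen e (Ch e i j :: 'k pointset)" "\<Union>(Ch e i j) = (UT {i, j} :: 'k cox set)" by (simp_all add: Ch_def)
qed

lemma tr_reg: "chart i j ==> reg e D (UT {i, j}) (tr e i j D)"
proof -
 assume ch: "chart i j"
 have "lau e D {i, j} (tr e i j D)" unfolding lau_chart[OF ch] by (intro exI[of _ 1]) simp
 thus ?thesis by (rule lau_reg) (use ch in \<open>auto simp: chart_def\<close>)
qed

lemma charts: "chart 0 2" "chart 0 3" "chart 1 2" "chart 1 3"
 by (auto simp: chart_def)

text \<open>On each chart f is a Laurent polynomial, and uniqueness of coefficients makes it the
  same one everywhere. The charts together exclude every negative exponent.\<close>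

lemma reg_cone_form:
 fixes f :: "'k::{alg_closed_field, field_char_0} cox => 'k"
 assumes "reg e D cone f"
 obtains F where "cox_form e D F" "!!p. p : cone ==> f p = F p"
proof -
 have "lau e D {i, j} f" if "chart i j" for i j
 proof (rule reg_lau[OF that])
  show "{i, j} <= {..<4}" using that by (auto simp: chart_def)
  thus "reg e D (UT {i, j}) f" using reg_subset[OF assms opn_UT UT_cone] by blast
 qed auto
 hence "EX c. finite {m. c m ~= 0} & {m. c m ~= 0} <= exps e D {i, j} & (ALL p:UT {i, j}. f p = evl e D c p)" if "chart i j" for i j
  using that unfolding lau_def by blast
 note * = this
 obtain c where c: "finite {m. c m ~= 0}" "{m. c m ~= 0} <= exps e D {0, 2}" "ALL p:UT {0, 2}. f p = evl e D c p"
  using *[OF charts(1)] by blast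
 have u: "{m. c m ~= 0} <= exps e D {i, j} & (ALL p:UT {i, j}. f p = evl e D c p)" if ch: "chart i j" for i j
 proof -
  obtain c' where c': "finite {m. c' m ~= 0}" "{m. c' m ~= 0} <= exps e D {i, j}" "ALL p:UT {i, j}. f p = evl e D c' p"
   using *[OF ch] by blast
  have "UT torus <= UT {0, 2}" "UT torus <= UT {i, j}"
   by (rule UT_anti, use ch in \<open>fastforce simp: chart_def\<close>)+
  hence "c = c'" using c(3) c'(3) by (intro evl_unique[OF c(1) c'(1)]) force
  thus ?thesis using c' by blast
 qed
 have "{m. c m ~= 0} <= exps e D {}"
 proof
  fix m assume "m : {m. c m ~= 0}"
  hence "m : exps e D {0, 2}" "m : exps e D {0, 3}" "m : exps e D {1, 2}"
   using u[OF charts(1)] u[OF charts(2)] u[OF charts(3)] by blast+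
  thus "m : exps e D {}" by (simp add: exps_iff)
 qed
 hence "lau e D {} (evl e D c)" using c(1) unfolding lau_def by blast
 then obtain F where F: "cox_form e D F" "!!p. p : cone ==> evl e D c p = F p" using lau_empty_cox_form by blast
 moreover have "f p = evl e D c p" if p: "p : cone" for p
  by (rule cone_chart[OF p]) (use u in blast)
 ultimately show ?thesis using that by metis
qed

lemma is_morD:
 assumes "is_mor_on e U F G \<phi>" "zopen e V" "V <= U"
 shows "s : carrier (sect F V) ==> \<phi> V s : carrier (sect G V)"
  and "s : carrier (sect F V) ==> t : carrier (sect F V) ==>
   \<phi> V (s \<oplus>\<^bsub>sect F V\<^esub> t) = \<phi> V s \<oplus>\<^bsub>sect G V\<^esub> \<phi> V t"
  and "f : line_sections e 0 V ==> s : carrier (sect F V) ==>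
   \<phi> V (f \<odot>\<^bsub>sect F V\<^esub> s) = f \<odot>\<^bsub>sect G V\<^esub> \<phi> V s"
  and "zopen e W ==> W <= V ==> s : carrier (sect F V) ==> \<phi> W (rest F V W s) = rest G V W (\<phi> V s)"
 using assms unfolding is_mor_on_def by (auto simp: OX_simps)

lemma reg_Int:
 assumes "reg e D (\<Union>U) f" "zopen e V" "V <= U"
 shows "reg e D (\<Union>V) f"
 by (rule reg_subset[OF assms(1) zopen_opn[OF assms(2)]]) (use assms(3) in blast)

lemma line_add: "zopen e U ==> s : line_sections e D U ==> t : line_sections e D U ==> (%p. s p + t p) : line_sections e D U"
 by (simp add: line_sections_iff reg_add)

lemma line_smult:
 assumes "zopen e U" "f : line_sections e 0 U" "s : line_sections e D U"
 shows "(%p. f p * s p) : line_sections e D U"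
proof -
 have "reg e (0 + D) (\<Union>U) (%p. f p * s p)" using assms by (intro reg_mult) (simp_all add: line_sections_iff)
 thus ?thesis using assms by (simp add: line_sections_iff)
qed

lemma line_rest:
 assumes "zopen e U" "zopen e V" "V <= U" "s : line_sections e D U"
 shows "ext V s : line_sections e D V"
 by (rule ext_in[OF assms(2) reg_Int[OF line_sectionsD(1)[OF assms(1,4)] assms(2,3)]])

lemma tr_line:
 assumes "chart i j" "zopen e V" "V <= Ch e i j"
 shows "ext V (tr e i j D) : line_sections e D V"
 by (rule ext_in[OF assms(2) reg_subset[OF tr_reg[OF assms(1)] zopen_opn[OF assms(2)]]])
  (use Ch(2)[OF assms(1)] assms(3) in blast)

lemma Ch_Union_sub: "chart i j ==> V <= Ch e i j ==> \<Union>V <= UT {i, j}"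
 using Ch(2) by blast

lemma tr_div:
 assumes "chart i j" "zopen e V" "V <= Ch e i j" "reg e (D' + D) (\<Union>V) s"
 shows "reg e D' (\<Union>V) (%p. s p / tr e i j D p)"
proof -
 have "reg e (D' + D - D) (\<Union>V) (%p. s p / tr e i j D p)"
  by (intro reg_divide assms(4) reg_subset[OF tr_reg[OF assms(1)] zopen_opn[OF assms(2)]] tr_nonzero)
   (use Ch_Union_sub[OF assms(1,3)] in blast)+
 thus ?thesis by simp
qed

lemma tup_eqD: "tup n U v = tup n U w ==> k < n ==> p : \<Union>U ==> v k p = w k p"
 unfolding tup_eq by blast

lemma ext_at: "p : \<Union>U ==> ext U f p = f p"
 by (simp add: ext_def del: Union_iff)

lemma chart_nbhd:
 assumes U: "zopen e U" and p: "p : \<Union>U"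
 obtains i j V where "chart i j" "zopen e V" "p : \<Union>V" "V <= U" "V <= Ch e i j"
proof -
 have "p : cone" using p opn_cone[OF zopen_opn[OF U]] by blast
 then obtain i j where ij: "chart i j" "p : UT {i, j}" by (rule cone_chart)
 have z: "zopen e (Ch e i j :: 'a pointset)" by (rule Ch(1)[OF ij(1)])
 show ?thesis
  by (rule that[OF ij(1) zopen_Int[OF U z]])
   (use p ij(2) in \<open>simp_all add: zopen_Union_Int[OF U z] Ch(2)[OF ij(1)] del: Union_iff\<close>)
qed

text \<open>Evaluating a morphism on a section that does not vanish at p allows cancellation at p;
  multipliers are recovered from morphisms in this way.\<close>

lemma line_test:
 assumes U: "zopen e U" and p: "p : \<Union>U"
 obtains V s where "zopen e V" "p : \<Union>V" "V <= U" "s : line_sections e D V" "s p ~= 0"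
proof -
 obtain i j V where V: "chart i j" "zopen e V" "p : \<Union>V" "V <= U" "V <= Ch e i j" by (rule chart_nbhd[OF U p])
 have "ext V (tr e i j D) p ~= 0"
  unfolding ext_at[OF V(3)] by (rule tr_nonzero) (use Ch_Union_sub[OF V(1,5)] V(3) in blast)
 thus ?thesis by (rule that[OF V(2-4) tr_line[OF V(1,2,5)]])
qed

lemma mor_on_subset: "is_mor_on e X F G \<phi> ==> U <= X ==> is_mor_on e U F G \<phi>"
 unfolding is_mor_on_def by (intro conjI allI impI ballI; elim conjE; meson order_trans)

lemma mor_comp:
 assumes "is_mor_on e U F G \<phi>" "is_mor_on e U G H \<psi>"
 shows "is_mor_on e U F H (%V s. \<psi> V (\<phi> V s))"
 using assms unfolding is_mor_on_def by (intro conjI allI impI ballI; elim conjE) metis+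

lemma glue_reg:
 fixes C :: "'k::{alg_closed_field, field_char_0} pointset => (nat => 'k cox => 'k) => bool"
 assumes ex: "!!p. p : \<Union>U ==> EX W a. C W a & p : \<Union>W" and sub: "!!W a. C W a ==> W <= U"
  and reg: "!!W a i. C W a ==> i < n ==> reg e (D i) (\<Union>W) (a i)"
  and eq: "!!W a W' a' i p. C W a ==> C W' a' ==> i < n ==> p : \<Union>W ==> p : \<Union>W' ==> a i p = a' i p"
 obtains b where "!!i. i < n ==> reg e (D i) (\<Union>U) (b i)" "!!W a i p. C W a ==> i < n ==> p : \<Union>W ==> b i p = a i p"
proof -
 define w where "w p = (SOME x. C (fst x) (snd x) & p : \<Union>(fst x))" for p
 define b where "b i p = snd (w p) i p" for i p
 have b: "b i p = a i p" if "C W a" "i < n" "p : \<Union>W" for W a i p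
 proof -
  have "C (fst (w p)) (snd (w p)) & p : \<Union>(fst (w p))"
   unfolding w_def by (rule someI[of _ "(W, a)"]) (use that in simp)
  thus ?thesis unfolding b_def using that by (intro eq) blast+
 qed
 have "reg e (D i) (\<Union>U) (b i)" if i: "i < n" for i
 proof (rule reg_local)
  fix p assume "p : \<Union>U"
  then obtain W a where C: "C W a" "p : \<Union>W" using ex by blast
  have "reg e (D i) (\<Union>W) (b i)" by (rule reg_cong[OF reg[OF C(1) i] b[OF C(1) i]])
  moreover have "\<Union>W <= \<Union>U" using sub[OF C(1)] by blast
  ultimately show "EX B. p : B & B <= \<Union>U & reg e (D i) B (b i)" using C(2) by (intro exI[of _ "\<Union>W"]) simp
 qed
 thus ?thesis using b by (rule that)
qed

lemma line_mor_generator: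
 assumes mor: "is_mor_on e U (OX e D) F \<phi>" and U: "zopen e U" "chart i h" "U <= Ch e i h"
  and W: "zopen e W" "W <= U" and s: "s : line_sections e D W"
 shows "ext W (%p. s p / tr e i h D p) : line_sections e 0 W"
  and "\<phi> W s = ext W (%p. s p / tr e i h D p) \<odot>\<^bsub>sect F W\<^esub> rest F U W (\<phi> U (ext U (tr e i h D)))"
proof -
 let ?f = "ext W (%p. s p / tr e i h D p)"
 note m = is_morD[OF mor, unfolded OX_simps]
 have WC: "W <= Ch e i h" using W(2) U(3) by blast
 show f: "?f : line_sections e 0 W"
  by (rule ext_in[OF W(1) tr_div[OF U(2) W(1) WC]]) (use line_sectionsD(1)[OF W(1) s] in simp)
 have "s = (%p. ?f p * ext W (tr e i h D) p)"
 proof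
  fix p show "s p = ?f p * ext W (tr e i h D) p"
   using fun_cong[OF line_sectionsD(2)[OF W(1) s], of p] tr_nonzero[of p i h e D] Ch_Union_sub[OF U(2) WC]
   by (cases "p : \<Union>W") (auto simp: ext_def simp del: Union_iff)
 qed
 hence "\<phi> W s = \<phi> W (%p. ?f p * ext W (tr e i h D) p)" by simp
 also have "... = ?f \<odot>\<^bsub>sect F W\<^esub> \<phi> W (ext W (tr e i h D))" by (rule m(3)[OF W f tr_line[OF U(2) W(1) WC]])
 also have "ext W (tr e i h D) = ext W (ext U (tr e i h D))"
  using W(2) by (auto simp: ext_def fun_eq_iff)
 finally show "\<phi> W s = ?f \<odot>\<^bsub>sect F W\<^esub> rest F U W (\<phi> U (ext U (tr e i h D)))"
  unfolding m(4)[OF U(1) order_refl W tr_line[OF U(2,1,3)]] .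
qed

text \<open>A morphism from O(D) to a direct sum of line bundles is multiplication by a vector of regular
 functions: on each chart O(D) is generated by a monomial.\<close>

lemma line_mor:
 fixes \<phi> :: "('k::{alg_closed_field, field_char_0}, 'k cox => 'k, nat => 'k cox => 'k) mor"
 assumes U: "zopen e U" and mor: "is_mor_on e U (OX e D) (split_bundle e Bs) \<phi>"
 obtains v where "!!l. l < length Bs ==> reg e (Bs ! l - D) (\<Union>U) (v l)"
  "!!V s. zopen e V ==> V <= U ==> s : line_sections e D V ==> \<phi> V s = tup (length Bs) V (%l p. v l p * s p)"
proof -
 let ?n = "length Bs"
 note m = is_morD[OF mor, unfolded OX_simps]
 \<comment> \<open>Open sets on which the morphism is already known to be multiplication by a. By
   \<open>line_test\<close> such a are unique on overlaps, so they glue.\<close>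
 define C where "C W a \<longleftrightarrow> zopen e W & W <= U & (ALL l<?n. reg e (Bs ! l - D) (\<Union>W) (a l)) &
  (ALL N s. zopen e N --> N <= W --> s : line_sections e D N --> \<phi> N s = tup ?n N (%l p. a l p * s p))" for W a
 have CD: "zopen e W" "W <= U" "l < ?n ==> reg e (Bs ! l - D) (\<Union>W) (a l)"
  "zopen e N ==> N <= W ==> s : line_sections e D N ==> \<phi> N s = tup ?n N (%l p. a l p * s p)" if "C W a" for W a l N s
  using that unfolding C_def by blast+
 have ex: "EX W a. C W a & p : \<Union>W" if p: "p : \<Union>U" for p
 proof -
  obtain i h V where V: "chart i h" "zopen e V" "p : \<Union>V" "V <= U" "V <= Ch e i h" by (rule chart_nbhd[OF U p])
  obtain g where g: "!!l. l < ?n ==> reg e (Bs ! l) (\<Union>V) (g l)" "\<phi> V (ext V (tr e i h D)) = tup ?n V g"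
   by (rule tup_ex[OF V(2) m(1)[OF V(2,4) tr_line[OF V(1,2,5)]]]) (rule that, assumption+)
  define a where "a l p = g l p / tr e i h D p" for l p
  have "\<phi> N s = tup ?n N (%l p. a l p * s p)" if N: "zopen e N" "N <= V" and s: "s : line_sections e D N" for N s
   unfolding line_mor_generator(2)[OF mor_on_subset[OF mor V(4)] V(2,1,5) N s] g(2) tup_rest[OF N(2)] tup_smult
   by (rule tup_cong) (simp add: a_def ext_at)
  moreover have "reg e (Bs ! l - D) (\<Union>V) (a l)" if "l < ?n" for l
   unfolding a_def by (rule tr_div[OF V(1,2,5)]) (use g(1)[OF that] in simp)
  ultimately have "C V a" unfolding C_def using V by blast
  thus ?thesis using V(3) by blast
 qed
 have eq: "a l p = a' l p" if C: "C W a" "C W' a'" and l: "l < ?n" and p: "p : \<Union>W" "p : \<Union>W'" for W a W' a' l p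
 proof -
  note Z = CD(1)[OF C(1)] CD(1)[OF C(2)]
  have "p : \<Union>(W Int W')" unfolding zopen_Union_Int[OF Z] using p by (rule IntI)
  then obtain N s where N: "zopen e N" "p : \<Union>N" "N <= W Int W'" "s : line_sections e D N" "s p ~= 0" by (rule line_test[OF zopen_Int[OF Z]])
  have "tup ?n N (%l p. a l p * s p) = tup ?n N (%l p. a' l p * s p)"
   using CD(4)[OF C(1) N(1) _ N(4)] CD(4)[OF C(2) N(1) _ N(4)] N(3) by simp
  from tup_eqD[OF this l N(2)] show ?thesis using N(5) by simp
 qed
 obtain v where v: "!!l. l < ?n ==> reg e (Bs ! l - D) (\<Union>U) (v l)" "!!W a l p. C W a ==> l < ?n ==> p : \<Union>W ==> v l p = a l p"
  by (rule glue_reg[where C = C and D = "%l. Bs ! l - D" and n = ?n]) (rule ex CD(2,3) eq that, assumption+)+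
 show ?thesis
 proof (rule that[OF v(1)])
  fix W s assume W: "zopen e W" "W <= U" and s: "s : line_sections e D W"
  obtain u where u: "\<phi> W s = tup ?n W u" by (rule tup_ex[OF W(1) m(1)[OF W s]]) (rule that, assumption+)
  have "u l p = v l p * s p" if l: "l < ?n" and p: "p : \<Union>W" for l p
  proof -
   have "p : \<Union>U" using p W(2) by blast
   then obtain V a where C: "C V a" "p : \<Union>V" using ex by blast
   note Z = zopen_Int[OF W(1) CD(1)[OF C(1)]]
   have pN: "p : \<Union>(W Int V)" unfolding zopen_Union_Int[OF W(1) CD(1)[OF C(1)]] using p C(2) by (rule IntI)
   have "tup ?n (W Int V) u = \<phi> (W Int V) (ext (W Int V) s)" unfolding m(4)[OF W Z Int_lower1 s] u by (rule tup_rest[OF Int_lower1, symmetric])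
   also have "... = tup ?n (W Int V) (%l p. a l p * ext (W Int V) s p)"
    by (rule CD(4)[OF C(1) Z Int_lower2 line_rest[OF W(1) Z Int_lower1 s]])
   finally have "u l p = a l p * ext (W Int V) s p" by (rule tup_eqD[OF _ l pN])
   thus ?thesis using v(2)[OF C(1) l C(2)] ext_at[OF pN, of s] by simp
  qed
  thus "\<phi> W s = tup ?n W (%l p. v l p * s p)" unfolding u by (rule tup_cong)
 qed
qed

text \<open>The k-th column comes from composing with the inclusion \<open>I k\<close> of the k-th
  summand. Its multipliers are regular on the whole cone, hence agree with forms there.\<close>

theorem morphism_matrix:
 fixes \<phi> :: "('k::{alg_closed_field, field_char_0}, nat => 'k cox => 'k, nat => 'k cox => 'k) mor"
 assumes mor: "is_mor e (split_bundle e As) (split_bundle e Bs) \<phi>"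
 obtains M where "!!l k. l < length Bs ==> k < length As ==> cox_form e (Bs ! l - As ! k) (M l k)"
  "!!U v. zopen e U ==> (!!k. k < length As ==> reg e (As ! k) (\<Union>U) (v k)) ==>
    \<phi> U (tup (length As) U v) = tup (length Bs) U (%l p. SUM k<length As. M l k p * v k p)"
proof -
 define nA where "nA = length As"
 define nB where "nB = length Bs"
 define I where "I k V s = tup nA V (%k' p. if k' = k then s p else 0)" for k V and s :: "'k cox => 'k"
 have I_in: "I k V s : carrier (sect (split_bundle e As) V)" if V: "zopen e V" and s: "s : line_sections e (As ! k) V" for k V s
  unfolding I_def nA_def
 proof (rule tup_in[OF V])
  show "reg e (As ! k') (\<Union>V) (%p. if k' = k then s p else 0)" for k'
   using line_sectionsD(1)[OF V s] reg_0[OF zopen_opn[OF V]] by (cases "k' = k") auto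
 qed
 have I: "is_mor e (OX e (As ! k)) (split_bundle e As) (I k)" if k: "k < nA" for k
  unfolding is_mor_on_def OX_simps
 proof (intro conjI allI impI ballI; elim conjE)
  show "I k W (ext W s) = rest (split_bundle e As) V W (I k V s)" if "W <= V" for V W s
   unfolding I_def nA_def tup_rest[OF that] by (rule tup_cong) (simp add: ext_at)
 qed (simp_all add: I_in, auto simp: I_def nA_def tup_add tup_smult intro!: tup_cong)
 define Q where "Q k v \<longleftrightarrow> (ALL l<nB. reg e (Bs ! l - As ! k) cone (v l)) &
   (ALL V s. zopen e V --> s : line_sections e (As ! k) V --> \<phi> V (I k V s) = tup nB V (%l p. v l p * s p))" for k v
 have "EX v. Q k v" if k: "k < nA" for k
 proof -
  obtain v where "!!l. l < length Bs ==> reg e (Bs ! l - As ! k) (\<Union>(hirzebruch e)) (v l)"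
   "!!V s. zopen e V ==> V <= hirzebruch e ==> s : line_sections e (As ! k) V ==> \<phi> V (I k V s) = tup (length Bs) V (%l p. v l p * s p)"
   by (rule line_mor[OF zopen_hirzebruch mor_comp[OF I[OF k] mor]]) (rule that, assumption+)
  thus ?thesis unfolding Q_def nB_def by (intro exI[of _ v] conjI allI impI) (simp_all add: Union_hirz zopen_hirz)
 qed
 hence Q: "Q k (SOME v. Q k v)" if "k < nA" for k using that by (intro someI_ex[of "Q k"])
 define u where "u k = (SOME v. Q k v)" for k
 have u: "!!l. l < nB ==> reg e (Bs ! l - As ! k) cone (u k l)"
  "!!V s. zopen e V ==> s : line_sections e (As ! k) V ==> \<phi> V (I k V s) = tup nB V (%l p. u k l p * s p)"
  if "k < nA" for k using Q[OF that] unfolding Q_def u_def by blast+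
 define P where "P l k F \<longleftrightarrow> cox_form e (Bs ! l - As ! k) F & (ALL p:cone. u k l p = F p)" for l k F
 have "EX F. P l k F" if kl: "k < nA" "l < nB" for k l
 proof -
  obtain F where "cox_form e (Bs ! l - As ! k) F" "!!p. p : cone ==> u k l p = F p"
   by (rule reg_cone_form[OF u(1)[OF kl]]) (rule that, assumption+)
  thus ?thesis unfolding P_def by (intro exI[of _ F]) simp
 qed
 hence P: "P l k (SOME F. P l k F)" if "k < nA" "l < nB" for k l using that by (intro someI_ex[of "P l k"])
 define M where "M l k = (SOME F. P l k F)" for l k
 have M: "cox_form e (Bs ! l - As ! k) (M l k)" "!!p. p : cone ==> u k l p = M l k p" if "k < nA" "l < nB" for k l
  using P[OF that] unfolding P_def M_def by blast+
 have \<phi>I: "\<phi> V (I k V s) = tup nB V (%l p. M l k p * s p)" if k: "k < nA" and V: "zopen e V" and s: "s : line_sections e (As ! k) V" for k V s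
 proof -
  have "\<phi> V (I k V s) = tup nB V (%l p. u k l p * s p)" by (rule u(2)[OF k V s])
  also have "... = tup nB V (%l p. M l k p * s p)"
  proof (rule tup_cong)
   fix l p assume l: "l < nB" and "p : \<Union>V"
   hence "p : cone" using opn_cone[OF zopen_opn[OF V]] by blast
   thus "u k l p * s p = M l k p * s p" using M(2)[OF k l] by simp
  qed
  finally show ?thesis .
 qed
 show ?thesis
 proof (rule that)
  fix l k assume "l < length Bs" "k < length As"
  thus "cox_form e (Bs ! l - As ! k) (M l k)" using M(1) by (simp add: nA_def nB_def)
 next
  fix U :: "'k pointset" and v assume U: "zopen e U" and v: "!!k. k < length As ==> reg e (As ! k) (\<Union>U) (v k)"
  note m = is_morD[OF mor U zopen_hirz[OF U]] and o = zopen_opn[OF U]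
  \<comment> \<open>Additivity is applied one summand at a time; at the zero vector, linearity over
    the zero function gives the start.\<close>
  have "\<phi> U (tup nA U (%k p. if k < i then v k p else 0)) = tup nB U (%l p. SUM k<i. M l k p * v k p)" if "i <= nA" for i
   using that
  proof (induction i)
   case 0
   have z: "tup nA U (%k p. 0) : carrier (sect (split_bundle e As) U)" unfolding nA_def by (intro tup_in U reg_0 o)
   obtain w where w: "\<phi> U (tup nA U (%k p. 0)) = tup nB U w"
    by (rule tup_ex[OF U m(1)[OF z]]) (rule that, simp add: nB_def)
   have f: "(%p. 0) : line_sections e 0 U" by (simp add: line_sections_iff[OF U] reg_0[OF o])
   show ?case using m(3)[OF f z] unfolding w unfolding nA_def nB_def tup_smult by simp
  next
   case (Suc i)
   have i: "i < nA" "i < length As" using Suc(2) by (simp_all add: nA_def)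
   have s: "ext U (v i) : line_sections e (As ! i) U" by (rule ext_in[OF U v[OF i(2)]])
   have c: "tup nA U (%k p. if k < i then v k p else 0) : carrier (sect (split_bundle e As) U)"
    unfolding nA_def
   proof (rule tup_in[OF U])
    show "reg e (As ! k) (\<Union>U) (%p. if k < i then v k p else 0)" if "k < length As" for k
     using v[OF that] reg_0[OF o] by (cases "k < i") auto
   qed
   have "tup nA U (%k p. if k < Suc i then v k p else 0) =
    tup nA U (%k p. if k < i then v k p else 0) \<oplus>\<^bsub>sect (split_bundle e As) U\<^esub> I i U (ext U (v i))"
    unfolding I_def nA_def tup_add by (rule tup_cong) (auto simp: ext_at less_Suc_eq)
   thus ?case using m(2)[OF c I_in[OF U s]] Suc \<phi>I[OF i(1) U s]
    by (simp add: tup_add nB_def) (rule tup_cong, simp add: ext_at)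
  qed
  from this[of nA] show "\<phi> U (tup (length As) U v) = tup (length Bs) U (%l p. SUM k<length As. M l k p * v k p)"
   using tup_cong[of nA U "%k p. if k < nA then v k p else 0" v] by (simp add: nA_def nB_def)
 qed
qed

section \<open>Refinements of coverings and Cech cohomology of presheaves\<close>

definition good_cover :: "nat => 'k::{alg_closed_field, field_char_0} pointset set => ('k pointset => 'k cox => 'k) =>
  ('k pointset => divclass) => ('k pointset => nat) => ('k pointset => nat) => bool" where
 "good_cover e \<V> f d ci cj \<longleftrightarrow> open_cover e \<V> & basic_cover e \<V> f d ci cj &
   (ALL V:\<V>. \<Union>V = {p:cone. f V p ~= 0})"

lemma open_cover_zopen: "open_cover e \<U> ==> U : \<U> ==> zopen e U"
 by (simp add: open_cover_def)

lemma open_cover_pt: "open_cover e \<U> ==> p : cone ==> EX U:\<U>. p : \<Union>U"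
proof -
 assume U: "open_cover e \<U>" and p: "p : cone"
 have "p : \<Union>(hirzebruch e)" using p by (simp only: Union_hirz)
 then obtain P where P: "P : hirzebruch e" "p : P" by blast
 moreover have "\<Union>\<U> = hirzebruch e" using U by (simp add: open_cover_def)
 ultimately obtain U where "U : \<U>" "P : U" by blast
 thus ?thesis using P(2) by blast
qed

lemma open_coverI:
 fixes \<U> :: "'k::field pointset set"
 assumes "!!U. U : \<U> ==> zopen e U" "!!p. p : cone ==> EX U:\<U>. p : \<Union>U"
 shows "open_cover e \<U>"
proof -
 have "\<Union>\<U> = hirzebruch e"
 proof (intro equalityI subsetI)
  fix P :: "'k cox set" assume P: "P : hirzebruch e"
  then obtain p where p: "p : cone" "p : P" using hirz_ne by blast
  then obtain U Q where U: "U : \<U>" "Q : U" "p : Q" using assms(2) by blast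
  hence "Q = P" using hirz_unique[OF _ P _ p(2)] zopen_hirz[OF assms(1)[OF U(1)]] by blast
  thus "P : \<Union>\<U>" using U by blast
 qed (use assms(1) zopen_hirz in blast)
 thus ?thesis using assms(1) by (simp add: open_cover_def)
qed

text \<open>Around each point of a chart some form is nonzero only inside the chart and inside a
  member of the covering. The Nullstellensatz keeps finitely many of these forms for each
  chart.\<close>

lemma basic_refinement:
 fixes \<U> :: "'k::{alg_closed_field, field_char_0} pointset set"
 assumes cov: "open_cover e \<U>"
 obtains \<V> rr f d ci cj where "good_cover e \<V> f d ci cj" "refines_by \<V> \<U> rr"
proof -
 define K :: "nat => nat => (divclass \<times> ('k cox => 'k)) set" where
  "K i j = {DF. cox_form e (fst DF) (snd DF) & {p:cone. snd DF p ~= 0} <= UT {i, j} &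
    (EX U:\<U>. {p:cone. snd DF p ~= 0} <= \<Union>U)}" for i j
 have ex: "EX K0. finite K0 & K0 <= K i j & (ALL p:UT {i, j}. EX k:K0. snd k p ~= 0)" if ch: "chart i j" for i j
 proof -
  have ij: "{i, j} <= {..<4}" using ch by (auto simp: chart_def)
  \<comment> \<open>The product vanishes nowhere on the chart, so an expression of w^N through
    finitely many of the forms shows that these have no common zero there.\<close>
  define w :: "'k cox => 'k" where "w p = (PROD i:{i, j}. cc p i)" for p
  have w: "cox_form e (UTdeg e {i, j}) w" using UT_form[OF ij, of e] by (simp only: w_def[abs_def])
  have wnz: "w p ~= 0" if "p : UT {i, j}" for p using that by (simp add: w_def UT_def)
  have "EX k:K i j. snd k p ~= 0" if p: "p : UT {i, j}" for p
  proof -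
   have "p : cone" using p UT_cone by blast
   then obtain U where U: "U : \<U>" "p : \<Union>U" using open_cover_pt[OF cov] by blast
   have "opn e (\<Union>U Int UT {i, j})"
    by (intro opn_Int opn_UT ij zopen_opn open_cover_zopen[OF cov U(1)])
   moreover have "p : \<Union>U Int UT {i, j}" using U p by simp
   ultimately obtain D F where F: "cox_form e D F" "F p ~= 0" "!!q. q : cone ==> F q ~= 0 ==> q : \<Union>U Int UT {i, j}"
    by (rule opnE) (rule that, assumption+)
   have "{p:cone. F p ~= 0} <= UT {i, j}" "{p:cone. F p ~= 0} <= \<Union>U" using F(3) by blast+
   hence "(D, F) : K i j" unfolding K_def using F(1) U(1) by auto
   thus ?thesis using F(2) by (intro bexI[of _ "(D, F)"]) auto
  qed
  moreover have "cox_form e (fst k) (snd k)" if "k : K i j" for k using that by (simp add: K_def)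
  ultimately obtain N K0 g where N: "finite K0" "K0 <= K i j" "ALL p:UT {i, j}. w p ^ N = (SUM k:K0. g k p * snd k p)"
   using chart_nullstellensatz[where K = "K i j" and d = fst and H = snd, OF ch w] by blast
  have "EX k:K0. snd k p ~= 0" if p: "p : UT {i, j}" for p
  proof (rule ccontr)
   assume "~ (EX k:K0. snd k p ~= 0)"
   hence "w p ^ N = 0" using N(3) p by simp
   thus False using wnz[OF p] by simp
  qed
  thus ?thesis using N by blast
 qed
 define K0 where "K0 i j = (SOME K0. finite K0 & K0 <= K i j & (ALL p:UT {i, j}. EX k:K0. snd k p ~= 0))" for i j
 have K0: "finite (K0 i j) & K0 i j <= K i j & (ALL p:UT {i, j}. EX k:K0 i j. snd k p ~= 0)" if "chart i j" for i j
  unfolding K0_def by (rule someI_ex[OF ex[OF that]])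
 define up :: "divclass \<times> ('k cox => 'k) => 'k pointset" where "up k = Up e {p:cone. snd k p ~= 0}" for k
 define X where "X = {(i, j, k). chart i j & k : K0 i j}"
 define \<V> where "\<V> = (%(i, j, k). up k) ` X"
 have finX: "finite X"
 proof (rule finite_subset)
  show "X <= {0, 1} \<times> {2, 3} \<times> (K0 0 2 \<union> K0 0 3 \<union> K0 1 2 \<union> K0 1 3)"
   unfolding X_def chart_def by auto
  have "chart 0 2" "chart 0 3" "chart 1 2" "chart 1 3" by (auto simp: chart_def)
  thus "finite ({0, 1::nat} \<times> {2, 3::nat} \<times> (K0 0 2 \<union> K0 0 3 \<union> K0 1 2 \<union> K0 1 3))"
   using K0 by (intro finite_cartesian_product finite_UnI) auto
 qed
 define x where "x V = (SOME x. x : X & V = (case x of (i, j, k) => up k))" for V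
 have x: "x V : X & V = (case x V of (i, j, k) => up k)" if "V : \<V>" for V
 proof -
  have "EX x. x : X & V = (case x of (i, j, k) => up k)" using that unfolding \<V>_def by blast
  thus ?thesis unfolding x_def by (rule someI_ex)
 qed
 define ci where "ci V = fst (x V)" for V
 define cj where "cj V = fst (snd (x V))" for V
 define f where "f V = snd (snd (snd (x V)))" for V
 define d where "d V = fst (snd (snd (x V)))" for V
 have P: "chart (ci V) (cj V) & (d V, f V) : K (ci V) (cj V) & V = up (d V, f V)" if V: "V : \<V>" for V
 proof -
  obtain i j k where ijk: "x V = (i, j, k)" by (cases "x V") auto
  have "chart i j" "k : K0 i j" "V = up k" using x[OF V] unfolding ijk by (auto simp: X_def)
  moreover have "K0 i j <= K i j" using K0 calculation by blast
  moreover have "ci V = i" "cj V = j" "(d V, f V) = k" by (simp_all add: ci_def cj_def f_def d_def ijk)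
  ultimately show ?thesis by (simp only:) blast
 qed
 have form: "cox_form e (d V) (f V)" if "V : \<V>" for V
  using P[OF that] by (simp add: K_def)
 have UV: "zopen e V" "\<Union>V = {p:cone. f V p ~= 0}" if V: "V : \<V>" for V
  using Up_form[OF form[OF V]] P[OF V] by (simp_all add: up_def del: Union_iff)
 have pt: "EX V:\<V>. p : \<Union>V" if p: "p : cone" for p
 proof -
  obtain i j where ij: "chart i j" "p : UT {i, j}" by (rule cone_chart[OF p])
  then obtain k where k: "k : K0 i j" "snd k p ~= 0" using K0 by blast
  have "(i, j, k) : X" using ij k by (simp add: X_def)
  hence "(case (i, j, k) of (i, j, k) => up k) : \<V>" unfolding \<V>_def by (rule imageI)
  hence "up k : \<V>" by simp
  moreover have "cox_form e (fst k) (snd k)" using K0[OF ij(1)] k(1) by (auto simp: K_def)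
  hence "p : \<Union>(up k)" unfolding up_def using Up_form(2) k(2) p by blast
  ultimately show ?thesis by blast
 qed
 have ocV: "open_cover e \<V>" by (rule open_coverI[OF UV(1) pt])
 have bc: "basic_cover e \<V> f d ci cj"
 proof
  show "finite \<V>" unfolding \<V>_def using finX by simp
  fix V assume V: "V : \<V>"
  show "cox_form e (d V) (f V)" by (rule form[OF V])
  show "chart (ci V) (cj V)" using P[OF V] by blast
  show "{p : cone. f V p ~= 0} <= UT {ci V, cj V}" using P[OF V] by (simp add: K_def)
 next
  fix p :: "'k cox" assume p: "p : cone"
  then obtain V where V: "V : \<V>" "p : \<Union>V" using pt by blast
  thus "EX i:\<V>. f i p ~= 0" using UV(2)[OF V(1)] by blast
 qed
 have "EX U:\<U>. V <= U" if V: "V : \<V>" for V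
 proof -
  obtain U where U: "U : \<U>" "{p:cone. f V p ~= 0} <= \<Union>U" using P[OF V] by (auto simp: K_def)
  have "V <= U" unfolding zopen_subset_iff[OF UV(1)[OF V] open_cover_zopen[OF cov U(1)]] UV(2)[OF V] by (rule U(2))
  thus ?thesis using U(1) by blast
 qed
 hence "refines_by \<V> \<U> (%V. SOME U. U : \<U> & V <= U)"
  unfolding refines_by_def by (metis (mono_tags, lifting) someI_ex)
 moreover have "good_cover e \<V> f d ci cj" unfolding good_cover_def using ocV bc UV(2) by blast
 ultimately show ?thesis using that by blast
qed

text \<open>For lifts that exist only after shrinking: the sets satisfying Q form an open covering,
  and a good refinement of it inherits Q because Q passes to smaller open sets.\<close>

lemma property_refinement:
 fixes \<U> :: "'k::{alg_closed_field, field_char_0} pointset set"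
 assumes cov: "open_cover e \<U>"
  and loc: "!!U p. U : \<U> ==> p : \<Union>U ==> EX W. zopen e W & p : \<Union>W & W <= U & Q U W"
  and her: "!!U W W'. [|U : \<U>; zopen e W; W <= U; Q U W; zopen e W'; W' <= W|] ==> Q U W'"
 obtains \<V> rr f d ci cj where "good_cover e \<V> f d ci cj" "refines_by \<V> \<U> rr" "!!V. V : \<V> ==> Q (rr V) V"
proof -
 define \<W> where "\<W> = {W. zopen e W & (EX U:\<U>. W <= U & Q U W)}"
 have "open_cover e \<W>"
 proof (rule open_coverI)
  fix p :: "'k cox" assume "p : cone"
  then obtain U where U: "U : \<U>" "p : \<Union>U" using open_cover_pt[OF cov] by blast
  then obtain W where "zopen e W" "p : \<Union>W" "W <= U" "Q U W" using loc by blast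
  thus "EX U:\<W>. p : \<Union>U" unfolding \<W>_def using U(1) by blast
 qed (simp add: \<W>_def)
 then obtain \<V> rr f d ci cj where V: "good_cover e \<V> f d ci cj" "refines_by \<V> \<W> rr"
  by (rule basic_refinement)
 define \<sigma> where "\<sigma> W = (SOME U. U : \<U> & W <= U & Q U W)" for W
 have \<sigma>: "\<sigma> W : \<U> & W <= \<sigma> W & Q (\<sigma> W) W" if "W : \<W>" for W
  unfolding \<sigma>_def by (rule someI_ex) (use that in \<open>auto simp: \<W>_def\<close>)
 have ref: "rr V : \<W> & V <= rr V" if "V : \<V>" for V using V(2) that unfolding refines_by_def by blast
 have zV: "zopen e V" if "V : \<V>" for V using V(1) that unfolding good_cover_def open_cover_def by blast
 show ?thesis
 proof (rule that[OF V(1)])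
  show "refines_by \<V> \<U> (%V. \<sigma> (rr V))" unfolding refines_by_def using ref \<sigma> by blast
  fix V assume v: "V : \<V>"
  have "zopen e (rr V)" using ref[OF v] by (simp add: \<W>_def)
  thus "Q (\<sigma> (rr V)) V" using her[of "\<sigma> (rr V)" "rr V" V] \<sigma>[of "rr V"] ref[OF v] zV[OF v] by blast
 qed
qed

text \<open>The Cech complex is formed from sums, negatives and restrictions; this is the structure
  that is established for the twists.\<close>

definition ab_presheaf :: "nat => ('k::field, 'm) msheaf => bool" where
 "ab_presheaf e F \<longleftrightarrow> (ALL U. zopen e U --> abelian_group (sect F U)) &
   (ALL U V s. zopen e U --> zopen e V --> V <= U --> s : carrier (sect F U) --> rest F U V s : carrier (sect F V)) &
   (ALL U V s t. zopen e U --> zopen e V --> V <= U --> s : carrier (sect F U) --> t : carrier (sect F U) -->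
    rest F U V (s \<oplus>\<^bsub>sect F U\<^esub> t) = rest F U V s \<oplus>\<^bsub>sect F V\<^esub> rest F U V t) &
   (ALL U V W s. zopen e U --> zopen e V --> zopen e W --> W <= V --> V <= U --> s : carrier (sect F U) -->
    rest F V W (rest F U V s) = rest F U W s)"

lemma ab_presheafD:
 assumes "ab_presheaf e F" "zopen e U"
 shows "abelian_group (sect F U)"
  and "!!V s. zopen e V ==> V <= U ==> s : carrier (sect F U) ==> rest F U V s : carrier (sect F V)"
  and "!!V s t. zopen e V ==> V <= U ==> s : carrier (sect F U) ==> t : carrier (sect F U) ==>
   rest F U V (s \<oplus>\<^bsub>sect F U\<^esub> t) = rest F U V s \<oplus>\<^bsub>sect F V\<^esub> rest F U V t"
  and "!!V W s. zopen e V ==> zopen e W ==> W <= V ==> V <= U ==> s : carrier (sect F U) ==>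
   rest F V W (rest F U V s) = rest F U W s"
 using assms unfolding ab_presheaf_def by blast+

lemma ab_presheaf_rest_zero:
 assumes ab: "ab_presheaf e F" and z: "zopen e U" "zopen e V" "V <= U"
 shows "rest F U V \<zero>\<^bsub>sect F U\<^esub> = \<zero>\<^bsub>sect F V\<^esub>"
proof -
 interpret U: abelian_group "sect F U" by (rule ab_presheafD(1)[OF ab z(1)])
 interpret V: abelian_group "sect F V" by (rule ab_presheafD(1)[OF ab z(2)])
 note r = ab_presheafD(2)[OF ab z] and ra = ab_presheafD(3)[OF ab z]
 have "rest F U V \<zero>\<^bsub>sect F U\<^esub> \<oplus>\<^bsub>sect F V\<^esub> rest F U V \<zero>\<^bsub>sect F U\<^esub> = rest F U V \<zero>\<^bsub>sect F U\<^esub>"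
  using ra[of "\<zero>\<^bsub>sect F U\<^esub>" "\<zero>\<^bsub>sect F U\<^esub>"] by simp
 thus ?thesis using r[OF U.zero_closed] by (metis V.add.r_cancel_one)
qed

lemma ab_presheaf_rest_neg:
 assumes ab: "ab_presheaf e F" and z: "zopen e U" "zopen e V" "V <= U" and s: "s : carrier (sect F U)"
 shows "rest F U V (\<ominus>\<^bsub>sect F U\<^esub> s) = \<ominus>\<^bsub>sect F V\<^esub> rest F U V s"
proof -
 interpret U: abelian_group "sect F U" by (rule ab_presheafD(1)[OF ab z(1)])
 interpret V: abelian_group "sect F V" by (rule ab_presheafD(1)[OF ab z(2)])
 note r = ab_presheafD(2)[OF ab z] and ra = ab_presheafD(3)[OF ab z]
 note z = ab_presheaf_rest_zero[OF ab z]
 have "rest F U V (\<ominus>\<^bsub>sect F U\<^esub> s) \<oplus>\<^bsub>sect F V\<^esub> rest F U V s = \<zero>\<^bsub>sect F V\<^esub>"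
  using ra[of "\<ominus>\<^bsub>sect F U\<^esub> s" s] s z by (simp add: U.l_neg)
 thus ?thesis using r[of s] r[of "\<ominus>\<^bsub>sect F U\<^esub> s"] s by (metis U.a_inv_closed V.minus_equality)
qed

lemma simplices_0: "xs : simplices 0 \<U> \<longleftrightarrow> (EX a:\<U>. xs = [a])"
 and simplices_1: "xs : simplices (Suc 0) \<U> \<longleftrightarrow> (EX a:\<U>. EX b:\<U>. xs = [a, b])"
 and simplices_2: "xs : simplices (Suc (Suc 0)) \<U> \<longleftrightarrow> (EX a:\<U>. EX b:\<U>. EX c:\<U>. xs = [a, b, c])"
 and simplices_3: "xs : simplices (Suc (Suc (Suc 0))) \<U> \<longleftrightarrow> (EX a:\<U>. EX b:\<U>. EX c:\<U>. EX d:\<U>. xs = [a, b, c, d])"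
 unfolding simplices_def by (auto simp: length_Suc_conv)

lemma zopen_Inter:
 "xs ~= [] ==> (!!U. U : set xs ==> zopen e U) ==> zopen e (\<Inter>(set xs)) & \<Union>(\<Inter>(set xs)) = (INT U:set xs. \<Union>U)"
proof (induction xs rule: list_nonempty_induct)
 case (cons U xs)
 thus ?case using zopen_Int[of e U "\<Inter>(set xs)"] zopen_Union_Int[of e U "\<Inter>(set xs)"] by simp
qed simp

lemma simplex_zopen:
 assumes "open_cover e \<U>" "xs : simplices q \<U>"
 shows "zopen e (\<Inter>(set xs))" "\<Union>(\<Inter>(set xs)) = (INT U:set xs. \<Union>U)"
proof -
 have "xs ~= []" "!!U. U : set xs ==> zopen e U"
  using assms open_cover_zopen[OF assms(1)] by (auto simp: simplices_def)
 from zopen_Inter[OF this] show "zopen e (\<Inter>(set xs))" "\<Union>(\<Inter>(set xs)) = (INT U:set xs. \<Union>U)" by blast+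
qed

lemma face: "map rr (face j xs) = face j (map rr xs)" "j < length xs ==> length (face j xs) = length xs - 1"
 "set (face j xs) <= set xs"
 by (auto simp: face_def take_map drop_map dest: in_set_takeD in_set_dropD)

lemma face_simplex:
 assumes "xs : simplices (Suc q) \<V>" "j < length xs"
 shows "face j xs : simplices q \<V>" "\<Inter>(set xs) <= \<Inter>(set (face j xs))"
 using face(2)[OF assms(2)] face(3)[of j xs] assms unfolding simplices_def by auto

lemma refinesD:
 assumes "refines_by \<V> \<U> rr" "V : \<V>" shows "rr V : \<U>" "V <= rr V"
 using assms unfolding refines_by_def by auto

lemma refines_simplex:
 assumes "refines_by \<V> \<U> rr" "xs : simplices q \<V>"
 shows "map rr xs : simplices q \<U>" "\<Inter>(set xs) <= \<Inter>(set (map rr xs))"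
 using refinesD[OF assms(1)] assms(2) by (fastforce simp: simplices_def)+

lemma refines_comp: "refines_by \<V> \<U> rr ==> refines_by \<W> \<V> rr' ==> refines_by \<W> \<U> (%x. rr (rr' x))"
 unfolding refines_by_def by blast

lemma coboundaries_cong:
 assumes "g : coboundaries F \<V> q" "!!xs. xs : simplices q \<V> ==> g' xs = g xs"
 shows "g' : coboundaries F \<V> q"
 using assms by (cases q) auto

context
 fixes e :: nat and F :: "('k::{alg_closed_field, field_char_0}, 'm) msheaf"
 assumes ab: "ab_presheaf e F"
begin

lemma rest_finsum:
 assumes z: "zopen e U" "zopen e V" "V <= U" and x: "!!j. j < n ==> x j : carrier (sect F U)"
 shows "rest F U V (finsum (sect F U) x {..<n}) = finsum (sect F V) (%j. rest F U V (x j)) {..<n::nat}"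
proof -
 interpret U: abelian_group "sect F U" by (rule ab_presheafD(1)[OF ab z(1)])
 interpret V: abelian_group "sect F V" by (rule ab_presheafD(1)[OF ab z(2)])
 show ?thesis using x
 proof (induction n)
 case 0 show ?case using ab_presheaf_rest_zero[OF ab z] by simp
 next
 case (Suc n)
 have "x : {..<n} \<rightarrow> carrier (sect F U)" using Suc(2) by auto
 moreover have "(%j. rest F U V (x j)) : {..<n} \<rightarrow> carrier (sect F V)" using Suc(2) ab_presheafD(2)[OF ab z] by auto
 ultimately show ?case
  using Suc ab_presheafD(2,3)[OF ab z] by (simp add: lessThan_Suc)
 qed
qed

context
 fixes \<U> \<V> :: "'k pointset set" and rr
 assumes U: "open_cover e \<U>" and V: "open_cover e \<V>" and r: "refines_by \<V> \<U> rr"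
begin

lemma pull_cochains:
 assumes c: "c : cochains F \<U> q" shows "pull F rr c : cochains F \<V> q"
proof -
 have "rest F (\<Inter>(set (map rr xs))) (\<Inter>(set xs)) (c (map rr xs)) : carrier (sect F (\<Inter>(set xs)))" if s: "xs : simplices q \<V>" for xs
  using c refines_simplex[OF r s] unfolding cochains_def
  by (intro ab_presheafD(2)[OF ab simplex_zopen(1)[OF U] simplex_zopen(1)[OF V s]]) blast+
 thus ?thesis unfolding cochains_def pull_def by blast
qed

lemma pull_cech_d:
 assumes c: "c : cochains F \<U> q" and s: "xs : simplices (Suc q) \<V>"
 shows "cech_d F (pull F rr c) xs = pull F rr (cech_d F c) xs"
proof -
 define T where "T = \<Inter>(set xs)"
 define R where "R = \<Inter>(set (map rr xs))"
 define S where "S j = \<Inter>(set (map rr (face j xs)))" for j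
 note rs = refines_simplex[OF r s]
 have z: "zopen e R" "zopen e T" "T <= R"
  unfolding T_def R_def using rs simplex_zopen(1)[OF U rs(1)] simplex_zopen(1)[OF V s] by auto
 interpret T: abelian_group "sect F T" by (rule ab_presheafD(1)[OF ab z(2)])
 interpret R: abelian_group "sect F R" by (rule ab_presheafD(1)[OF ab z(1)])
 define y where "y j = rest F (S j) R (c (map rr (face j xs)))" for j
 have y: "y j : carrier (sect F R)" "rest F R T (y j) = rest F (\<Inter>(set (face j xs))) T (pull F rr c (face j xs))"
  if j: "j < length xs" for j
 proof -
  note f = face_simplex[OF s j]
  note rf = refines_simplex[OF r f(1)]
  have zS: "zopen e (S j)" "R <= S j"
   unfolding S_def R_def using simplex_zopen(1)[OF U rf(1)] face(3)[of j xs] by auto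
  have cS: "c (map rr (face j xs)) : carrier (sect F (S j))" using c rf(1) by (auto simp: cochains_def S_def)
  show "y j : carrier (sect F R)" unfolding y_def by (rule ab_presheafD(2)[OF ab zS(1) z(1) zS(2) cS])
  have "rest F R T (y j) = rest F (S j) T (c (map rr (face j xs)))"
   unfolding y_def by (rule ab_presheafD(4)[OF ab zS(1) z zS(2) cS])
  also have "... = rest F (\<Inter>(set (face j xs))) T (pull F rr c (face j xs))"
   unfolding pull_def S_def[symmetric] T_def
   by (rule ab_presheafD(4)[OF ab zS(1) simplex_zopen(1)[OF V f(1)] z(2)[unfolded T_def] f(2) _ cS, symmetric]) (use rf(2) S_def in simp)
  finally show "rest F R T (y j) = rest F (\<Inter>(set (face j xs))) T (pull F rr c (face j xs))" .
 qed
 have E: "(%j. let x = rest F (\<Inter>(set (face j (map rr xs)))) R (c (face j (map rr xs)))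
   in if even j then x else \<ominus>\<^bsub>sect F R\<^esub> x) = (%j. if even j then y j else \<ominus>\<^bsub>sect F R\<^esub> y j)"
  by (simp add: fun_eq_iff y_def S_def face(1))
 have "pull F rr (cech_d F c) xs = rest F R T (finsum (sect F R) (%j. if even j then y j else \<ominus>\<^bsub>sect F R\<^esub> y j) {..<length xs})"
  unfolding pull_def cech_d_def R_def[symmetric] T_def[symmetric] length_map E ..
 also have "... = finsum (sect F T) (%j. rest F R T (if even j then y j else \<ominus>\<^bsub>sect F R\<^esub> y j)) {..<length xs}"
  by (rule rest_finsum[OF z]) (use y(1) in simp)
 also have "... = finsum (sect F T) (%j. let x = rest F (\<Inter>(set (face j xs))) T (pull F rr c (face j xs))
   in if even j then x else \<ominus>\<^bsub>sect F T\<^esub> x) {..<length xs}"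
 proof (rule T.finsum_cong'[OF refl])
  fix j assume "j : {..<length xs}"
  thus "rest F R T (if even j then y j else \<ominus>\<^bsub>sect F R\<^esub> y j) =
   (let x = rest F (\<Inter>(set (face j xs))) T (pull F rr c (face j xs)) in if even j then x else \<ominus>\<^bsub>sect F T\<^esub> x)"
   using y[of j] ab_presheaf_rest_neg[OF ab z, of "y j"] by simp
 qed (use y(1) ab_presheafD(2)[OF ab z] in \<open>auto simp: Let_def y(2)[symmetric]\<close>)
 finally show ?thesis unfolding cech_d_def T_def by simp
qed

lemma pull_cocycles:
 assumes c: "c : cocycles F \<U> q" shows "pull F rr c : cocycles F \<V> q"
proof -
 have cc: "c : cochains F \<U> q" using c by (simp add: cocycles_def)
 have "cech_d F (pull F rr c) xs = \<zero>\<^bsub>sect F (\<Inter>(set xs))\<^esub>" if s: "xs : simplices (Suc q) \<V>" for xs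
  using ab_presheaf_rest_zero[OF ab simplex_zopen(1)[OF U refines_simplex(1)[OF r s]] simplex_zopen(1)[OF V s] refines_simplex(2)[OF r s]]
   refines_simplex(1)[OF r s] c
  unfolding pull_cech_d[OF cc s] by (simp add: cocycles_def pull_def)
 thus ?thesis using pull_cochains[OF cc] by (simp add: cocycles_def)
qed

lemma pull_coboundaries:
 assumes g: "g : coboundaries F \<U> q" shows "pull F rr g : coboundaries F \<V> q"
proof (cases q)
 case 0
 have "pull F rr g xs = \<zero>\<^bsub>sect F (\<Inter>(set xs))\<^esub>" if s: "xs : simplices 0 \<V>" for xs
  using ab_presheaf_rest_zero[OF ab simplex_zopen(1)[OF U refines_simplex(1)[OF r s]] simplex_zopen(1)[OF V s] refines_simplex(2)[OF r s]]
   refines_simplex(1)[OF r s] g 0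
  by (simp add: pull_def)
 thus ?thesis by (simp add: 0)
next
 case (Suc q')
 then obtain b where b: "b : cochains F \<U> q'" "!!xs. xs : simplices (Suc q') \<U> ==> g xs = cech_d F b xs" using g by auto
 have "pull F rr g xs = cech_d F (pull F rr b) xs" if s: "xs : simplices (Suc q') \<V>" for xs
  unfolding pull_cech_d[OF b(1) s] by (simp add: pull_def b(2)[OF refines_simplex(1)[OF r s]])
 thus ?thesis using pull_cochains[OF b(1)] by (auto simp: Suc)
qed

lemma pull_pull:
 assumes W: "open_cover e \<W>" "refines_by \<W> \<V> rr'" and c: "c : cochains F \<U> q" and s: "xs : simplices q \<W>"
 shows "pull F (%x. rr (rr' x)) c xs = pull F rr' (pull F rr c) xs"
proof -
 note r' = refines_simplex[OF W(2) s]
 note r'' = refines_simplex[OF r r'(1)]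
 have "c (map rr (map rr' xs)) : carrier (sect F (\<Inter>(set (map rr (map rr' xs)))))" using c r''(1) unfolding cochains_def by blast
 from ab_presheafD(4)[OF ab simplex_zopen(1)[OF U r''(1)] simplex_zopen(1)[OF V r'(1)] simplex_zopen(1)[OF W(1) s] r'(2) r''(2) this]
 show ?thesis unfolding pull_def map_map comp_def by simp
qed

end

text \<open>A cocycle may first be pulled back to a good refinement, so good coverings suffice as a
  test.\<close>

theorem cohomology_zeroI:
 assumes "!!\<V> f d ci cj c. good_cover e \<V> f d ci cj ==> c : cocycles F \<V> q ==>
   EX \<W> rr. open_cover e \<W> & refines_by \<W> \<V> rr & pull F rr c : coboundaries F \<W> q"
 shows "cohomology_zero e q F"
 unfolding cohomology_zero_def
proof (intro allI impI ballI)
 fix \<U> :: "'k pointset set" and c assume U: "open_cover e \<U>" and c: "c : cocycles F \<U> q"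
 obtain \<V> rr f d ci cj where V: "good_cover e \<V> f d ci cj" "refines_by \<V> \<U> rr"
  by (rule basic_refinement[OF U])
 have oV: "open_cover e \<V>" using V(1) by (simp add: good_cover_def)
 obtain \<W> rr' where W: "open_cover e \<W>" "refines_by \<W> \<V> rr'" "pull F rr' (pull F rr c) : coboundaries F \<W> q"
  using assms[OF V(1) pull_cocycles[OF U oV V(2) c]] by blast
 have "c : cochains F \<U> q" using c by (simp add: cocycles_def)
 from coboundaries_cong[OF W(3) pull_pull[OF U oV V(2) W(1,2) this]] refines_comp[OF V(2) W(2)] W(1)
 show "EX \<V> rr. open_cover e \<V> & refines_by \<V> \<U> rr & pull F rr c : coboundaries F \<V> q" by blast
qed

corollary cohomology_zeroI':
 assumes "!!\<V> f d ci cj c. good_cover e \<V> f d ci cj ==> c : cocycles F \<V> q ==> c : coboundaries F \<V> q"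
 shows "cohomology_zero e q F"
proof (rule cohomology_zeroI)
 fix \<V> f d ci cj c assume V: "good_cover e \<V> f d ci cj" "c : cocycles F \<V> q"
 hence oV: "open_cover e \<V>" by (simp add: good_cover_def)
 have r: "refines_by \<V> \<V> (%x. x)" by (simp add: refines_by_def)
 show "EX \<W> rr. open_cover e \<W> & refines_by \<W> \<V> rr & pull F rr c : coboundaries F \<W> q"
  using pull_coboundaries[OF oV oV r assms[OF V]] oV r by blast
qed

text \<open>The refinement on which a class dies can be refined once more to a good one, since
  coboundaries pull back to coboundaries.\<close>

theorem cohomology_zeroE:
 assumes "cohomology_zero e q F" "open_cover e \<U>" "c : cocycles F \<U> q"
 obtains \<V> rr f d ci cj where "good_cover e \<V> f d ci cj" "refines_by \<V> \<U> rr" "pull F rr c : coboundaries F \<V> q"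
proof -
 obtain \<W> rr where W: "open_cover e \<W>" "refines_by \<W> \<U> rr" "pull F rr c : coboundaries F \<W> q"
  using assms unfolding cohomology_zero_def by blast
 obtain \<V> rr' f d ci cj where V: "good_cover e \<V> f d ci cj" "refines_by \<V> \<W> rr'"
  by (rule basic_refinement[OF W(1)])
 have oV: "open_cover e \<V>" using V(1) by (simp add: good_cover_def)
 have "c : cochains F \<U> q" using assms(3) by (simp add: cocycles_def)
 from coboundaries_cong[OF pull_coboundaries[OF W(1) oV V(2) W(3)] pull_pull[OF assms(2) W(1,2) oV V(2) this]]
 show ?thesis by (rule that[OF V(1) refines_comp[OF W(2) V(2)]])
qed

end

text \<open>The additive presheaves below are presented by vectors of functions: rep U s v says that the
 section s over U is presented by v.\<close>

locale rep_sheaf =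
 fixes e :: nat and F :: "('k::{alg_closed_field, field_char_0}, 'm) msheaf" and n :: nat and bd :: "nat => divclass"
  and rep :: "'k pointset => 'm => (nat => 'k cox => 'k) => bool"
 assumes ab: "ab_presheaf e F"
  and rep_carrier: "!!U s v. zopen e U ==> rep U s v ==> s : carrier (sect F U)"
  and rep_reg: "!!U s v k. zopen e U ==> rep U s v ==> k < n ==> reg e (bd k) (\<Union>U) (v k)"
  and rep_add: "!!U s t v w. zopen e U ==> rep U s v ==> rep U t w ==>
    rep U (s \<oplus>\<^bsub>sect F U\<^esub> t) (%k p. v k p + w k p)"
  and rep_neg: "!!U s v. zopen e U ==> rep U s v ==> rep U (\<ominus>\<^bsub>sect F U\<^esub> s) (%k p. - v k p)"
  and rep_rest: "!!U V s v. zopen e U ==> zopen e V ==> V <= U ==> rep U s v ==> rep V (rest F U V s) v"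
begin

lemma rep_zero: "zopen e U ==> rep U s v ==> rep U \<zero>\<^bsub>sect F U\<^esub> (%k p. 0)"
proof -
 assume U: "zopen e U" and r: "rep U s v"
 interpret G: abelian_group "sect F U" by (rule ab_presheafD(1)[OF ab U])
 have "s \<oplus>\<^bsub>sect F U\<^esub> \<ominus>\<^bsub>sect F U\<^esub> s = \<zero>\<^bsub>sect F U\<^esub>" by (rule G.r_neg[OF rep_carrier[OF U r]])
 thus ?thesis using rep_add[OF U r rep_neg[OF U r]] by simp
qed

lemma rep_rest2:
 assumes "zopen e U" "zopen e W" "zopen e N" "N <= W" "W <= U" "s : carrier (sect F U)" "rep W (rest F U W s) w"
 shows "rep N (rest F U N s) w"
 using rep_rest[OF assms(2-4,7)] ab_presheafD(4)[OF ab assms(1-6)] by simp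

text \<open>Turns the differential of sections into an alternating sum of functions, after which
  cochains are computed with pointwise in k.\<close>

lemma rep_cech_d:
 assumes V: "open_cover e \<V>" and s: "xs : simplices (Suc q) \<V>"
  and r: "!!\<tau>. \<tau> : simplices q \<V> ==> rep (\<Inter>(set \<tau>)) (c \<tau>) (v \<tau>)"
 shows "rep (\<Inter>(set xs)) (cech_d F c xs) (%k p. SUM j<length xs. (-1) ^ j * v (face j xs) k p)"
proof -
 define T where "T = \<Inter>(set xs)"
 have zT: "zopen e T" unfolding T_def by (rule simplex_zopen(1)[OF V s])
 interpret T: abelian_group "sect F T" by (rule ab_presheafD(1)[OF ab zT])
 define x where "x j = rest F (\<Inter>(set (face j xs))) T (c (face j xs))" for j
 define y where "y j = (if even j then x j else \<ominus>\<^bsub>sect F T\<^esub> x j)" for j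
 have x: "rep T (x j) (v (face j xs))" if j: "j < length xs" for j
  unfolding x_def T_def using face_simplex[OF s j]
  by (intro rep_rest[OF _ simplex_zopen(1)[OF V s]] r simplex_zopen(1)[OF V])
 have y: "rep T (y j) (%k p. (-1) ^ j * v (face j xs) k p)" if "j < length xs" for j
  using x[OF that] rep_neg[OF zT x[OF that]] by (simp add: y_def)
 have yc: "y j : carrier (sect F T)" if "j < length xs" for j by (rule rep_carrier[OF zT y[OF that]])
 have "m <= length xs ==> rep T (finsum (sect F T) y {..<m}) (%k p. SUM j<m. (-1) ^ j * v (face j xs) k p)" for m
 proof (induction m)
  case 0
  have "0 < length xs" using s by (simp add: simplices_def)
  from rep_zero[OF zT x[OF this]] show ?case by simp
 next
  case (Suc m)
  hence "y : {..<m} \<rightarrow> carrier (sect F T)" using yc by auto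
  hence "finsum (sect F T) y {..<Suc m} = y m \<oplus>\<^bsub>sect F T\<^esub> finsum (sect F T) y {..<m}"
   using yc[of m] Suc(2) by (simp add: lessThan_Suc)
  with rep_add[OF zT y[of m] Suc(1)] Suc(2) show ?case by (simp add: add.commute)
 qed
 moreover have "(%j. let x = rest F (\<Inter>(set (face j xs))) T (c (face j xs)) in if even j then x else \<ominus>\<^bsub>sect F T\<^esub> x) = y"
  by (simp add: fun_eq_iff y_def x_def)
 ultimately show ?thesis unfolding cech_d_def T_def[symmetric] by simp
qed

lemma rep_cocycle:
 assumes V: "open_cover e \<V>" and c: "c : cocycles F \<V> q" and s: "xs : simplices (Suc q) \<V>"
  and r: "!!\<tau>. \<tau> : simplices q \<V> ==> rep (\<Inter>(set \<tau>)) (c \<tau>) (v \<tau>)"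
 shows "rep (\<Inter>(set xs)) \<zero>\<^bsub>sect F (\<Inter>(set xs))\<^esub> (%k p. SUM j<length xs. (-1) ^ j * v (face j xs) k p)"
 using rep_cech_d[OF V s r] c s by (simp add: cocycles_def)

end

text \<open>A vector determines the section it presents, while a section may have several vectors.
  This is the common ground of kernels and cokernels.\<close>

locale det_sheaf = rep_sheaf e F n bd rep
 for e :: nat and F :: "('k::{alg_closed_field, field_char_0}, 'm) msheaf" and n bd rep +
 assumes rep_eq: "!!U s t v w. zopen e U ==> rep U s v ==> rep U t w ==>
    (!!k p. k < n ==> p : \<Union>U ==> v k p = w k p) ==> s = t"
begin

lemma rep_coboundary:
 assumes V: "open_cover e \<V>" and c: "!!xs. xs : simplices (Suc q) \<V> ==> rep (\<Inter>(set xs)) (c xs) (v xs)"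
  and b: "!!\<tau>. \<tau> : simplices q \<V> ==> EX s. rep (\<Inter>(set \<tau>)) s (w \<tau>)"
  and eq: "!!xs k p. xs : simplices (Suc q) \<V> ==> k < n ==> p : \<Union>(\<Inter>(set xs)) ==>
   v xs k p = (SUM j<length xs. (-1) ^ j * w (face j xs) k p)"
 shows "c : coboundaries F \<V> (Suc q)"
proof -
 have "EX b. ALL \<tau>:simplices q \<V>. rep (\<Inter>(set \<tau>)) (b \<tau>) (w \<tau>)" using b by (intro bchoice) blast
 then obtain b where b: "!!\<tau>. \<tau> : simplices q \<V> ==> rep (\<Inter>(set \<tau>)) (b \<tau>) (w \<tau>)" by blast
 have "c xs = cech_d F b xs" if s: "xs : simplices (Suc q) \<V>" for xs
  by (rule rep_eq[OF simplex_zopen(1)[OF V s] c[OF s] rep_cech_d[OF V s b]]) (assumption | rule eq[OF s])+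
 moreover have "b : cochains F \<V> q"
  using rep_carrier[OF simplex_zopen(1)[OF V] b] by (simp add: cochains_def)
 ultimately show ?thesis by auto
qed

end

lemma good_coverD:
 assumes "good_cover e \<V> f d ci cj" "V : \<V>"
 shows "zopen e V" "basic_cover.A f V = \<Union>V"
 using assms basic_cover.A_def[of e \<V> f d ci cj] unfolding good_cover_def open_cover_def by auto

lemma good_cover_open: "good_cover e \<V> f d ci cj ==> open_cover e \<V>"
 by (simp add: good_cover_def)

lemma good_cover_basic: "good_cover e \<V> f d ci cj ==> basic_cover e \<V> f d ci cj"
 by (simp add: good_cover_def)

lemma good_cover_Union:
 assumes V: "good_cover e \<V> f d ci cj" and s: "xs : simplices q \<V>"
 shows "\<Union>(\<Inter>(set xs)) = (INT x:set xs. basic_cover.A f x)"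
proof -
 have "set xs <= \<V>" using s by (simp add: simplices_def)
 thus ?thesis unfolding simplex_zopen(2)[OF good_cover_open[OF V] s]
  using good_coverD(2)[OF V] by (intro INF_cong refl) auto
qed

lemma form_comb_reg:
 assumes "opn e A" "!!k. k < n ==> cox_form e (D - bd k) (G k)" "!!k. k < n ==> reg e (bd k) A (v k)"
 shows "reg e D A (%p. SUM k<n. G k p * v k p)"
proof (rule reg_sum[OF assms(1)])
 fix k assume k: "k : {..<n}"
 have "reg e (D - bd k + bd k) A (%p. G k p * v k p)"
  using k by (intro reg_mult reg_form[OF assms(2) assms(1)] assms(3)) auto
 thus "reg e D A (%p. G k p * v k p)" by simp
qed

context basic_cover begin

lemma glue0:
 assumes m: "!!i. i : I ==> reg e D (A i) (m i)"
  and eq: "!!i j p. [|i : I; j : I; p : A i; p : A j|] ==> m i p = m j p"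
 obtains g where "reg e D cone g" "!!i p. i : I ==> p : A i ==> g p = m i p"
proof -
 have Ac: "A i Int cone = A i" for i using A_cone by blast
 obtain g where "reg e D cone g" "ALL i:I. ALL p:A i Int cone. g p = m i p"
  using glue[OF opn_cone', of D m] m eq unfolding Ac by blast
 thus ?thesis using that Ac by blast
qed

lemma H1_zero_tuple:
 assumes no: "!!k. k < n ==> noH1 e (D k)"
  and c: "!!i j k. i : I ==> j : I ==> k < n ==> reg e (D k) (A i Int A j) (c i j k)"
  and coc: "!!i j l k p. [|i : I; j : I; l : I; k < n; p : A i; p : A j; p : A l|] ==>
    c j l k p - c i l k p + c i j k p = 0"
 obtains b where "!!j k. j : I ==> k < n ==> reg e (D k) (A j) (b j k)"
   "!!i j k p. i : I ==> j : I ==> k < n ==> p : A i ==> p : A j ==> c i j k p = b j k p - b i k p"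
proof -
 define P where "P k b \<longleftrightarrow> (ALL j:I. reg e (D k) (A j) (b j)) &
   (ALL i:I. ALL j:I. ALL p:A i Int A j. c i j k p = b j p - b i p)" for k b
 have "EX b. P k b" if "k < n" for k
  unfolding P_def by (rule H1_zero[OF no[OF that], of "%i j. c i j k"]) (use c coc that in auto)
 hence P: "P k (SOME b. P k b)" if "k < n" for k using that by (intro someI_ex[of "P k"]) blast
 show ?thesis
  by (rule that[of "%j k. (SOME b. P k b) j"]) (use P in \<open>unfold P_def; blast\<close>)+
qed

lemma H2_zero_tuple:
 assumes no: "!!k m. k < n ==> ~ negexp e (D k) m"
  and c: "!!i j l k. i : I ==> j : I ==> l : I ==> k < n ==> reg e (D k) (A i Int A j Int A l) (c i j l k)"
  and coc: "!!i j l h k p. [|i : I; j : I; l : I; h : I; k < n; p : A i; p : A j; p : A l; p : A h|] ==>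
    c j l h k p - c i l h k p + c i j h k p - c i j l k p = 0"
 obtains b where "!!i j k. i : I ==> j : I ==> k < n ==> reg e (D k) (A i Int A j) (b i j k)"
   "!!i j l k p. i : I ==> j : I ==> l : I ==> k < n ==> p : A i ==> p : A j ==> p : A l ==>
    c i j l k p = b j l k p - b i l k p + b i j k p"
proof -
 define P where "P k b \<longleftrightarrow> (ALL i:I. ALL j:I. reg e (D k) (A i Int A j) (b i j)) &
   (ALL i:I. ALL j:I. ALL l:I. ALL p:A i Int A j Int A l. c i j l k p = b j l p - b i l p + b i j p)" for k b
 have "EX b. P k b" if "k < n" for k
  unfolding P_def by (rule H2_zero[OF no[OF that], of "%i j l. c i j l k"]) (use c coc that in auto)
 hence P: "P k (SOME b. P k b)" if "k < n" for k using that by (intro someI_ex[of "P k"]) blast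
 show ?thesis
  by (rule that[of "%i j k. (SOME b. P k b) i j"]) (use P in \<open>unfold P_def; blast\<close>)+
qed

end

section \<open>Cohomology of kernels\<close>

text \<open>Presentations are unique, and the vectors that occur are exactly those annihilated by M,
  so cochains of F are cochains of the split bundle in the kernel of M.\<close>

locale kernel_sheaf = det_sheaf e F n bd rep
 for e :: nat and F :: "('k::{alg_closed_field, field_char_0}, 'm) msheaf" and n bd rep +
 fixes m :: nat and cd :: "nat => divclass" and M :: "nat => nat => 'k cox => 'k"
 assumes M_form: "!!l k. l < m ==> k < n ==> cox_form e (cd l - bd k) (M l k)"
  and rep_ex: "!!U s. zopen e U ==> s : carrier (sect F U) ==> EX v. rep U s v"
  and rep_uniq: "!!U s v w k p. zopen e U ==> rep U s v ==> rep U s w ==> k < n ==> p : \<Union>U ==> v k p = w k p"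
  and rep_ker: "!!U s v l p. zopen e U ==> rep U s v ==> l < m ==> p : \<Union>U ==> (SUM k<n. M l k p * v k p) = 0"
  and rep_surj: "!!U v. zopen e U ==> (!!k. k < n ==> reg e (bd k) (\<Union>U) (v k)) ==>
    (!!l p. l < m ==> p : \<Union>U ==> (SUM k<n. M l k p * v k p) = 0) ==> EX s. rep U s v"
begin

lemma Mv_reg:
 assumes "opn e A" "!!k. k < n ==> reg e (bd k) A (v k)" "l < m"
 shows "reg e (cd l) A (%p. SUM k<n. M l k p * v k p)"
 by (rule form_comb_reg[OF assms(1) M_form[OF assms(3)] assms(2)])

lemma Mv_diff: "(SUM k<n. M l k p * (v k p - w k p)) = (SUM k<n. M l k p * v k p) - (SUM k<n. M l k p * w k p)"
 by (simp add: right_diff_distrib sum_subtractf)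

text \<open>A global vector in the kernel is a 0-cocycle for the covering by the whole surface. It
  dies on some refinement, and restriction of presentations then forces w to vanish near every
  point.\<close>

theorem H0_zeroE:
 assumes c: "cohomology_zero e 0 F" and w: "!!k. k < n ==> reg e (bd k) cone (w k)"
  and ker: "!!l p. l < m ==> p : cone ==> (SUM k<n. M l k p * w k p) = 0"
  and k: "k < n" and p: "p : cone"
 shows "w k p = 0"
proof -
 define X :: "'k pointset" where "X = hirzebruch e"
 have zX: "zopen e X" unfolding X_def by (rule zopen_hirzebruch)
 hence oX: "open_cover e {X}" by (simp add: open_cover_def X_def)
 obtain s where s: "rep X s w"
  using rep_surj[OF zX, of w] w ker by (auto simp: Union_hirz X_def)
 have r: "rep (\<Inter>(set \<tau>)) s w" if "\<tau> : simplices 0 {X}" for \<tau> using that s by (auto simp: simplices_0)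
 have "cech_d F (%_. s) xs = \<zero>\<^bsub>sect F (\<Inter>(set xs))\<^esub>" if x: "xs : simplices (Suc 0) {X}" for xs
  using x by (intro rep_eq[OF simplex_zopen(1)[OF oX x] rep_cech_d[OF oX x r] rep_zero[OF _ rep_cech_d[OF oX x r]]])
   (auto simp: simplices_1 zX)
 hence "(%_. s) : cocycles F {X} 0"
  using rep_carrier[OF zX s] by (auto simp: cocycles_def cochains_def simplices_0)
 then obtain \<V> rr f d ci cj where V: "good_cover e \<V> f d ci cj" "refines_by \<V> {X} rr" "pull F rr (%_. s) : coboundaries F \<V> 0"
  by (rule cohomology_zeroE[OF ab c oX])
 obtain a where a: "a : \<V>" "p : \<Union>a" using open_cover_pt[OF good_cover_open[OF V(1)] p] by blast
 note za = good_coverD(1)[OF V(1) a(1)]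
 have "[a] : simplices 0 \<V>" using a by (simp add: simplices_0)
 hence "pull F rr (%_. s) [a] = \<zero>\<^bsub>sect F (\<Inter>(set [a]))\<^esub>" using V(3) unfolding coboundaries.simps by blast
 hence "rest F X a s = \<zero>\<^bsub>sect F a\<^esub>" using refinesD[OF V(2) a(1)] by (simp add: pull_def)
 moreover have "a <= X" unfolding X_def by (rule zopen_hirz[OF za])
 ultimately have "rep a \<zero>\<^bsub>sect F a\<^esub> w" using rep_rest[OF zX za _ s] by simp
 from rep_uniq[OF za this rep_zero[OF za this] k a(2)] show ?thesis .
qed

lemma cocycle_rep:
 assumes V: "good_cover e \<V> f d ci cj" and c: "c : cocycles F \<V> q"
 obtains v where "!!xs. xs : simplices q \<V> ==> rep (\<Inter>(set xs)) (c xs) (v xs)"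
  "!!xs k. xs : simplices q \<V> ==> k < n ==> reg e (bd k) (INT x:set xs. basic_cover.A f x) (v xs k)"
  "!!xs l p. xs : simplices q \<V> ==> l < m ==> p : (INT x:set xs. basic_cover.A f x) ==> (SUM k<n. M l k p * v xs k p) = 0"
  "!!xs k p. xs : simplices (Suc q) \<V> ==> k < n ==> p : (INT x:set xs. basic_cover.A f x) ==>
    (SUM j<length xs. (-1) ^ j * v (face j xs) k p) = 0"
proof -
 note oV = good_cover_open[OF V]
 note z = simplex_zopen(1)[OF oV]
 have "c xs : carrier (sect F (\<Inter>(set xs)))" if "xs : simplices q \<V>" for xs
  using c that by (simp add: cocycles_def cochains_def)
 hence "EX v. ALL xs:simplices q \<V>. rep (\<Inter>(set xs)) (c xs) (v xs)" using rep_ex[OF z] by (intro bchoice) blast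
 then obtain v where v0: "ALL xs:simplices q \<V>. rep (\<Inter>(set xs)) (c xs) (v xs)" ..
 hence v: "rep (\<Inter>(set xs)) (c xs) (v xs)" if "xs : simplices q \<V>" for xs using that by blast
 show ?thesis
 proof (rule that[OF v])
  fix xs k p assume s: "xs : simplices (Suc q) \<V>" and k: "k < n" and p: "p : (INT x:set xs. basic_cover.A f x)"
  note R = rep_cocycle[OF oV c s v]
  from rep_uniq[OF z[OF s] R rep_zero[OF z[OF s] R] k] p
  show "(SUM j<length xs. (-1) ^ j * v (face j xs) k p) = 0" unfolding good_cover_Union[OF V s] by blast
 qed (use rep_reg[OF z v] rep_ker[OF z v] good_cover_Union[OF V] in auto)
qed

text \<open>The connecting map by hand: v = d\<beta> in the split bundle; M \<beta> does not depend
  on the member and glues to a global g, which is M w by \<open>surj\<close>; then \<beta> - w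
  presents a cochain of the kernel with coboundary v.\<close>

theorem H1_zeroI:
 assumes no: "!!k. k < n ==> noH1 e (bd k)"
  and surj: "!!g. (!!l. l < m ==> reg e (cd l) cone (g l)) ==>
    EX w. (ALL k<n. reg e (bd k) cone (w k)) & (ALL l<m. ALL p:cone. g l p = (SUM k<n. M l k p * w k p))"
 shows "cohomology_zero e (Suc 0) F"
proof (rule cohomology_zeroI'[OF ab])
 fix \<V> f d ci cj c assume V: "good_cover e \<V> f d ci cj" and c: "c : cocycles F \<V> (Suc 0)"
 interpret B: basic_cover e \<V> f d ci cj by (rule good_cover_basic[OF V])
 note zV = good_coverD(1)[OF V] and A = good_coverD(2)[OF V]
 obtain v where v: "!!xs. xs : simplices (Suc 0) \<V> ==> rep (\<Inter>(set xs)) (c xs) (v xs)"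
  "!!xs k. xs : simplices (Suc 0) \<V> ==> k < n ==> reg e (bd k) (INT x:set xs. B.A x) (v xs k)"
  "!!xs l p. xs : simplices (Suc 0) \<V> ==> l < m ==> p : (INT x:set xs. B.A x) ==> (SUM k<n. M l k p * v xs k p) = 0"
  "!!xs k p. xs : simplices (Suc (Suc 0)) \<V> ==> k < n ==> p : (INT x:set xs. B.A x) ==>
    (SUM j<length xs. (-1) ^ j * v (face j xs) k p) = 0"
  by (rule cocycle_rep[OF V c]) (rule that, assumption+)
 obtain \<beta> where \<beta>: "!!j k. j : \<V> ==> k < n ==> reg e (bd k) (B.A j) (\<beta> j k)"
   "!!i j k p. i : \<V> ==> j : \<V> ==> k < n ==> p : B.A i ==> p : B.A j ==> v [i, j] k p = \<beta> j k p - \<beta> i k p"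
 proof (rule B.H1_zero_tuple[where c = "%i j. v [i, j]" and D = bd and n = n, OF no])
  show "reg e (bd k) (B.A i Int B.A j) (v [i, j] k)" if "i : \<V>" "j : \<V>" "k < n" for i j k
   using v(2)[of "[i, j]" k] that by (simp add: simplices_1)
  show "v [j, l] k p - v [i, l] k p + v [i, j] k p = 0"
   if "i : \<V>" "j : \<V>" "l : \<V>" "k < n" "p : B.A i" "p : B.A j" "p : B.A l" for i j l k p
   using v(4)[of "[i, j, l]" k p] that by (simp add: simplices_2 face_def)
 qed (assumption | rule that)+
 have "EX g. reg e (cd l) cone g & (ALL i:\<V>. ALL p:B.A i. g p = (SUM k<n. M l k p * \<beta> i k p))" if l: "l < m" for l
 proof (rule B.glue0[where m = "%i p. SUM k<n. M l k p * \<beta> i k p" and D = "cd l"])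
  show "reg e (cd l) (B.A i) (%p. SUM k<n. M l k p * \<beta> i k p)" if "i : \<V>" for i
   by (intro Mv_reg B.opn_A that \<beta>(1) l)
  show "(SUM k<n. M l k p * \<beta> i k p) = (SUM k<n. M l k p * \<beta> j k p)"
   if ij: "i : \<V>" "j : \<V>" "p : B.A i" "p : B.A j" for i j p
  proof -
   have "(SUM k<n. M l k p * v [i, j] k p) = (SUM k<n. M l k p * (\<beta> j k p - \<beta> i k p))"
    using \<beta>(2)[OF ij(1,2) _ ij(3,4)] by (intro sum.cong refl) simp
   thus ?thesis using v(3)[of "[i, j]" l p] l ij unfolding Mv_diff by (simp add: simplices_1)
  qed
 qed blast
 hence "EX g. ALL l:{..<m}. reg e (cd l) cone (g l) & (ALL i:\<V>. ALL p:B.A i. g l p = (SUM k<n. M l k p * \<beta> i k p))"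
  by (intro bchoice) simp
 then obtain g where "ALL l:{..<m}. reg e (cd l) cone (g l) & (ALL i:\<V>. ALL p:B.A i. g l p = (SUM k<n. M l k p * \<beta> i k p))" ..
 hence g: "!!l. l < m ==> reg e (cd l) cone (g l)"
  "!!l i p. l < m ==> i : \<V> ==> p : B.A i ==> g l p = (SUM k<n. M l k p * \<beta> i k p)" by blast+
 obtain w where w: "ALL k<n. reg e (bd k) cone (w k)" "ALL l<m. ALL p:cone. g l p = (SUM k<n. M l k p * w k p)"
  using surj[OF g(1)] by blast
 have "EX s. rep a s (%k p. \<beta> a k p - w k p)" if a: "a : \<V>" for a
 proof (rule rep_surj[OF zV[OF a]])
  fix k assume k: "k < n"
  have "reg e (bd k) (B.A a) (w k)" by (rule reg_subset[OF w(1)[rule_format, OF k] B.opn_A[OF a] B.A_cone])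
  thus "reg e (bd k) (\<Union>a) (%p. \<beta> a k p - w k p)"
   using \<beta>(1)[OF a k] unfolding A[OF a, symmetric] by (intro reg_diff)
 next
  fix l p assume l: "l < m" and "p : \<Union>a"
  hence p: "p : B.A a" by (simp only: A[OF a])
  hence "g l p = (SUM k<n. M l k p * w k p)" using w(2) l B.A_cone by blast
  thus "(SUM k<n. M l k p * (\<beta> a k p - w k p)) = 0"
   unfolding Mv_diff using g(2)[OF l a p] by simp
 qed
 note ex = this
 show "c : coboundaries F \<V> (Suc 0)"
 proof (rule rep_coboundary[OF good_cover_open[OF V] v(1), where w = "%\<tau> k p. \<beta> (hd \<tau>) k p - w k p"])
  fix xs k p assume s: "xs : simplices (Suc 0) \<V>" and k: "k < n" and p: "p : \<Union>(\<Inter>(set xs))"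
  then obtain x y where "xs = [x, y]" "x : \<V>" "y : \<V>" by (auto simp: simplices_1)
  thus "v xs k p = (SUM j<length xs. (-1) ^ j * (\<beta> (hd (face j xs)) k p - w k p))"
   using p \<beta>(2)[of x y k p] k unfolding good_cover_Union[OF V s] by (simp add: face_def)
 qed (use ex in \<open>auto simp: simplices_0\<close>)
qed

text \<open>Two steps along the exact sequence: v = d\<beta>, and M \<beta> is a 1-cocycle of the
  target, hence d\<eta>. Lifts w of \<eta> exist after refining the covering; there \<beta> - dw is
  annihilated by M and still has coboundary v.\<close>

theorem H2_zeroI:
 assumes noB: "!!k x. k < n ==> ~ negexp e (bd k) x" and noC: "!!l. l < m ==> noH1 e (cd l)"
  and lift: "!!U p g. zopen e U ==> p : \<Union>U ==> (!!l. l < m ==> reg e (cd l) (\<Union>U) (g l)) ==>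
    EX W w. zopen e W & p : \<Union>W & W <= U & (ALL k<n. reg e (bd k) (\<Union>W) (w k)) &
     (ALL l<m. ALL q:\<Union>W. g l q = (SUM k<n. M l k q * w k q))"
 shows "cohomology_zero e (Suc (Suc 0)) F"
proof (rule cohomology_zeroI[OF ab])
 fix \<V> f d ci cj c assume V: "good_cover e \<V> f d ci cj" and c: "c : cocycles F \<V> (Suc (Suc 0))"
 interpret B: basic_cover e \<V> f d ci cj by (rule good_cover_basic[OF V])
 note zV = good_coverD(1)[OF V] and A = good_coverD(2)[OF V]
 obtain v where v: "!!xs. xs : simplices (Suc (Suc 0)) \<V> ==> rep (\<Inter>(set xs)) (c xs) (v xs)"
  "!!xs k. xs : simplices (Suc (Suc 0)) \<V> ==> k < n ==> reg e (bd k) (INT x:set xs. B.A x) (v xs k)"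
  "!!xs l p. xs : simplices (Suc (Suc 0)) \<V> ==> l < m ==> p : (INT x:set xs. B.A x) ==> (SUM k<n. M l k p * v xs k p) = 0"
  "!!xs k p. xs : simplices (Suc (Suc (Suc 0))) \<V> ==> k < n ==> p : (INT x:set xs. B.A x) ==>
    (SUM j<length xs. (-1) ^ j * v (face j xs) k p) = 0"
  by (rule cocycle_rep[OF V c]) (rule that, assumption+)
 obtain \<beta> where \<beta>: "!!i j k. i : \<V> ==> j : \<V> ==> k < n ==> reg e (bd k) (B.A i Int B.A j) (\<beta> i j k)"
   "!!i j l k p. i : \<V> ==> j : \<V> ==> l : \<V> ==> k < n ==> p : B.A i ==> p : B.A j ==> p : B.A l ==>
    v [i, j, l] k p = \<beta> j l k p - \<beta> i l k p + \<beta> i j k p"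
 proof (rule B.H2_zero_tuple[where c = "%i j l. v [i, j, l]" and D = bd and n = n, OF noB])
  show "reg e (bd k) (B.A i Int B.A j Int B.A l) (v [i, j, l] k)" if "i : \<V>" "j : \<V>" "l : \<V>" "k < n" for i j l k
   using v(2)[of "[i, j, l]" k] that by (simp add: simplices_2 Int_assoc)
  show "v [j, l, h] k p - v [i, l, h] k p + v [i, j, h] k p - v [i, j, l] k p = 0"
   if "i : \<V>" "j : \<V>" "l : \<V>" "h : \<V>" "k < n" "p : B.A i" "p : B.A j" "p : B.A l" "p : B.A h" for i j l h k p
   using v(4)[of "[i, j, l, h]" k p] that by (simp add: simplices_3 face_def)
 qed (assumption | rule that)+
 have regM: "reg e (cd l) (B.A i Int B.A j) (%p. SUM k<n. M l k p * \<beta> i j k p)" if "i : \<V>" "j : \<V>" "l < m" for i j l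
  by (intro Mv_reg opn_Int B.opn_A that \<beta>(1))
 have cocM: "(SUM k<n. M h k p * \<beta> j l k p) - (SUM k<n. M h k p * \<beta> i l k p) + (SUM k<n. M h k p * \<beta> i j k p) = 0"
  if a: "i : \<V>" "j : \<V>" "l : \<V>" "h < m" "p : B.A i" "p : B.A j" "p : B.A l" for i j l h p
 proof -
  have "(SUM k<n. M h k p * v [i, j, l] k p) = (SUM k<n. M h k p * (\<beta> j l k p - \<beta> i l k p + \<beta> i j k p))"
   using \<beta>(2)[OF a(1,2,3) _ a(5-7)] by (intro sum.cong refl) simp
  thus ?thesis using v(3)[of "[i, j, l]" h p] a by (simp add: simplices_2 ring_distribs sum.distrib sum_subtractf)
 qed
 obtain \<eta> where \<eta>: "!!j l. j : \<V> ==> l < m ==> reg e (cd l) (B.A j) (\<eta> j l)"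
   "!!i j l p. i : \<V> ==> j : \<V> ==> l < m ==> p : B.A i ==> p : B.A j ==>
    (SUM k<n. M l k p * \<beta> i j k p) = \<eta> j l p - \<eta> i l p"
  by (rule B.H1_zero_tuple[where c = "%i j l p. SUM k<n. M l k p * \<beta> i j k p" and D = cd and n = m, OF noC regM cocM])
    (assumption | rule that)+
 define Q where "Q a W \<longleftrightarrow> (EX w. (ALL k<n. reg e (bd k) (\<Union>W) (w k)) & (ALL l<m. ALL q:\<Union>W. \<eta> a l q = (SUM k<n. M l k q * w k q)))"
  for a W
 obtain \<W> rr' f' d' ci' cj' where W: "good_cover e \<W> f' d' ci' cj'" "refines_by \<W> \<V> rr'" "!!a. a : \<W> ==> Q (rr' a) a"
 proof (rule property_refinement[OF good_cover_open[OF V], of Q])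
  fix a p assume a: "a : \<V>" "p : \<Union>a"
  have "!!l. l < m ==> reg e (cd l) (\<Union>a) (\<eta> a l)" using \<eta>(1)[OF a(1)] A[OF a(1)] by simp
  from lift[OF zV[OF a(1)] a(2) this] show "EX W. zopen e W & p : \<Union>W & W <= a & Q a W"
   unfolding Q_def by blast
 next
  fix a W W' assume "a : \<V>" "zopen e W" "W <= a" "Q a W" "zopen e W'" "W' <= W"
  moreover then obtain w where w: "ALL k<n. reg e (bd k) (\<Union>W) (w k)" "ALL l<m. ALL q:\<Union>W. \<eta> a l q = (SUM k<n. M l k q * w k q)"
   unfolding Q_def by blast
  moreover have "\<Union>W' <= \<Union>W" using calculation by blast
  ultimately show "Q a W'" unfolding Q_def by (intro exI[of _ w]) (meson reg_Int subsetD)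
 qed (rule that, assumption+)
 note zW = good_coverD(1)[OF W(1)] and r' = refinesD[OF W(2)]
 have "EX w. ALL a:\<W>. (ALL k<n. reg e (bd k) (\<Union>a) (w a k)) & (ALL l<m. ALL q:\<Union>a. \<eta> (rr' a) l q = (SUM k<n. M l k q * w a k q))"
  using W(3) unfolding Q_def by (intro bchoice) blast
 then obtain w where w0: "ALL a:\<W>. (ALL k<n. reg e (bd k) (\<Union>a) (w a k)) &
   (ALL l<m. ALL q:\<Union>a. \<eta> (rr' a) l q = (SUM k<n. M l k q * w a k q))" ..
 have w: "reg e (bd k) (\<Union>a) (w a k)" if "a : \<W>" "k < n" for a k
  using w0[rule_format, OF that(1), THEN conjunct1] that(2) by simp
 have w': "\<eta> (rr' a) l q = (SUM k<n. M l k q * w a k q)" if "a : \<W>" "l < m" "q : \<Union>a" for a l q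
  using w0[rule_format, OF that(1), THEN conjunct2] that(2,3) by blast
 define z where "z a b k p = \<beta> (rr' a) (rr' b) k p - (w b k p - w a k p)" for a b k p
 have inA: "p : B.A (rr' a)" if "a : \<W>" "p : \<Union>a" for a p
  using that r'(2)[OF that(1)] A[OF r'(1)[OF that(1)]] by blast
 have "EX s. rep (a Int b) s (z a b)" if a: "a : \<W>" and b: "b : \<W>" for a b
 proof (rule rep_surj)
  show zab: "zopen e (a Int b)" by (intro zopen_Int zW a b)
  have ab: "\<Union>(a Int b) = \<Union>a Int \<Union>b" by (rule zopen_Union_Int[OF zW[OF a] zW[OF b]])
  fix k assume k: "k < n"
  show "reg e (bd k) (\<Union>(a Int b)) (z a b k)"
   unfolding z_def
  proof (intro reg_diff)
   show "reg e (bd k) (\<Union>(a Int b)) (\<beta> (rr' a) (rr' b) k)"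
    using inA[OF a] inA[OF b] unfolding ab
    by (intro reg_subset[OF \<beta>(1)[OF r'(1)[OF a] r'(1)[OF b] k]] opn_Int zopen_opn zW a b) blast
  qed (rule reg_Int[OF w[OF b k] zab], simp, rule reg_Int[OF w[OF a k] zab], simp)
 next
  have ab: "\<Union>(a Int b) = \<Union>a Int \<Union>b" by (rule zopen_Union_Int[OF zW[OF a] zW[OF b]])
  fix l p assume l: "l < m" and p: "p : \<Union>(a Int b)"
  have pa: "p : \<Union>a" "p : \<Union>b" using p unfolding ab by blast+
  show "(SUM k<n. M l k p * z a b k p) = 0"
   unfolding z_def
   using \<eta>(2)[OF r'(1)[OF a] r'(1)[OF b] l inA[OF a pa(1)] inA[OF b pa(2)]] w'[OF a l pa(1)] w'[OF b l pa(2)]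
   by (simp add: right_diff_distrib sum_subtractf)
 qed
 note ex = this
 have "pull F rr' c : coboundaries F \<W> (Suc (Suc 0))"
 proof (rule rep_coboundary[OF good_cover_open[OF W(1)], where w = "%\<tau>. z (\<tau> ! 0) (\<tau> ! 1)"])
  fix xs assume s: "xs : simplices (Suc (Suc 0)) \<W>"
  note rs = refines_simplex[OF W(2) s]
  show "rep (\<Inter>(set xs)) (pull F rr' c xs) (v (map rr' xs))"
   unfolding pull_def using rs(2)
   by (intro rep_rest v(1) rs(1) simplex_zopen(1)[OF good_cover_open[OF V] rs(1)] simplex_zopen(1)[OF good_cover_open[OF W(1)] s])
  fix k p assume k: "k < n" and p: "p : \<Union>(\<Inter>(set xs))"
  obtain x y q where q: "xs = [x, y, q]" "x : \<W>" "y : \<W>" "q : \<W>" using s by (auto simp: simplices_2)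
  have "p : \<Union>x" "p : \<Union>y" "p : \<Union>q" using p by (auto simp: q)
  from \<beta>(2)[OF r'(1)[OF q(2)] r'(1)[OF q(3)] r'(1)[OF q(4)] k inA[OF q(2) this(1)] inA[OF q(3) this(2)] inA[OF q(4) this(3)]]
  show "v (map rr' xs) k p = (SUM j<length xs. (-1) ^ j * z (face j xs ! 0) (face j xs ! 1) k p)"
   by (simp add: q(1) face_def z_def)
 qed (use ex in \<open>auto simp: simplices_1\<close>)
 thus "EX \<W> rr. open_cover e \<W> & refines_by \<W> \<V> rr & pull F rr c : coboundaries F \<W> (Suc (Suc 0))"
  using good_cover_open[OF W(1)] W(2) by blast
qed

end

section \<open>The residue pairing\<close>

text \<open>This is the exponent of 1 / (x0 x1 y0 y1), the only monomial of canonical degree with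
  four negative exponents; its coefficient is the residue.\<close>

lemma xp_canonical: "xp e (canonical e) (-1, -1) i = -1"
 by (simp add: xp_def canonical_def)

lemma xp_diff: "xp e (D - D') (m - m') i = xp e D m i - xp e D' m' i"
 by (simp add: xp_def algebra_simps)

lemma evl_mult_mon:
 fixes c :: "int \<times> int => 'k::field"
 assumes p: "p : UT torus" and c: "finite {m. c m ~= 0}"
 shows "evl e D c p * mon e D' m0 p = evl e (D + D') (%m. c (m - m0)) p"
proof -
 have "{m. c (m - m0) ~= 0} = (%m. m + m0) ` {m. c m ~= 0}"
 proof (intro equalityI subsetI)
  fix m assume m: "m : {m. c (m - m0) ~= 0}"
  have "m = (m - m0) + m0" by simp
  thus "m : (%m. m + m0) ` {m. c m ~= 0}" using m by blast
 qed auto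
 moreover have "inj_on (%m. m + m0) {m. c m ~= 0}" by (simp add: inj_on_def)
 ultimately have "evl e (D + D') (%m. c (m - m0)) p = (SUM m:{m. c m ~= 0}. c m * mon e (D + D') (m + m0) p)"
  unfolding evl_def by (simp add: sum.reindex)
 also have "... = (SUM m:{m. c m ~= 0}. c m * mon e D m p * mon e D' m0 p)"
 proof (rule sum.cong[OF refl])
  fix m
  have "m : exps e D torus" "m0 : exps e D' torus" by (simp_all add: exps_iff)
  from mon_mult[OF p this] show "c m * mon e (D + D') (m + m0) p = c m * mon e D m p * mon e D' m0 p"
   by (simp add: mult.assoc)
 qed
 finally show ?thesis by (simp add: evl_def sum_distrib_right)
qed

lemma finite_supp_shift: "finite {m. c m ~= 0} ==> finite {m :: int \<times> int. c (m - m0) ~= (0::'k::field)}"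
proof -
 assume "finite {m. c m ~= 0}"
 hence "finite ((%m. m + m0) ` {m. c m ~= 0})" by simp
 moreover have "{m. c (m - m0) ~= 0} <= (%m. m + m0) ` {m. c m ~= 0}"
 proof
  fix m assume m: "m : {m. c (m - m0) ~= 0}"
  have "m = (m - m0) + m0" by simp
  thus "m : (%m. m + m0) ` {m. c m ~= 0}" using m by blast
 qed
 ultimately show ?thesis by (rule finite_subset[rotated])
qed

text \<open>The residue pairing of H2(D) with the forms of degree K - D is nondegenerate.\<close>

lemma inZ_pairing_form:
 fixes F :: "'k::field_char_0 cox => 'k"
 assumes F: "cox_form e (canonical e - D) F"
  and Z: "!!m. inZ e (canonical e) (%p. F p * mon e D m p)"
 shows "p : cone ==> F p = 0"
proof -
 have "lau e (canonical e - D) {} F" by (rule cox_form_lau[OF F])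
 then obtain c where c: "finite {m. c m ~= 0}" "!!m. c m ~= 0 ==> m : exps e (canonical e - D) {}"
  "!!p. p : UT {} ==> F p = evl e (canonical e - D) c p" by (rule lau_coeffs) (rule that, assumption+)
 have "c m = 0" for m
 proof -
  \<comment> \<open>Multiplication by the monomial with this exponent moves the coefficient at m to
    the residue position.\<close>
  define m0 where "m0 = (-1, -1) - m"
  have "c ((-1, -1) - m0) = 0"
  proof (rule inZ_coeff[OF Z[of m0], where c = "%m. c (m - m0)"])
   show "finite {m. c (m - m0) ~= 0}" by (rule finite_supp_shift[OF c(1)])
   show "negexp e (canonical e) (-1, -1)" by (simp add: negexp_def xp_canonical)
   fix p :: "'k cox" assume p: "p : UT torus"
   hence "p : UT {}" using UT_cone by (auto simp: UT_empty)
   thus "F p * mon e D m0 p = evl e (canonical e) (%m. c (m - m0)) p"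
    using c(3) evl_mult_mon[OF p c(1), of e "canonical e - D" D m0] by simp
  qed
  thus ?thesis by (simp add: m0_def)
 qed
 hence "F p = 0" if "p : cone" for p using c(3)[of p] that by (simp add: UT_empty evl_def)
 thus "p : cone ==> F p = 0" .
qed

text \<open>The complementary exponent (-1, -1) - m belongs to a form exactly when all exponents of
  m are negative, so forms read off every coefficient that obstructs membership in
  \<open>inZ\<close>.\<close>

lemma inZ_pairing_laurent:
 fixes g :: "'k::field_char_0 cox => 'k"
 assumes g: "lau e D torus g"
  and Z: "!!F. cox_form e (canonical e - D) F ==> inZ e (canonical e) (%p. F p * g p)"
 shows "inZ e D g"
proof -
 obtain c where c: "finite {m. c m ~= 0}" "!!m. c m ~= 0 ==> m : exps e D torus"
  "!!p. p : UT torus ==> g p = evl e D c p" using lau_coeffs[OF g] by blast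
 show ?thesis
 proof (rule coeff_inZ[OF c(1) c(3)])
  fix m assume m: "negexp e D m"
  define m0 where "m0 = (-1, -1) - m"
  have "xp e (canonical e - D) m0 i = -1 - xp e D m i" for i
   unfolding m0_def xp_diff by (simp add: xp_canonical)
  hence "m0 : exps e (canonical e - D) {}" using m by (simp add: exps_def negexp_def all4)
  hence "cox_form e (canonical e - D) (%p. 1 * mon e (canonical e - D) m0 p)" by (rule cox_form_mon)
  from Z[OF this] have Z': "inZ e (canonical e) (%p. mon e (canonical e - D) m0 p * g p)" by simp
  have "c ((-1, -1) - m0) = 0"
  proof (rule inZ_coeff[OF Z', where c = "%m. c (m - m0)"])
   show "finite {m. c (m - m0) ~= 0}" by (rule finite_supp_shift[OF c(1)])
   show "negexp e (canonical e) (-1, -1)" by (simp add: negexp_def xp_canonical)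
   fix p :: "'k cox" assume p: "p : UT torus"
   thus "mon e (canonical e - D) m0 p * g p = evl e (canonical e) (%m. c (m - m0)) p"
    using c(3) evl_mult_mon[OF p c(1), of e D "canonical e - D" m0] by (simp add: mult.commute)
  qed
  thus "c m = 0" by (simp add: m0_def)
 qed
qed

context basic_cover begin

lemma std_cocycle: "std g j k l p - std g i k l p + std g i j l p - std g i j k p = 0"
 by (simp add: std_def algebra_simps)

text \<open>Injectivity of M on second cohomology, on the level of cochains: a is a cocycle whose
  image M a is the coboundary of w. For a form Z of the dual degree, \<open>sur\<close> provides a
  row X with X M equal to Z at place h and 0 elsewhere, so Z * a h is the coboundary of X w. Hence
  the class of a h pairs to zero with all forms.\<close>

lemma coboundary_lift:
 fixes M :: "nat => nat => 'k cox => 'k"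
 assumes sur: "!!h Z. h < m ==> cox_form e (canonical e - ad h) Z ==>
   EX X. (ALL k<n. cox_form e (canonical e - bd k) (X k)) &
    (ALL i<m. ALL p:cone. (SUM k<n. X k p * M k i p) = (if i = h then Z p else 0))"
  and a: "!!x y z i. x : I ==> y : I ==> z : I ==> i < m ==> reg e (ad i) (A x Int A y Int A z) (a x y z i)"
  and coc: "!!x y z w i p. [|x : I; y : I; z : I; w : I; i < m; p : A x; p : A y; p : A z; p : A w|] ==>
    a y z w i p - a x z w i p + a x y w i p - a x y z i p = 0"
  and w: "!!x y k. x : I ==> y : I ==> k < n ==> reg e (bd k) (A x Int A y) (w x y k)"
  and Ma: "!!x y z k p. [|x : I; y : I; z : I; k < n; p : A x; p : A y; p : A z|] ==>
    (SUM i<m. M k i p * a x y z i p) = w y z k p - w x z k p + w x y k p"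
 shows "EX b. (ALL x:I. ALL y:I. ALL i<m. reg e (ad i) (A x Int A y) (b x y i)) &
  (ALL x:I. ALL y:I. ALL z:I. ALL i<m. ALL p:A x Int A y Int A z. a x y z i p = b y z i p - b x z i p + b x y i p)"
proof -
 have "EX g. lau e (ad i) torus g & RR (ad i) (%x y z. a x y z i) g" if i: "i < m" for i
  by (rule RR_exists) (use a coc i in auto)
 hence "EX g. ALL i:{..<m}. lau e (ad i) torus (g i) & RR (ad i) (%x y z. a x y z i) (g i)"
  by (intro bchoice) simp
 then obtain g where g0: "ALL i:{..<m}. lau e (ad i) torus (g i) & RR (ad i) (%x y z. a x y z i) (g i)" ..
 hence g: "!!i. i < m ==> lau e (ad i) torus (g i)" "!!i. i < m ==> RR (ad i) (%x y z. a x y z i) (g i)" by simp_all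
 have Z: "inZ e (ad h) (g h)" if h: "h < m" for h
 proof (rule inZ_pairing_laurent[OF g(1)[OF h]])
  fix Z :: "'k cox => 'k" assume ZF: "cox_form e (canonical e - ad h) Z"
  obtain X where X: "!!k. k < n ==> cox_form e (canonical e - bd k) (X k)"
   "!!i p. i < m ==> p : cone ==> (SUM k<n. X k p * M k i p) = (if i = h then Z p else 0)"
   using sur[OF h ZF] by blast
  define G where "G i = (if i = h then Z else (%p. 0))" for i
  have GF: "cox_form e (canonical e - ad i) (G i)" for i using ZF by (auto simp: G_def cox_form_0)
  have R: "RR (canonical e) (%x y z p. SUM i<m. G i p * a x y z i p) (%p. SUM i<m. G i p * g i p)"
   by (rule RR_sum[where Dk = ad and c = "%i x y z. a x y z i"]) (use g(2) GF in auto)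
  have "inZ e (canonical e) (%p. SUM i<m. G i p * g i p)"
  proof (rule RR_coboundary_inZ[OF R, of "%x y p. SUM k<n. X k p * w x y k p"])
   fix x y assume xy: "x : I" "y : I"
   show "reg e (canonical e) (A x Int A y) (%p. SUM k<n. X k p * w x y k p)"
    by (rule form_comb_reg[of e _ n "canonical e" bd]) (intro opn_Int opn_A xy X w; assumption)+
  next
   fix x y z p assume xyz: "x : I" "y : I" "z : I" "p : A x" "p : A y" "p : A z"
   have pc: "p : cone" using xyz A_cone by blast
   have "(SUM k<n. X k p * w y z k p) - (SUM k<n. X k p * w x z k p) + (SUM k<n. X k p * w x y k p)
     = (SUM k<n. X k p * (w y z k p - w x z k p + w x y k p))"
    by (simp add: ring_distribs sum.distrib sum_subtractf)
   also have "... = (SUM k<n. X k p * (SUM i<m. M k i p * a x y z i p))"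
    using Ma[OF xyz(1-3) _ xyz(4-6)] by (intro sum.cong refl) simp
   also have "... = (SUM k<n. SUM i<m. X k p * M k i p * a x y z i p)"
    by (simp add: sum_distrib_left mult.assoc)
   also have "... = (SUM i<m. SUM k<n. X k p * M k i p * a x y z i p)" by (rule sum.swap)
   also have "... = (SUM i<m. (SUM k<n. X k p * M k i p) * a x y z i p)" by (simp add: sum_distrib_right)
   also have "... = (SUM i<m. G i p * a x y z i p)"
    using X(2)[OF _ pc] by (intro sum.cong refl) (auto simp: G_def)
   finally show "(SUM i<m. G i p * a x y z i p) =
    (SUM k<n. X k p * w y z k p) - (SUM k<n. X k p * w x z k p) + (SUM k<n. X k p * w x y k p)" by simp
  qed
  moreover have "(SUM i<m. G i p * g i p) = Z p * g h p" for p
  proof -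
   have "(SUM i<m. G i p * g i p) = (SUM i<m. if i = h then Z p * g h p else 0)"
    by (intro sum.cong refl) (auto simp: G_def)
   thus ?thesis using h by simp
  qed
  ultimately show "inZ e (canonical e) (%p. Z p * g h p)" by simp
 qed
 define P where "P i b \<longleftrightarrow> (ALL x:I. ALL y:I. reg e (ad i) (A x Int A y) (b x y)) &
   (ALL x:I. ALL y:I. ALL z:I. ALL p:A x Int A y Int A z. a x y z i p = b y z p - b x z p + b x y p)" for i b
 have "EX b. P i b" if "i < m" for i
  unfolding P_def by (rule RR_inZ_coboundary[OF g(2)[OF that] Z[OF that]])
 hence P: "P i (SOME b. P i b)" if "i < m" for i using that by (intro someI_ex[of "P i"]) blast
 show ?thesis
  by (rule exI[of _ "%x y i. (SOME b. P i b) x y"]) (use P in \<open>unfold P_def; blast\<close>)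
qed

end

section \<open>Cohomology of cokernels\<close>

text \<open>Presentations exist locally, and two of them differ by the image of M. That the
  difference comes from a vector over the same open set, as \<open>rep_same\<close> says, is where
  injectivity of the sheaf map enters.\<close>

locale coker_sheaf = det_sheaf e F n bd rep
 for e :: nat and F :: "('k::{alg_closed_field, field_char_0}, 'm) msheaf" and n bd rep +
 fixes m :: nat and ad :: "nat => divclass" and M :: "nat => nat => 'k cox => 'k"
 assumes M_form: "!!k i. k < n ==> i < m ==> cox_form e (bd k - ad i) (M k i)"
  and rep_ex: "!!U v. zopen e U ==> (!!k. k < n ==> reg e (bd k) (\<Union>U) (v k)) ==> EX s. rep U s v"
  and rep_same: "!!U s v w. zopen e U ==> rep U s v ==> rep U s w ==>
    EX a. (ALL i<m. reg e (ad i) (\<Union>U) (a i)) & (ALL k<n. ALL p:\<Union>U. v k p - w k p = (SUM i<m. M k i p * a i p))"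
  and rep_img: "!!U s v w a. zopen e U ==> rep U s v ==> (!!i. i < m ==> reg e (ad i) (\<Union>U) (a i)) ==>
    (!!k p. k < n ==> p : \<Union>U ==> w k p = v k p + (SUM i<m. M k i p * a i p)) ==> rep U s w"
  and rep_loc: "!!U s p. zopen e U ==> s : carrier (sect F U) ==> p : \<Union>U ==>
    EX W v. zopen e W & p : \<Union>W & W <= U & rep W (rest F U W s) v"
  and rep_sep: "!!U s t. zopen e U ==> s : carrier (sect F U) ==> t : carrier (sect F U) ==>
    (!!p. p : \<Union>U ==> EX W. zopen e W & p : \<Union>W & W <= U & rest F U W s = rest F U W t) ==> s = t"
begin

text \<open>An expression in a presentation that is unchanged by adding the image of M at a point is
  a function of the section alone; it is regular because it is so for each local
  presentation.\<close>

lemma local_value: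
 fixes \<Psi> :: "(nat => 'k cox => 'k) => 'k cox => 'k"
 assumes U: "zopen e U" and s: "s : carrier (sect F U)"
  and inv: "!!w w' a p. p : \<Union>U ==> (!!k. k < n ==> w k p - w' k p = (SUM i<m. M k i p * a i)) ==> \<Psi> w p = \<Psi> w' p"
  and reg: "!!W w. zopen e W ==> W <= U ==> rep W (rest F U W s) w ==> reg e D (\<Union>W) (\<Psi> w)"
 shows "EX x. reg e D (\<Union>U) x & (ALL W w p. zopen e W --> W <= U --> rep W (rest F U W s) w --> p : \<Union>W --> x p = \<Psi> w p)"
proof -
 define C where "C p w \<longleftrightarrow> (EX W. zopen e W & W <= U & rep W (rest F U W s) w & p : \<Union>W)" for p w
 define x where "x p = \<Psi> (SOME w. C p w) p" for p
 have x: "x p = \<Psi> w p" if W: "zopen e W" "W <= U" "rep W (rest F U W s) w" "p : \<Union>W" for W w p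
 proof -
  have "C p w" unfolding C_def using W by blast
  hence "C p (SOME w. C p w)" by (rule someI[of "C p"])
  then obtain W' where W': "zopen e W'" "W' <= U" "rep W' (rest F U W' s) (SOME w. C p w)" "p : \<Union>W'" unfolding C_def by blast
  define N where "N = W' Int W"
  have N: "zopen e N" "N <= W'" "N <= W" "p : \<Union>N"
   unfolding N_def using zopen_Int[OF W'(1) W(1)] zopen_Union_Int[OF W'(1) W(1)] W(4) W'(4) by auto
  obtain a where a: "ALL k<n. ALL q:\<Union>N. (SOME w. C p w) k q - w k q = (SUM i<m. M k i q * a i q)"
   using rep_same[OF N(1) rep_rest2[OF U W'(1) N(1,2) W'(2) s W'(3)] rep_rest2[OF U W(1) N(1,3) W(2) s W(3)]] by blast
  show ?thesis unfolding x_def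
   by (rule inv[of p _ _ "%i. a i p"]) (use a N(4) W(2,4) in blast)+
 qed
 have "reg e D (\<Union>U) x"
 proof (rule reg_local)
  fix p assume "p : \<Union>U"
  then obtain W w where W: "zopen e W" "p : \<Union>W" "W <= U" "rep W (rest F U W s) w" using rep_loc[OF U s] by blast
  have "reg e D (\<Union>W) x" by (rule reg_cong[OF reg[OF W(1,3,4)]]) (rule x[OF W(1,3,4)])
  thus "EX B. p : B & B <= \<Union>U & reg e D B x" using W by blast
 qed
 thus ?thesis using x by blast
qed

text \<open>Forms X annihilating the columns of M induce a morphism from F to the line bundle of D.\<close>

context
 fixes D and X :: "nat => 'k cox => 'k"
 assumes X: "!!k. k < n ==> cox_form e (D - bd k) (X k)"
  and ann: "!!i p. i < m ==> p : cone ==> (SUM k<n. X k p * M k i p) = 0"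
begin

text \<open>The value sits at index 0 because \<open>rep_sheaf\<close> expects vectors, here of
  length 1. It is defined through local presentations and so applies to sections without a
  presentation over all of U.\<close>

definition ev :: "'k pointset => 'm => (nat => 'k cox => 'k) => bool" where
 "ev U s x \<longleftrightarrow> s : carrier (sect F U) & reg e D (\<Union>U) (x 0) & (ALL p:\<Union>U. EX W w. zopen e W & p : \<Union>W & W <= U &
   rep W (rest F U W s) w & x 0 p = (SUM k<n. X k p * w k p))"

lemma X_eq:
 assumes p: "p : cone" and eq: "!!k. k < n ==> w k p - w' k p = (SUM i<m. M k i p * a i)"
 shows "(SUM k<n. X k p * w k p) = (SUM k<n. X k p * w' k p)"
proof -
 have "(SUM k<n. X k p * w k p) - (SUM k<n. X k p * w' k p) = (SUM k<n. X k p * (w k p - w' k p))"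
  by (simp add: right_diff_distrib sum_subtractf)
 also have "... = (SUM k<n. SUM i<m. X k p * M k i p * a i)"
  by (intro sum.cong refl) (simp add: eq sum_distrib_left mult.assoc)
 also have "... = (SUM i<m. (SUM k<n. X k p * M k i p) * a i)"
  by (subst sum.swap) (simp add: sum_distrib_right)
 also have "... = 0" using ann[OF _ p] by simp
 finally show ?thesis by simp
qed

lemma evE:
 assumes "ev U s x" "p : \<Union>U"
 obtains W w where "zopen e W" "p : \<Union>W" "W <= U" "rep W (rest F U W s) w" "x 0 p = (SUM k<n. X k p * w k p)"
 using assms unfolding ev_def by blast

lemma ev_uniq:
 assumes U: "zopen e U" and x: "ev U s x" "ev U s y" and p: "p : \<Union>U"
 shows "x 0 p = y 0 p"
proof -
 have s: "s : carrier (sect F U)" using x(1) by (simp add: ev_def)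
 obtain W w where W: "zopen e W" "p : \<Union>W" "W <= U" "rep W (rest F U W s) w" "x 0 p = (SUM k<n. X k p * w k p)" by (rule evE[OF x(1) p])
 obtain W' w' where W': "zopen e W'" "p : \<Union>W'" "W' <= U" "rep W' (rest F U W' s) w'" "y 0 p = (SUM k<n. X k p * w' k p)" by (rule evE[OF x(2) p])
 define N where "N = W Int W'"
 have N: "zopen e N" "N <= W" "N <= W'" "p : \<Union>N"
  unfolding N_def using zopen_Int[OF W(1) W'(1)] zopen_Union_Int[OF W(1) W'(1)] W(2) W'(2) by auto
 obtain a where a: "ALL k<n. ALL q:\<Union>N. w k q - w' k q = (SUM i<m. M k i q * a i q)"
  using rep_same[OF N(1) rep_rest2[OF U W(1) N(1,2) W(3) s W(4)] rep_rest2[OF U W'(1) N(1,3) W'(3) s W'(4)]] by blast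
 show ?thesis unfolding W(5) W'(5)
  by (rule X_eq[of p _ _ "%i. a i p"]) (use a N(4) opn_cone[OF zopen_opn[OF N(1)]] in blast)+
qed

lemma ev_ex:
 assumes U: "zopen e U" and s: "s : carrier (sect F U)"
 shows "EX x. ev U s x"
proof -
 have "EX x. reg e D (\<Union>U) x & (ALL W w p. zopen e W --> W <= U --> rep W (rest F U W s) w --> p : \<Union>W --> x p = (SUM k<n. X k p * w k p))"
 proof (rule local_value[OF U s, where \<Psi> = "%w p. SUM k<n. X k p * w k p"])
  fix w w' a p assume "p : \<Union>U" and *: "!!k. k < n ==> w k p - w' k p = (SUM i<m. M k i p * a i)"
  show "(SUM k<n. X k p * w k p) = (SUM k<n. X k p * w' k p)"
   by (rule X_eq[where w = w and w' = w' and p = p, OF _ *]) (use \<open>p : \<Union>U\<close> opn_cone[OF zopen_opn[OF U]] in blast)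
 qed (rule form_comb_reg[OF zopen_opn X rep_reg])
 then obtain x where x: "reg e D (\<Union>U) x" "!!W w p. zopen e W ==> W <= U ==> rep W (rest F U W s) w ==> p : \<Union>W ==> x p = (SUM k<n. X k p * w k p)" by blast
 have "ev U s (%k. x)" unfolding ev_def using rep_loc[OF U s] x s by metis
 thus ?thesis by (rule exI[of "ev U s"])
qed

lemma ev_rep:
 assumes U: "zopen e U" and r: "rep U s v"
 shows "ev U s (%k p. SUM k<n. X k p * v k p)"
 unfolding ev_def
 by (intro conjI ballI exI[of _ U] exI[of _ v] rep_carrier[OF U r] form_comb_reg[OF zopen_opn[OF U] X rep_reg[OF U r]]
  rep_rest[OF U U order_refl r] U order_refl refl; assumption)

lemma ev_sheaf: "rep_sheaf e F 1 (%_. D) ev"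
proof
 fix U s t x y assume U: "zopen e U" and x: "ev U s x" and y: "ev U t y"
 interpret G: abelian_group "sect F U" by (rule ab_presheafD(1)[OF ab U])
 have s: "s : carrier (sect F U)" and t: "t : carrier (sect F U)" using x y by (simp_all add: ev_def)
 show "ev U (s \<oplus>\<^bsub>sect F U\<^esub> t) (%k p. x k p + y k p)"
  unfolding ev_def
 proof (intro conjI ballI)
  fix p assume p: "p : \<Union>U"
  obtain W w where W: "zopen e W" "p : \<Union>W" "W <= U" "rep W (rest F U W s) w" "x 0 p = (SUM k<n. X k p * w k p)" by (rule evE[OF x p])
  obtain W' w' where W': "zopen e W'" "p : \<Union>W'" "W' <= U" "rep W' (rest F U W' t) w'" "y 0 p = (SUM k<n. X k p * w' k p)" by (rule evE[OF y p])
  define N where "N = W Int W'"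
  have N: "zopen e N" "N <= W" "N <= W'" "p : \<Union>N" "N <= U"
   unfolding N_def using zopen_Int[OF W(1) W'(1)] zopen_Union_Int[OF W(1) W'(1)] W(2,3) W'(2) by auto
  have "rep N (rest F U N (s \<oplus>\<^bsub>sect F U\<^esub> t)) (%k p. w k p + w' k p)"
   unfolding ab_presheafD(3)[OF ab U N(1,5) s t]
   by (rule rep_add[OF N(1) rep_rest2[OF U W(1) N(1,2) W(3) s W(4)] rep_rest2[OF U W'(1) N(1,3) W'(3) t W'(4)]])
  thus "EX W w. zopen e W & p : \<Union>W & W <= U & rep W (rest F U W (s \<oplus>\<^bsub>sect F U\<^esub> t)) w & x 0 p + y 0 p = (SUM k<n. X k p * w k p)"
   using N W(5) W'(5) by (intro exI[of _ N] exI[of _ "%k p. w k p + w' k p"]) (simp add: distrib_left sum.distrib)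
 qed (use x y s t in \<open>auto simp: ev_def intro: reg_add\<close>)
next
 fix U s x assume U: "zopen e U" and x: "ev U s x"
 interpret G: abelian_group "sect F U" by (rule ab_presheafD(1)[OF ab U])
 have s: "s : carrier (sect F U)" using x by (simp add: ev_def)
 show "ev U (\<ominus>\<^bsub>sect F U\<^esub> s) (%k p. - x k p)"
  unfolding ev_def
 proof (intro conjI ballI)
  fix p assume p: "p : \<Union>U"
  obtain W w where W: "zopen e W" "p : \<Union>W" "W <= U" "rep W (rest F U W s) w" "x 0 p = (SUM k<n. X k p * w k p)" by (rule evE[OF x p])
  have "rep W (rest F U W (\<ominus>\<^bsub>sect F U\<^esub> s)) (%k p. - w k p)"
   unfolding ab_presheaf_rest_neg[OF ab U W(1,3) s] by (rule rep_neg[OF W(1,4)])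
  thus "EX W w. zopen e W & p : \<Union>W & W <= U & rep W (rest F U W (\<ominus>\<^bsub>sect F U\<^esub> s)) w & - x 0 p = (SUM k<n. X k p * w k p)"
   using W by (intro exI[of _ W] exI[of _ "%k p. - w k p"]) (simp add: sum_negf)
 qed (use x s in \<open>auto simp: ev_def intro: reg_uminus\<close>)
next
 fix U V s x assume U: "zopen e U" and V: "zopen e V" "V <= U" and x: "ev U s x"
 have s: "s : carrier (sect F U)" using x by (simp add: ev_def)
 show "ev V (rest F U V s) x"
  unfolding ev_def
 proof (intro conjI ballI)
  fix p assume p: "p : \<Union>V"
  hence "p : \<Union>U" using V(2) by blast
  then obtain W w where W: "zopen e W" "p : \<Union>W" "W <= U" "rep W (rest F U W s) w" "x 0 p = (SUM k<n. X k p * w k p)" by (rule evE[OF x])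
  define N where "N = W Int V"
  have N: "zopen e N" "N <= W" "N <= V" "p : \<Union>N"
   unfolding N_def using zopen_Int[OF W(1) V(1)] zopen_Union_Int[OF W(1) V(1)] W(2) p by auto
  have "rep N (rest F V N (rest F U V s)) w"
   using rep_rest2[OF U W(1) N(1,2) W(3) s W(4)] ab_presheafD(4)[OF ab U V(1) N(1,3) V(2) s] by simp
  thus "EX W w. zopen e W & p : \<Union>W & W <= V & rep W (rest F V W (rest F U V s)) w & x 0 p = (SUM k<n. X k p * w k p)"
   using N W(5) by blast
 next
  show "reg e D (\<Union>V) (x 0)" using x V by (auto simp: ev_def intro: reg_Int)
 qed (rule ab_presheafD(2)[OF ab U V s])
qed (use ab in \<open>auto simp: ev_def\<close>)

end

text \<open>X k0 is paired with every monomial g of degree \<open>bd k0\<close>. The cup product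
  cocycle of g, placed in component k0, becomes a coboundary in the cokernel; applying X, which
  kills the image of M, yields a coboundary of regular functions for X k0 * g, and the pairing is
  nondegenerate.\<close>

theorem H2_zeroE:
 assumes H2: "cohomology_zero e (Suc (Suc 0)) F"
  and X: "!!k. k < n ==> cox_form e (canonical e - bd k) (X k)"
  and ann: "!!i p. i < m ==> p : cone ==> (SUM k<n. X k p * M k i p) = 0"
  and k0: "k0 < n" and p: "p : cone"
 shows "X k0 p = 0"
proof (rule inZ_pairing_form[OF X[OF k0] _ p])
 fix m0
 interpret E: rep_sheaf e F 1 "%_. canonical e" "ev (canonical e) X" by (rule ev_sheaf[OF X ann])
 have oX: "open_cover e {hirzebruch e :: 'k pointset}" using zopen_hirzebruch by (simp add: open_cover_def)
 obtain \<U> :: "'k pointset set" and rr0 f d ci cj where U: "good_cover e \<U> f d ci cj" "refines_by \<U> {hirzebruch e} rr0"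
  by (rule basic_refinement[OF oX])
 interpret B: basic_cover e \<U> f d ci cj by (rule good_cover_basic[OF U(1)])
 note oU = good_cover_open[OF U(1)]
 define g where "g = (%p. mon e (bd k0) m0 p :: 'k)"
 have g: "lau e (bd k0) torus g"
  using lau_mono[of m0 e "bd k0" torus 1] by (simp add: exps_iff g_def)
 \<comment> \<open>The test class: the cup product cocycle of the monomial in the single component
   k0.\<close>
 define v where "v xs k = (if k = k0 then B.std g (xs ! 0) (xs ! 1) (xs ! 2) else (%p. 0))" for xs k
 have "EX c. ALL xs:simplices (Suc (Suc 0)) \<U>. rep (\<Inter>(set xs)) (c xs) (v xs)"
 proof (intro bchoice ballI)
  fix xs assume s: "xs : simplices (Suc (Suc 0)) \<U>"
  then obtain x y z where x: "xs = [x, y, z]" "x : \<U>" "y : \<U>" "z : \<U>" by (auto simp: simplices_2)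
  show "EX t. rep (\<Inter>(set xs)) t (v xs)"
  proof (rule rep_ex[OF simplex_zopen(1)[OF oU s]])
   have "\<Union>(\<Inter>(set xs)) = B.A x Int B.A y Int B.A z" using good_cover_Union[OF U(1) s] by (simp add: x(1) Int_assoc)
   thus "reg e (bd k) (\<Union>(\<Inter>(set xs))) (v xs k)" for k
    using B.std_reg[OF g x(2-4)] reg_0[OF opn_Int[OF opn_Int[OF B.opn_A[OF x(2)] B.opn_A[OF x(3)]] B.opn_A[OF x(4)]], of "bd k"]
    by (simp add: v_def x(1))
  qed
 qed
 then obtain c where c: "!!xs. xs : simplices (Suc (Suc 0)) \<U> ==> rep (\<Inter>(set xs)) (c xs) (v xs)" by blast
 have "cech_d F c xs = \<zero>\<^bsub>sect F (\<Inter>(set xs))\<^esub>" if s: "xs : simplices (Suc (Suc (Suc 0))) \<U>" for xs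
 proof -
  note z = simplex_zopen(1)[OF oU s] and r = rep_cech_d[OF oU s c]
  obtain x y z w where x: "xs = [x, y, z, w]" using s by (auto simp: simplices_3)
  show ?thesis
  proof (rule rep_eq[OF z r rep_zero[OF z r]])
   show "(SUM j<length xs. (- 1) ^ j * v (face j xs) k p) = 0" for k p
    using B.std_cocycle[of g y z w p x] by (cases "k = k0") (simp_all add: v_def x face_def)
  qed
 qed
 hence "c : cocycles F \<U> (Suc (Suc 0))"
  using rep_carrier[OF simplex_zopen(1)[OF oU] c] by (simp add: cocycles_def cochains_def)
 then obtain \<V> \<tau> f2 d2 ci2 cj2 where V: "good_cover e \<V> f2 d2 ci2 cj2" "refines_by \<V> \<U> \<tau>" "pull F \<tau> c : coboundaries F \<V> (Suc (Suc 0))"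
  by (rule cohomology_zeroE[OF ab H2 oU])
 then obtain b where b: "b : cochains F \<V> (Suc 0)" "!!xs. xs : simplices (Suc (Suc 0)) \<V> ==> pull F \<tau> c xs = cech_d F b xs" by auto
 note oV = good_cover_open[OF V(1)] and \<tau> = refinesD[OF V(2)]
 interpret B0: basic_cover e \<V> f2 d2 ci2 cj2 by (rule good_cover_basic[OF V(1)])
 \<comment> \<open>The refinement carries the chart labels of the coarser covering, so that pulling
   back the cup product cocycle gives the cup product cocycle of the refinement.\<close>
 have "basic_cover e \<V> f2 d2 (%x. ci (\<tau> x)) (%x. cj (\<tau> x))"
 proof
  fix x assume x: "x : \<V>"
  show "chart (ci (\<tau> x)) (cj (\<tau> x))" by (rule B.ch[OF \<tau>(1)[OF x]])
  have "\<Union>x <= \<Union>(\<tau> x)" using \<tau>(2)[OF x] by blast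
  thus "{p : cone. f2 x p ~= 0} <= UT {ci (\<tau> x), cj (\<tau> x)}"
   using B.A_sub[OF \<tau>(1)[OF x]] good_coverD(2)[OF U(1) \<tau>(1)[OF x]] good_coverD(2)[OF V(1) x] unfolding B0.A_def by blast
 qed (use B0.fin B0.form B0.cov in auto)
 then interpret B2: basic_cover e \<V> f2 d2 "%x. ci (\<tau> x)" "%x. cj (\<tau> x)" .
 have A2: "\<Union>(\<Inter>(set xs)) = (INT x:set xs. B2.A x)" if "xs : simplices q \<V>" for xs q
  using good_cover_Union[OF V(1) that] by (simp add: B2.A_def[abs_def] B0.A_def)
 have std_eq: "B2.std h x y z p = B.std h (\<tau> x) (\<tau> y) (\<tau> z) p" for h x y z p
  by (simp add: B2.std_def B.std_def B2.cX_def B.cX_def B2.cY_def B.cY_def)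
 \<comment> \<open>The primitive b consists of sections of the cokernel, which may lack
   presentations over whole overlaps; \<open>ev\<close> still turns them into regular
   functions.\<close>
 have "EX val. ALL xs:simplices (Suc 0) \<V>. ev (canonical e) X (\<Inter>(set xs)) (b xs) (val xs)"
  using b(1) by (intro bchoice ballI ev_ex[OF X ann] simplex_zopen(1)[OF oV]) (auto simp: cochains_def)
 then obtain val where val: "!!xs. xs : simplices (Suc 0) \<V> ==> ev (canonical e) X (\<Inter>(set xs)) (b xs) (val xs)" by blast
 have gX: "lau e (canonical e) torus (%p. X k0 p * g p)"
  using lau_mult[OF cox_form_lau[OF X[OF k0], of torus] g] by simp
 have "inZ e (canonical e) (%p. - (X k0 p * g p))"
 proof (rule B2.RR_coboundary_inZ[OF B2.RR_std[OF gX], of "%x y. val [x, y] 0"])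
  fix x y assume "x : \<V>" "y : \<V>"
  hence s: "[x, y] : simplices (Suc 0) \<V>" by (simp add: simplices_1)
  show "reg e (canonical e) (B2.A x Int B2.A y) (val [x, y] 0)"
   using E.rep_reg[OF simplex_zopen(1)[OF oV s] val[OF s], of 0] A2[OF s] by simp
 next
  fix x y z p assume x: "x : \<V>" "y : \<V>" "z : \<V>" and p: "p : B2.A x" "p : B2.A y" "p : B2.A z"
  define xs where "xs = [x, y, z]"
  have s: "xs : simplices (Suc (Suc 0)) \<V>" using x by (simp add: simplices_2 xs_def)
  note rs = refines_simplex[OF V(2) s] and z = simplex_zopen(1)[OF oV s]
  have "rep (\<Inter>(set xs)) (cech_d F b xs) (v (map \<tau> xs))"
   unfolding b(2)[OF s, symmetric] pull_def
   by (rule rep_rest[OF simplex_zopen(1)[OF oU rs(1)] z rs(2) c[OF rs(1)]])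
  from ev_uniq[OF X ann z ev_rep[OF X ann z this] E.rep_cech_d[OF oV s val], of p]
  have "(SUM k<n. X k p * v (map \<tau> xs) k p) = val [y, z] 0 p - val [x, z] 0 p + val [x, y] 0 p"
   using p unfolding A2[OF s] by (simp add: xs_def face_def)
  moreover have "(SUM k<n. X k p * v (map \<tau> xs) k p) = (SUM k<n. if k = k0 then X k0 p * B.std g (\<tau> x) (\<tau> y) (\<tau> z) p else 0)"
   by (intro sum.cong refl) (auto simp: v_def xs_def)
  ultimately show "B2.std (%p. X k0 p * g p) x y z p = val [y, z] 0 p - val [x, z] 0 p + val [x, y] 0 p"
   using k0 unfolding std_eq by (simp add: B.std_def algebra_simps)
 qed
 hence "inZ e (canonical e) (%p. X k0 p * g p)" by (rule inZ_uminus)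
 thus "inZ e (canonical e) (%p. X k0 p * mon e (bd k0) m0 p)" by (simp add: g_def)
qed

end

text \<open>Left inverses of M over the charts split the exact sequence there, so that sections over
  subsets of a chart do have presentations.\<close>

locale split_coker = coker_sheaf e F n bd rep m ad M
 for e :: nat and F :: "('k::{alg_closed_field, field_char_0}, 'm) msheaf" and n bd rep m ad M +
 assumes splitting: "!!i j. chart i j ==> EX \<sigma>. (ALL h<m. ALL k<n. reg e (ad h - bd k) (UT {i, j}) (\<sigma> h k)) &
   (ALL h<m. ALL l<m. ALL p:UT {i, j}. (SUM k<n. \<sigma> h k p * M k l p) = (if l = h then 1 else 0))"
begin

lemma left_inverse:
 assumes "ALL h<m. ALL l<m. ALL p:T. (SUM k<n. \<sigma> h k p * M k l p) = (if l = h then 1 else 0)" "h < m" "p : T"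
 shows "(SUM k<n. \<sigma> h k p * (SUM l<m. M k l p * a l)) = a h"
proof -
 have "(SUM k<n. \<sigma> h k p * (SUM l<m. M k l p * a l)) = (SUM k<n. SUM l<m. \<sigma> h k p * M k l p * a l)"
  by (simp add: sum_distrib_left mult.assoc)
 also have "... = (SUM l<m. (SUM k<n. \<sigma> h k p * M k l p) * a l)"
  by (subst sum.swap) (simp add: sum_distrib_right)
 also have "... = (SUM l<m. if l = h then a h else 0)"
  using assms by (intro sum.cong refl) simp
 finally show ?thesis using assms(2) by simp
qed

lemma M_inj:
 assumes p: "p : cone" and eq: "!!k. k < n ==> (SUM l<m. M k l p * a l) = 0" and h: "h < m"
 shows "a h = 0"
proof -
 obtain i j where ij: "chart i j" "p : UT {i, j}" using p by (rule cone_chart)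
 obtain \<sigma> where s: "ALL h<m. ALL l<m. ALL p:UT {i, j}. (SUM k<n. \<sigma> h k p * M k l p) = (if l = h then 1 else 0)"
  using splitting[OF ij(1)] by blast
 from left_inverse[OF s h ij(2), of a] show ?thesis using eq by simp
qed

text \<open>Local presentations, normalised by the splitting, agree on overlaps and glue. The
  section presented by the result equals s locally, hence everywhere by
  \<open>rep_sep\<close>.\<close>

lemma lift:
 assumes ch: "chart i j" and U: "zopen e U" "\<Union>U <= UT {i, j}" and s: "s : carrier (sect F U)"
 shows "EX v. rep U s v"
proof -
 obtain \<sigma> where sg: "ALL h<m. ALL k<n. reg e (ad h - bd k) (UT {i, j}) (\<sigma> h k)"
  "ALL h<m. ALL l<m. ALL p:UT {i, j}. (SUM k<n. \<sigma> h k p * M k l p) = (if l = h then 1 else 0)"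
  using splitting[OF ch] by blast
 define t where "t w l p = (SUM k<n. \<sigma> l k p * w k p)" for w l p
 \<comment> \<open>The projection 1 - M \<sigma> kills the image of M, so it takes the same value on
   all presentations of a section.\<close>
 define pr where "pr k w p = w k p - (SUM l<m. M k l p * t w l p)" for k w p
 have t_reg: "reg e (ad l) (\<Union>W) (t w l)" if W: "zopen e W" "W <= U" "rep W (rest F U W s) w" and l: "l < m" for W w l
  unfolding t_def
 proof (rule reg_sum[OF zopen_opn[OF W(1)]])
  fix k assume "k : {..<n}"
  hence k: "k < n" by simp
  have *: "\<Union>W <= UT {i, j}" using U(2) W(2) by blast
  have "reg e (ad l - bd k + bd k) (\<Union>W) (%p. \<sigma> l k p * w k p)"
   by (rule reg_mult[OF reg_subset[OF _ zopen_opn[OF W(1)] *] rep_reg[OF W(1,3) k]]) (use sg(1) l k in blast)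
  thus "reg e (ad l) (\<Union>W) (%p. \<sigma> l k p * w k p)" by simp
 qed
 define P where "P k x \<longleftrightarrow> reg e (bd k) (\<Union>U) x &
  (ALL W w p. zopen e W --> W <= U --> rep W (rest F U W s) w --> p : \<Union>W --> x p = pr k w p)" for k x
 have "EX x. P k x" if k: "k < n" for k
  unfolding P_def
 proof (rule local_value[OF U(1) s])
  fix w w' a p assume p: "p : \<Union>U" and eq: "!!k. k < n ==> w k p - w' k p = (SUM l<m. M k l p * a l)"
  have "t w l p - t w' l p = a l" if l: "l < m" for l
  proof -
   have "t w l p - t w' l p = (SUM k<n. \<sigma> l k p * (SUM l<m. M k l p * a l))"
    by (simp add: t_def sum_subtractf[symmetric] right_diff_distrib[symmetric] eq)
   also have "... = a l" by (rule left_inverse[OF sg(2) l]) (use p U(2) in blast)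
   finally show ?thesis .
  qed
  hence "(SUM l<m. M k l p * t w l p) - (SUM l<m. M k l p * t w' l p) = w k p - w' k p"
   by (simp add: eq[OF k] sum_subtractf[symmetric] right_diff_distrib[symmetric])
  thus "pr k w p = pr k w' p" unfolding pr_def by (simp add: algebra_simps)
 next
  fix W w assume W: "zopen e W" "W <= U" "rep W (rest F U W s) w"
  show "reg e (bd k) (\<Union>W) (pr k w)"
   unfolding pr_def by (intro reg_diff rep_reg[OF W(1,3) k] form_comb_reg[OF zopen_opn[OF W(1)] M_form[OF k] t_reg[OF W]])
 qed
 hence P: "P k (SOME x. P k x)" if "k < n" for k using that by (intro someI_ex[of "P k"]) blast
 define v where "v k = (SOME x. P k x)" for k
 have v: "reg e (bd k) (\<Union>U) (v k)" "!!W w p. zopen e W ==> W <= U ==> rep W (rest F U W s) w ==> p : \<Union>W ==> v k p = pr k w p"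
  if "k < n" for k using P[OF that] unfolding P_def v_def by blast+
 obtain q where q: "rep U q v" using rep_ex[OF U(1)] v(1) by blast
 have "s = q"
 proof (rule rep_sep[OF U(1) s rep_carrier[OF U(1) q]])
  fix p assume "p : \<Union>U"
  then obtain W w where W: "zopen e W" "p : \<Union>W" "W <= U" "rep W (rest F U W s) w" using rep_loc[OF U(1) s] by blast
  have 1: "rep W (rest F U W s) v"
  proof (rule rep_img[OF W(1,4)])
   show "reg e (ad l) (\<Union>W) (%p. - t w l p)" if "l < m" for l
    by (rule reg_uminus[OF t_reg[OF W(1,3,4) that]])
   show "v k p = w k p + (SUM l<m. M k l p * - t w l p)" if "k < n" "p : \<Union>W" for k p
    unfolding v(2)[OF that(1) W(1,3,4) that(2)] pr_def by (simp add: sum_negf)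
  qed
  have "rest F U W s = rest F U W q"
   by (rule rep_eq[OF W(1) 1 rep_rest[OF U(1) W(1,3) q]]) simp
  thus "EX W. zopen e W & p : \<Union>W & W <= U & rest F U W s = rest F U W q" using W by blast
 qed
 thus ?thesis using q by blast
qed

lemma rep_zero_img:
 assumes "zopen e U" "rep U \<zero>\<^bsub>sect F U\<^esub> v"
 shows "EX a. (ALL i<m. reg e (ad i) (\<Union>U) (a i)) & (ALL k<n. ALL p:\<Union>U. v k p = (SUM i<m. M k i p * a i p))"
proof -
 obtain a where a: "ALL i<m. reg e (ad i) (\<Union>U) (a i)" "ALL k<n. ALL p:\<Union>U. v k p - 0 = (SUM i<m. M k i p * a i p)"
  using rep_same[OF assms rep_zero[OF assms]] by blast
 thus ?thesis by (intro exI[of _ a]) simp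
qed

lemma Ma_reg:
 assumes "opn e A" "!!l. l < m ==> reg e (ad l) A (v l)" "k < n"
 shows "reg e (bd k) A (%p. SUM l<m. M k l p * v l p)"
 by (rule form_comb_reg[OF assms(1) M_form[OF assms(3)] assms(2)])

lemma Ma_diff: "(SUM l<m. M k l p * (v l - w l)) = (SUM l<m. M k l p * v l) - (SUM l<m. M k l p * w l)"
 by (simp add: right_diff_distrib sum_subtractf)

lemma Ma_add: "(SUM l<m. M k l p * (v l + w l)) = (SUM l<m. M k l p * v l) + (SUM l<m. M k l p * w l)"
 by (simp add: distrib_left sum.distrib)

lemma cocycle_rep:
 assumes V: "good_cover e \<V> f d ci cj" and c: "c : cocycles F \<V> q"
 obtains v a where "!!xs. xs : simplices q \<V> ==> rep (\<Inter>(set xs)) (c xs) (v xs)"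
  "!!xs k. xs : simplices q \<V> ==> k < n ==> reg e (bd k) (INT x:set xs. basic_cover.A f x) (v xs k)"
  "!!xs i. xs : simplices (Suc q) \<V> ==> i < m ==> reg e (ad i) (INT x:set xs. basic_cover.A f x) (a xs i)"
  "!!xs k p. xs : simplices (Suc q) \<V> ==> k < n ==> p : (INT x:set xs. basic_cover.A f x) ==>
    (SUM j<length xs. (-1) ^ j * v (face j xs) k p) = (SUM i<m. M k i p * a xs i p)"
proof -
 interpret B: basic_cover e \<V> f d ci cj by (rule good_cover_basic[OF V])
 note oV = good_cover_open[OF V] and U = good_cover_Union[OF V]
 note z = simplex_zopen(1)[OF oV]
 have "EX v. rep (\<Inter>(set xs)) (c xs) v" if s: "xs : simplices q \<V>" for xs
 proof -
  have h: "hd xs : \<V>" "hd xs : set xs" using s by (cases xs; auto simp: simplices_def)+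
  show ?thesis
  proof (rule lift[OF B.ch[OF h(1)] z[OF s]])
   show "\<Union>(\<Inter>(set xs)) <= UT {ci (hd xs), cj (hd xs)}" unfolding U[OF s] using B.A_sub[OF h(1)] h(2) by blast
   show "c xs : carrier (sect F (\<Inter>(set xs)))" using c s by (simp add: cocycles_def cochains_def)
  qed
 qed
 hence "EX v. ALL xs:simplices q \<V>. rep (\<Inter>(set xs)) (c xs) (v xs)" by (intro bchoice) blast
 then obtain v where v0: "ALL xs:simplices q \<V>. rep (\<Inter>(set xs)) (c xs) (v xs)" ..
 hence v: "rep (\<Inter>(set xs)) (c xs) (v xs)" if "xs : simplices q \<V>" for xs using that by blast
 have "EX a. ALL xs:simplices (Suc q) \<V>. (ALL i<m. reg e (ad i) (\<Union>(\<Inter>(set xs))) (a xs i)) &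
  (ALL k<n. ALL p:\<Union>(\<Inter>(set xs)). (SUM j<length xs. (-1) ^ j * v (face j xs) k p) = (SUM i<m. M k i p * a xs i p))"
  by (intro bchoice ballI rep_zero_img z rep_cocycle[OF oV c _ v])
 then obtain a where a: "ALL xs:simplices (Suc q) \<V>. (ALL i<m. reg e (ad i) (\<Union>(\<Inter>(set xs))) (a xs i)) &
  (ALL k<n. ALL p:\<Union>(\<Inter>(set xs)). (SUM j<length xs. (-1) ^ j * v (face j xs) k p) = (SUM i<m. M k i p * a xs i p))" ..
 show ?thesis
 proof (rule that[OF v])
  show "reg e (bd k) (INT x:set xs. B.A x) (v xs k)" if "xs : simplices q \<V>" "k < n" for xs k
   using rep_reg[OF z[OF that(1)] v[OF that(1)] that(2)] unfolding U[OF that(1)] .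
 qed (use a U in auto)
qed

text \<open>A 0-cocycle is presented by v with dv = M a. As M is injective, a is a cocycle, say db,
  and v - M b is a global vector, zero by hypothesis. Thus v lies in the image of M and presents
  0.\<close>

theorem H0_zeroI:
 assumes no: "!!i. i < m ==> noH1 e (ad i)"
  and z: "!!k (f :: 'k cox => 'k) p. k < n ==> reg e (bd k) cone f ==> p : cone ==> f p = 0"
 shows "cohomology_zero e 0 F"
proof (rule cohomology_zeroI'[OF ab])
 fix \<V> f d ci cj c assume V: "good_cover e \<V> f d ci cj" and c: "c : cocycles F \<V> 0"
 interpret B: basic_cover e \<V> f d ci cj by (rule good_cover_basic[OF V])
 note zV = good_coverD(1)[OF V] and A = good_coverD(2)[OF V]
 obtain v a where v: "!!xs. xs : simplices 0 \<V> ==> rep (\<Inter>(set xs)) (c xs) (v xs)"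
  "!!xs k. xs : simplices 0 \<V> ==> k < n ==> reg e (bd k) (INT x:set xs. B.A x) (v xs k)"
  "!!xs i. xs : simplices (Suc 0) \<V> ==> i < m ==> reg e (ad i) (INT x:set xs. B.A x) (a xs i)"
  "!!xs k p. xs : simplices (Suc 0) \<V> ==> k < n ==> p : (INT x:set xs. B.A x) ==>
    (SUM j<length xs. (-1) ^ j * v (face j xs) k p) = (SUM i<m. M k i p * a xs i p)"
  by (rule cocycle_rep[OF V c]) (rule that, assumption+)
 have a_reg: "reg e (ad i) (B.A x Int B.A y) (a [x, y] i)" if "x : \<V>" "y : \<V>" "i < m" for x y i
  using v(3)[of "[x, y]" i] that by (simp add: simplices_1)
 have a_eq: "v [y] k p - v [x] k p = (SUM i<m. M k i p * a [x, y] i p)" if "x : \<V>" "y : \<V>" "k < n" "p : B.A x" "p : B.A y" for x y k p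
  using v(4)[of "[x, y]" k p] that by (simp add: simplices_1 face_def)
 have coc: "a [y, w] i p - a [x, w] i p + a [x, y] i p = 0"
  if x: "x : \<V>" "y : \<V>" "w : \<V>" "i < m" "p : B.A x" "p : B.A y" "p : B.A w" for x y w i p
 proof (rule M_inj[where a = "%i. a [y, w] i p - a [x, w] i p + a [x, y] i p", OF _ _ x(4)])
  show "p : cone" using x(5) B.A_cone by blast
  show "(SUM l<m. M k l p * (a [y, w] l p - a [x, w] l p + a [x, y] l p)) = 0" if k: "k < n" for k
   unfolding Ma_diff Ma_add a_eq[OF x(2,3) k x(6,7), symmetric] a_eq[OF x(1,3) k x(5,7), symmetric]
    a_eq[OF x(1,2) k x(5,6), symmetric] by simp
 qed
 obtain b where b: "!!j k. j : \<V> ==> k < m ==> reg e (ad k) (B.A j) (b j k)"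
   "!!i j k p. i : \<V> ==> j : \<V> ==> k < m ==> p : B.A i ==> p : B.A j ==> a [i, j] k p = b j k p - b i k p"
  by (rule B.H1_zero_tuple[where c = "%i j. a [i, j]" and D = ad and n = m, OF no a_reg coc]) (assumption | rule that)+
 have vz: "v [x] k p = (SUM l<m. M k l p * b x l p)" if k: "k < n" and x: "x : \<V>" and p: "p : B.A x" for k x p
 proof (rule B.glue0[where m = "%x p. v [x] k p - (SUM l<m. M k l p * b x l p)" and D = "bd k"])
  show "reg e (bd k) (B.A y) (%p. v [y] k p - (SUM l<m. M k l p * b y l p))" if y: "y : \<V>" for y
   using v(2)[of "[y]" k] y k by (intro reg_diff Ma_reg B.opn_A y b(1) k) (auto simp: simplices_0)
  show "v [y] k q - (SUM l<m. M k l q * b y l q) = v [w] k q - (SUM l<m. M k l q * b w l q)"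
   if y: "y : \<V>" "w : \<V>" "q : B.A y" "q : B.A w" for y w q
  proof -
   have "(SUM l<m. M k l q * a [y, w] l q) = (SUM l<m. M k l q * (b w l q - b y l q))"
    using b(2)[OF y(1,2) _ y(3,4)] by (intro sum.cong refl) simp
   thus ?thesis using a_eq[OF y(1,2) k y(3,4)] unfolding Ma_diff by (simp add: algebra_simps)
  qed
  fix g assume g: "reg e (bd k) cone g" "!!i p. i : \<V> ==> p : B.A i ==> g p = v [i] k p - (SUM l<m. M k l p * b i l p)"
  have "g p = 0" by (rule z[OF k g(1)]) (use p B.A_cone in blast)
  thus ?thesis using g(2)[OF x p] by simp
 qed
 have "c xs = \<zero>\<^bsub>sect F (\<Inter>(set xs))\<^esub>" if s: "xs : simplices 0 \<V>" for xs
 proof -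
  obtain x where x: "xs = [x]" "x : \<V>" using s by (auto simp: simplices_0)
  have r: "rep x (c xs) (v [x])" using v(1)[OF s] x by simp
  have 1: "rep x (c xs) (%k p. 0)"
  proof (rule rep_img[OF zV[OF x(2)] r])
   show "reg e (ad i) (\<Union>x) (%p. - b x i p)" if "i < m" for i
    using b(1)[OF x(2) that] unfolding A[OF x(2)] by (rule reg_uminus)
   show "0 = v [x] k p + (SUM i<m. M k i p * - b x i p)" if "k < n" "p : \<Union>x" for k p
    using vz[OF that(1) x(2)] that(2) unfolding A[OF x(2)] by (simp add: sum_negf)
  qed
  show ?thesis using rep_eq[OF zV[OF x(2)] 1 rep_zero[OF zV[OF x(2)] 1]] x by simp
 qed
 thus "c : coboundaries F \<V> 0" by simp
qed

text \<open>\<open>H2A\<close> is injectivity on second cohomology in the form met here: dv = M a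
  with a 2-cocycle a. Writing a = db, the vectors v - M b form a 1-cocycle of the split bundle; its
  potential presents the required cochain.\<close>

theorem H1_zeroI:
 assumes no: "!!k. k < n ==> noH1 e (bd k)"
  and H2A: "!!(I :: 'k pointset set) f d ci cj a w. [|basic_cover e I f d ci cj;
   !!x y z i. x : I ==> y : I ==> z : I ==> i < m ==>
    reg e (ad i) (basic_cover.A f x Int basic_cover.A f y Int basic_cover.A f z) (a x y z i);
   !!x y z w i p. [|x : I; y : I; z : I; w : I; i < m; p : basic_cover.A f x; p : basic_cover.A f y;
     p : basic_cover.A f z; p : basic_cover.A f w|] ==> a y z w i p - a x z w i p + a x y w i p - a x y z i p = 0;
   !!x y k. x : I ==> y : I ==> k < n ==> reg e (bd k) (basic_cover.A f x Int basic_cover.A f y) (w x y k);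
   !!x y z k p. [|x : I; y : I; z : I; k < n; p : basic_cover.A f x; p : basic_cover.A f y; p : basic_cover.A f z|] ==>
    (SUM i<m. M k i p * a x y z i p) = w y z k p - w x z k p + w x y k p|] ==>
   EX b. (ALL x:I. ALL y:I. ALL i<m. reg e (ad i) (basic_cover.A f x Int basic_cover.A f y) (b x y i)) &
    (ALL x:I. ALL y:I. ALL z:I. ALL i<m. ALL p:basic_cover.A f x Int basic_cover.A f y Int basic_cover.A f z.
     a x y z i p = b y z i p - b x z i p + b x y i p)"
 shows "cohomology_zero e (Suc 0) F"
proof (rule cohomology_zeroI'[OF ab])
 fix \<V> f d ci cj c assume V: "good_cover e \<V> f d ci cj" and c: "c : cocycles F \<V> (Suc 0)"
 interpret B: basic_cover e \<V> f d ci cj by (rule good_cover_basic[OF V])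
 note oV = good_cover_open[OF V] and U = good_cover_Union[OF V]
 obtain v a where v: "!!xs. xs : simplices (Suc 0) \<V> ==> rep (\<Inter>(set xs)) (c xs) (v xs)"
  "!!xs k. xs : simplices (Suc 0) \<V> ==> k < n ==> reg e (bd k) (INT x:set xs. B.A x) (v xs k)"
  "!!xs i. xs : simplices (Suc (Suc 0)) \<V> ==> i < m ==> reg e (ad i) (INT x:set xs. B.A x) (a xs i)"
  "!!xs k p. xs : simplices (Suc (Suc 0)) \<V> ==> k < n ==> p : (INT x:set xs. B.A x) ==>
    (SUM j<length xs. (-1) ^ j * v (face j xs) k p) = (SUM i<m. M k i p * a xs i p)"
  by (rule cocycle_rep[OF V c]) (rule that, assumption+)
 have v_reg: "reg e (bd k) (B.A x Int B.A y) (v [x, y] k)" if "x : \<V>" "y : \<V>" "k < n" for x y k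
  using v(2)[of "[x, y]" k] that by (simp add: simplices_1)
 have a_reg: "reg e (ad i) (B.A x Int B.A y Int B.A z) (a [x, y, z] i)" if "x : \<V>" "y : \<V>" "z : \<V>" "i < m" for x y z i
  using v(3)[of "[x, y, z]" i] that by (simp add: simplices_2 Int_assoc)
 have a_eq: "v [y, z] k p - v [x, z] k p + v [x, y] k p = (SUM i<m. M k i p * a [x, y, z] i p)"
  if "x : \<V>" "y : \<V>" "z : \<V>" "k < n" "p : B.A x" "p : B.A y" "p : B.A z" for x y z k p
  using v(4)[of "[x, y, z]" k p] that by (simp add: simplices_2 face_def)
 have coc: "a [y, z, w] i p - a [x, z, w] i p + a [x, y, w] i p - a [x, y, z] i p = 0"
  if x: "x : \<V>" "y : \<V>" "z : \<V>" "w : \<V>" "i < m" "p : B.A x" "p : B.A y" "p : B.A z" "p : B.A w" for x y z w i p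
 proof (rule M_inj[where a = "%i. a [y, z, w] i p - a [x, z, w] i p + a [x, y, w] i p - a [x, y, z] i p", OF _ _ x(5)])
  show "p : cone" using x(6) B.A_cone by blast
  show "(SUM l<m. M k l p * (a [y, z, w] l p - a [x, z, w] l p + a [x, y, w] l p - a [x, y, z] l p)) = 0" if k: "k < n" for k
   unfolding Ma_diff Ma_add a_eq[OF x(2,3,4) k x(7-9), symmetric] a_eq[OF x(1,3,4) k x(6,8,9), symmetric]
    a_eq[OF x(1,2,4) k x(6,7,9), symmetric] a_eq[OF x(1-3) k x(6-8), symmetric] by simp
 qed
 obtain b where b0: "ALL x:\<V>. ALL y:\<V>. ALL i<m. reg e (ad i) (B.A x Int B.A y) (b x y i)"
   "ALL x:\<V>. ALL y:\<V>. ALL z:\<V>. ALL i<m. ALL p:B.A x Int B.A y Int B.A z. a [x, y, z] i p = b y z i p - b x z i p + b x y i p"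
  using H2A[OF B.basic_cover_axioms a_reg coc v_reg a_eq[symmetric]] by blast
 have b: "reg e (ad i) (B.A x Int B.A y) (b x y i)" if "x : \<V>" "y : \<V>" "i < m" for x y i
  using b0(1) that by blast
 have b_eq: "a [x, y, z] i p = b y z i p - b x z i p + b x y i p"
  if "x : \<V>" "y : \<V>" "z : \<V>" "i < m" "p : B.A x" "p : B.A y" "p : B.A z" for x y z i p
  using b0(2) that by blast
 define u where "u x y k p = v [x, y] k p - (SUM l<m. M k l p * b x y l p)" for x y k p
 have u_reg: "reg e (bd k) (B.A x Int B.A y) (u x y k)" if "x : \<V>" "y : \<V>" "k < n" for x y k
  unfolding u_def by (intro reg_diff v_reg Ma_reg opn_Int B.opn_A b that)
 have u_coc: "u y z k p - u x z k p + u x y k p = 0"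
  if x: "x : \<V>" "y : \<V>" "z : \<V>" "k < n" "p : B.A x" "p : B.A y" "p : B.A z" for x y z k p
 proof -
  have "(SUM i<m. M k i p * a [x, y, z] i p) = (SUM i<m. M k i p * (b y z i p - b x z i p + b x y i p))"
   using b_eq[OF x(1-3) _ x(5-7)] by (intro sum.cong refl) simp
  note this[unfolded Ma_diff Ma_add a_eq[OF x, symmetric]]
  thus ?thesis unfolding u_def by (simp add: algebra_simps)
 qed
 obtain t where t: "!!j k. j : \<V> ==> k < n ==> reg e (bd k) (B.A j) (t j k)"
   "!!i j k p. i : \<V> ==> j : \<V> ==> k < n ==> p : B.A i ==> p : B.A j ==> u i j k p = t j k p - t i k p"
  by (rule B.H1_zero_tuple[where c = u and D = bd and n = n, OF no u_reg u_coc]) (assumption | rule that)+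
 have ex: "EX s. rep x s (t x)" if x: "x : \<V>" for x
  by (rule rep_ex[OF good_coverD(1)[OF V x]]) (use t(1)[OF x] good_coverD(2)[OF V x] in simp)
 show "c : coboundaries F \<V> (Suc 0)"
 proof (rule rep_coboundary[OF oV, where v = "%xs. u (xs ! 0) (xs ! 1)" and w = "%\<tau>. t (hd \<tau>)"])
  fix xs assume s: "xs : simplices (Suc 0) \<V>"
  then obtain x y where x: "xs = [x, y]" "x : \<V>" "y : \<V>" by (auto simp: simplices_1)
  have Un: "\<Union>(\<Inter>(set xs)) = B.A x Int B.A y" using U[OF s] by (simp add: x(1))
  show "rep (\<Inter>(set xs)) (c xs) (u (xs ! 0) (xs ! 1))"
  proof (rule rep_img[OF simplex_zopen(1)[OF oV s] v(1)[OF s]])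
   show "reg e (ad i) (\<Union>(\<Inter>(set xs))) (%p. - b x y i p)" if "i < m" for i
    unfolding Un by (rule reg_uminus[OF b[OF x(2,3) that]])
  qed (simp add: u_def sum_negf x)
  show "u (xs ! 0) (xs ! 1) k p = (SUM j<length xs. (-1) ^ j * t (hd (face j xs)) k p)" if "k < n" "p : \<Union>(\<Inter>(set xs))" for k p
   using t(2)[OF x(2,3) that(1)] that(2) unfolding Un by (simp add: x face_def)
 qed (use ex in \<open>auto simp: simplices_0\<close>)
qed

end

section \<open>Twists of kernel and cokernel sheaves\<close>

lemma msheafD:
 assumes "is_msheaf e F" "zopen e U"
 shows "Module.module (sect (OX e 0) U) (sect F U)"
  and "!!V s. zopen e V ==> V <= U ==> s : carrier (sect F U) ==> rest F U V s : carrier (sect F V)"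
  and "!!V s t. zopen e V ==> V <= U ==> s : carrier (sect F U) ==> t : carrier (sect F U) ==>
   rest F U V (s \<oplus>\<^bsub>sect F U\<^esub> t) = rest F U V s \<oplus>\<^bsub>sect F V\<^esub> rest F U V t"
  and "!!V f s. zopen e V ==> V <= U ==> f : line_sections e 0 U ==> s : carrier (sect F U) ==>
   rest F U V (f \<odot>\<^bsub>sect F U\<^esub> s) = ext V f \<odot>\<^bsub>sect F V\<^esub> rest F U V s"
  and "!!s. s : carrier (sect F U) ==> rest F U U s = s"
  and "!!V W s. zopen e V ==> zopen e W ==> W <= V ==> V <= U ==> s : carrier (sect F U) ==>
   rest F V W (rest F U V s) = rest F U W s"
proof -
 note d = assms(1)[unfolded is_msheaf_def OX_simps]
 note d1 = d[THEN conjunct1, rule_format]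
  and d2 = d[THEN conjunct2, THEN conjunct1, rule_format]
  and d3 = d[THEN conjunct2, THEN conjunct2, THEN conjunct1, rule_format]
  and d4 = d[THEN conjunct2, THEN conjunct2, THEN conjunct2, THEN conjunct1, rule_format]
 show "Module.module (sect (OX e 0) U) (sect F U)" by (rule d1[OF assms(2)])
 show "!!s. s : carrier (sect F U) ==> rest F U U s = s" by (rule d3[OF assms(2)])
 fix V s t f W assume V: "zopen e V" "V <= U" and s: "s : carrier (sect F U)"
 note d2' = d2[of U V, OF conjI[OF assms(2) conjI[OF V]]]
 show "rest F U V s : carrier (sect F V)" using d2' s by blast
 show "t : carrier (sect F U) ==> rest F U V (s \<oplus>\<^bsub>sect F U\<^esub> t) = rest F U V s \<oplus>\<^bsub>sect F V\<^esub> rest F U V t"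
  using d2' s by blast
 show "f : line_sections e 0 U ==> rest F U V (f \<odot>\<^bsub>sect F U\<^esub> s) = ext V f \<odot>\<^bsub>sect F V\<^esub> rest F U V s"
  using d2' s by blast
 show "zopen e W ==> W <= V ==> rest F V W (rest F U V s) = rest F U W s"
  using d4[of U V W s] assms(2) V s by blast
qed

lemma vector_mor:
 assumes v: "!!k. k < length Bs ==> reg e (Bs ! k + D) (\<Union>U) (v k)"
 shows "is_mor_on e U (OX e (- D)) (split_bundle e Bs) (%V s. tup (length Bs) V (%k p. v k p * s p))"
 unfolding is_mor_on_def OX_simps
proof (intro conjI allI impI ballI; elim conjE)
 show "tup (length Bs) W (%k p. v k p * ext W s p) = rest (split_bundle e Bs) V W (tup (length Bs) V (%k p. v k p * s p))"
  if "W <= V" for V W s unfolding tup_rest[OF that] by (rule tup_cong) (simp add: ext_at)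
 show "tup (length Bs) V (%k p. v k p * s p) : carrier (sect (split_bundle e Bs) V)"
  if V: "zopen e V" "V <= U" and s: "s : line_sections e (- D) V" for V s
  by (rule tup_in[OF V(1)]) (use reg_mult[OF reg_Int[OF v V] line_sectionsD(1)[OF V(1) s]] in simp)
qed (simp_all add: tup_add tup_smult distrib_left mult.left_commute)

lemma mor_lift:
 assumes j: "is_mor_on e U E H j" "!!V. zopen e V ==> V <= U ==> inj_on (j V) (carrier (sect E V))"
  and E: "is_msheaf e E" and \<phi>: "is_mor_on e U F H \<phi>"
  and im: "!!V s. zopen e V ==> V <= U ==> s : carrier (sect F V) ==> \<phi> V s : j V ` carrier (sect E V)"
 shows "is_mor_on e U F E (%V s. inv_into (carrier (sect E V)) (j V) (\<phi> V s))" (is "is_mor_on e U F E ?g")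
 unfolding is_mor_on_def OX_simps
proof (intro conjI allI impI ballI; elim conjE)
 fix V s assume V: "zopen e V" "V <= U" and s: "s : carrier (sect F V)"
 note m = is_morD[OF \<phi> V] and jm = is_morD[OF j(1) V] and inv = inv_into_f_f[OF j(2)[OF V]]
 interpret V: module "sect (OX e 0) V" "sect E V" by (rule msheafD(1)[OF E V(1)])
 obtain x where x: "x : carrier (sect E V)" "\<phi> V s = j V x" using im[OF V s] by blast
 show "?g V s : carrier (sect E V)" unfolding x(2) inv[OF x(1)] by (rule x(1))
 show "?g V (h \<odot>\<^bsub>sect F V\<^esub> s) = h \<odot>\<^bsub>sect E V\<^esub> ?g V s" if h: "h : line_sections e 0 V" for h
 proof -
  have "h \<odot>\<^bsub>sect E V\<^esub> x : carrier (sect E V)" by (rule V.smult_closed[OF _ x(1)]) (use h in \<open>simp add: OX_simps\<close>)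
  thus ?thesis unfolding m(3)[OF h s] x(2) jm(3)[OF h x(1), symmetric] inv[OF x(1)] by (rule inv)
 qed
 show "?g W (rest F V W s) = rest E V W (?g V s)" if W: "zopen e W" "W <= V" for W
 proof -
  have "W <= U" using W V by blast
  thus ?thesis unfolding m(4)[OF W s] x(2) jm(4)[OF W x(1), symmetric] inv[OF x(1)]
   by (rule inv_into_f_f[OF j(2)[OF W(1)] msheafD(2)[OF E V(1) W x(1)]])
 qed
 fix t assume t: "t : carrier (sect F V)"
 obtain y where y: "y : carrier (sect E V)" "\<phi> V t = j V y" using im[OF V t] by blast
 show "?g V (s \<oplus>\<^bsub>sect F V\<^esub> t) = ?g V s \<oplus>\<^bsub>sect E V\<^esub> ?g V t"
  unfolding m(2)[OF s t] x(2) y(2) jm(2)[OF x(1) y(1), symmetric] inv[OF x(1)] inv[OF y(1)]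
  by (rule inv[OF V.add.m_closed[OF x(1) y(1)]])
qed

lemma msheaf_ab:
 assumes F: "is_msheaf e F" shows "ab_presheaf e F"
 unfolding ab_presheaf_def
proof (intro conjI allI impI)
 show "abelian_group (sect F U)" if "zopen e U" for U by (rule module.axioms(2)[OF msheafD(1)[OF F that]])
qed (rule msheafD[OF F]; assumption)+

text \<open>Both s and t glue the family of their restrictions to the sets on which they agree, and
  the glued section is unique.\<close>

lemma msheaf_separated:
 assumes F: "is_msheaf e F" and U: "zopen e U" and s: "s : carrier (sect F U)" "t : carrier (sect F U)"
  and loc: "!!P. P : U ==> EX W. zopen e W & P : W & W <= U & rest F U W s = rest F U W t"
 shows "s = t"
proof -
 define \<V> where "\<V> = {W. zopen e W & W <= U & rest F U W s = rest F U W t}"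
 have Un: "\<Union>\<V> = U" using loc unfolding \<V>_def by blast
 have z: "zopen e V" "V <= U" "rest F U V s = rest F U V t" if "V : \<V>" for V using that unfolding \<V>_def by blast+
 define \<sigma> where "\<sigma> V = rest F U V s" for V
 have 1: "ALL V:\<V>. zopen e V & \<sigma> V : carrier (sect F V)"
  unfolding \<sigma>_def using z msheafD(2)[OF F U] s by blast
 have 2: "ALL V:\<V>. ALL W:\<V>. rest F V (V Int W) (\<sigma> V) = rest F W (V Int W) (\<sigma> W)"
 proof (intro ballI)
  fix V W assume VW: "V : \<V>" "W : \<V>"
  have zi: "zopen e (V Int W)" by (intro zopen_Int z VW)
  have "rest F V (V Int W) (\<sigma> V) = rest F U (V Int W) s" unfolding \<sigma>_def
   by (rule msheafD(6)[OF F U z(1)[OF VW(1)] zi _ z(2)[OF VW(1)] s(1)]) blast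
  moreover have "rest F W (V Int W) (\<sigma> W) = rest F U (V Int W) s" unfolding \<sigma>_def
   by (rule msheafD(6)[OF F U z(1)[OF VW(2)] zi _ z(2)[OF VW(2)] s(1)]) blast
  ultimately show "rest F V (V Int W) (\<sigma> V) = rest F W (V Int W) (\<sigma> W)" by simp
 qed
 have "EX! t. t : carrier (sect F (\<Union>\<V>)) & (ALL V:\<V>. rest F (\<Union>\<V>) V t = \<sigma> V)"
  using F 1 2 unfolding is_msheaf_def by (elim conjE) (erule allE[of _ \<V>], erule allE[of _ \<sigma>], blast)
 hence "EX! t. t : carrier (sect F U) & (ALL V:\<V>. rest F U V t = \<sigma> V)" unfolding Un .
 moreover have "ALL V:\<V>. rest F U V s = \<sigma> V" "ALL V:\<V>. rest F U V t = \<sigma> V" using z unfolding \<sigma>_def by auto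
 ultimately show ?thesis using s by blast
qed

lemma mor_zero:
 assumes \<phi>: "is_mor_on e U F G \<phi>" and V: "zopen e V" "V <= U"
  and F: "abelian_group (sect F V)" and G: "abelian_group (sect G V)"
 shows "\<phi> V \<zero>\<^bsub>sect F V\<^esub> = \<zero>\<^bsub>sect G V\<^esub>"
proof -
 interpret F: abelian_group "sect F V" by fact
 interpret G: abelian_group "sect G V" by fact
 have "\<phi> V \<zero>\<^bsub>sect F V\<^esub> \<oplus>\<^bsub>sect G V\<^esub> \<phi> V \<zero>\<^bsub>sect F V\<^esub> = \<phi> V \<zero>\<^bsub>sect F V\<^esub>"
  using is_morD(2)[OF \<phi> V F.zero_closed F.zero_closed] by simp
 thus ?thesis using is_morD(1)[OF \<phi> V F.zero_closed] by (metis G.add.r_cancel_one)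
qed

lemma mor_neg:
 assumes \<phi>: "is_mor_on e U F G \<phi>" and V: "zopen e V" "V <= U"
  and F: "abelian_group (sect F V)" and G: "abelian_group (sect G V)" and s: "s : carrier (sect F V)"
 shows "\<phi> V (\<ominus>\<^bsub>sect F V\<^esub> s) = \<ominus>\<^bsub>sect G V\<^esub> \<phi> V s"
proof -
 interpret F: abelian_group "sect F V" by fact
 interpret G: abelian_group "sect G V" by fact
 have "\<phi> V (\<ominus>\<^bsub>sect F V\<^esub> s) \<oplus>\<^bsub>sect G V\<^esub> \<phi> V s = \<zero>\<^bsub>sect G V\<^esub>"
  using is_morD(2)[OF \<phi> V F.a_inv_closed[OF s] s] mor_zero[OF \<phi> V F G] s by (simp add: F.l_neg)
 thus ?thesis using is_morD(1)[OF \<phi> V] s by (metis F.a_inv_closed G.minus_equality)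
qed

lemma split_abelian:
 assumes U: "zopen e U"
 shows "abelian_group (sect (split_bundle e Ds) U)"
  and "(!!k. k < length Ds ==> reg e (Ds ! k) (\<Union>U) (v k)) ==>
   \<ominus>\<^bsub>sect (split_bundle e Ds) U\<^esub> tup (length Ds) U v = tup (length Ds) U (%k p. - v k p)"
proof -
 show G: "abelian_group (sect (split_bundle e Ds) U)"
 proof (rule abelian_groupI)
  fix x y assume x: "x : carrier (sect (split_bundle e Ds) U)" and y: "y : carrier (sect (split_bundle e Ds) U)"
  obtain v where v: "!!k. k < length Ds ==> reg e (Ds ! k) (\<Union>U) (v k)" "x = tup (length Ds) U v" by (rule tup_ex[OF U x]) (rule that, assumption+)
  obtain w where w: "!!k. k < length Ds ==> reg e (Ds ! k) (\<Union>U) (w k)" "y = tup (length Ds) U w" by (rule tup_ex[OF U y]) (rule that, assumption+)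
  show "x \<oplus>\<^bsub>sect (split_bundle e Ds) U\<^esub> y : carrier (sect (split_bundle e Ds) U)"
   unfolding v(2) w(2) tup_add by (intro tup_in U reg_add v w)
  show "x \<oplus>\<^bsub>sect (split_bundle e Ds) U\<^esub> y = y \<oplus>\<^bsub>sect (split_bundle e Ds) U\<^esub> x"
   unfolding v(2) w(2) tup_add by (simp add: add.commute)
  show "\<zero>\<^bsub>sect (split_bundle e Ds) U\<^esub> \<oplus>\<^bsub>sect (split_bundle e Ds) U\<^esub> x = x"
   unfolding v(2) tup_zero tup_add by simp
  fix z assume z: "z : carrier (sect (split_bundle e Ds) U)"
  obtain u where u: "!!k. k < length Ds ==> reg e (Ds ! k) (\<Union>U) (u k)" "z = tup (length Ds) U u" by (rule tup_ex[OF U z]) (rule that, assumption+)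
  show "x \<oplus>\<^bsub>sect (split_bundle e Ds) U\<^esub> y \<oplus>\<^bsub>sect (split_bundle e Ds) U\<^esub> z =
    x \<oplus>\<^bsub>sect (split_bundle e Ds) U\<^esub> (y \<oplus>\<^bsub>sect (split_bundle e Ds) U\<^esub> z)"
   unfolding v(2) w(2) u(2) tup_add by (simp add: add.assoc)
 next
  show "\<zero>\<^bsub>sect (split_bundle e Ds) U\<^esub> : carrier (sect (split_bundle e Ds) U)"
   unfolding tup_zero by (intro tup_in U reg_0 zopen_opn)
  fix x assume x: "x : carrier (sect (split_bundle e Ds) U)"
  obtain v where v: "!!k. k < length Ds ==> reg e (Ds ! k) (\<Union>U) (v k)" "x = tup (length Ds) U v" by (rule tup_ex[OF U x]) (rule that, assumption+)
  show "EX y:carrier (sect (split_bundle e Ds) U). y \<oplus>\<^bsub>sect (split_bundle e Ds) U\<^esub> x = \<zero>\<^bsub>sect (split_bundle e Ds) U\<^esub>"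
   unfolding v(2) tup_zero
   by (rule bexI[of _ "tup (length Ds) U (%k p. - v k p)"]) (simp add: tup_add, intro tup_in U reg_uminus v)
 qed
 interpret G: abelian_group "sect (split_bundle e Ds) U" by (rule G)
 assume v: "!!k. k < length Ds ==> reg e (Ds ! k) (\<Union>U) (v k)"
 show "\<ominus>\<^bsub>sect (split_bundle e Ds) U\<^esub> tup (length Ds) U v = tup (length Ds) U (%k p. - v k p)"
 proof (rule G.minus_equality)
  show "tup (length Ds) U (%k p. - v k p) \<oplus>\<^bsub>sect (split_bundle e Ds) U\<^esub> tup (length Ds) U v = \<zero>\<^bsub>sect (split_bundle e Ds) U\<^esub>"
   unfolding tup_zero tup_add by simp
 qed (rule tup_in[OF U], erule v, rule tup_in[OF U], rule reg_uminus, erule v)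
qed

definition twdom :: "nat => divclass => 'k::field pointset => 'k pointset => ('k cox => 'k) => bool" where
 "twdom e D U V s \<longleftrightarrow> zopen e V & V <= U & s : line_sections e (- D) V"

lemma twist_simps:
 "carrier (sect (twist e D E) U) = {\<phi>. is_mor_on e U (OX e (- D)) E \<phi> & (ALL V s. ~ twdom e D U V s --> \<phi> V s = undefined)}"
 "\<zero>\<^bsub>sect (twist e D E) U\<^esub> = (%V s. if twdom e D U V s then \<zero>\<^bsub>sect E V\<^esub> else undefined)"
 "\<phi> \<oplus>\<^bsub>sect (twist e D E) U\<^esub> \<psi> = (%V s. if twdom e D U V s then \<phi> V s \<oplus>\<^bsub>sect E V\<^esub> \<psi> V s else undefined)"
 "rest (twist e D E) U W \<phi> = (%V s. if twdom e D W V s then \<phi> V s else undefined)"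
 by (simp_all add: twist_def sheaf_Hom_def Let_def twdom_def OX_simps)

lemma twistD:
 assumes "\<phi> : carrier (sect (twist e D E) U)" "zopen e V" "V <= U"
 shows "s : line_sections e (- D) V ==> \<phi> V s : carrier (sect E V)"
  and "s : line_sections e (- D) V ==> t : line_sections e (- D) V ==>
   \<phi> V (%p. s p + t p) = \<phi> V s \<oplus>\<^bsub>sect E V\<^esub> \<phi> V t"
  and "f : line_sections e 0 V ==> s : line_sections e (- D) V ==>
   \<phi> V (%p. f p * s p) = f \<odot>\<^bsub>sect E V\<^esub> \<phi> V s"
  and "zopen e W ==> W <= V ==> s : line_sections e (- D) V ==> \<phi> W (ext W s) = rest E V W (\<phi> V s)"
proof -
 have m: "is_mor_on e U (OX e (- D)) E \<phi>" using assms(1) by (simp add: twist_simps)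
 note * = is_morD[OF m assms(2,3), unfolded OX_simps]
 show "s : line_sections e (- D) V ==> \<phi> V s : carrier (sect E V)" by (rule *(1))
 show "s : line_sections e (- D) V ==> t : line_sections e (- D) V ==>
   \<phi> V (%p. s p + t p) = \<phi> V s \<oplus>\<^bsub>sect E V\<^esub> \<phi> V t" by (rule *(2))
 show "f : line_sections e 0 V ==> s : line_sections e (- D) V ==>
   \<phi> V (%p. f p * s p) = f \<odot>\<^bsub>sect E V\<^esub> \<phi> V s" by (rule *(3))
 show "zopen e W ==> W <= V ==> s : line_sections e (- D) V ==> \<phi> W (ext W s) = rest E V W (\<phi> V s)"
  by (rule *(4))
qed

lemma twistI:
 assumes "!!V s. zopen e V ==> V <= U ==> s : line_sections e (- D) V ==> g V s : carrier (sect E V)"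
  and "!!V s t. zopen e V ==> V <= U ==> s : line_sections e (- D) V ==> t : line_sections e (- D) V ==>
   g V (%p. s p + t p) = g V s \<oplus>\<^bsub>sect E V\<^esub> g V t"
  and "!!V f s. zopen e V ==> V <= U ==> f : line_sections e 0 V ==> s : line_sections e (- D) V ==>
   g V (%p. f p * s p) = f \<odot>\<^bsub>sect E V\<^esub> g V s"
  and "!!V W s. zopen e V ==> V <= U ==> zopen e W ==> W <= V ==> s : line_sections e (- D) V ==>
   g W (ext W s) = rest E V W (g V s)"
 shows "(%V s. if twdom e D U V s then g V s else undefined) : carrier (sect (twist e D E) U)"
proof -
 have [simp]: "(if twdom e D U V s then g V s else undefined) = g V s"
  if "zopen e V" "V <= U" "s : line_sections e (- D) V" for V s
  using that by (simp add: twdom_def)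
 have "is_mor_on e U (OX e (- D)) E (%V s. if twdom e D U V s then g V s else undefined)"
  unfolding is_mor_on_def OX_simps
 proof (intro conjI allI impI ballI; elim conjE)
  fix V W s assume "zopen e V" "zopen e W" "W <= V" "V <= U" "s : line_sections e (- D) V"
  moreover have "W <= U" using calculation by blast
  moreover have "ext W s : line_sections e (- D) W" using calculation by (intro line_rest)
  ultimately show "(if twdom e D U W (ext W s) then g W (ext W s) else undefined) =
    rest E V W (if twdom e D U V s then g V s else undefined)" by (simp add: assms(4))
 qed (simp_all add: line_add line_smult assms(1-3))
 thus ?thesis by (simp add: twist_simps)
qed

lemma twist_in:
 assumes "is_mor_on e U (OX e (- D)) E g"
 shows "(%V s. if twdom e D U V s then g V s else undefined) : carrier (sect (twist e D E) U)"
 by (rule twistI) (rule is_morD[OF assms, unfolded OX_simps]; assumption)+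

lemma twist_eqI:
 assumes "\<phi> : carrier (sect (twist e D E) U)" "\<psi> : carrier (sect (twist e D E) U)"
  and "!!V s. zopen e V ==> V <= U ==> s : line_sections e (- D) V ==> \<phi> V s = \<psi> V s"
 shows "\<phi> = \<psi>"
proof (intro HOL.ext)
 fix V s show "\<phi> V s = \<psi> V s"
  using assms unfolding twist_simps by (cases "twdom e D U V s") (simp_all add: twdom_def)
qed

text \<open>Operations on morphisms are pointwise. The negative is given abstractly by the group
  structure, so its pointwise value is identified through uniqueness of inverses.\<close>

lemma twist_ab:
 fixes E :: "('k::field, 'm) msheaf"
 assumes E: "is_msheaf e E"
 shows "ab_presheaf e (twist e D E)"
  and "zopen e U ==> \<phi> : carrier (sect (twist e D E) U) ==> zopen e V ==> V <= U ==> s : line_sections e (- D) V ==>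
   (\<ominus>\<^bsub>sect (twist e D E) U\<^esub> \<phi>) V s = \<ominus>\<^bsub>sect E V\<^esub> \<phi> V s"
proof -
 let ?F = "twist e D E"
 have mod: "Module.module (sect (OX e 0) U) (sect E U)" if "zopen e U" for U by (rule msheafD(1)[OF E that])
 have ab: "abelian_group (sect E U)" if "zopen e U" for U by (rule module.axioms(2)[OF mod[OF that]])
 have abE: "ab_presheaf e E" by (rule msheaf_ab[OF E])
 define neg where "neg U \<phi> = (%V s. if twdom e D U V s then \<ominus>\<^bsub>sect E V\<^esub> \<phi> V s else undefined)" for U and \<phi> :: "('k, 'k cox => 'k, 'm) mor"
 have addc: "\<phi> \<oplus>\<^bsub>sect ?F U\<^esub> \<psi> : carrier (sect ?F U)" if \<phi>: "\<phi> : carrier (sect ?F U)" and \<psi>: "\<psi> : carrier (sect ?F U)" for U \<phi> \<psi>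
  unfolding twist_simps(3)
 proof (rule twistI)
  fix V s assume V: "zopen e V" "V <= U" and s: "s : line_sections e (- D) V"
  interpret V: module "sect (OX e 0) V" "sect E V" by (rule mod[OF V(1)])
  note P = twistD[OF \<phi> V] and Q = twistD[OF \<psi> V]
  show "\<phi> V s \<oplus>\<^bsub>sect E V\<^esub> \<psi> V s : carrier (sect E V)" using P(1)[OF s] Q(1)[OF s] by simp
  show "\<phi> V (%p. s p + t p) \<oplus>\<^bsub>sect E V\<^esub> \<psi> V (%p. s p + t p) = \<phi> V s \<oplus>\<^bsub>sect E V\<^esub> \<psi> V s \<oplus>\<^bsub>sect E V\<^esub> (\<phi> V t \<oplus>\<^bsub>sect E V\<^esub> \<psi> V t)"
   if t: "t : line_sections e (- D) V" for t
   unfolding P(2)[OF s t] Q(2)[OF s t] using P(1)[OF s] Q(1)[OF s] P(1)[OF t] Q(1)[OF t] by (simp add: V.a_ac)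
  show "\<phi> V (%p. f p * s p) \<oplus>\<^bsub>sect E V\<^esub> \<psi> V (%p. f p * s p) = f \<odot>\<^bsub>sect E V\<^esub> (\<phi> V s \<oplus>\<^bsub>sect E V\<^esub> \<psi> V s)"
   if f: "f : line_sections e 0 V" for f
   unfolding P(3)[OF f s] Q(3)[OF f s] using V.smult_r_distr[of f "\<phi> V s" "\<psi> V s"] f P(1)[OF s] Q(1)[OF s] by (simp add: OX_simps)
  show "\<phi> W (ext W s) \<oplus>\<^bsub>sect E W\<^esub> \<psi> W (ext W s) = rest E V W (\<phi> V s \<oplus>\<^bsub>sect E V\<^esub> \<psi> V s)"
   if W: "zopen e W" "W <= V" for W
   unfolding P(4)[OF W s] Q(4)[OF W s] using msheafD(3)[OF E V(1) W P(1)[OF s] Q(1)[OF s]] by simp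
 qed
 have zeroc: "\<zero>\<^bsub>sect ?F U\<^esub> : carrier (sect ?F U)" for U
  unfolding twist_simps(2)
 proof (rule twistI)
  fix V s assume V: "zopen e V" "V <= U" and s: "s : line_sections e (- D) V"
  interpret V: module "sect (OX e 0) V" "sect E V" by (rule mod[OF V(1)])
  show "\<zero>\<^bsub>sect E V\<^esub> : carrier (sect E V)" "\<zero>\<^bsub>sect E V\<^esub> = \<zero>\<^bsub>sect E V\<^esub> \<oplus>\<^bsub>sect E V\<^esub> \<zero>\<^bsub>sect E V\<^esub>" by simp_all
  show "\<zero>\<^bsub>sect E V\<^esub> = f \<odot>\<^bsub>sect E V\<^esub> \<zero>\<^bsub>sect E V\<^esub>" if "f : line_sections e 0 V" for f
   using V.smult_r_null[of f] that by (simp add: OX_simps)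
  show "\<zero>\<^bsub>sect E W\<^esub> = rest E V W \<zero>\<^bsub>sect E V\<^esub>" if W: "zopen e W" "W <= V" for W
   using ab_presheaf_rest_zero[OF abE V(1) W] by simp
 qed
 have negc: "neg U \<phi> : carrier (sect ?F U)" if \<phi>: "\<phi> : carrier (sect ?F U)" for U \<phi>
  unfolding neg_def
 proof (rule twistI)
  fix V s assume V: "zopen e V" "V <= U" and s: "s : line_sections e (- D) V"
  interpret V: module "sect (OX e 0) V" "sect E V" by (rule mod[OF V(1)])
  note P = twistD[OF \<phi> V]
  show "\<ominus>\<^bsub>sect E V\<^esub> \<phi> V s : carrier (sect E V)" using P(1)[OF s] by simp
  show "\<ominus>\<^bsub>sect E V\<^esub> \<phi> V (%p. s p + t p) = \<ominus>\<^bsub>sect E V\<^esub> \<phi> V s \<oplus>\<^bsub>sect E V\<^esub> \<ominus>\<^bsub>sect E V\<^esub> \<phi> V t"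
   if t: "t : line_sections e (- D) V" for t
   unfolding P(2)[OF s t] using P(1)[OF s] P(1)[OF t] by (rule V.minus_add)
  show "\<ominus>\<^bsub>sect E V\<^esub> \<phi> V (%p. f p * s p) = f \<odot>\<^bsub>sect E V\<^esub> (\<ominus>\<^bsub>sect E V\<^esub> \<phi> V s)"
   if f: "f : line_sections e 0 V" for f
   unfolding P(3)[OF f s] using V.smult_r_minus[of f "\<phi> V s"] f P(1)[OF s] by (simp add: OX_simps)
  show "\<ominus>\<^bsub>sect E W\<^esub> \<phi> W (ext W s) = rest E V W (\<ominus>\<^bsub>sect E V\<^esub> \<phi> V s)" if W: "zopen e W" "W <= V" for W
   unfolding P(4)[OF W s] using ab_presheaf_rest_neg[OF abE V(1) W P(1)[OF s]] by simp
 qed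
 note S = twist_simps twdom_def neg_def
 note gr = abelian_groupE(4)[OF ab] abelian_groupE(3)[OF ab] abelian_groupE(5)[OF ab] abelian_group.l_neg[OF ab]
 have negl: "neg U x \<oplus>\<^bsub>sect ?F U\<^esub> x = \<zero>\<^bsub>sect ?F U\<^esub>" if x: "x : carrier (sect ?F U)" for U x
  by (rule twist_eqI[OF addc[OF negc[OF x] x] zeroc]) (simp add: S gr(4) twistD(1)[OF x])
 have AG: "abelian_group (sect ?F U)" for U
 proof (rule abelian_groupI)
  fix x y z assume x: "x : carrier (sect ?F U)" and y: "y : carrier (sect ?F U)"
  show "x \<oplus>\<^bsub>sect ?F U\<^esub> y : carrier (sect ?F U)" by (rule addc[OF x y])
  show "x \<oplus>\<^bsub>sect ?F U\<^esub> y = y \<oplus>\<^bsub>sect ?F U\<^esub> x"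
   by (rule twist_eqI[OF addc[OF x y] addc[OF y x]]) (simp add: S gr(1) twistD(1)[OF x] twistD(1)[OF y])
  assume z: "z : carrier (sect ?F U)"
  show "x \<oplus>\<^bsub>sect ?F U\<^esub> y \<oplus>\<^bsub>sect ?F U\<^esub> z = x \<oplus>\<^bsub>sect ?F U\<^esub> (y \<oplus>\<^bsub>sect ?F U\<^esub> z)"
   by (rule twist_eqI[OF addc[OF addc[OF x y] z] addc[OF x addc[OF y z]]])
    (simp add: S gr(2) twistD(1)[OF x] twistD(1)[OF y] twistD(1)[OF z])
 next
  fix x assume x: "x : carrier (sect ?F U)"
  show "\<zero>\<^bsub>sect ?F U\<^esub> \<oplus>\<^bsub>sect ?F U\<^esub> x = x"
   by (rule twist_eqI[OF addc[OF zeroc x] x]) (simp add: S gr(3) twistD(1)[OF x])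
  show "EX y:carrier (sect ?F U). y \<oplus>\<^bsub>sect ?F U\<^esub> x = \<zero>\<^bsub>sect ?F U\<^esub>" using negl[OF x] negc[OF x] by blast
 qed (rule zeroc)
 show "ab_presheaf e ?F" unfolding ab_presheaf_def
 proof (intro conjI allI impI ballI AG; (elim conjE)?)
  fix U V \<phi> assume U: "zopen e U" and V: "zopen e V" "V <= U" and \<phi>: "\<phi> : carrier (sect ?F U)"
  show "rest ?F U V \<phi> : carrier (sect ?F V)"
   unfolding twist_simps(4) by (rule twistI) (use V twistD[OF \<phi>] in \<open>meson order_trans\<close>)+
  fix \<psi> assume "\<psi> : carrier (sect ?F U)"
  show "rest ?F U V (\<phi> \<oplus>\<^bsub>sect ?F U\<^esub> \<psi>) = rest ?F U V \<phi> \<oplus>\<^bsub>sect ?F V\<^esub> rest ?F U V \<psi>"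
   using V(2) by (auto simp: twist_simps twdom_def fun_eq_iff)
 next
  fix U V W :: "'k pointset" and \<phi> assume "V <= U" "W <= V"
  thus "rest ?F V W (rest ?F U V \<phi>) = rest ?F U W \<phi>"
   by (auto simp: twist_simps twdom_def fun_eq_iff)
 qed
 assume U: "zopen e U" and \<phi>: "\<phi> : carrier (sect ?F U)" and V: "zopen e V" "V <= U" and s: "s : line_sections e (- D) V"
 interpret F: abelian_group "sect ?F U" by (rule AG)
 have "\<ominus>\<^bsub>sect ?F U\<^esub> \<phi> = neg U \<phi>" by (rule F.minus_equality[OF negl[OF \<phi>] \<phi> negc[OF \<phi>]])
 thus "(\<ominus>\<^bsub>sect ?F U\<^esub> \<phi>) V s = \<ominus>\<^bsub>sect E V\<^esub> \<phi> V s" using V s by (simp add: neg_def twdom_def)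
qed

lemma vs_reg:
 assumes "zopen e V" "V <= U" "reg e (A + D) (\<Union>U) v" "s : line_sections e (- D) V"
 shows "reg e A (\<Union>V) (%p. v p * s p)"
proof -
 have "reg e (A + D + - D) (\<Union>V) (%p. v p * s p)"
  by (rule reg_mult[OF reg_Int[OF assms(3,1,2)] line_sectionsD(1)[OF assms(1,4)]])
 thus ?thesis by simp
qed

lemma kernelD:
 assumes "is_kernel e F G \<psi> E j"
 shows "is_msheaf e E" "is_mor e E F j" "!!U. zopen e U ==> inj_on (j U) (carrier (sect E U))"
  "!!U s. zopen e U ==> s : carrier (sect F U) ==> \<psi> U s = \<zero>\<^bsub>sect G U\<^esub> \<longleftrightarrow> s : j U ` carrier (sect E U)"
 using assms unfolding is_kernel_def injective_mor_def by blast+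

locale matrix_kernel =
 fixes e :: nat and As Bs :: "divclass list"
  and \<psi> :: "('k::{alg_closed_field, field_char_0}, nat => 'k cox => 'k, nat => 'k cox => 'k) mor"
  and E :: "('k, 'm) msheaf" and j :: "('k, 'm, nat => 'k cox => 'k) mor" and M :: "nat => nat => 'k cox => 'k"
 assumes ker: "is_kernel e (split_bundle e As) (split_bundle e Bs) \<psi> E j"
  and M_form: "!!l k. l < length Bs ==> k < length As ==> cox_form e (Bs ! l - As ! k) (M l k)"
  and M_eq: "!!U v. zopen e U ==> (!!k. k < length As ==> reg e (As ! k) (\<Union>U) (v k)) ==>
    \<psi> U (tup (length As) U v) = tup (length Bs) U (%l p. SUM k<length As. M l k p * v k p)"
begin

lemmas E = kernelD(1)[OF ker] and j_mor = kernelD(2)[OF ker] and j_inj = kernelD(3)[OF ker]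

abbreviation "n == length As"
abbreviation "m == length Bs"

lemma j_ex:
 assumes U: "zopen e U" and x: "x : carrier (sect E U)"
 obtains v where "!!k. k < n ==> reg e (As ! k) (\<Union>U) (v k)" "j U x = tup n U v"
  "!!l p. l < m ==> p : \<Union>U ==> (SUM k<n. M l k p * v k p) = 0"
proof -
 have c: "j U x : carrier (sect (split_bundle e As) U)" by (rule is_morD(1)[OF j_mor U zopen_hirz[OF U] x])
 then obtain v where v: "!!k. k < n ==> reg e (As ! k) (\<Union>U) (v k)" "j U x = tup n U v"
  by (rule tup_ex[OF U]) (rule that, assumption+)
 have Mv: "\<psi> U (tup n U v) = tup m U (%l p. SUM k<n. M l k p * v k p)" by (rule M_eq[OF U v(1)])
 have "\<psi> U (j U x) = \<zero>\<^bsub>sect (split_bundle e Bs) U\<^esub>" using kernelD(4)[OF ker U c] x by blast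
 hence "tup m U (%l p. SUM k<n. M l k p * v k p) = tup m U (%k p. 0)"
  unfolding v(2) Mv tup_zero .
 hence "ALL l<m. ALL p:\<Union>U. (SUM k<n. M l k p * v k p) = 0" unfolding tup_eq .
 thus ?thesis by (intro that[OF v]) blast+
qed

lemma j_surj:
 assumes U: "zopen e U" and v: "!!k. k < n ==> reg e (As ! k) (\<Union>U) (v k)"
  and z: "!!l p. l < m ==> p : \<Union>U ==> (SUM k<n. M l k p * v k p) = 0"
 shows "EX x:carrier (sect E U). j U x = tup n U v"
proof -
 have Mv: "\<psi> U (tup n U v) = tup m U (%l p. SUM k<n. M l k p * v k p)" by (rule M_eq[OF U v])
 have "\<psi> U (tup n U v) = \<zero>\<^bsub>sect (split_bundle e Bs) U\<^esub>"
  unfolding Mv tup_zero by (rule tup_cong) (rule z)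
 thus ?thesis using kernelD(4)[OF ker U tup_in[OF U v]] by (metis imageE)
qed

text \<open>A section of the twist is a morphism from O(-D) to E. Followed by j it is multiplication
  by a vector whose k-th entry has degree \<open>As ! k + D\<close>, and this vector is the
  presentation.\<close>

definition rep :: "divclass => 'k pointset => ('k, 'k cox => 'k, 'm) mor => (nat => 'k cox => 'k) => bool" where
 "rep D U \<phi> v \<longleftrightarrow> \<phi> : carrier (sect (twist e D E) U) & (ALL k<n. reg e (As ! k + D) (\<Union>U) (v k)) &
   (ALL V s. zopen e V --> V <= U --> s : line_sections e (- D) V --> j V (\<phi> V s) = tup n V (%k p. v k p * s p))"

lemma repD:
 assumes "rep D U \<phi> v"
 shows "\<phi> : carrier (sect (twist e D E) U)" "k < n ==> reg e (As ! k + D) (\<Union>U) (v k)"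
  "zopen e V ==> V <= U ==> s : line_sections e (- D) V ==> j V (\<phi> V s) = tup n V (%k p. v k p * s p)"
 using assms unfolding rep_def by blast+

lemma rep_neg:
 assumes U: "zopen e U" and r: "rep D U \<phi> v"
 shows "rep D U (\<ominus>\<^bsub>sect (twist e D E) U\<^esub> \<phi>) (%k p. - v k p)"
proof -
 interpret G: abelian_group "sect (twist e D E) U" by (rule ab_presheafD(1)[OF twist_ab(1)[OF E] U])
 note \<phi> = repD(1)[OF r]
 have "j V ((\<ominus>\<^bsub>sect (twist e D E) U\<^esub> \<phi>) V s) = tup n V (%k p. - v k p * s p)"
  if V: "zopen e V" "V <= U" and s: "s : line_sections e (- D) V" for V s
 proof -
  have x: "\<phi> V s : carrier (sect E V)" by (rule twistD(1)[OF \<phi> V s])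
  have "j V ((\<ominus>\<^bsub>sect (twist e D E) U\<^esub> \<phi>) V s) = j V (\<ominus>\<^bsub>sect E V\<^esub> \<phi> V s)"
   by (simp add: twist_ab(2)[OF E U \<phi> V s])
  also have "... = \<ominus>\<^bsub>sect (split_bundle e As) V\<^esub> j V (\<phi> V s)"
   by (rule mor_neg[OF j_mor V(1) zopen_hirz[OF V(1)] ab_presheafD(1)[OF msheaf_ab[OF E] V(1)] split_abelian(1)[OF V(1)] x])
  also have "... = tup n V (%k p. - (v k p * s p))"
   unfolding repD(3)[OF r V s] by (rule split_abelian(2)[OF V(1)]) (rule vs_reg[OF V repD(2)[OF r] s])
  finally show ?thesis by simp
 qed
 thus ?thesis unfolding rep_def using \<phi> repD(2)[OF r] by (intro conjI allI impI reg_uminus) (simp_all add: G.a_inv_closed)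
qed

lemma rep_add:
 assumes U: "zopen e U" and r: "rep D U \<phi> v" "rep D U \<chi> w"
 shows "rep D U (\<phi> \<oplus>\<^bsub>sect (twist e D E) U\<^esub> \<chi>) (%k p. v k p + w k p)"
proof -
 interpret G: abelian_group "sect (twist e D E) U" by (rule ab_presheafD(1)[OF twist_ab(1)[OF E] U])
 note \<phi> = repD(1)[OF r(1)] and \<chi> = repD(1)[OF r(2)]
 have "j V ((\<phi> \<oplus>\<^bsub>sect (twist e D E) U\<^esub> \<chi>) V s) = tup n V (%k p. (v k p + w k p) * s p)"
  if V: "zopen e V" "V <= U" and s: "s : line_sections e (- D) V" for V s
 proof -
  have x: "\<phi> V s : carrier (sect E V)" "\<chi> V s : carrier (sect E V)" by (rule twistD(1)[OF \<phi> V s] twistD(1)[OF \<chi> V s])+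
  have "j V ((\<phi> \<oplus>\<^bsub>sect (twist e D E) U\<^esub> \<chi>) V s) = j V (\<phi> V s \<oplus>\<^bsub>sect E V\<^esub> \<chi> V s)"
   using V s by (simp add: twist_simps twdom_def)
  also have "... = j V (\<phi> V s) \<oplus>\<^bsub>sect (split_bundle e As) V\<^esub> j V (\<chi> V s)"
   by (rule is_morD(2)[OF j_mor V(1) zopen_hirz[OF V(1)] x])
  also have "... = tup n V (%k p. v k p * s p + w k p * s p)"
   unfolding repD(3)[OF r(1) V s] repD(3)[OF r(2) V s] by (rule tup_add)
  finally show ?thesis by (simp add: distrib_right)
 qed
 thus ?thesis unfolding rep_def using G.a_closed[OF \<phi> \<chi>] repD(2)[OF r(1)] repD(2)[OF r(2)] by (intro conjI allI impI reg_add) simp_all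
qed

lemma rep_rest:
 assumes U: "zopen e U" and V: "zopen e V" "V <= U" and r: "rep D U \<phi> v"
 shows "rep D V (rest (twist e D E) U V \<phi>) v"
proof -
 have "rest (twist e D E) U V \<phi> : carrier (sect (twist e D E) V)"
  by (rule ab_presheafD(2)[OF twist_ab(1)[OF E] U V repD(1)[OF r]])
 moreover have "j W (rest (twist e D E) U V \<phi> W s) = tup n W (%k p. v k p * s p)"
  if W: "zopen e W" "W <= V" and s: "s : line_sections e (- D) W" for W s
 proof -
  have "rest (twist e D E) U V \<phi> W s = \<phi> W s" using W s by (simp add: twist_simps twdom_def)
  thus ?thesis using repD(3)[OF r W(1) order_trans[OF W(2) V(2)] s] by simp
 qed
 ultimately show ?thesis unfolding rep_def using reg_Int[OF repD(2)[OF r] V] by blast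
qed

lemma rep_uniq:
 assumes U: "zopen e U" and r: "rep D U \<phi> v" "rep D U \<phi> w" and k: "k < n" and p: "p : \<Union>U"
 shows "v k p = w k p"
proof -
 obtain V s where V: "zopen e V" "p : \<Union>V" "V <= U" "s : line_sections e (- D) V" "s p ~= 0" by (rule line_test[OF U p])
 have "tup n V (%k p. v k p * s p) = tup n V (%k p. w k p * s p)"
  using repD(3)[OF r(1) V(1,3,4)] repD(3)[OF r(2) V(1,3,4)] by simp
 from tup_eqD[OF this k V(2)] show ?thesis using V(5) by simp
qed

lemma rep_ker:
 assumes U: "zopen e U" and r: "rep D U \<phi> v" and l: "l < m" and p: "p : \<Union>U"
 shows "(SUM k<n. M l k p * v k p) = 0"
proof -
 obtain V s where V: "zopen e V" "p : \<Union>V" "V <= U" "s : line_sections e (- D) V" "s p ~= 0" by (rule line_test[OF U p])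
 obtain w where w: "j V (\<phi> V s) = tup n V w" "!!l p. l < m ==> p : \<Union>V ==> (SUM k<n. M l k p * w k p) = 0"
  by (rule j_ex[OF V(1) twistD(1)[OF repD(1)[OF r] V(1,3,4)]]) (rule that, assumption+)
 have "tup n V w = tup n V (%k p. v k p * s p)" using repD(3)[OF r V(1,3,4)] w(1) by simp
 from tup_eqD[OF this _ V(2)] have "(SUM k<n. M l k p * v k p) * s p = (SUM k<n. M l k p * w k p)"
  unfolding sum_distrib_right by (intro sum.cong refl) simp
 thus ?thesis using w(2)[OF l V(2)] V(5) by simp
qed

lemma rep_ex:
 assumes U: "zopen e U" and \<phi>: "\<phi> : carrier (sect (twist e D E) U)"
 shows "EX v. rep D U \<phi> v"
proof -
 have "is_mor_on e U (OX e (- D)) E \<phi>" using \<phi> by (simp add: twist_simps)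
 from mor_comp[OF this mor_on_subset[OF j_mor zopen_hirz[OF U]]]
 obtain v where "!!k. k < n ==> reg e (As ! k - - D) (\<Union>U) (v k)"
  "!!V s. zopen e V ==> V <= U ==> s : line_sections e (- D) V ==> j V (\<phi> V s) = tup n V (%k p. v k p * s p)"
  by (rule line_mor[OF U]) (rule that, assumption+)
 thus ?thesis unfolding rep_def using \<phi> by (intro exI[of _ v]) simp
qed

lemma rep_surj:
 assumes U: "zopen e U" and v: "!!k. k < n ==> reg e (As ! k + D) (\<Union>U) (v k)"
  and z: "!!l p. l < m ==> p : \<Union>U ==> (SUM k<n. M l k p * v k p) = 0"
 shows "EX \<phi>. rep D U \<phi> v"
proof -
 let ?v = "%V s. tup n V (%k p. v k p * s p)"
 define g where "g V s = inv_into (carrier (sect E V)) (j V) (?v V s)" for V s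
 have im: "?v V s : j V ` carrier (sect E V)" if V: "zopen e V" "V <= U" and s: "s : line_sections e (- D) V" for V s
 proof -
  have "EX x:carrier (sect E V). j V x = ?v V s"
  proof (rule j_surj[OF V(1)])
   show "reg e (As ! k) (\<Union>V) (%p. v k p * s p)" if "k < n" for k by (rule vs_reg[OF V v[OF that] s])
   fix l p assume "l < m" "p : \<Union>V"
   moreover have "p : \<Union>U" using calculation V(2) by blast
   moreover have "(SUM k<n. M l k p * (v k p * s p)) = (SUM k<n. M l k p * v k p) * s p"
    by (simp add: sum_distrib_right mult.assoc)
   ultimately show "(SUM k<n. M l k p * (v k p * s p)) = 0" using z by simp
  qed
  thus ?thesis by (metis imageI)
 qed
 have "is_mor_on e U (OX e (- D)) E g" unfolding g_def
  by (rule mor_lift[OF mor_on_subset[OF j_mor zopen_hirz[OF U]] j_inj E vector_mor[OF v]]) (simp_all add: OX_simps im)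
 from twist_in[OF this] have "rep D U (%V s. if twdom e D U V s then g V s else undefined) v"
  unfolding rep_def using v f_inv_into_f[OF im] by (simp add: twdom_def g_def)
 thus ?thesis by blast
qed

lemma rep_eq:
 assumes U: "zopen e U" and r: "rep D U \<phi> v" "rep D U \<chi> w"
  and eq: "!!k p. k < n ==> p : \<Union>U ==> v k p = w k p"
 shows "\<phi> = \<chi>"
proof (rule twist_eqI[OF repD(1)[OF r(1)] repD(1)[OF r(2)]])
 fix V s assume V: "zopen e V" "V <= U" and s: "s : line_sections e (- D) V"
 have "tup n V (%k p. v k p * s p) = tup n V (%k p. w k p * s p)"
 proof (rule tup_cong)
  fix k p assume "k < n" "p : \<Union>V"
  moreover have "p : \<Union>U" using calculation V(2) by blast
  ultimately show "v k p * s p = w k p * s p" using eq by simp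
 qed
 hence "j V (\<phi> V s) = j V (\<chi> V s)" using repD(3)[OF r(1) V s] repD(3)[OF r(2) V s] by simp
 thus "\<phi> V s = \<chi> V s"
  using j_inj[OF V(1)] twistD(1)[OF repD(1)[OF r(1)] V s] twistD(1)[OF repD(1)[OF r(2)] V s] unfolding inj_on_def by blast
qed

theorem twist_kernel_sheaf:
 "kernel_sheaf e (twist e D E) n (%k. As ! k + D) (rep D) m (%l. Bs ! l + D) M"
proof
 show "ab_presheaf e (twist e D E)" by (rule twist_ab(1)[OF E])
 show "cox_form e ((Bs ! l + D) - (As ! k + D)) (M l k)" if "l < m" "k < n" for l k
  using M_form[OF that] by simp
qed (rule repD rep_add rep_neg rep_rest rep_ex rep_eq rep_uniq rep_ker rep_surj; assumption)+

end

lemma cokernelD: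
 assumes "is_cokernel e F G \<phi> E q"
 shows "is_msheaf e E" "is_mor e G E q"
  "!!U t. zopen e U ==> t : carrier (sect E U) ==> locally_in_image e G E q U t"
  "!!U t. zopen e U ==> t : carrier (sect G U) ==> q U t = \<zero>\<^bsub>sect E U\<^esub> \<longleftrightarrow> locally_in_image e F G \<phi> U t"
 using assms unfolding is_cokernel_def surjective_mor_def by blast+

lemma locally_in_imageD:
 assumes "locally_in_image e F G \<phi> U t" "p : \<Union>U"
 obtains V s where "zopen e V" "p : \<Union>V" "V <= U" "s : carrier (sect F V)" "\<phi> V s = rest G U V t"
proof -
 obtain P where P: "P : U" "p : P" using assms(2) by blast
 then obtain V s where V: "zopen e V" "P : V" "V <= U" "s : carrier (sect F V)" "\<phi> V s = rest G U V t"
  using assms(1) unfolding locally_in_image_def by blast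
 show ?thesis by (rule that[OF V(1) _ V(3-5)]) (use P V in blast)
qed

locale matrix_coker =
 fixes e :: nat and As Bs :: "divclass list"
  and \<phi> :: "('k::{alg_closed_field, field_char_0}, nat => 'k cox => 'k, nat => 'k cox => 'k) mor"
  and E :: "('k, 'm) msheaf" and q :: "('k, nat => 'k cox => 'k, 'm) mor" and M :: "nat => nat => 'k cox => 'k"
 assumes inj: "injective_mor e (split_bundle e As) \<phi>"
  and coker: "is_cokernel e (split_bundle e As) (split_bundle e Bs) \<phi> E q"
  and M_form: "!!k i. k < length Bs ==> i < length As ==> cox_form e (Bs ! k - As ! i) (M k i)"
  and M_eq: "!!U a. zopen e U ==> (!!i. i < length As ==> reg e (As ! i) (\<Union>U) (a i)) ==>
    \<phi> U (tup (length As) U a) = tup (length Bs) U (%k p. SUM i<length As. M k i p * a i p)"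
begin

lemmas E = cokernelD(1)[OF coker] and q_mor = cokernelD(2)[OF coker]

abbreviation "n == length Bs"
abbreviation "m == length As"

lemma q_in:
 assumes "zopen e U" "!!k. k < n ==> reg e (Bs ! k) (\<Union>U) (v k)"
 shows "q U (tup n U v) : carrier (sect E U)"
 by (rule is_morD(1)[OF q_mor assms(1) zopen_hirz[OF assms(1)] tup_in[OF assms]])

lemma q_add:
 assumes U: "zopen e U" and v: "!!k. k < n ==> reg e (Bs ! k) (\<Union>U) (v k)" and w: "!!k. k < n ==> reg e (Bs ! k) (\<Union>U) (w k)"
 shows "q U (tup n U (%k p. v k p + w k p)) = q U (tup n U v) \<oplus>\<^bsub>sect E U\<^esub> q U (tup n U w)"
 using is_morD(2)[OF q_mor U zopen_hirz[OF U] tup_in[OF U v] tup_in[OF U w]] unfolding tup_add .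

lemma q_neg:
 assumes U: "zopen e U" and v: "!!k. k < n ==> reg e (Bs ! k) (\<Union>U) (v k)"
 shows "q U (tup n U (%k p. - v k p)) = \<ominus>\<^bsub>sect E U\<^esub> q U (tup n U v)"
proof -
 have "\<ominus>\<^bsub>sect (split_bundle e Bs) U\<^esub> tup n U v = tup n U (%k p. - v k p)"
  by (rule split_abelian(2)[OF U v])
 thus ?thesis
  using mor_neg[OF q_mor U zopen_hirz[OF U] split_abelian(1)[OF U] ab_presheafD(1)[OF msheaf_ab[OF E] U] tup_in[OF U v]] by simp
qed

lemma Ma_reg:
 assumes "opn e A" "!!l. l < m ==> reg e (As ! l) A (v l)" "k < n"
 shows "reg e (Bs ! k) A (%p. SUM l<m. M k l p * v l p)"
 by (rule form_comb_reg[OF assms(1) M_form[OF assms(3)] assms(2)])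

lemma q_img:
 assumes U: "zopen e U" and a: "!!i. i < m ==> reg e (As ! i) (\<Union>U) (a i)"
 shows "q U (tup n U (%k p. SUM i<m. M k i p * a i p)) = \<zero>\<^bsub>sect E U\<^esub>"
proof -
 have c: "tup n U (%k p. SUM i<m. M k i p * a i p) : carrier (sect (split_bundle e Bs) U)"
  by (rule tup_in[OF U Ma_reg[OF zopen_opn[OF U] a]])
 have eq: "\<phi> U (tup m U a) = tup n U (%k p. SUM i<m. M k i p * a i p)" by (rule M_eq[OF U a])
 have "locally_in_image e (split_bundle e As) (split_bundle e Bs) \<phi> U (tup n U (%k p. SUM i<m. M k i p * a i p))"
  unfolding locally_in_image_def
 proof
  fix P assume "P : U"
  moreover have "tup m U a : carrier (sect (split_bundle e As) U)" by (rule tup_in[OF U a])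
  ultimately show "EX V. zopen e V & P : V & V <= U & (EX s:carrier (sect (split_bundle e As) V).
    \<phi> V s = rest (split_bundle e Bs) U V (tup n U (%k p. SUM i<m. M k i p * a i p)))"
   using U eq by (intro exI[of _ U] conjI bexI[of _ "tup m U a"]) (simp_all add: tup_rest)
 qed
 thus ?thesis using cokernelD(4)[OF coker U c] by blast
qed

text \<open>Local preimages under the matrix glue, since injectivity makes them unique.\<close>

lemma glue_preimage:
 assumes U: "zopen e U"
  and loc: "!!p. p : \<Union>U ==> EX W a. zopen e W & p : \<Union>W & W <= U & (ALL i<m. reg e (As ! i + D) (\<Union>W) (a i)) &
   (ALL k<n. ALL p:\<Union>W. d k p = (SUM i<m. M k i p * a i p))"
 shows "EX a. (ALL i<m. reg e (As ! i + D) (\<Union>U) (a i)) & (ALL k<n. ALL p:\<Union>U. d k p = (SUM i<m. M k i p * a i p))"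
proof -
 define C where "C W a \<longleftrightarrow> zopen e W & W <= U & (ALL i<m. reg e (As ! i + D) (\<Union>W) (a i)) &
   (ALL k<n. ALL p:\<Union>W. d k p = (SUM i<m. M k i p * a i p))" for W a
 have CD: "zopen e W" "W <= U" "i < m ==> reg e (As ! i + D) (\<Union>W) (a i)"
  "k < n ==> p : \<Union>W ==> d k p = (SUM i<m. M k i p * a i p)" if "C W a" for W a i k p
  using that unfolding C_def by blast+
 have ex: "EX W a. C W a & p : \<Union>W" if p: "p : \<Union>U" for p
  using loc[OF that] unfolding C_def by blast
 have eq: "a l p = a' l p" if C: "C W a" "C W' a'" and l: "l < m" and p: "p : \<Union>W" "p : \<Union>W'" for W a W' a' l p
 proof -
  note Z = CD(1)[OF C(1)] CD(1)[OF C(2)]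
  have "p : \<Union>(W Int W')" unfolding zopen_Union_Int[OF Z] using p by (rule IntI)
  then obtain N t where N: "zopen e N" "p : \<Union>N" "N <= W Int W'" "t : line_sections e (- D) N" "t p ~= 0"
   by (rule line_test[OF zopen_Int[OF Z]])
  have NW: "N <= W" "N <= W'" using N(3) by blast+
  have r: "reg e (As ! i) (\<Union>N) (%p. a i p * t p)" "reg e (As ! i) (\<Union>N) (%p. a' i p * t p)" if "i < m" for i
   using vs_reg[OF N(1) NW(1) CD(3)[OF C(1) that] N(4)] vs_reg[OF N(1) NW(2) CD(3)[OF C(2) that] N(4)] .
  have "\<phi> N (tup m N (%i p. a i p * t p)) = tup n N (%k p. SUM i<m. M k i p * (a i p * t p))"
   by (rule M_eq[OF N(1) r(1)])
  also have "... = tup n N (%k p. SUM i<m. M k i p * (a' i p * t p))"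
  proof (rule tup_cong)
   fix k x assume k: "k < n" and x: "x : \<Union>N"
   have "x : \<Union>W" "x : \<Union>W'" using x NW by blast+
   hence "(SUM i<m. M k i x * a i x) * t x = (SUM i<m. M k i x * a' i x) * t x" using CD(4)[OF C(1) k] CD(4)[OF C(2) k] by metis
   thus "(SUM i<m. M k i x * (a i x * t x)) = (SUM i<m. M k i x * (a' i x * t x))"
    by (simp add: sum_distrib_right mult.assoc)
  qed
  also have "... = \<phi> N (tup m N (%i p. a' i p * t p))" by (rule M_eq[OF N(1) r(2), symmetric])
  finally have "tup m N (%i p. a i p * t p) = tup m N (%i p. a' i p * t p)"
   using inj tup_in[OF N(1), of As "%i p. a i p * t p", OF r(1)] tup_in[OF N(1), of As "%i p. a' i p * t p", OF r(2)] N(1)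
   unfolding injective_mor_def inj_on_def by simp
  from tup_eqD[OF this l N(2)] show ?thesis using N(5) by simp
 qed
 obtain b where b: "!!i. i < m ==> reg e (As ! i + D) (\<Union>U) (b i)" "!!W a i p. C W a ==> i < m ==> p : \<Union>W ==> b i p = a i p"
  by (rule glue_reg[where C = C and D = "%i. As ! i + D" and n = m]) (rule ex CD(2,3) eq that, assumption+)+
 have "d k p = (SUM i<m. M k i p * b i p)" if k: "k < n" and p: "p : \<Union>U" for k p
 proof -
  obtain W a where C: "C W a" "p : \<Union>W" using ex p by blast
  show ?thesis unfolding CD(4)[OF C(1) k C(2)] by (intro sum.cong refl) (simp add: b(2)[OF C(1) _ C(2)])
 qed
 thus ?thesis using b(1) by blast
qed

lemma q_eqD:
 assumes U: "zopen e U" and v: "!!k. k < n ==> reg e (Bs ! k) (\<Union>U) (v k)" and w: "!!k. k < n ==> reg e (Bs ! k) (\<Union>U) (w k)"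
  and eq: "q U (tup n U v) = q U (tup n U w)"
 shows "EX a. (ALL i<m. reg e (As ! i) (\<Union>U) (a i)) & (ALL k<n. ALL p:\<Union>U. v k p - w k p = (SUM i<m. M k i p * a i p))"
proof -
 interpret G: abelian_group "sect E U" by (rule ab_presheafD(1)[OF msheaf_ab[OF E] U])
 define d where "d k p = v k p - w k p" for k p
 have d: "reg e (Bs ! k) (\<Union>U) (d k)" if "k < n" for k unfolding d_def using v w that by (intro reg_diff)
 have "q U (tup n U (%k p. v k p + - w k p)) = q U (tup n U v) \<oplus>\<^bsub>sect E U\<^esub> q U (tup n U (%k p. - w k p))"
  by (rule q_add[OF U v reg_uminus[OF w]])
 also have "q U (tup n U (%k p. - w k p)) = \<ominus>\<^bsub>sect E U\<^esub> q U (tup n U w)" by (rule q_neg[OF U w])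
 also have "q U (tup n U v) \<oplus>\<^bsub>sect E U\<^esub> \<ominus>\<^bsub>sect E U\<^esub> q U (tup n U w) = \<zero>\<^bsub>sect E U\<^esub>"
  unfolding eq using q_in[OF U w] by (rule G.r_neg)
 finally have "q U (tup n U d) = \<zero>\<^bsub>sect E U\<^esub>" by (simp add: d_def[abs_def])
 hence L: "locally_in_image e (split_bundle e As) (split_bundle e Bs) \<phi> U (tup n U d)"
  using cokernelD(4)[OF coker U tup_in[OF U d]] by blast
 have "EX a. (ALL i<m. reg e (As ! i + 0) (\<Union>U) (a i)) & (ALL k<n. ALL p:\<Union>U. d k p = (SUM i<m. M k i p * a i p))"
 proof (rule glue_preimage[OF U])
  fix p assume p: "p : \<Union>U"
  obtain W s where W: "zopen e W" "p : \<Union>W" "W <= U" "s : carrier (sect (split_bundle e As) W)"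
    "\<phi> W s = rest (split_bundle e Bs) U W (tup n U d)" by (rule locally_in_imageD[OF L p])
  obtain a where a: "!!i. i < m ==> reg e (As ! i) (\<Union>W) (a i)" "s = tup m W a"
   by (rule tup_ex[OF W(1,4)]) (rule that, assumption+)
  have "tup n W d = tup n W (%k p. SUM i<m. M k i p * a i p)"
   using W(5) M_eq[OF W(1) a(1)] unfolding a(2) tup_rest[OF W(3)] by simp
  hence "ALL k<n. ALL p:\<Union>W. d k p = (SUM i<m. M k i p * a i p)" unfolding tup_eq .
  thus "EX W a. zopen e W & p : \<Union>W & W <= U & (ALL i<m. reg e (As ! i + 0) (\<Union>W) (a i)) &
   (ALL k<n. ALL p:\<Union>W. d k p = (SUM i<m. M k i p * a i p))" using W(1-3) a(1) unfolding add_0_right by blast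
 qed
 thus ?thesis unfolding add_0_right d_def .
qed

text \<open>The morphism from O(-D) to E is required to factor as multiplication by v followed by q.
  Such a factorisation need not exist over all of U, and it is unique only up to the image of the
  matrix.\<close>

definition rep :: "divclass => 'k pointset => ('k, 'k cox => 'k, 'm) mor => (nat => 'k cox => 'k) => bool" where
 "rep D U x v \<longleftrightarrow> x : carrier (sect (twist e D E) U) & (ALL k<n. reg e (Bs ! k + D) (\<Union>U) (v k)) &
   (ALL V s. zopen e V --> V <= U --> s : line_sections e (- D) V --> x V s = q V (tup n V (%k p. v k p * s p)))"

lemma repD:
 assumes "rep D U x v"
 shows "x : carrier (sect (twist e D E) U)" "k < n ==> reg e (Bs ! k + D) (\<Union>U) (v k)"
  "zopen e V ==> V <= U ==> s : line_sections e (- D) V ==> x V s = q V (tup n V (%k p. v k p * s p))"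
 using assms unfolding rep_def by blast+

lemma rep_neg:
 assumes U: "zopen e U" and r: "rep D U x v"
 shows "rep D U (\<ominus>\<^bsub>sect (twist e D E) U\<^esub> x) (%k p. - v k p)"
proof -
 interpret G: abelian_group "sect (twist e D E) U" by (rule ab_presheafD(1)[OF twist_ab(1)[OF E] U])
 note x = repD(1)[OF r]
 have "(\<ominus>\<^bsub>sect (twist e D E) U\<^esub> x) V s = q V (tup n V (%k p. - v k p * s p))"
  if V: "zopen e V" "V <= U" and s: "s : line_sections e (- D) V" for V s
 proof -
  have "q V (tup n V (%k p. - (v k p * s p))) = \<ominus>\<^bsub>sect E V\<^esub> q V (tup n V (%k p. v k p * s p))"
   by (rule q_neg[OF V(1)]) (rule vs_reg[OF V repD(2)[OF r] s])
  thus ?thesis using twist_ab(2)[OF E U x V s] repD(3)[OF r V s] by simp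
 qed
 thus ?thesis unfolding rep_def using x repD(2)[OF r] by (intro conjI allI impI reg_uminus) (simp_all add: G.a_inv_closed)
qed

lemma rep_add:
 assumes U: "zopen e U" and r: "rep D U x v" "rep D U y w"
 shows "rep D U (x \<oplus>\<^bsub>sect (twist e D E) U\<^esub> y) (%k p. v k p + w k p)"
proof -
 interpret G: abelian_group "sect (twist e D E) U" by (rule ab_presheafD(1)[OF twist_ab(1)[OF E] U])
 note x = repD(1)[OF r(1)] and y = repD(1)[OF r(2)]
 have "(x \<oplus>\<^bsub>sect (twist e D E) U\<^esub> y) V s = q V (tup n V (%k p. (v k p + w k p) * s p))"
  if V: "zopen e V" "V <= U" and s: "s : line_sections e (- D) V" for V s
 proof -
  have "q V (tup n V (%k p. v k p * s p + w k p * s p)) = q V (tup n V (%k p. v k p * s p)) \<oplus>\<^bsub>sect E V\<^esub> q V (tup n V (%k p. w k p * s p))"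
   by (rule q_add[OF V(1)]) (rule vs_reg[OF V repD(2)[OF r(1)] s] vs_reg[OF V repD(2)[OF r(2)] s], assumption)+
  moreover have "(x \<oplus>\<^bsub>sect (twist e D E) U\<^esub> y) V s = x V s \<oplus>\<^bsub>sect E V\<^esub> y V s"
   using V s by (simp add: twist_simps twdom_def)
  ultimately show ?thesis using repD(3)[OF r(1) V s] repD(3)[OF r(2) V s] by (simp add: distrib_right)
 qed
 thus ?thesis unfolding rep_def using G.a_closed[OF x y] repD(2)[OF r(1)] repD(2)[OF r(2)] by (intro conjI allI impI reg_add) simp_all
qed

lemma rep_rest:
 assumes U: "zopen e U" and V: "zopen e V" "V <= U" and r: "rep D U x v"
 shows "rep D V (rest (twist e D E) U V x) v"
proof -
 have "rest (twist e D E) U V x : carrier (sect (twist e D E) V)"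
  by (rule ab_presheafD(2)[OF twist_ab(1)[OF E] U V repD(1)[OF r]])
 moreover have "rest (twist e D E) U V x W s = q W (tup n W (%k p. v k p * s p))"
  if W: "zopen e W" "W <= V" and s: "s : line_sections e (- D) W" for W s
 proof -
  have "rest (twist e D E) U V x W s = x W s" using W s by (simp add: twist_simps twdom_def)
  thus ?thesis using repD(3)[OF r W(1) order_trans[OF W(2) V(2)] s] by simp
 qed
 ultimately show ?thesis unfolding rep_def using reg_Int[OF repD(2)[OF r] V] by blast
qed

lemma rep_ex:
 assumes U: "zopen e U" and v: "!!k. k < n ==> reg e (Bs ! k + D) (\<Union>U) (v k)"
 shows "EX x. rep D U x v"
proof -
 have "is_mor_on e U (OX e (- D)) E (%V s. q V (tup n V (%k p. v k p * s p)))"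
  by (rule mor_comp[OF vector_mor[OF v] mor_on_subset[OF q_mor zopen_hirz[OF U]]])
 from twist_in[OF this] have "rep D U (%V s. if twdom e D U V s then q V (tup n V (%k p. v k p * s p)) else undefined) v"
  unfolding rep_def using v by (simp add: twdom_def)
 thus ?thesis by blast
qed

lemma rep_eq:
 assumes U: "zopen e U" and r: "rep D U x v" "rep D U y w"
  and eq: "!!k p. k < n ==> p : \<Union>U ==> v k p = w k p"
 shows "x = y"
proof (rule twist_eqI[OF repD(1)[OF r(1)] repD(1)[OF r(2)]])
 fix V s assume V: "zopen e V" "V <= U" and s: "s : line_sections e (- D) V"
 have "tup n V (%k p. v k p * s p) = tup n V (%k p. w k p * s p)"
 proof (rule tup_cong)
  fix k p assume "k < n" "p : \<Union>V"
  moreover have "p : \<Union>U" using calculation V(2) by blast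
  ultimately show "v k p * s p = w k p * s p" using eq by simp
 qed
 thus "x V s = y V s" using repD(3)[OF r(1) V s] repD(3)[OF r(2) V s] by simp
qed

lemma rep_img:
 assumes U: "zopen e U" and r: "rep D U x v" and a: "!!i. i < m ==> reg e (As ! i + D) (\<Union>U) (a i)"
  and w: "!!k p. k < n ==> p : \<Union>U ==> w k p = v k p + (SUM i<m. M k i p * a i p)"
 shows "rep D U x w"
proof -
 have wr: "reg e (Bs ! k + D) (\<Union>U) (w k)" if k: "k < n" for k
 proof (rule reg_cong[OF _ w[OF k]])
  have "reg e (Bs ! k + D) (\<Union>U) (%p. SUM i<m. M k i p * a i p)"
   by (rule form_comb_reg[OF zopen_opn[OF U], where bd = "%i. As ! i + D", OF _ a]) (use M_form[OF k] in simp)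
  thus "reg e (Bs ! k + D) (\<Union>U) (%p. v k p + (SUM i<m. M k i p * a i p))" by (intro reg_add repD(2)[OF r k])
 qed
 moreover have "x V s = q V (tup n V (%k p. w k p * s p))" if V: "zopen e V" "V <= U" and s: "s : line_sections e (- D) V" for V s
 proof -
  interpret G: abelian_group "sect E V" by (rule ab_presheafD(1)[OF msheaf_ab[OF E] V(1)])
  have ar: "reg e (As ! i) (\<Union>V) (%p. a i p * s p)" if "i < m" for i by (rule vs_reg[OF V a[OF that] s])
  have "tup n V (%k p. w k p * s p) = tup n V (%k p. v k p * s p + (SUM i<m. M k i p * (a i p * s p)))"
  proof (rule tup_cong)
   fix k p assume k: "k < n" and p: "p : \<Union>V"
   hence "w k p = v k p + (SUM i<m. M k i p * a i p)" using w V(2) by blast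
   thus "w k p * s p = v k p * s p + (SUM i<m. M k i p * (a i p * s p))"
    by (simp add: distrib_right sum_distrib_right mult.assoc)
  qed
  moreover have "q V (tup n V (%k p. v k p * s p + (SUM i<m. M k i p * (a i p * s p)))) =
    q V (tup n V (%k p. v k p * s p)) \<oplus>\<^bsub>sect E V\<^esub> q V (tup n V (%k p. SUM i<m. M k i p * (a i p * s p)))"
   by (rule q_add[OF V(1) vs_reg[OF V repD(2)[OF r] s] Ma_reg[OF zopen_opn[OF V(1)] ar]])
  moreover have "q V (tup n V (%k p. SUM i<m. M k i p * (a i p * s p))) = \<zero>\<^bsub>sect E V\<^esub>"
   by (rule q_img[OF V(1) ar])
  ultimately have "q V (tup n V (%k p. w k p * s p)) = x V s"
   using repD(3)[OF r V s] twistD(1)[OF repD(1)[OF r] V s] by simp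
  thus ?thesis by simp
 qed
 ultimately show ?thesis unfolding rep_def using repD(1)[OF r] by blast
qed

text \<open>On a chart, evaluation at the generator of O(-D) reduces the claim to
  \<open>q_eqD\<close>; division by the generator restores the degree, and
  \<open>glue_preimage\<close> assembles the local solutions.\<close>

lemma rep_same:
 assumes U: "zopen e U" and r: "rep D U x v" "rep D U x w"
 shows "EX a. (ALL i<m. reg e (As ! i + D) (\<Union>U) (a i)) & (ALL k<n. ALL p:\<Union>U. v k p - w k p = (SUM i<m. M k i p * a i p))"
proof -
 have v: "!!k. k < n ==> reg e (Bs ! k + D) (\<Union>U) (v k)" and w: "!!k. k < n ==> reg e (Bs ! k + D) (\<Union>U) (w k)"
  using repD(2)[OF r(1)] repD(2)[OF r(2)] by blast+
 have "EX W a. zopen e W & p : \<Union>W & W <= U & (ALL i<m. reg e (As ! i + D) (\<Union>W) (a i)) &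
   (ALL k<n. ALL p:\<Union>W. v k p - w k p = (SUM i<m. M k i p * a i p))" if p: "p : \<Union>U" for p
 proof -
  obtain i h W where ch: "chart i h" and W: "zopen e W" "p : \<Union>W" "W <= U" "W <= Ch e i h" by (rule chart_nbhd[OF U p])
  have t: "ext W (tr e i h (- D)) : line_sections e (- D) W" by (rule tr_line[OF ch W(1,4)])
  have "q W (tup n W (%k p. v k p * ext W (tr e i h (- D)) p)) = q W (tup n W (%k p. w k p * ext W (tr e i h (- D)) p))"
   using repD(3)[OF r(1) W(1,3) t] repD(3)[OF r(2) W(1,3) t] by simp
  from q_eqD[OF W(1) vs_reg[OF W(1,3) v t] vs_reg[OF W(1,3) w t] this]
  obtain a where a: "ALL i<m. reg e (As ! i) (\<Union>W) (a i)"
   "ALL k<n. ALL p:\<Union>W. v k p * ext W (tr e i h (- D)) p - w k p * ext W (tr e i h (- D)) p = (SUM i<m. M k i p * a i p)" by blast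
  define b where "b l p = a l p / tr e i h (- D) p" for l p
  have "reg e (As ! l + D) (\<Union>W) (b l)" if "l < m" for l
   unfolding b_def by (rule tr_div[OF ch W(1,4)]) (use a(1) that in simp)
  moreover have "v k p - w k p = (SUM i<m. M k i p * b i p)" if "k < n" "p : \<Union>W" for k p
  proof -
   have nz: "tr e i h (- D) p ~= 0" by (rule tr_nonzero) (use Ch_Union_sub[OF ch W(4)] that(2) in blast)
   have "v k p * ext W (tr e i h (- D)) p - w k p * ext W (tr e i h (- D)) p = (SUM i<m. M k i p * a i p)"
    using a(2) that by blast
   hence "(v k p - w k p) * tr e i h (- D) p = (SUM i<m. M k i p * a i p)"
    unfolding ext_at[OF that(2)] by (simp add: left_diff_distrib)
   hence "v k p - w k p = (SUM i<m. M k i p * a i p) / tr e i h (- D) p" using nz by (simp add: field_simps)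
   thus ?thesis by (simp add: b_def sum_divide_distrib)
  qed
  ultimately show ?thesis using W by blast
 qed
 thus ?thesis by (rule glue_preimage[OF U])
qed

text \<open>A morphism on O(-D) over a chart is determined by its value at the generator, and that
  value lifts through q after shrinking.\<close>

lemma rep_loc:
 assumes U: "zopen e U" and x: "x : carrier (sect (twist e D E) U)" and p: "p : \<Union>U"
 shows "EX W v. zopen e W & p : \<Union>W & W <= U & rep D W (rest (twist e D E) U W x) v"
proof -
 obtain i h V where ch: "chart i h" and V: "zopen e V" "p : \<Union>V" "V <= U" "V <= Ch e i h" by (rule chart_nbhd[OF U p])
 let ?t = "tr e i h (- D)"
 have t: "ext V ?t : line_sections e (- D) V" by (rule tr_line[OF ch V(1,4)])
 obtain W s where W: "zopen e W" "p : \<Union>W" "W <= V" "s : carrier (sect (split_bundle e Bs) W)" "q W s = rest E V W (x V (ext V ?t))"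
  by (rule locally_in_imageD[OF cokernelD(3)[OF coker V(1) twistD(1)[OF x V(1,3) t]] V(2)])
 obtain g where g: "!!k. k < n ==> reg e (Bs ! k) (\<Union>W) (g k)" "s = tup n W g"
  by (rule tup_ex[OF W(1,4)]) (rule that, assumption+)
 have WC: "W <= Ch e i h" and WU: "W <= U" using W V by blast+
 define v where "v k p = g k p / ?t p" for k p
 have v: "reg e (Bs ! k + D) (\<Union>W) (v k)" if "k < n" for k
  unfolding v_def by (rule tr_div[OF ch W(1) WC]) (use g(1) that in simp)
 have "ext W ?t = ext W (ext V ?t)" using W(3) by (auto simp: ext_def fun_eq_iff)
 hence "x W (ext W ?t) = q W (tup n W g)" using twistD(4)[OF x V(1,3) W(1,3) t] W(5) g(2) by simp
 also have "tup n W g = tup n W (%k p. v k p * ext W ?t p)"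
 proof (rule tup_cong)
  fix k y assume "y : \<Union>W"
  moreover have "?t y ~= 0" by (rule tr_nonzero) (use calculation Ch_Union_sub[OF ch WC] in blast)
  ultimately show "g k y = v k y * ext W ?t y" by (simp add: v_def ext_at)
 qed
 finally have eq: "x W (ext W ?t) = q W (tup n W (%k p. v k p * ext W ?t p))" .
 have y: "is_mor_on e W (OX e (- D)) E (%V s. q V (tup n V (%k p. v k p * s p)))"
  by (rule mor_comp[OF vector_mor[OF v] mor_on_subset[OF q_mor zopen_hirz[OF W(1)]]])
 have xW: "is_mor_on e W (OX e (- D)) E x" by (rule mor_on_subset[OF _ WU]) (use x in \<open>simp add: twist_simps\<close>)
 have "rest (twist e D E) U W x N r = q N (tup n N (%k p. v k p * r p))"
  if N: "zopen e N" "N <= W" and r: "r : line_sections e (- D) N" for N r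
  using line_mor_generator(2)[OF xW W(1) ch WC N r] line_mor_generator(2)[OF y W(1) ch WC N r] N r
  unfolding eq by (simp add: twist_simps twdom_def)
 moreover have "rest (twist e D E) U W x : carrier (sect (twist e D E) W)"
  by (rule ab_presheafD(2)[OF twist_ab(1)[OF E] U W(1) WU x])
 ultimately have "rep D W (rest (twist e D E) U W x) v" unfolding rep_def using v by blast
 thus ?thesis using W(1,2) WU by blast
qed

lemma rep_sep:
 assumes U: "zopen e U" and x: "x : carrier (sect (twist e D E) U)" and y: "y : carrier (sect (twist e D E) U)"
  and loc: "!!p. p : \<Union>U ==> EX W. zopen e W & p : \<Union>W & W <= U & rest (twist e D E) U W x = rest (twist e D E) U W y"
 shows "x = y"
proof (rule twist_eqI[OF x y])
 fix V s assume V: "zopen e V" "V <= U" and s: "s : line_sections e (- D) V"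
 show "x V s = y V s"
 proof (rule msheaf_separated[OF E V(1) twistD(1)[OF x V s] twistD(1)[OF y V s]])
  fix P assume P: "P : V"
  then obtain p where p: "p : P" using hirz_ne zopen_hirz[OF V(1)] by blast
  have "p : \<Union>U" using P p V by blast
  then obtain W where W: "zopen e W" "p : \<Union>W" "W <= U" "rest (twist e D E) U W x = rest (twist e D E) U W y" using loc by blast
  define N where "N = V Int W"
  have N: "zopen e N" "N <= V" "N <= W" unfolding N_def using zopen_Int[OF V(1) W(1)] by auto
  obtain Q where Q: "Q : W" "p : Q" using W(2) by blast
  have "P = Q" by (rule hirz_unique[OF _ _ p Q(2)]) (use P Q zopen_hirz[OF V(1)] zopen_hirz[OF W(1)] in blast)+
  hence PN: "P : N" using P Q unfolding N_def by blast
  have sN: "ext N s : line_sections e (- D) N" by (rule line_rest[OF V(1) N(1,2) s])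
  have "rest (twist e D E) U W x N (ext N s) = rest (twist e D E) U W y N (ext N s)" unfolding W(4) ..
  hence "x N (ext N s) = y N (ext N s)" using N sN by (simp add: twist_simps twdom_def)
  hence "rest E V N (x V s) = rest E V N (y V s)" unfolding twistD(4)[OF x V N(1,2) s] twistD(4)[OF y V N(1,2) s] .
  thus "EX W. zopen e W & P : W & W <= V & rest E V W (x V s) = rest E V W (y V s)" using N PN by blast
 qed
qed

theorem twist_coker_sheaf:
 "coker_sheaf e (twist e D E) n (%k. Bs ! k + D) (rep D) m (%i. As ! i + D) M"
proof
 show "ab_presheaf e (twist e D E)" by (rule twist_ab(1)[OF E])
 show "cox_form e ((Bs ! k + D) - (As ! i + D)) (M k i)" if "k < n" "i < m" for k i
  using M_form[OF that] by simp
qed (rule repD rep_add rep_neg rep_rest rep_ex rep_eq rep_same rep_img rep_loc rep_sep; assumption)+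

end

section \<open>Completing independent columns to invertible matrices\<close>

definition inverse_pair :: "nat => (nat => nat => 'a::field) => (nat => nat => 'a) => bool" where
 "inverse_pair n N N' \<longleftrightarrow> (ALL k<n. ALL h<n. (SUM l<n. N k l * N' l h) = (if k = h then 1 else 0)) &
   (ALL k<n. ALL h<n. (SUM l<n. N' k l * N l h) = (if k = h then 1 else 0))"

lemma inverse_pairD:
 assumes "inverse_pair n N N'" "k < n" "h < n"
 shows "(SUM l<n. N k l * N' l h) = (if k = h then 1 else 0)" "(SUM l<n. N' k l * N l h) = (if k = h then 1 else 0)"
 using assms unfolding inverse_pair_def by blast+

lemma inverse_pair_sym: "inverse_pair n N N' ==> inverse_pair n N' N"
 unfolding inverse_pair_def by blast

lemma inverse_pair_apply:
 assumes "inverse_pair n N N'" "k < n"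
 shows "(SUM l<n. N k l * (SUM h<n. N' l h * v h)) = v k"
proof -
 have "(SUM l<n. N k l * (SUM h<n. N' l h * v h)) = (SUM l<n. SUM h<n. N k l * N' l h * v h)"
  by (simp add: sum_distrib_left mult.assoc)
 also have "... = (SUM h<n. (SUM l<n. N k l * N' l h) * v h)" by (subst sum.swap) (simp add: sum_distrib_right)
 also have "... = (SUM h<n. if h = k then v k else 0)"
  by (intro sum.cong refl) (auto simp: inverse_pairD(1)[OF assms(1,2)])
 finally show ?thesis using assms(2) by simp
qed

lemma inverse_pair_perm:
 assumes N: "inverse_pair n N N'" and s: "bij_betw s {..<n} {..<n}"
 shows "inverse_pair n (%k x. N k (s x)) (%x k. N' (s x) k)"
 unfolding inverse_pair_def
proof (intro conjI allI impI)
 fix k h assume k: "k < n" and h: "h < n"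
 show "(SUM l<n. N k (s l) * N' (s l) h) = (if k = h then 1 else 0)"
  using sum.reindex_bij_betw[OF s, of "%l. N k l * N' l h"] inverse_pairD(1)[OF N k h] by simp
 have "s k < n" "s h < n" using s k h by (auto simp: bij_betw_def)
 moreover have "s k = s h \<longleftrightarrow> k = h" using s k h by (auto simp: bij_betw_def inj_on_def)
 ultimately show "(SUM l<n. N' (s k) l * N l (s h)) = (if k = h then 1 else 0)"
  using inverse_pairD(2)[OF N, of "s k" "s h"] by simp
qed

lemma sum_remove_lessThan: "g < (n::nat) ==> (SUM l<n. f l) = f g + (SUM l:{..<n} - {g}. f l)"
 for f :: "nat => 'a::comm_monoid_add"
 by (simp add: sum.remove)

text \<open>Exchange step: the column g is replaced by c = N w.\<close>

lemma inverse_pair_exchange: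
 fixes N N' :: "nat => nat => 'a::field"
 assumes N: "inverse_pair n N N'" and g: "g < n" and w: "!!x. w x = (SUM k<n. N' x k * c k)" and wg: "w g ~= 0"
 shows "inverse_pair n (%k x. if x = g then c k else N k x)
  (%x k. if x = g then N' g k / w g else N' x k - w x / w g * N' g k)" (is "inverse_pair n ?P ?Q")
 unfolding inverse_pair_def
proof (intro conjI allI impI)
 fix k h assume k: "k < n" and h: "h < n"
 have c: "c k = (SUM l<n. N k l * w l)" unfolding w using inverse_pair_apply[OF N k, of c] by simp
 have c': "c k - (SUM l:{..<n}-{g}. N k l * w l) = N k g * w g"
  unfolding c using sum_remove_lessThan[OF g, of "%l. N k l * w l"] by simp
 have "(SUM l<n. ?P k l * ?Q l h) = c k * (N' g h / w g) + (SUM l:{..<n}-{g}. N k l * (N' l h - w l / w g * N' g h))"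
  unfolding sum_remove_lessThan[OF g] by simp
 also have "... = (c k - (SUM l:{..<n}-{g}. N k l * w l)) * (N' g h / w g) + (SUM l:{..<n}-{g}. N k l * N' l h)"
  by (simp add: right_diff_distrib left_diff_distrib sum_subtractf sum_distrib_right sum_distrib_left sum_divide_distrib mult_ac)
 also have "... = N k g * N' g h + (SUM l:{..<n}-{g}. N k l * N' l h)" unfolding c' using wg by simp
 also have "... = (SUM l<n. N k l * N' l h)" unfolding sum_remove_lessThan[OF g] ..
 finally show "(SUM l<n. ?P k l * ?Q l h) = (if k = h then 1 else 0)" using inverse_pairD(1)[OF N k h] by simp
 note D = inverse_pairD(2)[OF N]
 have Qg: "(SUM l<n. ?Q k l * b l) = (if k = g then (SUM l<n. N' g l * b l) / w g
   else (SUM l<n. N' k l * b l) - w k / w g * (SUM l<n. N' g l * b l))" for b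
  by (simp add: left_diff_distrib right_diff_distrib sum_subtractf sum_distrib_left sum_divide_distrib mult_ac)
 show "(SUM l<n. ?Q k l * ?P l h) = (if k = h then 1 else 0)"
 proof (cases "h = g")
  case True
  have "(SUM l<n. ?Q k l * ?P l h) = (SUM l<n. ?Q k l * c l)" using True by simp
  also have "... = (if k = g then w g / w g else w k - w k / w g * w g)" unfolding Qg w[symmetric] ..
  finally show ?thesis using True wg by simp
 next
  case False
  have "(SUM l<n. ?Q k l * ?P l h) = (SUM l<n. ?Q k l * N l h)" using False by simp
  also have "... = (if k = g then (SUM l<n. N' g l * N l h) / w g
   else (SUM l<n. N' k l * N l h) - w k / w g * (SUM l<n. N' g l * N l h))" by (rule Qg)
  finally show ?thesis unfolding D[OF k h] D[OF g h] using False by auto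
 qed
qed

lemma reg_nonzero_nbhd:
 assumes "reg e D A f" "p : A" "f p ~= 0"
 obtains B where "opn e B" "p : B" "B <= A" "!!q. q : B ==> f q ~= 0"
proof -
 obtain D' G H where F: "cox_form e D' H" "cox_form e (D + D') G" "H p ~= 0"
  "ALL q:cone. H q ~= 0 --> q : A & f q = G q / H q"
  using assms(1,2) unfolding reg_def by blast
 have pc: "p : cone" using assms(1,2) reg_cone by blast
 define B where "B = {q : cone. G q * H q ~= 0}"
 have "opn e B" unfolding B_def by (rule opn_form[OF cox_form_mult[OF F(2,1)]])
 moreover have "f p = G p / H p" using F(3,4) pc by blast
 hence "p : B" using pc F(3) assms(3) unfolding B_def by simp
 moreover have "q : A & f q = G q / H q & G q ~= 0 & H q ~= 0" if "q : B" for q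
  using F(4)[rule_format, of q] that unfolding B_def by simp
 hence "B <= A" "!!q. q : B ==> f q ~= 0" by auto
 ultimately show ?thesis using that by blast
qed

lemma reg_mult_0: "reg e 0 A f ==> reg e D A g ==> reg e D A (%p. f p * g p)"
 using reg_mult[of e 0 A f D g] by simp

lemma reg_divide_0: "reg e 0 A f ==> reg e 0 A g ==> (!!p. p : A ==> g p ~= 0) ==> reg e 0 A (%p. f p / g p)"
 using reg_divide[of e 0 A f 0 g] by simp

text \<open>Starting from the identity, the columns of C are inserted one by one. Independence at p
  gives the next column a nonzero coordinate beyond those already fixed; that coordinate is the
  pivot, and B is shrunk to where it does not vanish.\<close>

lemma independent_completion:
 fixes C :: "nat => nat => 'k::{alg_closed_field, field_char_0} cox => 'k"
 assumes A: "opn e A" "p : A" and C0: "ALL k<n. ALL i<m. reg e 0 A (C k i)"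
  and ind: "ALL c. (ALL k<n. (SUM i<m. C k i p * c i) = 0) --> (ALL i<m. c i = 0)"
 shows "EX B N N'. opn e B & p : B & B <= A & m <= n & (ALL k<n. ALL l<n. reg e 0 B (N k l) & reg e 0 B (N' k l)) &
  (ALL q:B. inverse_pair n (%k l. N k l q) (%k l. N' k l q)) & (ALL k<n. ALL i<m. N k i = C k i)"
proof -
 have C: "reg e 0 A (C k i)" if "k < n" "i < m" for k i using C0 that by simp
 have "EX B N N'. opn e B & p : B & B <= A & g <= n & (ALL k<n. ALL l<n. reg e 0 B (N k l) & reg e 0 B (N' k l)) &
  (ALL q:B. inverse_pair n (%k l. N k l q) (%k l. N' k l q)) & (ALL k<n. ALL i<g. N k i = C k i)" if "g <= m" for g
  using that
 proof (induction g)
  case 0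
  define I :: "nat => nat => 'k cox => 'k" where "I k l = (%q. if k = l then 1 else 0)" for k l
  have "reg e 0 A (I k l)" for k l unfolding I_def using A(1) by (rule reg_const)
  moreover have "inverse_pair n (%k l. I k l q) (%k l. I k l q)" for q
   unfolding inverse_pair_def I_def by (simp add: if_distrib[of "%x. x * _"] cong: if_cong)
  ultimately show ?case using A by (intro exI[of _ A] exI[of _ I]) simp
 next
  case (Suc g)
  have gm: "g < m" "g <= m" using Suc.prems by auto
  obtain B N N' where H: "opn e B & p : B & B <= A & g <= n & (ALL k<n. ALL l<n. reg e 0 B (N k l) & reg e 0 B (N' k l)) &
   (ALL q:B. inverse_pair n (%k l. N k l q) (%k l. N' k l q)) & (ALL k<n. ALL i<g. N k i = C k i)"
   using Suc.IH[OF gm(2)] by (elim exE) (rule that)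
  have B: "opn e B" "p : B" "B <= A" and "g <= n" using H by simp_all
  have Nr: "reg e 0 B (N k l)" "reg e 0 B (N' k l)" if "k < n" "l < n" for k l using H that by simp_all
  have Ni: "inverse_pair n (%k l. N k l q) (%k l. N' k l q)" if "q : B" for q using H that by simp
  have NC: "N k i = C k i" if "k < n" "i < g" for k i using H that by simp
  define u where "u l q = (SUM k<n. N' l k q * C k g q)" for l q
  have "EX l<n. g <= l & u l p ~= 0"
  proof (rule ccontr)
   assume "~ (EX l<n. g <= l & u l p ~= 0)"
   hence u0: "u l p = 0" if "l < n" "g <= l" for l using that by blast
   \<comment> \<open>If all coordinates from g on vanished at p, column g would be a combination of
     the earlier ones; c records this relation.\<close>
   define c where "c i = (if i < g then u i p else if i = g then -1 else 0)" for i
   have "(SUM i<m. C k i p * c i) = 0" if k: "k < n" for k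
   proof -
    have "C k g p = (SUM l<n. N k l p * u l p)"
     unfolding u_def by (rule inverse_pair_apply[OF Ni[OF B(2)] k, symmetric])
    also have "... = (SUM l<g. N k l p * u l p)"
     using u0 \<open>g <= n\<close> by (intro sum.mono_neutral_right) auto
    also have "... = (SUM l<g. C k l p * u l p)" by (intro sum.cong refl) (simp add: NC k)
    finally have 1: "C k g p = (SUM l<g. C k l p * u l p)" .
    have "(SUM i<m. C k i p * c i) = (SUM i<Suc g. C k i p * c i)"
     using gm by (intro sum.mono_neutral_right) (auto simp: c_def)
    also have "... = (SUM i<g. C k i p * u i p) - C k g p" by (simp add: c_def)
    finally show ?thesis using 1 by simp
   qed
   hence "c g = 0" using ind gm(1) by blast
   thus False by (simp add: c_def)
  qed
  then obtain l where l: "l < n" "g <= l" "u l p ~= 0" by blast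
  have gn: "g < n" using l by simp
  \<comment> \<open>The transposition that brings the pivot l into position g; as g is at most l,
    the columns inserted before stay in place.\<close>
  define s where "s x = (if x = g then l else if x = l then g else x)" for x
  have s: "s x < n" if "x < n" for x using that gn l by (simp add: s_def)
  have ss: "s (s x) = x" for x by (simp add: s_def)
  have sb: "bij_betw s {..<n} {..<n}" by (rule bij_betw_byWitness[of _ s]) (use s ss in auto)
  have ureg: "reg e 0 B (u x)" if "x < n" for x
   unfolding u_def using that gm by (intro reg_sum B(1) reg_mult_0 Nr reg_subset[OF C B(1,3)]) auto
  obtain B' where B': "opn e B'" "p : B'" "B' <= B" "!!q. q : B' ==> u l q ~= 0"
   by (rule reg_nonzero_nbhd[OF ureg[OF l(1)] B(2) l(3)]) (rule that, assumption+)
  define P where "P k x = (if x = g then C k g else N k (s x))" for k x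
  define Q where "Q x k = (if x = g then (%q. N' (s g) k q / u (s g) q) else (%q. N' (s x) k q - u (s x) q / u (s g) q * N' (s g) k q))" for x k
  have sg: "s g = l" by (simp add: s_def)
  have r: "reg e 0 B' f" if "reg e 0 B f" for f by (rule reg_subset[OF that B'(1,3)])
  have "reg e 0 B' (P k x)" if "k < n" "x < n" for k x
   unfolding P_def using that gm s by (auto intro!: r Nr reg_subset[OF C B(1,3)])
  moreover have "reg e 0 B' (Q k x)" if "k < n" "x < n" for k x
  proof -
   have N': "reg e 0 B' (N' l x)" "reg e 0 B' (N' (s k) x)" by (intro r Nr l s that)+
   have d: "reg e 0 B' (%q. u (s k) q / u l q)" "reg e 0 B' (%q. N' l x q / u l q)"
    by (rule reg_divide_0[OF _ r[OF ureg[OF l(1)]] B'(4)], intro r ureg s that N', assumption)+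
   show ?thesis unfolding Q_def sg using reg_diff[OF N'(2) reg_mult_0[OF d(1) N'(1)]] d(2) by simp
  qed
  moreover have "inverse_pair n (%k l. P k l q) (%k l. Q k l q)" if q: "q : B'" for q
  proof -
   have qB: "q : B" using q B'(3) by blast
   have "inverse_pair n (%k x. if x = g then C k g q else N k (s x) q)
    (%x k. if x = g then N' (s g) k q / u (s g) q else N' (s x) k q - u (s x) q / u (s g) q * N' (s g) k q)"
    by (rule inverse_pair_exchange[OF inverse_pair_perm[OF Ni[OF qB] sb] gn])
     (use B'(4)[OF q] in \<open>simp_all add: u_def sg\<close>)
   thus ?thesis unfolding P_def Q_def by (simp add: if_distrib[of "%f. f q"] cong: if_cong)
  qed
  moreover have "P k i = C k i" if "k < n" "i < Suc g" for k i
   using that NC[of k i] l by (cases "i = g") (auto simp: P_def s_def)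
  moreover have "B' <= A" using B'(3) B(3) by blast
  ultimately show ?case using B'(1,2) gn by (intro exI[of _ B'] exI[of _ P] exI[of _ Q] conjI allI impI ballI) simp_all
 qed
 thus ?thesis by blast
qed

lemma sum_split_lessThan:
 fixes f :: "nat => 'a::comm_monoid_add"
 assumes "m <= n" shows "(SUM l<n. f l) = (SUM l<m. f l) + (SUM x<n - m. f (m + x))"
proof -
 obtain d where "n = m + d" using assms le_Suc_ex by blast
 moreover have "(SUM l<m + d. f l) = (SUM l<m. f l) + (SUM x<d. f (m + x))"
  by (induction d) (simp_all add: add.assoc)
 ultimately show ?thesis by simp
qed

text \<open>Combinations of the last rows of the inverse are annihilated by the first m columns of
  N; \<open>inverse_pair_tail_apply\<close> shows that nothing else is.\<close>

lemma inverse_pair_tail_zero: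
 assumes N: "inverse_pair n N N'" and m: "m <= n" "l < m"
 shows "(SUM k<n. N k l * (SUM x<n - m. N' (m + x) k * f x)) = 0"
proof -
 have "(SUM k<n. N k l * (SUM x<n - m. N' (m + x) k * f x)) = (SUM k<n. SUM x<n - m. N' (m + x) k * N k l * f x)"
  by (simp add: sum_distrib_left mult_ac)
 also have "... = (SUM x<n - m. (SUM k<n. N' (m + x) k * N k l) * f x)"
  by (subst sum.swap) (simp add: sum_distrib_right)
 also have "... = 0" using inverse_pairD(2)[OF N] m by (intro sum.neutral) simp
 finally show ?thesis .
qed

lemma inverse_pair_tail_apply:
 assumes N: "inverse_pair n N N'" and m: "m <= n" and k: "k < n"
  and y: "!!l. l < m ==> (SUM h<n. N h l * y h) = 0"
 shows "(SUM x<n - m. N' (m + x) k * (SUM h<n. N h (m + x) * y h)) = y k"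
proof -
 have "(SUM x<n - m. N' (m + x) k * (SUM h<n. N h (m + x) * y h)) = (SUM l<n. N' l k * (SUM h<n. N h l * y h))"
  using sum_split_lessThan[OF m, of "%l. N' l k * (SUM h<n. N h l * y h)"] y by simp
 also have "... = (SUM l<n. SUM h<n. N h l * N' l k * y h)" by (simp add: sum_distrib_left mult_ac)
 also have "... = (SUM h<n. (SUM l<n. N h l * N' l k) * y h)" by (subst sum.swap) (simp add: sum_distrib_right)
 also have "... = (SUM h<n. if h = k then y k else 0)"
  using inverse_pairD(1)[OF N _ k] by (intro sum.cong refl) auto
 finally show ?thesis using k by simp
qed

text \<open>The last columns are independent modulo the first m: a relation between them is a
  relation among all columns, which the inverse excludes.\<close>

lemma inverse_pair_tail_inj:
 assumes N: "inverse_pair n N N'" and m: "m <= n" and x: "x < n - m"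
  and eq: "!!k. k < n ==> (SUM x<n - m. N k (m + x) * d x) = (SUM i<m. N k i * b i)"
 shows "d x = 0"
proof -
 define c where "c l = (if l < m then - b l else d (l - m))" for l
 have z: "(SUM l<n. N k l * c l) = 0" if "k < n" for k
  using sum_split_lessThan[OF m, of "%l. N k l * c l"] eq[OF that] by (simp add: c_def sum_negf)
 have "c (m + x) = (SUM k<n. N' (m + x) k * (SUM l<n. N k l * c l))"
  by (rule inverse_pair_apply[OF inverse_pair_sym[OF N], symmetric]) (use x in simp)
 also have "... = 0" using z by simp
 finally show ?thesis by (simp add: c_def)
qed

lemma inverse_pair_scale:
 assumes N: "inverse_pair n N N'" and nz: "!!k. a k ~= 0" "!!l. b l ~= 0"
 shows "inverse_pair n (%k l. a k * N k l / b l) (%l k. b l * N' l k / a k)"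
 unfolding inverse_pair_def
proof (intro conjI allI impI)
 fix k h assume kh: "k < n" "h < n"
 have "(SUM l<n. a k * N k l / b l * (b l * N' l h / a h)) = a k / a h * (SUM l<n. N k l * N' l h)"
  "(SUM l<n. b k * N' k l / a l * (a l * N l h / b h)) = b k / b h * (SUM l<n. N' k l * N l h)"
  using nz by (simp_all add: sum_distrib_left mult_ac)
 thus "(SUM l<n. a k * N k l / b l * (b l * N' l h / a h)) = (if k = h then 1 else 0)"
  "(SUM l<n. b k * N' k l / a l * (a l * N l h / b h)) = (if k = h then 1 else 0)"
  using inverse_pairD[OF N kh] nz by simp_all
qed

text \<open>L is an invertible matrix that completes the columns C; the new columns have degree 0.\<close>

definition frame :: "nat => 'k::field pointset => nat => nat => (nat => divclass) => (nat => divclass) =>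
  (nat => nat => 'k cox => 'k) => (nat => nat => 'k cox => 'k) => (nat => nat => 'k cox => 'k) => bool" where
 "frame e V n m d c C L L' \<longleftrightarrow> zopen e V & m <= n &
  (ALL k<n. ALL l<n. reg e (d k - (if l < m then c l else 0)) (\<Union>V) (L k l) & reg e ((if l < m then c l else 0) - d k) (\<Union>V) (L' l k)) &
  (ALL q:\<Union>V. inverse_pair n (%k l. L k l q) (%k l. L' k l q)) & (ALL k<n. ALL i<m. ALL q:\<Union>V. C k i q = L k i q)"

lemma frameD:
 assumes "frame e V n m d c C L L'"
 shows "zopen e V" "m <= n" "q : \<Union>V ==> inverse_pair n (%k l. L k l q) (%k l. L' k l q)"
  "k < n ==> i < m ==> q : \<Union>V ==> C k i q = L k i q"
  "k < n ==> i < m ==> reg e (c i - d k) (\<Union>V) (L' i k)"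
  "k < n ==> x < n - m ==> reg e (d k) (\<Union>V) (L k (m + x))"
  "k < n ==> x < n - m ==> reg e (- d k) (\<Union>V) (L' (m + x) k)"
proof -
 have reg: "reg e (d k - (if l < m then c l else 0)) (\<Union>V) (L k l)" "reg e ((if l < m then c l else 0) - d k) (\<Union>V) (L' l k)"
  if "k < n" "l < n" for k l using assms that unfolding frame_def by blast+
 show "zopen e V" and m: "m <= n" and "q : \<Union>V ==> inverse_pair n (%k l. L k l q) (%k l. L' k l q)"
  "k < n ==> i < m ==> q : \<Union>V ==> C k i q = L k i q" using assms unfolding frame_def by blast+
 show "k < n ==> i < m ==> reg e (c i - d k) (\<Union>V) (L' i k)" using reg(2)[of k i] m by simp
 show "k < n ==> x < n - m ==> reg e (d k) (\<Union>V) (L k (m + x))" using reg(1)[of k "m + x"] by simp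
 show "k < n ==> x < n - m ==> reg e (- d k) (\<Union>V) (L' (m + x) k)" using reg(2)[of k "m + x"] by simp
qed

text \<open>The generators \<open>tr\<close> of a chart bring all entries to degree 0, where
  \<open>independent_completion\<close> applies; scaling back restores the degrees.\<close>

lemma local_frame:
 fixes C :: "nat => nat => 'k::{alg_closed_field, field_char_0} cox => 'k"
 assumes p: "p : cone" and C: "!!k i. k < n ==> i < m ==> reg e (d k - c i) cone (C k i)"
  and ind: "ALL c. (ALL k<n. (SUM i<m. C k i p * c i) = 0) --> (ALL i<m. c i = 0)"
 shows "EX V L L'. p : \<Union>V & frame e V n m d c C L L'"
proof -
 obtain a b where ch: "chart a b" "p : UT {a, b}" using p by (rule cone_chart)
 let ?A = "UT {a, b} :: 'k cox set" and ?t = "tr e a b :: divclass => 'k cox => 'k"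
 have oA: "opn e ?A" by (rule reg_opn[OF tr_reg[OF ch(1), of e 0]])
 note nz = tr_nonzero[of _ a b e]
 define K where "K k i q = C k i q * ?t (c i) q / ?t (d k) q" for k i q
 have K: "ALL k<n. ALL i<m. reg e 0 ?A (K k i)"
 proof (intro allI impI)
  fix k i assume that: "k < n" "i < m"
  have "reg e (d k - c i + c i - d k) ?A (K k i)" unfolding K_def
   by (intro reg_divide reg_mult tr_reg ch(1) nz reg_subset[OF C[OF that] oA UT_cone])
  thus "reg e 0 ?A (K k i)" by simp
 qed
 have indK: "ALL x. (ALL k<n. (SUM i<m. K k i p * x i) = 0) --> (ALL i<m. x i = 0)"
 proof (intro allI impI)
  fix x i assume z: "ALL k<n. (SUM i<m. K k i p * x i) = 0" and i: "i < m"
  have "ALL k<n. (SUM i<m. C k i p * (?t (c i) p * x i)) = 0"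
  proof (intro allI impI)
   fix k assume k: "k < n"
   have "(SUM i<m. C k i p * (?t (c i) p * x i)) = ?t (d k) p * (SUM i<m. K k i p * x i)"
    using nz[OF ch(2)] by (simp add: sum_distrib_left K_def mult_ac)
   thus "(SUM i<m. C k i p * (?t (c i) p * x i)) = 0" using z k by simp
  qed
  from ind[rule_format, OF this[rule_format] i] show "x i = 0" using nz[OF ch(2)] by simp
 qed
 obtain B N N' where H: "opn e B & p : B & B <= ?A & m <= n & (ALL k<n. ALL l<n. reg e 0 B (N k l) & reg e 0 B (N' k l)) &
  (ALL q:B. inverse_pair n (%k l. N k l q) (%k l. N' k l q)) & (ALL k<n. ALL i<m. N k i = K k i)"
  using independent_completion[where C = K and m = m and n = n, OF oA ch(2) K indK] by (elim exE) (rule that)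
 have B: "opn e B" "p : B" "B <= ?A" using H by simp_all
 have V: "zopen e (Up e B)" "\<Union>(Up e B) = B" by (rule Up_zopen[OF B(1)])+
 have tB: "reg e D B (?t D)" for D by (rule reg_subset[OF tr_reg[OF ch(1)] B(1,3)])
 have nzB: "?t D q ~= 0" if "q : B" for D q using that B(3) by (intro nz) blast
 define z where "z l = (if l < m then c l else 0)" for l
 show ?thesis
 proof (intro exI conjI)
  show "p : \<Union>(Up e B)" unfolding V(2) by (rule B(2))
  show "frame e (Up e B) n m d c C (%k l q. ?t (d k) q * N k l q / ?t (z l) q) (%l k q. ?t (z l) q * N' l k q / ?t (d k) q)"
   unfolding frame_def V(2) z_def[symmetric]
  proof (intro conjI allI impI ballI V(1))
   fix k l assume "k < n" "l < n"
   hence "reg e (d k + 0 - z l) B (%q. ?t (d k) q * N k l q / ?t (z l) q)"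
    "reg e (z l + 0 - d k) B (%q. ?t (z l) q * N' l k q / ?t (d k) q)"
    using H by (intro reg_divide reg_mult tB nzB; simp)+
   thus "reg e (d k - z l) B (%q. ?t (d k) q * N k l q / ?t (z l) q)"
    "reg e (z l - d k) B (%q. ?t (z l) q * N' l k q / ?t (d k) q)" by simp_all
  next
   fix q assume "q : B"
   thus "inverse_pair n (%k l. ?t (d k) q * N k l q / ?t (z l) q) (%l k. ?t (z l) q * N' l k q / ?t (d k) q)"
    using H by (intro inverse_pair_scale nzB) blast+
  next
   fix k i q assume "k < n" "i < m" "q : B"
   thus "C k i q = ?t (d k) q * N k i q / ?t (z i) q" using H nzB by (simp add: K_def z_def)
  qed (use H in blast)
 qed
qed

section \<open>Local freeness of cokernels and kernels\<close>

lemma zopen_mem: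
 assumes "P : hirzebruch e" "p : P" "zopen e V" "p : \<Union>V"
 shows "P : V"
proof -
 obtain Q where Q: "p : Q" "Q : V" using assms(4) by (rule UnionE)
 have "P = Q" by (rule hirz_unique[OF assms(1) subsetD[OF zopen_hirz[OF assms(3)] Q(2)] assms(2) Q(1)])
 thus ?thesis using Q(2) by simp
qed

lemma tup_at: "k < n ==> p : \<Union>U ==> tup n U v k p = v k p"
 by (simp add: tup_def ext_at del: Union_iff)

lemma matrix_mor:
 assumes "!!k x. k < length Bs ==> x < length As ==> reg e (Bs ! k - As ! x) (\<Union>U) (G k x)"
 shows "is_mor_on e U (split_bundle e As) (split_bundle e Bs)
  (%V s. tup (length Bs) V (%k p. SUM x<length As. G k x p * s x p))"
 unfolding is_mor_on_def OX_simps
proof (intro conjI allI impI ballI; elim conjE)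
 fix V s assume V: "zopen e V" "V <= U" and s: "s : carrier (sect (split_bundle e As) V)"
 obtain f where f: "!!x. x < length As ==> reg e (As ! x) (\<Union>V) (f x)" "s = tup (length As) V f"
  by (rule tup_ex[OF V(1) s]) (rule that, assumption+)
 have S: "tup (length Bs) V (%k p. SUM x<length As. G k x p * tup (length As) V f x p) =
  tup (length Bs) V (%k p. SUM x<length As. G k x p * f x p)" for f V
  by (rule tup_cong, rule sum.cong) (simp_all add: tup_at del: Union_iff)
 show "tup (length Bs) V (%k p. SUM x<length As. G k x p * s x p) : carrier (sect (split_bundle e Bs) V)"
  unfolding f(2) S
 proof (rule tup_in[OF V(1)], rule reg_sum[OF zopen_opn[OF V(1)]])
  fix k x assume "k < length Bs" "x : {..<length As}"
  thus "reg e (Bs ! k) (\<Union>V) (%p. G k x p * f x p)"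
   using reg_mult[OF reg_Int[OF assms[of k x] V] f(1)[of x]] by simp
 qed
 show "tup (length Bs) W (%k p. SUM x<length As. G k x p * rest (split_bundle e As) V W s x p) =
  rest (split_bundle e Bs) V W (tup (length Bs) V (%k p. SUM x<length As. G k x p * s x p))" if "W <= V" for W
  unfolding f(2) tup_rest[OF that] S ..
 show "tup (length Bs) V (%k p. SUM x<length As. G k x p * (h \<odot>\<^bsub>sect (split_bundle e As) V\<^esub> s) x p) =
  h \<odot>\<^bsub>sect (split_bundle e Bs) V\<^esub> tup (length Bs) V (%k p. SUM x<length As. G k x p * s x p)" for h
  unfolding f(2) tup_smult S by (simp add: sum_distrib_left mult.left_commute)
 fix t assume t: "t : carrier (sect (split_bundle e As) V)"
 obtain g where g: "t = tup (length As) V g" by (rule tup_ex[OF V(1) t]) (rule that, assumption+)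
 show "tup (length Bs) V (%k p. SUM x<length As. G k x p * (s \<oplus>\<^bsub>sect (split_bundle e As) V\<^esub> t) x p) =
  tup (length Bs) V (%k p. SUM x<length As. G k x p * s x p) \<oplus>\<^bsub>sect (split_bundle e Bs) V\<^esub>
  tup (length Bs) V (%k p. SUM x<length As. G k x p * t x p)"
  unfolding f(2) g tup_add S by (simp add: distrib_left sum.distrib)
qed

text \<open>Preimages that exist locally are unique by injectivity, so the vectors describing them
  glue to a preimage over V.\<close>

lemma local_iso_bij:
 fixes E :: "('k::{alg_closed_field, field_char_0}, 'm) msheaf"
 assumes E: "is_msheaf e E" and Ph: "is_mor_on e U (split_bundle e Ds) E Ph"
  and inj: "!!V. zopen e V ==> V <= U ==> inj_on (Ph V) (carrier (sect (split_bundle e Ds) V))"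
  and sur: "!!V t. zopen e V ==> V <= U ==> t : carrier (sect E V) ==> locally_in_image e (split_bundle e Ds) E Ph V t"
  and V: "zopen e V" "V <= U"
 shows "bij_betw (Ph V) (carrier (sect (split_bundle e Ds) V)) (carrier (sect E V))"
proof -
 let ?n = "length Ds"
 have "t : Ph V ` carrier (sect (split_bundle e Ds) V)" if t: "t : carrier (sect E V)" for t
 proof -
  define C where "C W a \<longleftrightarrow> zopen e W & W <= V & (ALL k<?n. reg e (Ds ! k) (\<Union>W) (a k)) & Ph W (tup ?n W a) = rest E V W t" for W a
  have CD: "zopen e W" "W <= V" "k < ?n ==> reg e (Ds ! k) (\<Union>W) (a k)" "Ph W (tup ?n W a) = rest E V W t" if "C W a" for W a k
   using that unfolding C_def by blast+
  have ex: "EX W a. C W a & P : W" if P: "P : V" for P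
  proof -
   obtain W s where W: "zopen e W" "P : W" "W <= V" "s : carrier (sect (split_bundle e Ds) W)" "Ph W s = rest E V W t"
    using sur[OF V t] P unfolding locally_in_image_def by blast
   obtain a where "!!k. k < ?n ==> reg e (Ds ! k) (\<Union>W) (a k)" "s = tup ?n W a"
    by (rule tup_ex[OF W(1,4)]) (rule that, assumption+)
   thus ?thesis using W unfolding C_def by blast
  qed
  have ex': "EX W a. C W a & p : \<Union>W" if "p : \<Union>V" for p using that ex by blast
  have eq: "a k p = a' k p" if C: "C W a" "C W' a'" and k: "k < ?n" and p: "p : \<Union>W" "p : \<Union>W'" for W a W' a' k p
  proof -
   note Z = CD(1)[OF C(1)] CD(1)[OF C(2)]
   have N: "zopen e (W Int W')" by (rule zopen_Int[OF Z])
   have NU: "W Int W' <= U" using CD(2)[OF C(1)] V(2) by blast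
   have *: "Ph (W Int W') (tup ?n (W Int W') a) = rest E V (W Int W') t" "tup ?n (W Int W') a : carrier (sect (split_bundle e Ds) (W Int W'))"
    if C: "C W1 a" and N1: "W Int W' <= W1" for W1 a
   proof -
    have "W1 <= U" using CD(2)[OF C] V(2) by blast
    from is_morD(4)[OF Ph CD(1)[OF C] this N N1 tup_in[OF CD(1,3)[OF C]]]
    show "Ph (W Int W') (tup ?n (W Int W') a) = rest E V (W Int W') t"
     unfolding CD(4)[OF C] tup_rest[OF N1] msheafD(6)[OF E V(1) CD(1)[OF C] N N1 CD(2)[OF C] t] by simp
    show "tup ?n (W Int W') a : carrier (sect (split_bundle e Ds) (W Int W'))"
     by (rule tup_in[OF N reg_Int[OF CD(3)[OF C] N N1]])
   qed
   have "tup ?n (W Int W') a = tup ?n (W Int W') a'"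
    using inj[OF N NU] *[OF C(1) Int_lower1] *[OF C(2) Int_lower2] unfolding inj_on_def by simp
   thus ?thesis using k by (rule tup_eqD) (unfold zopen_Union_Int[OF Z], rule IntI[OF p])
  qed
  obtain b where breg: "!!k. k < ?n ==> reg e (Ds ! k) (\<Union>V) (b k)" and b: "!!W a k p. C W a ==> k < ?n ==> p : \<Union>W ==> b k p = a k p"
   by (rule glue_reg[where C = C and D = "%k. Ds ! k" and n = ?n]) (rule ex' CD(2,3) eq that, assumption+)+
  have bin: "tup ?n V b : carrier (sect (split_bundle e Ds) V)" by (rule tup_in[OF V(1) breg])
  have "Ph V (tup ?n V b) = t"
  proof (rule msheaf_separated[OF E V(1) is_morD(1)[OF Ph V bin] t])
   fix P assume "P : V"
   then obtain W a where C: "C W a" "P : W" using ex by blast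
   have W: "zopen e W" "W <= V" "Ph W (tup ?n W a) = rest E V W t" using C(1) unfolding C_def by blast+
   have "rest E V W (Ph V (tup ?n V b)) = Ph W (tup ?n W b)"
    using is_morD(4)[OF Ph V W(1,2) bin] unfolding tup_rest[OF W(2)] by simp
   also have "tup ?n W b = tup ?n W a" by (rule tup_cong) (rule b[OF C(1)])
   finally show "EX W. zopen e W & P : W & W <= V & rest E V W (Ph V (tup ?n V b)) = rest E V W t"
    using W C(2) by auto
  qed
  thus ?thesis using bin by blast
 qed
 moreover have "Ph V ` carrier (sect (split_bundle e Ds) V) <= carrier (sect E V)" using is_morD(1)[OF Ph V] by blast
 ultimately show ?thesis using inj[OF V] unfolding bij_betw_def by blast
qed

lemma tup_replicate_ex:
 assumes "zopen e U" "t : carrier (sect (split_bundle e (replicate r 0)) U)"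
 obtains f where "!!x. x < r ==> reg e 0 (\<Union>U) (f x)" "t = tup r U f"
 using tup_ex[OF assms] by (metis length_replicate nth_replicate)

lemma tup_replicate_in:
 assumes "zopen e U" "!!x. x < r ==> reg e 0 (\<Union>U) (f x)"
 shows "tup r U f : carrier (sect (split_bundle e (replicate r 0)) U)"
 using tup_in[of e U "replicate r 0" f] assms by simp

context matrix_coker begin

text \<open>As the columns of M are independent at every point, they can be completed to a local
  frame, and the complementary columns map to a basis of the cokernel.\<close>

theorem vector_bundle:
 assumes ind: "!!p. p : cone ==> ALL c. (ALL k<n. (SUM i<m. M k i p * c i) = 0) --> (ALL i<m. c i = 0)"
 shows "vector_bundle e E"
 unfolding vector_bundle_def
proof (intro conjI exI[of _ "n - m"] ballI E)
 let ?r = "n - m"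
 let ?R = "replicate ?r (0::divclass)"
 let ?S = "split_bundle e ?R :: ('k, nat => 'k cox => 'k) msheaf"
 fix P :: "'k cox set" assume P: "P : hirzebruch e"
 then obtain p where p: "p : P" "p : cone" using hirz_ne by blast
 have Mr: "reg e (Bs ! k - As ! i) cone (M k i)" if "k < n" "i < m" for k i
  using reg_form[OF M_form[OF that] zopen_opn[OF zopen_hirzebruch]] unfolding Union_hirz by simp
 obtain U L L' where pU: "p : \<Union>U" and F: "frame e U n m (%k. Bs ! k) (%i. As ! i) M L L'"
  using local_frame[where C = M and d = "%k. Bs ! k" and c = "%i. As ! i", OF p(2) Mr ind[OF p(2)]] by blast
 note U = frameD(1)[OF F] and mn = frameD(2)[OF F] and Li = frameD(3)[OF F] and LM = frameD(4)[OF F]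
 \<comment> \<open>The combination of the n - m complementary columns with coefficients f.\<close>
 define G where "G f = (%k q. SUM x<?r. L k (m + x) q * f x q)" for f :: "nat => 'k cox => 'k"
 define Ph where "Ph V s = q V (tup n V (G s))" for V s
 have Pht: "Ph V (tup ?r V f) = q V (tup n V (G f))" for V f
  unfolding Ph_def by (rule arg_cong[where f = "q V"], rule tup_cong) (simp add: G_def tup_at del: Union_iff)
 have Gr: "reg e (Bs ! k) (\<Union>V) (G f k)" if V: "zopen e V" "V <= U" and f: "!!x. x < ?r ==> reg e 0 (\<Union>V) (f x)" and k: "k < n" for V f k
  unfolding G_def
 proof (rule reg_sum[OF zopen_opn[OF V(1)]])
  fix x assume "x : {..<?r}"
  thus "reg e (Bs ! k) (\<Union>V) (%q. L k (m + x) q * f x q)"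
   using reg_mult[OF reg_Int[OF frameD(6)[OF F k, of x] V] f[of x]] by simp
 qed
 have "is_mor_on e U ?S (split_bundle e Bs) (%V s. tup n V (%k p. SUM x<length ?R. L k (m + x) p * s x p))"
  by (rule matrix_mor) (use frameD(6)[OF F] in simp)
 from mor_comp[OF this mor_on_subset[OF q_mor zopen_hirz[OF U]]] have Ph_mor: "is_mor_on e U ?S E Ph"
  unfolding Ph_def[abs_def] G_def by simp
 have Ph_inj: "inj_on (Ph V) (carrier (sect ?S V))" if V: "zopen e V" "V <= U" for V
 proof (rule inj_onI)
  fix s t assume s: "s : carrier (sect ?S V)" and t: "t : carrier (sect ?S V)" and eq: "Ph V s = Ph V t"
  obtain f where f: "!!x. x < ?r ==> reg e 0 (\<Union>V) (f x)" "s = tup ?r V f" by (rule tup_replicate_ex[OF V(1) s]) (rule that, assumption+)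
  obtain g where g: "!!x. x < ?r ==> reg e 0 (\<Union>V) (g x)" "t = tup ?r V g" by (rule tup_replicate_ex[OF V(1) t]) (rule that, assumption+)
  have "q V (tup n V (G f)) = q V (tup n V (G g))" using eq unfolding f(2) g(2) Pht .
  from q_eqD[OF V(1) Gr[OF V f(1)] Gr[OF V g(1)] this]
  obtain c where c: "!!k y. k < n ==> y : \<Union>V ==> G f k y - G g k y = (SUM i<m. M k i y * c i y)" by blast
  have "f x y = g x y" if x: "x < ?r" and y: "y : \<Union>V" for x y
  proof -
   have yU: "y : \<Union>U" using y V(2) by blast
   have "f x y - g x y = 0"
   proof (rule inverse_pair_tail_inj[OF Li[OF yU] mn x, where d = "%x. f x y - g x y" and b = "%i. c i y"])
    fix k assume k: "k < n"
    show "(SUM x<?r. L k (m + x) y * (f x y - g x y)) = (SUM i<m. L k i y * c i y)"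
     using c[OF k y] by (simp add: G_def right_diff_distrib sum_subtractf LM[OF k _ yU])
   qed
   thus ?thesis by simp
  qed
  thus "s = t" unfolding f(2) g(2) by (rule tup_cong)
 qed
 have Ph_sur: "locally_in_image e ?S E Ph V t" if V: "zopen e V" "V <= U" and t: "t : carrier (sect E V)" for V t
  unfolding locally_in_image_def
 proof
  fix Q assume Q: "Q : V"
  obtain W s where W: "zopen e W" "Q : W" "W <= V" "s : carrier (sect (split_bundle e Bs) W)" "q W s = rest E V W t"
   using cokernelD(3)[OF coker V(1) t] Q unfolding locally_in_image_def by blast
  obtain g where g: "!!k. k < n ==> reg e (Bs ! k) (\<Union>W) (g k)" "s = tup n W g"
   by (rule tup_ex[OF W(1,4)]) (rule that, assumption+)
  have WU: "W <= U" using W(3) V(2) by blast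
  define c where "c l y = (SUM k<n. L' l k y * g k y)" for l y
  have cr: "reg e D (\<Union>W) (c l)" if "!!k. k < n ==> reg e (D - Bs ! k) (\<Union>U) (L' l k)" for D l
   unfolding c_def
  proof (rule reg_sum[OF zopen_opn[OF W(1)]])
   fix k assume "k : {..<n}"
   thus "reg e D (\<Union>W) (%y. L' l k y * g k y)" using reg_mult[OF reg_Int[OF that[of k] W(1) WU] g(1)[of k]] by simp
  qed
  have c0: "reg e 0 (\<Union>W) (c (m + x))" if "x < ?r" for x by (rule cr) (use frameD(7)[OF F] that in simp)
  have cA: "reg e (As ! i) (\<Union>W) (c i)" if "i < m" for i by (rule cr) (use frameD(5)[OF F] that in simp)
  have geq: "g k y = G (%x. c (m + x)) k y + (SUM i<m. M k i y * c i y)" if k: "k < n" and y: "y : \<Union>W" for k y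
  proof -
   have yU: "y : \<Union>U" using y WU by blast
   have "g k y = (SUM l<n. L k l y * c l y)"
    unfolding c_def by (rule inverse_pair_apply[OF Li[OF yU] k, symmetric])
   thus ?thesis unfolding sum_split_lessThan[OF mn] by (simp add: G_def LM[OF k _ yU])
  qed
  interpret G: abelian_group "sect E W" by (rule ab_presheafD(1)[OF msheaf_ab[OF E] W(1)])
  have Gc: "reg e (Bs ! k) (\<Union>W) (G (%x. c (m + x)) k)" if "k < n" for k by (rule Gr[OF W(1) WU c0 that])
  have "rest E V W t = q W (tup n W g)" using W(5) g(2) by simp
  also have "tup n W g = tup n W (%k p. G (%x. c (m + x)) k p + (SUM i<m. M k i p * c i p))" by (rule tup_cong) (rule geq)
  also have "q W ... = q W (tup n W (G (%x. c (m + x)))) \<oplus>\<^bsub>sect E W\<^esub> q W (tup n W (%k p. SUM i<m. M k i p * c i p))"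
   by (rule q_add[OF W(1) Gc Ma_reg[OF zopen_opn[OF W(1)] cA]])
  also have "q W (tup n W (%k p. SUM i<m. M k i p * c i p)) = \<zero>\<^bsub>sect E W\<^esub>" by (rule q_img[OF W(1) cA])
  also have "q W (tup n W (G (%x. c (m + x)))) \<oplus>\<^bsub>sect E W\<^esub> \<zero>\<^bsub>sect E W\<^esub> = Ph W (tup ?r W (%x. c (m + x)))"
   unfolding Pht by (rule G.r_zero[OF q_in[OF W(1) Gc]])
  finally have "Ph W (tup ?r W (%x. c (m + x))) = rest E V W t" ..
  moreover have "tup ?r W (%x. c (m + x)) : carrier (sect ?S W)" by (rule tup_replicate_in[OF W(1) c0])
  ultimately show "EX W. zopen e W & Q : W & W <= V & (EX s:carrier (sect ?S W). Ph W s = rest E V W t)"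
   using W(1-3) by blast
 qed
 show "EX U \<phi>. zopen e U & P : U & is_mor_on e U ?S E \<phi> &
   (ALL V. zopen e V & V <= U --> bij_betw (\<phi> V) (carrier (sect ?S V)) (carrier (sect E V)))"
  by (intro exI[of _ U] exI[of _ Ph] conjI allI impI U zopen_mem[OF P p(1) U pU] Ph_mor; elim conjE)
   (rule local_iso_bij[OF E Ph_mor Ph_inj Ph_sur])
qed

end

lemma inverse_pair_head_apply:
 assumes N: "inverse_pair n N N'" and m: "m <= n" "l < m"
 shows "(SUM k<n. N k l * (SUM i<m. N' i k * y i)) = y l"
proof -
 have "(SUM k<n. N k l * (SUM i<m. N' i k * y i)) = (SUM k<n. SUM i<m. N' i k * N k l * y i)"
  by (simp add: sum_distrib_left mult_ac)
 also have "... = (SUM i<m. (SUM k<n. N' i k * N k l) * y i)" by (subst sum.swap) (simp add: sum_distrib_right)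
 also have "... = (SUM i<m. if i = l then y l else 0)"
  using inverse_pairD(2)[OF N] m by (intro sum.cong refl) auto
 finally show ?thesis using m(2) by simp
qed

lemma inverse_pair_transpose:
 assumes N: "inverse_pair n N N'" shows "inverse_pair n (%k l. N' l k) (%k l. N l k)"
 unfolding inverse_pair_def
proof (intro conjI allI impI)
 fix k h assume "k < n" "h < n"
 thus "(SUM l<n. N' l k * N h l) = (if k = h then 1 else 0)" "(SUM l<n. N l k * N' h l) = (if k = h then 1 else 0)"
  using inverse_pairD[OF N, of h k] by (auto simp: mult.commute)
qed

context matrix_kernel begin

text \<open>A local preimage of the h-th basis vector, scaled by a generator, is a vector v. Pairing
  a relation c between the rows with v leaves a nonzero multiple of c h.\<close>

lemma rows_independent:
 assumes sur: "surjective_mor e (split_bundle e As) (split_bundle e Bs) \<psi>" and p: "p : cone"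
 shows "ALL c. (ALL k<n. (SUM l<m. M l k p * c l) = 0) --> (ALL l<m. c l = 0)"
proof (intro allI impI)
 fix c h assume c: "ALL k<n. (SUM l<m. M l k p * c l) = 0" and h: "h < m"
 obtain a b where ab: "chart a b" "p : UT {a, b}" using p by (rule cone_chart)
 define U :: "'k pointset" where "U = Ch e a b"
 have U: "zopen e U" "\<Union>U = UT {a, b}" unfolding U_def by (rule Ch[OF ab(1)])+
 define t where "t l = (if l = h then tr e a b (Bs ! h) else (%p. 0 :: 'k))" for l
 have tr: "reg e (Bs ! l) (\<Union>U) (t l)" for l
  unfolding t_def U(2) 
  by (simp add: tr_reg[OF ab(1)] reg_0[OF reg_opn[OF tr_reg[OF ab(1), of e 0]]])
 have "locally_in_image e (split_bundle e As) (split_bundle e Bs) \<psi> U (tup m U t)"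
  using sur U(1) tup_in[OF U(1) tr] unfolding surjective_mor_def by blast
 then obtain V s where V: "zopen e V" "p : \<Union>V" "V <= U" "s : carrier (sect (split_bundle e As) V)"
   "\<psi> V s = rest (split_bundle e Bs) U V (tup m U t)"
  by (rule locally_in_imageD) (use ab(2) U(2) in simp)
 obtain v where v: "!!k. k < n ==> reg e (As ! k) (\<Union>V) (v k)" "s = tup n V v"
  by (rule tup_ex[OF V(1,4)]) (rule that, assumption+)
 have Mv: "\<psi> V (tup n V v) = tup m V (%l p. SUM k<n. M l k p * v k p)" by (rule M_eq[OF V(1) v(1)])
 have "tup m V (%l p. SUM k<n. M l k p * v k p) = tup m V t"
  using V(5) Mv unfolding v(2) tup_rest[OF V(3)] by simp
 from tup_eqD[OF this _ V(2)] have e: "(SUM k<n. M l k p * v k p) = t l p" if "l < m" for l using that .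
 have "c h * tr e a b (Bs ! h) p = (SUM l<m. if l = h then c h * tr e a b (Bs ! h) p else 0)" using h by simp
 also have "... = (SUM l<m. c l * (SUM k<n. M l k p * v k p))"
  by (intro sum.cong refl) (auto simp: e t_def)
 also have "... = (SUM k<n. (SUM l<m. M l k p * c l) * v k p)"
  unfolding sum_distrib_left sum_distrib_right by (subst sum.swap) (simp add: mult_ac)
 also have "... = 0" using c by simp
 finally show "c h = 0" using tr_nonzero[OF ab(2), of e "Bs ! h"] by simp
qed

lemma kernel_frame:
 assumes sur: "surjective_mor e (split_bundle e As) (split_bundle e Bs) \<psi>" and p: "p : cone"
 shows "EX V L L'. p : \<Union>V & frame e V n m (%k. - (As ! k)) (%l. - (Bs ! l)) (%k l. M l k) L L'"
proof (rule local_frame[where C = "%k l. M l k" and d = "%k. - (As ! k)" and c = "%l. - (Bs ! l)", OF p _ rows_independent[OF sur p]])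
 show "reg e (- (As ! k) - - (Bs ! l)) cone (M l k)" if "k < n" "l < m" for k l
  using reg_form[OF M_form[OF that(2,1)] zopen_opn[OF zopen_hirzebruch]] unfolding Union_hirz by simp
qed

text \<open>The first m rows of the inverse frame provide a right inverse of M near p.\<close>

lemma local_lift:
 assumes sur: "surjective_mor e (split_bundle e As) (split_bundle e Bs) \<psi>" and U: "zopen e U" "p : \<Union>U"
  and g: "!!l. l < m ==> reg e (Bs ! l + D) (\<Union>U) (g l)"
 shows "EX W w. zopen e W & p : \<Union>W & W <= U & (ALL k<n. reg e (As ! k + D) (\<Union>W) (w k)) &
     (ALL l<m. ALL q:\<Union>W. g l q = (SUM k<n. M l k q * w k q))"
proof -
 have "p : cone" using U opn_cone[OF zopen_opn[OF U(1)]] by blast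
 from kernel_frame[OF sur this]
 obtain V L L' where pV: "p : \<Union>V" and F: "frame e V n m (%k. - (As ! k)) (%l. - (Bs ! l)) (%k l. M l k) L L'" by blast
 note V = frameD(1)[OF F] and mn = frameD(2)[OF F] and LM = frameD(4)[OF F]
 define W where "W = U Int V"
 have W: "zopen e W" "W <= U" "W <= V" "p : \<Union>W"
  unfolding W_def zopen_Union_Int[OF U(1) V] using zopen_Int[OF U(1) V] U(2) pV by blast+
 define w where "w k q = (SUM l<m. L' l k q * g l q)" for k q
 have "reg e (As ! k + D) (\<Union>W) (w k)" if k: "k < n" for k
  unfolding w_def
 proof (rule reg_sum[OF zopen_opn[OF W(1)]])
  fix l assume "l : {..<m}"
  thus "reg e (As ! k + D) (\<Union>W) (%q. L' l k q * g l q)"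
   using reg_mult[OF reg_Int[OF frameD(5)[OF F k, of l] W(1,3)] reg_Int[OF g W(1,2), of l]] by (simp add: algebra_simps)
 qed
 moreover have "g l q = (SUM k<n. M l k q * w k q)" if l: "l < m" and q: "q : \<Union>W" for l q
 proof -
  have qV: "q : \<Union>V" using q W(3) by blast
  show ?thesis
   using inverse_pair_head_apply[OF frameD(3)[OF F qV] mn l, of "%i. g i q"] by (simp add: w_def LM[OF _ l qV])
 qed
 ultimately show ?thesis using W by blast
qed

text \<open>The frame is that of the transposed matrix; the last n - m rows of its inverse form a
  basis of the kernel of M over every smaller open set.\<close>

theorem vector_bundle:
 assumes sur: "surjective_mor e (split_bundle e As) (split_bundle e Bs) \<psi>"
 shows "vector_bundle e E"
 unfolding vector_bundle_def
proof (intro conjI exI[of _ "n - m"] ballI E)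
 let ?r = "n - m"
 let ?R = "replicate ?r (0::divclass)"
 let ?S = "split_bundle e ?R :: ('k, nat => 'k cox => 'k) msheaf"
 fix P :: "'k cox set" assume P: "P : hirzebruch e"
 then obtain p where p: "p : P" "p : cone" using hirz_ne by blast
 obtain U L L' where pU: "p : \<Union>U" and F: "frame e U n m (%k. - (As ! k)) (%l. - (Bs ! l)) (%k l. M l k) L L'"
  using kernel_frame[OF sur p(2)] by blast
 note U = frameD(1)[OF F] and mn = frameD(2)[OF F] and Li = frameD(3)[OF F] and LM = frameD(4)[OF F]
 \<comment> \<open>The combination of these last rows with coefficients f;
   \<open>inverse_pair_tail_zero\<close> puts it into the kernel.\<close>
 define G where "G f = (%k q. SUM x<?r. L' (m + x) k q * f x q)" for f :: "nat => 'k cox => 'k"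
 define Ph where "Ph V s = inv_into (carrier (sect E V)) (j V) (tup n V (G s))" for V s
 have Gt: "tup n V (G (tup ?r V f)) = tup n V (G f)" for V f
  by (rule tup_cong) (simp add: G_def tup_at del: Union_iff)
 have im: "tup n V (G s) : j V ` carrier (sect E V)" if V: "zopen e V" "V <= U" and s: "s : carrier (sect ?S V)" for V s
 proof -
  obtain f where f: "!!x. x < ?r ==> reg e 0 (\<Union>V) (f x)" "s = tup ?r V f" by (rule tup_replicate_ex[OF V(1) s]) (rule that, assumption+)
  have "EX x:carrier (sect E V). j V x = tup n V (G f)"
  proof (rule j_surj[OF V(1)])
   fix k assume k: "k < n"
   show "reg e (As ! k) (\<Union>V) (G f k)" unfolding G_def
   proof (rule reg_sum[OF zopen_opn[OF V(1)]])
    fix x assume "x : {..<?r}"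
    thus "reg e (As ! k) (\<Union>V) (%q. L' (m + x) k q * f x q)"
     using reg_mult[OF reg_Int[OF frameD(7)[OF F k, of x] V] f(1)[of x]] by simp
   qed
  next
   fix l q assume l: "l < m" and "q : \<Union>V"
   hence q: "q : \<Union>U" using V(2) by blast
   show "(SUM k<n. M l k q * G f k q) = 0"
    using inverse_pair_tail_zero[OF Li[OF q] mn l, of "%x. f x q"] by (simp add: G_def LM[OF _ l q])
  qed
  thus ?thesis unfolding f(2) Gt by (metis imageI)
 qed
 have jPh: "j V (Ph V s) = tup n V (G s)" if "zopen e V" "V <= U" "s : carrier (sect ?S V)" for V s
  unfolding Ph_def by (rule f_inv_into_f[OF im[OF that]])
 have "is_mor_on e U ?S (split_bundle e As) (%V s. tup n V (%k p. SUM x<length ?R. L' (m + x) k p * s x p))"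
  by (rule matrix_mor) (use frameD(7)[OF F] in simp)
 hence "is_mor_on e U ?S (split_bundle e As) (%V s. tup n V (G s))" by (simp add: G_def)
 from mor_lift[OF mor_on_subset[OF j_mor zopen_hirz[OF U]] j_inj E this im]
 have Ph_mor: "is_mor_on e U ?S E Ph" unfolding Ph_def[abs_def] .
 have Ph_inj: "inj_on (Ph V) (carrier (sect ?S V))" if V: "zopen e V" "V <= U" for V
 proof (rule inj_onI)
  fix s t assume s: "s : carrier (sect ?S V)" and t: "t : carrier (sect ?S V)" and eq: "Ph V s = Ph V t"
  obtain f where f: "s = tup ?r V f" by (rule tup_replicate_ex[OF V(1) s]) (rule that, assumption+)
  obtain g where g: "t = tup ?r V g" by (rule tup_replicate_ex[OF V(1) t]) (rule that, assumption+)
  have Geq: "tup n V (G f) = tup n V (G g)" using jPh[OF V s] jPh[OF V t] eq unfolding f g Gt by simp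
  have "f x y = g x y" if x: "x < ?r" and y: "y : \<Union>V" for x y
  proof -
   have yU: "y : \<Union>U" using y V(2) by blast
   have "f x y - g x y = 0"
   proof (rule inverse_pair_tail_inj[where d = "%x. f x y - g x y" and b = "%i. 0", OF inverse_pair_transpose[OF Li[OF yU]] mn x])
    fix k assume k: "k < n"
    show "(SUM x<?r. L' (m + x) k y * (f x y - g x y)) = (SUM i<m. L' i k y * 0)"
     using tup_eqD[OF Geq k y] by (simp add: G_def right_diff_distrib sum_subtractf)
   qed
   thus ?thesis by simp
  qed
  thus "s = t" unfolding f g by (rule tup_cong)
 qed
 have Ph_sur: "x : Ph V ` carrier (sect ?S V)" if V: "zopen e V" "V <= U" and x: "x : carrier (sect E V)" for V x
 proof -
  obtain v where v: "!!k. k < n ==> reg e (As ! k) (\<Union>V) (v k)" "j V x = tup n V v"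
   "!!l p. l < m ==> p : \<Union>V ==> (SUM k<n. M l k p * v k p) = 0" by (rule j_ex[OF V(1) x]) (rule that, assumption+)
  define f where "f x y = (SUM k<n. L k (m + x) y * v k y)" for x y
  have fr: "reg e 0 (\<Union>V) (f x)" if x: "x < ?r" for x
   unfolding f_def
  proof (rule reg_sum[OF zopen_opn[OF V(1)]])
   fix k assume "k : {..<n}"
   thus "reg e 0 (\<Union>V) (%y. L k (m + x) y * v k y)"
    using reg_mult[OF reg_Int[OF frameD(6)[OF F _ x, of k] V] v(1)[of k]] by simp
  qed
  have c: "tup ?r V f : carrier (sect ?S V)" by (rule tup_replicate_in[OF V(1) fr])
  have "tup n V (G f) = tup n V v"
  proof (rule tup_cong)
   fix k y assume k: "k < n" and y: "y : \<Union>V"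
   have yU: "y : \<Union>U" using y V(2) by blast
   show "G f k y = v k y" unfolding G_def f_def
   proof (rule inverse_pair_tail_apply[OF Li[OF yU] mn k, where y = "%k. v k y"])
    fix l assume l: "l < m"
    show "(SUM h<n. L h l y * v h y) = 0" using v(3)[OF l y] by (simp add: LM[OF _ l yU])
   qed
  qed
  hence "j V x = j V (Ph V (tup ?r V f))" unfolding jPh[OF V c] Gt v(2) by simp
  hence "x = Ph V (tup ?r V f)" by (rule inj_onD[OF j_inj[OF V(1)] _ x is_morD(1)[OF Ph_mor V c]])
  thus ?thesis using c by blast
 qed
 have "bij_betw (Ph V) (carrier (sect ?S V)) (carrier (sect E V))" if V: "zopen e V" "V <= U" for V
  using Ph_inj[OF V] Ph_sur[OF V] is_morD(1)[OF Ph_mor V] unfolding bij_betw_def by blast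
 thus "EX U \<phi>. zopen e U & P : U & is_mor_on e U ?S E \<phi> &
   (ALL V. zopen e V & V <= U --> bij_betw (\<phi> V) (carrier (sect ?S V)) (carrier (sect E V)))"
  by (intro exI[of _ U] exI[of _ Ph] conjI allI impI U zopen_mem[OF P p(1) U pU] Ph_mor; elim conjE)
qed

end

section \<open>Linear algebra on spaces of forms and counting monomials\<close>

lemma homogeneous_nontrivial:
 fixes A :: "'b => 'a => 'k::field"
 assumes "finite J" "finite I" "card J < card I"
 shows "EX x. (EX i:I. x i ~= 0) & (ALL y:J. (SUM i:I. A y i * x i) = 0)"
 using assms
proof (induction J arbitrary: I A rule: finite_induct)
 case empty
 hence "I ~= {}" by auto
 thus ?case by (intro exI[of _ "%_. 1"]) auto
next
 case (insert y J)
 show ?case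
 proof (cases "ALL i:I. A y i = 0")
  case True
  have "card J < card I" using insert.prems insert.hyps by simp
  then obtain x where "EX i:I. x i ~= 0" "ALL z:J. (SUM i:I. A z i * x i) = 0"
   using insert.IH[OF insert.prems(1)] by blast
  thus ?thesis using True by (intro exI[of _ x]) simp
 next
  case False
  then obtain i0 where i0: "i0 : I" "A y i0 ~= 0" by blast
  define B where "B z i = A z i - A z i0 * A y i / A y i0" for z i
  have "card J < card (I - {i0})" using insert.prems insert.hyps i0 by simp
  then obtain x where x: "EX i:I - {i0}. x i ~= 0" "ALL z:J. (SUM i:I - {i0}. B z i * x i) = 0"
   using insert.IH[of "I - {i0}" B] insert.prems(1) by auto
  define s where "s = (SUM i:I - {i0}. A y i * x i)"
  define x' where "x' = x(i0 := - s / A y i0)"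
  have sum: "(SUM i:I. A z i * x' i) = A z i0 * (- s / A y i0) + (SUM i:I - {i0}. A z i * x i)" for z
  proof -
   have "(SUM i:I - {i0}. A z i * x' i) = (SUM i:I - {i0}. A z i * x i)"
    by (intro sum.cong refl) (simp add: x'_def)
   thus ?thesis using sum.remove[OF insert.prems(1) i0(1), of "%i. A z i * x' i"] by (simp add: x'_def)
  qed
  have "(SUM i:I. A y i * x' i) = 0" unfolding sum using i0(2) by (simp add: s_def)
  moreover have "(SUM i:I. A z i * x' i) = 0" if "z : J" for z
  proof -
   have "(SUM i:I - {i0}. B z i * x i) = (SUM i:I - {i0}. A z i * x i) - A z i0 * s / A y i0"
    by (simp add: B_def s_def left_diff_distrib right_diff_distrib sum_subtractf sum_distrib_left sum_divide_distrib mult_ac)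
   thus ?thesis unfolding sum using x(2) that by simp
  qed
  moreover have "EX i:I. x' i ~= 0" using x(1) by (auto simp: x'_def)
  ultimately show ?thesis by (intro exI[of _ x']) simp
 qed
qed

text \<open>Adjoin an unknown with column -b, indexed by \<open>None\<close>: there are then more
  unknowns than equations. In a nontrivial solution the new unknown is nonzero by injectivity, and
  dividing by it solves the inhomogeneous system.\<close>

lemma square_injective_imp_surjective:
 fixes A :: "'b => 'a => 'k::field"
 assumes fin: "finite I" "finite J" "card I = card J"
  and inj: "!!x. (ALL y:J. (SUM i:I. A y i * x i) = 0) ==> (ALL i:I. x i = 0)"
 shows "EX x. ALL y:J. (SUM i:I. A y i * x i) = b y"
proof -
 define A' where "A' y o' = (case o' of None => - b y | Some i => A y i)" for y o'
 define I' where "I' = insert None (Some ` I)"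
 have "card I' = Suc (card I)" unfolding I'_def using fin by (simp add: card_image)
 hence "card J < card I'" using fin by simp
 moreover have "finite I'" unfolding I'_def using fin by simp
 ultimately obtain x where x: "EX i:I'. x i ~= 0" "ALL y:J. (SUM i:I'. A' y i * x i) = 0"
  using homogeneous_nontrivial[OF fin(2), of I' A'] by blast
 have eq: "(SUM i:I. A y i * x (Some i)) = b y * x None" if "y : J" for y
 proof -
  have "(SUM i:I'. A' y i * x i) = - b y * x None + (SUM i:I. A y i * x (Some i))"
   unfolding I'_def A'_def using fin by (simp add: sum.reindex)
  thus ?thesis using x(2) that by simp
 qed
 have "x None ~= 0"
 proof
  assume z: "x None = 0"
  hence "ALL i:I. x (Some i) = 0" using eq by (intro inj) simp
  thus False using x(1) z by (auto simp: I'_def)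
 qed
 hence "(SUM i:I. A y i * (x (Some i) / x None)) = b y" if "y : J" for y
  using eq[OF that] by (simp add: sum_divide_distrib[symmetric])
 thus ?thesis by (intro exI[of _ "%i. x (Some i) / x None"] ballI)
qed

lemma mon_independent:
 fixes c :: "int \<times> int => 'k::field_char_0"
 assumes "!!p. p : cone ==> (SUM m:exps e D {}. c m * mon e D m p) = 0" "m : exps e D {}"
 shows "c m = 0"
proof -
 define c' where "c' m = (if m : exps e D {} then c m else 0)" for m
 have sub: "{m. c' m ~= 0} <= exps e D {}" by (auto simp: c'_def)
 have "c' m = 0"
 proof (rule evl_eq_0_imp)
  show "finite {m. c' m ~= 0}" by (rule finite_subset[OF sub]) simp
  fix p :: "'k cox" assume "p : UT {0, 1, 2, 3}"
  hence "p : cone" by (simp add: UT_def)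
  moreover have "evl e D c' p = (SUM m:exps e D {}. c' m * mon e D m p)" by (rule evl_superset[OF _ sub]) simp
  moreover have "... = (SUM m:exps e D {}. c m * mon e D m p)" by (intro sum.cong refl) (simp add: c'_def)
  ultimately show "evl e D c' p = 0" using assms(1) by simp
 qed
 thus ?thesis using assms(2) by (simp add: c'_def)
qed

text \<open>Multiplication by the matrix is linear in the coefficients with respect to the monomial
  bases, and by \<open>card\<close> both spaces have the same finite dimension.\<close>

theorem form_matrix_surjective:
 fixes F :: "nat => nat => 'k::field_char_0 cox => 'k"
 assumes F: "!!j k. j < q ==> k < n ==> cox_form e (T j - S k) (F j k)"
  and card: "(SUM k<n. card (exps e (S k) {})) = (SUM j<q. card (exps e (T j) {}))"
  and inj: "!!w. [|ALL k<n. cox_form e (S k) (w k); ALL j<q. ALL p:cone. (SUM k<n. F j k p * w k p) = 0|]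
    ==> ALL k<n. ALL p:cone. w k p = 0"
  and g: "!!j. j < q ==> cox_form e (T j) (g j)"
 shows "EX w. (ALL k<n. cox_form e (S k) (w k)) & (ALL j<q. ALL p:cone. g j p = (SUM k<n. F j k p * w k p))"
proof -
 define P where "P j k \<nu> c \<longleftrightarrow> (ALL p. F j k p * mon e (S k) \<nu> p = (SUM \<mu>:exps e (T j) {}. c \<mu> * mon e (T j) \<mu> p))" for j k \<nu> c
 define a where "a j k \<nu> = (SOME c. P j k \<nu> c)" for j k \<nu>
 have a: "F j k p * mon e (S k) \<nu> p = (SUM \<mu>:exps e (T j) {}. a j k \<nu> \<mu> * mon e (T j) \<mu> p)"
  if "j < q" "k < n" "\<nu> : exps e (S k) {}" for j k \<nu> p
 proof -
  have "cox_form e (T j - S k + S k) (%p. F j k p * (1 * mon e (S k) \<nu> p))"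
   by (rule cox_form_mult[OF F[OF that(1,2)] cox_form_mon[OF that(3)]])
  hence "cox_form e (T j) (%p. F j k p * mon e (S k) \<nu> p)" by simp
  then obtain c where "(%p. F j k p * mon e (S k) \<nu> p) = (%p. SUM \<mu>:exps e (T j) {}. c \<mu> * mon e (T j) \<mu> p)"
   unfolding cox_form_iff by blast
  hence "P j k \<nu> c" unfolding P_def by (simp add: fun_eq_iff)
  hence "P j k \<nu> (a j k \<nu>)" unfolding a_def by (rule someI[of "P j k \<nu>"])
  thus ?thesis unfolding P_def by blast
 qed
 define I where "I = Sigma {..<n} (%k. exps e (S k) {})"
 define J where "J = Sigma {..<q} (%j. exps e (T j) {})"
 define A where "A y i = a (fst y) (fst i) (snd i) (snd y)" for y i
 have fin: "finite I" "finite J" unfolding I_def J_def by (intro finite_SigmaI; simp)+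
 have cIJ: "card I = card J" unfolding I_def J_def using card by simp
 define w where "w x k = (%p. SUM \<nu>:exps e (S k) {}. x (k, \<nu>) * mon e (S k) \<nu> p)"
  for x :: "nat \<times> int \<times> int => 'k" and k
 have wF: "cox_form e (S k) (w x k)" for x k unfolding w_def cox_form_iff by (rule exI[of _ "%\<nu>. x (k, \<nu>)"]) simp
 have Fw: "(SUM k<n. F j k p * w x k p) = (SUM \<mu>:exps e (T j) {}. (SUM i:I. A (j, \<mu>) i * x i) * mon e (T j) \<mu> p)" if j: "j < q" for j p x
 proof -
  have "(SUM k<n. F j k p * w x k p) = (SUM k<n. SUM \<nu>:exps e (S k) {}. (F j k p * mon e (S k) \<nu> p) * x (k, \<nu>))"
   by (simp add: w_def sum_distrib_left mult_ac)
  also have "... = (SUM k<n. SUM \<nu>:exps e (S k) {}. SUM \<mu>:exps e (T j) {}. a j k \<nu> \<mu> * x (k, \<nu>) * mon e (T j) \<mu> p)"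
   by (intro sum.cong refl) (simp add: a[OF j] sum_distrib_left sum_distrib_right mult_ac)
  also have "... = (SUM i:I. SUM \<mu>:exps e (T j) {}. A (j, \<mu>) i * x i * mon e (T j) \<mu> p)"
   unfolding I_def A_def by (subst sum.Sigma) (simp_all add: case_prod_unfold)
  also have "... = (SUM \<mu>:exps e (T j) {}. SUM i:I. A (j, \<mu>) i * x i * mon e (T j) \<mu> p)" by (rule sum.swap)
  finally show ?thesis by (simp add: sum_distrib_right)
 qed
 have "EX c. g j = (%p. SUM \<mu>:exps e (T j) {}. c \<mu> * mon e (T j) \<mu> p)" if "j < q" for j
  using g[OF that] unfolding cox_form_iff .
 hence "EX c. ALL j:{..<q}. g j = (%p. SUM \<mu>:exps e (T j) {}. c j \<mu> * mon e (T j) \<mu> p)" by (intro bchoice) simp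
 then obtain c where c: "ALL j:{..<q}. g j = (%p. SUM \<mu>:exps e (T j) {}. c j \<mu> * mon e (T j) \<mu> p)" ..
 have "EX x. ALL y:J. (SUM i:I. A y i * x i) = c (fst y) (snd y)"
 proof (rule square_injective_imp_surjective[OF fin cIJ])
  fix x assume z: "ALL y:J. (SUM i:I. A y i * x i) = 0"
  have "(SUM k<n. F j k p * w x k p) = 0" if "j < q" for j p
   unfolding Fw[OF that] using z that by (intro sum.neutral) (simp add: J_def)
  hence w0: "ALL k<n. ALL p:cone. w x k p = 0" using wF by (intro inj) simp_all
  show "ALL i:I. x i = 0"
  proof
   fix i assume "i : I"
   then obtain k \<nu> where i: "i = (k, \<nu>)" "k < n" "\<nu> : exps e (S k) {}" unfolding I_def by (elim SigmaE) simp
   have "x (k, \<nu>) = 0" using mon_independent[where e = e and D = "S k" and c = "%\<nu>. x (k, \<nu>)" and m = \<nu>] w0 i(2,3) by (simp add: w_def)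
   thus "x i = 0" by (simp add: i(1))
  qed
 qed
 then obtain x where x: "ALL y:J. (SUM i:I. A y i * x i) = c (fst y) (snd y)" ..
 have "g j p = (SUM k<n. F j k p * w x k p)" if j: "j < q" for j p
 proof -
  have "g j p = (SUM \<mu>:exps e (T j) {}. c j \<mu> * mon e (T j) \<mu> p)" using c j by simp
  also have "... = (SUM \<mu>:exps e (T j) {}. (SUM i:I. A (j, \<mu>) i * x i) * mon e (T j) \<mu> p)"
   using x j by (intro sum.cong refl) (simp add: J_def)
  finally show ?thesis unfolding Fw[OF j] .
 qed
 thus ?thesis using wF by (intro exI[of _ "w x"]) simp
qed

lemma exps_mem: "(i, l) : exps e (s, t) {} \<longleftrightarrow> 0 <= i & i <= t - int e * l & 0 <= l & l <= s"
 by (auto simp: exps_iff xp_def)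

text \<open>Induction on the number of rows l = 0, ..., n - 1 of the trapezoid of exponents. The
  bound -1 admits an empty last row, for which the formula remains true; doubling avoids a
  division.\<close>

lemma card_exps_nat:
 assumes "-1 <= t - int e * (int n - 1)"
 shows "2 * int (card (exps e (int n - 1, t) {})) = int n * (2 * t + 2 - int e * (int n - 1))"
 using assms
proof (induction n)
 case 0
 have "exps e (int 0 - 1, t) {} = {}"
 proof (rule equals0I)
  fix m assume "m : exps e (int 0 - 1, t) {}"
  thus False by (cases m) (auto simp: exps_mem)
 qed
 thus ?case by simp
next
 case (Suc n)
 have t: "-1 <= t - int e * int n" using Suc.prems by simp
 have "int e * (int n - 1) <= int e * int n" by (simp add: mult_left_mono)
 hence IH: "2 * int (card (exps e (int n - 1, t) {})) = int n * (2 * t + 2 - int e * (int n - 1))"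
  using t by (intro Suc.IH) linarith
 have eq: "exps e (int (Suc n) - 1, t) {} = exps e (int n - 1, t) {} \<union> (%i. (i, int n)) ` {0..t - int e * int n}"
 proof (rule Set.set_eqI)
  fix m show "m : exps e (int (Suc n) - 1, t) {} \<longleftrightarrow> m : exps e (int n - 1, t) {} \<union> (%i. (i, int n)) ` {0..t - int e * int n}"
   by (cases m) (auto simp: exps_mem)
 qed
 have "card (exps e (int (Suc n) - 1, t) {}) = card (exps e (int n - 1, t) {}) + card ((%i. (i, int n)) ` {0..t - int e * int n})"
  unfolding eq by (rule card_Un_disjoint) (auto simp: exps_mem)
 also have "card ((%i. (i, int n)) ` {0..t - int e * int n}) = nat (t - int e * int n + 1)"
  by (subst card_image) (auto simp: inj_on_def)
 finally have "int (card (exps e (int (Suc n) - 1, t) {})) = int (card (exps e (int n - 1, t) {})) + (t - int e * int n + 1)"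
  using t by simp
 thus ?case using IH by (simp add: algebra_simps)
qed

lemma card_exps:
 assumes "-1 <= s" "-1 <= t - int e * s"
 shows "2 * int (card (exps e (s, t) {})) = (s + 1) * (2 * t + 2 - int e * s)"
proof -
 have "s = int (nat (s + 1)) - 1" using assms by simp
 thus ?thesis using card_exps_nat[of t e "nat (s + 1)"] assms by simp
qed

text \<open>The two sign patterns need s < l < 0 with 0 <= i <= t - e l, or 0 <= l <= s with t - e l
  < i < 0. As e l grows with l, the extreme values l = s + 1 and l = s decide.\<close>

lemma noH1_I:
 assumes "(s <= -1 & t < int e * (s + 1)) | (-1 <= s & -1 <= t - int e * s)"
 shows "noH1 e (s, t)"
 unfolding noH1_def
proof (intro allI conjI notI)
 fix m :: "int \<times> int"
 obtain i l where m: "m = (i, l)" by (cases m)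
 { assume "0 <= xp e (s, t) m 0 & 0 <= xp e (s, t) m 1 & xp e (s, t) m 2 < 0 & xp e (s, t) m 3 < 0"
  hence h: "0 <= t - int e * l - i" "0 <= i" "s < l" "l < 0" by (simp_all add: m xp_def)
  hence "int e * (s + 1) <= int e * l" by (intro mult_left_mono) auto
  thus False using assms h by linarith }
 { assume "xp e (s, t) m 0 < 0 & xp e (s, t) m 1 < 0 & 0 <= xp e (s, t) m 2 & 0 <= xp e (s, t) m 3"
  hence h: "t - int e * l - i < 0" "i < 0" "l <= s" "0 <= l" by (simp_all add: m xp_def)
  hence "int e * l <= int e * s" by (intro mult_left_mono) auto
  thus False using assms h by linarith }
qed

text \<open>Four negative exponents mean s < l < 0 and t - e l < i < 0. The first alternative leaves
  no l; in the second l = -1, and t + e = -1 leaves no i.\<close>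

lemma no_negexp:
 assumes "-1 <= s | (s = -2 & t = -1 - int e)"
 shows "~ negexp e (s, t) m"
proof
 obtain i l where m: "m = (i, l)" by (cases m)
 assume "negexp e (s, t) m"
 hence h: "t - int e * l - i < 0" "i < 0" "s < l" "l < 0" by (simp_all add: m xp_def negexp_def all4)
 have st: "s = -2" "t = -1 - int e" using assms h by auto
 have l: "l = -1" using h st by linarith
 show False using h(1,2) unfolding st l by simp
qed

lemma exps_empty_reg:
 fixes f :: "'k::{alg_closed_field, field_char_0} cox => 'k"
 assumes "exps e D {} = {}" "reg e D cone f" "p : cone" shows "f p = 0"
proof -
 obtain F where F: "cox_form e D F" "!!p. p : cone ==> f p = F p" using reg_cone_form[OF assms(2)] by blast
 obtain c where "F = (%p. SUM m:exps e D {}. c m * mon e D m p)" using F(1) unfolding cox_form_iff by blast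
 thus ?thesis using F(2)[OF assms(3)] assms(1) by simp
qed

lemma exps_empty: "s < 0 | t < 0 ==> exps e (s, t) {} = {}"
proof (rule equals0I)
 fix m assume h: "s < 0 | t < 0" "m : exps e (s, t) {}"
 obtain i l where m: "m = (i, l)" by (cases m)
 have "0 <= i" "i <= t - int e * l" "0 <= l" "l <= s" using h(2) by (simp_all add: m exps_mem)
 moreover have "0 <= int e * l" using calculation by simp
 ultimately show False using h(1) by linarith
qed

text \<open>Global sections are spanned by monomials, so a few points test them: p1 and p2 lie on
  one fibre, p2 and p3 on C0. For a = 0 no monomial separates p1 from p2; for b = a e none separates
  p2 from p3, for b < a e all vanish at p2, and for negative a there are none.\<close>

lemma very_ample_pos:
 assumes va: "very_ample TYPE('k::{alg_closed_field, field_char_0}) e (a, b)"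
 shows "1 <= a" "a * int e < b"
proof -
 obtain N and s :: "nat => 'k cox => 'k" where s: "ALL i<=N. s i : line_sections e (a, b) (hirzebruch e)"
  "ALL p : \<Union>(hirzebruch e). EX i<=N. s i p ~= 0"
  "ALL P : hirzebruch e. ALL Q : hirzebruch e. (EX p:P. EX q:Q. EX c. c ~= 0 & (ALL i<=N. s i p = c * s i q)) --> P = Q"
  using va unfolding very_ample_def by (elim exE conjE) (rule that)
 have form: "EX c. ALL p:cone. s i p = (SUM m:exps e (a, b) {}. c m * mon e (a, b) m p)" if "i <= N" for i
 proof -
  have "reg e (a, b) cone (s i)"
   using line_sectionsD(1)[OF zopen_hirzebruch s(1)[rule_format, OF that]] unfolding Union_hirz .
  then obtain F where F: "cox_form e (a, b) F" "!!p. p : cone ==> s i p = F p" using reg_cone_form by blast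
  obtain c where "F = (%p. SUM m:exps e (a, b) {}. c m * mon e (a, b) m p)" using F(1) unfolding cox_form_iff by blast
  thus ?thesis using F(2) by auto
 qed
 have ne: "EX m:exps e (a, b) {}. mon e (a, b) m p ~= 0" if p: "p : cone" for p :: "'k cox"
 proof (rule ccontr)
  assume z: "~ (EX m:exps e (a, b) {}. mon e (a, b) m p ~= 0)"
  have "s i p = 0" if "i <= N" for i
   using form[OF that] p z by auto
  thus False using s(2) p unfolding Union_hirz by blast
 qed
 have sep: "EX m:exps e (a, b) {}. mon e (a, b) m p ~= mon e (a, b) m q"
  if p: "p : cone" "q : cone" and pq: "torus_orbit e p ~= torus_orbit e q" for p q :: "'k cox"
 proof (rule ccontr)
  assume z: "~ (EX m:exps e (a, b) {}. mon e (a, b) m p ~= mon e (a, b) m q)"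
  have "s i p = 1 * s i q" if i: "i <= N" for i
  proof -
   obtain c where c: "ALL p:cone. s i p = (SUM m:exps e (a, b) {}. c m * mon e (a, b) m p)" using form[OF i] by (elim exE) (rule that)
   have "(SUM m:exps e (a, b) {}. c m * mon e (a, b) m p) = (SUM m:exps e (a, b) {}. c m * mon e (a, b) m q)"
    using z by (intro sum.cong refl) simp
   thus ?thesis using c[rule_format, OF p(1)] c[rule_format, OF p(2)] by simp
  qed
  hence "EX p':torus_orbit e p. EX q':torus_orbit e q. EX c. c ~= 0 & (ALL i<=N. s i p' = c * s i q')"
   using orbit_self[of p e] orbit_self[of q e] by (intro bexI[of _ p] bexI[of _ q] exI[of _ 1]) simp_all
  moreover have "torus_orbit e p : hirzebruch e" "torus_orbit e q : hirzebruch e"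
   unfolding hirzebruch_eq using p by blast+
  ultimately show False using s(3) pq by blast
 qed
 define p1 p2 p3 :: "'k cox" where "p1 = (1, 0, 1, 0)" and "p2 = (1, 0, 0, 1)" and "p3 = (0, 1, 0, 1)"
 have pc: "p1 : cone" "p2 : cone" "p3 : cone" by (simp_all add: p1_def p2_def p3_def cone_def cc_def)
 have o12: "torus_orbit e p1 ~= torus_orbit e p2"
 proof -
  have "p1 ~: torus_orbit e p2" by (simp add: torus_orbit_def p1_def p2_def)
  thus ?thesis using orbit_self[of p1 e] by blast
 qed
 have o23: "torus_orbit e p2 ~= torus_orbit e p3"
 proof -
  have "p2 ~: torus_orbit e p3" by (simp add: torus_orbit_def p2_def p3_def)
  thus ?thesis using orbit_self[of p2 e] by blast
 qed
 have ex: "EX i l. m = (i, l) & 0 <= i & i <= b - int e * l & 0 <= l & l <= a" if "m : exps e (a, b) {}" for m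
  using that by (cases m) (simp add: exps_mem)
 show a: "1 <= a"
 proof (rule ccontr)
  assume "~ 1 <= a"
  then consider "a < 0" | "a = 0" by linarith
  thus False
  proof cases
   case 1 thus False using ne[OF pc(1)] exps_empty[of a b e] by simp
  next
   case 2
   obtain m where m: "m : exps e (a, b) {}" "mon e (a, b) m p1 ~= mon e (a, b) m p2" using sep[OF pc(1,2) o12] by blast
   obtain i l where "m = (i, l)" "0 <= l" "l <= a" using ex[OF m(1)] by blast
   thus False using m(2) 2 by (simp add: mon_def xp_def cc_def p1_def p2_def)
  qed
 qed
 show "a * int e < b"
 proof (rule ccontr)
  assume "~ a * int e < b"
  then consider "b < a * int e" | "b = a * int e" by linarith
  thus False
  proof cases
   case 1
   obtain m where m: "m : exps e (a, b) {}" "mon e (a, b) m p2 ~= 0" using ne[OF pc(2)] by blast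
   obtain i l where il: "m = (i, l)" "0 <= i" "i <= b - int e * l" "0 <= l" "l <= a" using ex[OF m(1)] by blast
   have "l = a" using m(2) by (simp add: mon_def xp_def cc_def p2_def il(1) split: if_splits)
   thus False using il 1 by (simp add: mult.commute)
  next
   case 2
   obtain m where m: "m : exps e (a, b) {}" "mon e (a, b) m p2 ~= mon e (a, b) m p3" using sep[OF pc(2,3) o23] by blast
   obtain i l where il: "m = (i, l)" "0 <= i" "i <= b - int e * l" "0 <= l" "l <= a" using ex[OF m(1)] by blast
   show False
   proof (cases "l = a")
    case True
    hence "i = 0" using il 2 by (simp add: mult.commute)
    thus False using m(2) 2 True by (simp add: mon_def xp_def cc_def p2_def p3_def il(1))
   next
    case False
    thus False using m(2) by (simp add: mon_def xp_def cc_def p2_def p3_def il(1))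
   qed
  qed
 qed
qed

lemma chart_form:
 assumes "chart i j" "0 <= s" "0 <= t - int e * s"
 obtains Z :: "'k::field cox => 'k" where "cox_form e (s, t) Z" "!!p. p : UT {i, j} ==> Z p ~= 0"
proof -
 define n where "n = nat s"
 define r where "r = nat (if j = 2 then t else t - int e * s)"
 have j: "i = 0 | i = 1" "j = 2 | j = 3" using assms(1) by (auto simp: chart_def)
 have "0 <= int e * s" using assms(2) by simp
 hence t: "0 <= t" using assms(3) by linarith
 have F: "cox_form e (nd n (dg e j) + nd r (dg e i)) (%p. cc p j ^ n * cc p i ^ r :: 'k)"
  using j by (intro cox_form_mult cox_form_power cox_form_cc) auto
 have deg: "nd n (dg e j) + nd r (dg e i) = (s, t)"
  using j assms t by (auto simp: nd_def dg_def n_def r_def mult.commute)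
 have nz: "cc p j ^ n * cc p i ^ r ~= 0" if "p : UT {i, j}" for p :: "'k cox" using that by (simp add: UT_def)
 show ?thesis by (rule that[OF F[unfolded deg] nz])
qed

lemma sum_list_replicate_pair: "sum_list (replicate n (x, y)) = (int n * x, int n * y)"
 by (induction n) (simp_all add: zero_prod_def algebra_simps)

lemma nth_two_blocks:
 "k < m + n ==> (replicate m x @ replicate n y) ! k = (if k < m then x else y)"
 by (simp add: nth_append)

lemma sum_two_blocks:
 fixes f :: "'a => nat"
 shows "(SUM k<m + n. f ((replicate m x @ replicate n y) ! k)) = m * f x + n * f y"
 using sum_split_lessThan[of m "m + n" "%k. f ((replicate m x @ replicate n y) ! k)"] by (simp add: nth_append)

text \<open>The factors in \<open>num\<close> are twice the numbers of monomials of the three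
  degrees. The inequalities on a and b keep these degrees in the range of \<open>card_exps\<close>,
  including the boundary case a = 1, where the second space is zero.\<close>

lemma card_exps_blocks:
 assumes a: "1 <= a" "a * int e < b"
  and num: "int m * (a * (2 * b - 2 - int e * (a - 1))) + int n * ((a - 1) * (2 * b - int e * a)) =
   int r * (a * (2 * b - int e * (a - 1)))"
 shows "m * card (exps e (a - 1, b - 2) {}) + n * card (exps e (a - 2, b - 1 - int e) {}) = r * card (exps e (a - 1, b - 1) {})"
proof -
 have "0 <= int e" by simp
 hence c: "2 * int (card (exps e (a - 1, b - 2) {})) = a * (2 * b - 2 - int e * (a - 1))"
   "2 * int (card (exps e (a - 2, b - 1 - int e) {})) = (a - 1) * (2 * b - int e * a)"
   "2 * int (card (exps e (a - 1, b - 1) {})) = a * (2 * b - int e * (a - 1))"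
  using a by (subst card_exps; simp add: algebra_simps)+
 have "2 * int (m * card (exps e (a - 1, b - 2) {}) + n * card (exps e (a - 2, b - 1 - int e) {})) =
   int m * (2 * int (card (exps e (a - 1, b - 2) {}))) + int n * (2 * int (card (exps e (a - 2, b - 1 - int e) {})))" by simp
 also have "... = 2 * int (r * card (exps e (a - 1, b - 1) {}))" unfolding c num by (simp add: c(3)[symmetric])
 finally show ?thesis unfolding mult_cancel_left of_nat_eq_iff by simp
qed

section \<open>The two Ulrich criteria\<close>

lemma (in matrix_coker) twist_split_coker:
 assumes "!!i j. chart i j ==> EX \<sigma>. (ALL h<m. ALL k<n. reg e (As ! h - Bs ! k) (UT {i, j}) (\<sigma> h k)) &
   (ALL h<m. ALL l<m. ALL p:UT {i, j}. (SUM k<n. \<sigma> h k p * M k l p) = (if l = h then 1 else 0))"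
 shows "split_coker e (twist e D E) n (%k. Bs ! k + D) (rep D) m (%i. As ! i + D) M"
 by (rule split_coker.intro[OF twist_coker_sheaf split_coker_axioms.intro]) (use assms in simp)

theorem ulrich_cokernel:
 fixes E :: "('k::{alg_closed_field, field_char_0}, 'm) msheaf"
 assumes ab: "1 <= a" "a * int e < b"
  and As: "As = replicate \<gamma> (a - 1, b - int e - 1)"
  and Bs: "Bs = replicate \<delta> (a - 1, b - int e) @ replicate \<tau> (a, b - 1)"
  and mor: "is_mor e (split_bundle e As) (split_bundle e Bs) \<phi>"
  and inj: "injective_mor e (split_bundle e As) \<phi>"
  and coker: "is_cokernel e (split_bundle e As) (split_bundle e Bs) \<phi> E q"
  and num: "int \<delta> * (a * (2 * b - 2 - int e * (a - 1))) + int \<tau> * ((a - 1) * (2 * b - int e * a)) =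
   int \<gamma> * (a * (2 * b - int e * (a - 1)))"
  and H2: "cohomology_zero e 2 (twist e (- ((a, b) + (a, b))) E)"
 shows "ulrich e (a, b) E"
proof -
 obtain M where M: "!!l k. l < length Bs ==> k < length As ==> cox_form e (Bs ! l - As ! k) (M l k)"
  "!!U v. zopen e U ==> (!!k. k < length As ==> reg e (As ! k) (\<Union>U) (v k)) ==>
    \<phi> U (tup (length As) U v) = tup (length Bs) U (%l p. SUM k<length As. M l k p * v k p)"
 proof (rule morphism_matrix[OF mor], goal_cases)
  case (1 M)
  show ?case by (rule 1(1)[OF 1(2,3)])
 qed
 interpret C: matrix_coker e As Bs \<phi> E q M by unfold_locales (rule inj coker M; assumption?)+
 have len: "length As = \<gamma>" "length Bs = \<delta> + \<tau>" by (simp_all add: As Bs)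
 have An: "As ! i = (a - 1, b - int e - 1)" if "i < length As" for i using that by (simp add: As)
 have Bn: "Bs ! k = (if k < \<delta> then (a - 1, b - int e) else (a, b - 1))" if "k < length Bs" for k
  using that unfolding Bs by (intro nth_two_blocks) simp
 define D1 where "D1 = - (a, b)"
 define D2 where "D2 = - ((a, b) + (a, b))"
 interpret C2: coker_sheaf e "twist e D2 E" "length Bs" "%k. Bs ! k + D2" "C.rep D2" "length As" "%i. As ! i + D2" M
  by (rule C.twist_coker_sheaf)
 \<comment> \<open>The degrees Serre dual to those of source and target twisted by -2h; the
   transposed matrix maps forms of degrees S to forms of degrees T.\<close>
 define T where "T i = canonical e - (As ! i + D2)" for i
 define S where "S k = canonical e - (Bs ! k + D2)" for k
 have TA: "T i = (a - 1, b - 1)" if "i < length As" for i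
  unfolding T_def An[OF that] D2_def canonical_def by simp
 have SB: "S k = (if k < \<delta> then (a - 1, b - 2) else (a - 2, b - 1 - int e))" if "k < length Bs" for k
  unfolding S_def Bn[OF that] D2_def canonical_def by simp
 have "(SUM k<length Bs. card (exps e (S k) {})) =
   (SUM k<\<delta> + \<tau>. card (exps e ((replicate \<delta> (a - 1, b - 2) @ replicate \<tau> (a - 2, b - 1 - int e)) ! k) {}))"
  unfolding len(2)[symmetric] by (intro sum.cong refl) (simp add: SB nth_two_blocks[symmetric] len)
 also have "... = \<delta> * card (exps e (a - 1, b - 2) {}) + \<tau> * card (exps e (a - 2, b - 1 - int e) {})"
  by (rule sum_two_blocks)
 also have "... = \<gamma> * card (exps e (a - 1, b - 1) {})" by (rule card_exps_blocks[OF ab num])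
 also have "... = (SUM i<length As. card (exps e (T i) {}))" by (simp add: TA len)
 finally have dim: "(SUM k<length Bs. card (exps e (S k) {})) = (SUM i<length As. card (exps e (T i) {}))" .
 have surX: "EX X. (ALL k<length Bs. cox_form e (S k) (X k)) & (ALL i<length As. ALL p:cone. g i p = (SUM k<length Bs. M k i p * X k p))"
  if g: "!!i. i < length As ==> cox_form e (T i) (g i)" for g
 proof (rule form_matrix_surjective[where F = "%i k. M k i", OF _ dim _ g])
  show "cox_form e (T i - S k) (M k i)" if "i < length As" "k < length Bs" for i k
   using M(1)[OF that(2,1)] by (simp add: T_def S_def)
  show "ALL k<length Bs. ALL p:cone. X k p = 0"
   if X: "ALL k<length Bs. cox_form e (S k) (X k)" "ALL i<length As. ALL p:cone. (SUM k<length Bs. M k i p * X k p) = 0" for X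
  proof (intro allI impI ballI)
   fix k :: nat and p :: "'k cox" assume k: "k < length Bs" and p: "p : cone"
   show "X k p = 0"
   proof (rule C2.H2_zeroE[folded numeral_2_eq_2, OF _ _ _ k p])
    show "cohomology_zero e 2 (twist e D2 E)" using H2 unfolding D2_def .
    show "cox_form e (canonical e - (Bs ! k + D2)) (X k)" if "k < length Bs" for k using X(1) that by (simp add: S_def)
    show "(SUM k<length Bs. X k p * M k i p) = 0" if "i < length As" "p : cone" for i p
     using X(2) that by (simp add: mult.commute)
   qed
  qed
 qed
 \<comment> \<open>Applied to Z at place h and 0 elsewhere, surjectivity yields row h of a matrix X
   with X M equal to Z times the identity.\<close>
 have sur: "EX X. (ALL k<length Bs. cox_form e (S k) (X k)) &
   (ALL i<length As. ALL p:cone. (SUM k<length Bs. X k p * M k i p) = (if i = h then Z p else 0))"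
  if h: "h < length As" and Z: "cox_form e (T h) Z" for h Z
 proof -
  have "cox_form e (T i) (if i = h then Z else (%p. 0))" for i using Z by (simp add: cox_form_0)
  from surX[of "%i. if i = h then Z else (%p. 0)", OF this]
  obtain X where X: "ALL k<length Bs. cox_form e (S k) (X k)"
   "ALL i<length As. ALL p:cone. (if i = h then Z else (%p. 0)) p = (SUM k<length Bs. M k i p * X k p)" by (elim exE conjE) (rule that)
  thus ?thesis by (intro exI[of _ X]) (simp add: mult.commute if_distrib[of "%f. f _"])
 qed
 have splitting: "EX \<sigma>. (ALL h<length As. ALL k<length Bs. reg e (As ! h - Bs ! k) (UT {i, j}) (\<sigma> h k)) &
   (ALL h<length As. ALL l<length As. ALL p:UT {i, j}. (SUM k<length Bs. \<sigma> h k p * M k l p) = (if l = h then 1 else 0))"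
  if ch: "chart i j" for i j
 proof -
  have "int e * (a - 1) <= b - 1" using ab by (simp add: algebra_simps)
  \<comment> \<open>A form of the degree of T without zeros on the chart; dividing X by it turns X M
    = Z into a left inverse of M there.\<close>
  then obtain Z :: "'k cox => 'k" where Z: "cox_form e (a - 1, b - 1) Z" "!!p. p : UT {i, j} ==> Z p ~= 0"
   using chart_form[OF ch, of "a - 1" "b - 1" e] ab by (metis diff_ge_0_iff_ge)
  have "ALL h:{..<length As}. EX X. (ALL k<length Bs. cox_form e (S k) (X k)) &
   (ALL i<length As. ALL p:cone. (SUM k<length Bs. X k p * M k i p) = (if i = h then Z p else 0))"
   using sur Z(1) TA by simp
  from bchoice[OF this] obtain X where X: "ALL h:{..<length As}. (ALL k<length Bs. cox_form e (S k) (X h k)) &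
   (ALL i<length As. ALL p:cone. (SUM k<length Bs. X h k p * M k i p) = (if i = h then Z p else 0))" ..
  have o: "opn e (UT {i, j})" by (rule reg_opn[OF tr_reg[OF ch, of e 0]])
  show ?thesis
  proof (intro exI[of _ "%h k p. X h k p / Z p"] conjI allI impI ballI)
   fix h k assume h: "h < length As" and k: "k < length Bs"
   have "reg e (S k - T h) (UT {i, j}) (%p. X h k p / Z p)"
    using X h k by (intro reg_divide reg_form o Z(2)) (simp_all add: TA Z(1))
   thus "reg e (As ! h - Bs ! k) (UT {i, j}) (%p. X h k p / Z p)" by (simp add: S_def T_def)
  next
   fix h l and p :: "'k cox" assume h: "h < length As" and l: "l < length As" and p: "p : UT {i, j}"
   have "p : cone" using p by (simp add: UT_def)
   hence "(SUM k<length Bs. X h k p * M k l p) = (if l = h then Z p else 0)" using X h l by simp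
   moreover have "(SUM k<length Bs. X h k p / Z p * M k l p) = (SUM k<length Bs. X h k p * M k l p) / Z p"
    by (simp add: sum_divide_distrib)
   ultimately show "(SUM k<length Bs. X h k p / Z p * M k l p) = (if l = h then 1 else 0)" using Z(2)[OF p] by simp
  qed
 qed
 interpret S1: split_coker e "twist e D1 E" "length Bs" "%k. Bs ! k + D1" "C.rep D1" "length As" "%i. As ! i + D1" M
  by (rule C.twist_split_coker[OF splitting])
 interpret S2: split_coker e "twist e D2 E" "length Bs" "%k. Bs ! k + D2" "C.rep D2" "length As" "%i. As ! i + D2" M
  by (rule C.twist_split_coker[OF splitting])
 \<comment> \<open>Twisted by -h, all summands have first entry -1 or degree (0, -1) and so no
   cohomology at all; hence both groups of E(-h) vanish.\<close>
 have A1: "As ! i + D1 = (-1, - int e - 1)" if "i < length As" for i unfolding An[OF that] D1_def by simp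
 have B1: "Bs ! k + D1 = (if k < \<delta> then (-1, - int e) else (0, -1))" if "k < length Bs" for k unfolding Bn[OF that] D1_def by simp
 have B2: "Bs ! k + D2 = (if k < \<delta> then (- a - 1, - b - int e) else (- a, - b - 1))" if "k < length Bs" for k
  unfolding Bn[OF that] D2_def by simp
 have "vector_bundle e E"
 proof (rule C.vector_bundle, intro allI impI)
  fix p :: "'k cox" and c i assume p: "p : cone" and z: "ALL k<length Bs. (SUM i<length As. M k i p * c i) = 0" and i: "i < length As"
  show "c i = 0" by (rule S1.M_inj[OF p _ i]) (use z in simp)
 qed
 moreover have "cohomology_zero e 0 (twist e D1 E)"
 proof (rule S1.H0_zeroI)
  show "noH1 e (As ! i + D1)" if "i < length As" for i unfolding A1[OF that] by (rule noH1_I) simp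
  fix k and f :: "'k cox => 'k" and p :: "'k cox" assume k: "k < length Bs" and f: "reg e (Bs ! k + D1) cone f" and p: "p : cone"
  show "f p = 0"
   by (rule exps_empty_reg[OF _ f p]) (simp add: B1[OF k] exps_empty)
 qed
 moreover have "cohomology_zero e 1 (twist e D1 E)"
 proof (rule S1.H1_zeroI[folded One_nat_def], goal_cases)
  case (1 k)
  show ?case unfolding B1[OF 1] by (simp add: noH1_I)
 next
  case prems: (2 I f d ci cj a w)
  interpret B: basic_cover e I f d ci cj by (rule prems(1))
  have ne: "~ negexp e (As ! i + D1) x" if "i < length As" for i x unfolding A1[OF that] by (rule no_negexp) simp
  obtain b where b: "!!x y k. x : I ==> y : I ==> k < length As ==> reg e (As ! k + D1) (B.A x Int B.A y) (b x y k)"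
   "!!x y z k p. x : I ==> y : I ==> z : I ==> k < length As ==> p : B.A x ==> p : B.A y ==> p : B.A z ==>
    a x y z k p = b y z k p - b x z k p + b x y k p"
   by (rule B.H2_zero_tuple[where c = a and D = "%i. As ! i + D1" and n = "length As", OF ne prems(2,3)]) (assumption | rule that)+
  show ?case by (intro exI[of _ b] conjI ballI allI impI) (use b in blast)+
 qed
 moreover have "cohomology_zero e 1 (twist e D2 E)"
 proof (rule S2.H1_zeroI[folded One_nat_def], goal_cases)
  case (1 k)
  show ?case unfolding B2[OF 1] using ab by (auto intro!: noH1_I simp: algebra_simps)
 next
  case prems: (2 I f d ci cj a w)
  interpret B: basic_cover e I f d ci cj by (rule prems(1))
  show ?case
   by (rule B.coboundary_lift[where bd = "%k. Bs ! k + D2" and M = M and n = "length Bs" and w = w, OF _ prems(2-5)])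
    (use sur in \<open>simp add: S_def T_def\<close>)
 qed
 ultimately show ?thesis using H2 unfolding ulrich_def D1_def D2_def by blast
qed

theorem ulrich_kernel:
 fixes E :: "('k::{alg_closed_field, field_char_0}, 'm) msheaf"
 assumes ab: "1 <= a" "a * int e < b"
  and As: "As = replicate lam (2 * a - 1, 2 * b - 2) @ replicate \<mu> (2 * a - 2, 2 * b - 1 - int e)"
  and Bs: "Bs = replicate \<nu> (2 * a - 1, 2 * b - 1)"
  and mor: "is_mor e (split_bundle e As) (split_bundle e Bs) \<psi>"
  and surj: "surjective_mor e (split_bundle e As) (split_bundle e Bs) \<psi>"
  and ker: "is_kernel e (split_bundle e As) (split_bundle e Bs) \<psi> E j"
  and num: "int lam * (a * (2 * b - 2 - int e * (a - 1))) + int \<mu> * ((a - 1) * (2 * b - int e * a)) =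
   int \<nu> * (a * (2 * b - int e * (a - 1)))"
  and H0: "cohomology_zero e 0 (twist e (- (a, b)) E)"
 shows "ulrich e (a, b) E"
proof -
 obtain M where M: "!!l k. l < length Bs ==> k < length As ==> cox_form e (Bs ! l - As ! k) (M l k)"
  "!!U v. zopen e U ==> (!!k. k < length As ==> reg e (As ! k) (\<Union>U) (v k)) ==>
    \<psi> U (tup (length As) U v) = tup (length Bs) U (%l p. SUM k<length As. M l k p * v k p)"
 proof (rule morphism_matrix[OF mor], goal_cases)
  case (1 M)
  show ?case by (rule 1(1)[OF 1(2,3)])
 qed
 interpret C: matrix_kernel e As Bs \<psi> E j M by unfold_locales (rule ker M; assumption?)+
 have len: "length As = lam + \<mu>" "length Bs = \<nu>" by (simp_all add: As Bs)
 have Bn: "Bs ! l = (2 * a - 1, 2 * b - 1)" if "l < length Bs" for l using that by (simp add: Bs)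
 have An: "As ! k = (if k < lam then (2 * a - 1, 2 * b - 2) else (2 * a - 2, 2 * b - 1 - int e))" if "k < length As" for k
  using that unfolding As by (intro nth_two_blocks) simp
 define D1 where "D1 = - (a, b)"
 define D2 where "D2 = - ((a, b) + (a, b))"
 interpret K1: kernel_sheaf e "twist e D1 E" "length As" "%k. As ! k + D1" "C.rep D1" "length Bs" "%l. Bs ! l + D1" M
  by (rule C.twist_kernel_sheaf)
 interpret K2: kernel_sheaf e "twist e D2 E" "length As" "%k. As ! k + D2" "C.rep D2" "length Bs" "%l. Bs ! l + D2" M
  by (rule C.twist_kernel_sheaf)
 have B1: "Bs ! l + D1 = (a - 1, b - 1)" if "l < length Bs" for l unfolding Bn[OF that] D1_def by simp
 \<comment> \<open>Twisted by -2h, the target has neither sections nor first cohomology, and the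
   source below has no first or second cohomology; this gives both groups of E(-2h).\<close>
 have B2: "Bs ! l + D2 = (-1, -1)" if "l < length Bs" for l unfolding Bn[OF that] D2_def by simp
 have A1: "As ! k + D1 = (if k < lam then (a - 1, b - 2) else (a - 2, b - 1 - int e))" if "k < length As" for k
  unfolding An[OF that] D1_def by simp
 have A2: "As ! k + D2 = (if k < lam then (-1, -2) else (-2, -1 - int e))" if "k < length As" for k
  unfolding An[OF that] D2_def by simp
 have "(SUM k<length As. card (exps e (As ! k + D1) {})) =
   (SUM k<lam + \<mu>. card (exps e ((replicate lam (a - 1, b - 2) @ replicate \<mu> (a - 2, b - 1 - int e)) ! k) {}))"
  unfolding len(1)[symmetric] by (intro sum.cong refl) (simp add: A1 nth_two_blocks[symmetric] len)
 also have "... = lam * card (exps e (a - 1, b - 2) {}) + \<mu> * card (exps e (a - 2, b - 1 - int e) {})"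
  by (rule sum_two_blocks)
 also have "... = \<nu> * card (exps e (a - 1, b - 1) {})" by (rule card_exps_blocks[OF ab num])
 also have "... = (SUM l<length Bs. card (exps e (Bs ! l + D1) {}))" by (simp add: B1 len)
 finally have dim: "(SUM k<length As. card (exps e (As ! k + D1) {})) = (SUM l<length Bs. card (exps e (Bs ! l + D1) {}))" .
 have sur: "EX w. (ALL k<length As. cox_form e (As ! k + D1) (w k)) & (ALL l<length Bs. ALL p:cone. g l p = (SUM k<length As. M l k p * w k p))"
  if g: "!!l. l < length Bs ==> cox_form e (Bs ! l + D1) (g l)" for g
 proof (rule form_matrix_surjective[where F = M, OF _ dim _ g])
  show "cox_form e ((Bs ! l + D1) - (As ! k + D1)) (M l k)" if "l < length Bs" "k < length As" for l k
   using M(1)[OF that] by simp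
  show "ALL k<length As. ALL p:cone. w k p = 0"
   if w: "ALL k<length As. cox_form e (As ! k + D1) (w k)" "ALL l<length Bs. ALL p:cone. (SUM k<length As. M l k p * w k p) = 0" for w
  proof (intro allI impI ballI)
   fix k :: nat and p :: "'k cox" assume k: "k < length As" and p: "p : cone"
   show "w k p = 0"
    by (rule K1.H0_zeroE[OF _ _ _ k p]) (use H0 w in \<open>simp_all add: D1_def reg_form\<close>)
  qed
 qed
 have "vector_bundle e E" by (rule C.vector_bundle[OF surj])
 moreover have "cohomology_zero e 1 (twist e D1 E)"
 proof (rule K1.H1_zeroI[folded One_nat_def])
  show "noH1 e (As ! k + D1)" if "k < length As" for k
   unfolding A1[OF that] using ab by (auto intro!: noH1_I simp: algebra_simps)
  fix g :: "nat => 'k cox => 'k" assume g: "!!l. l < length Bs ==> reg e (Bs ! l + D1) cone (g l)"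
  have "EX G. cox_form e (Bs ! l + D1) G & (ALL p:cone. g l p = G p)" if "l < length Bs" for l
  proof (rule reg_cone_form[OF g[OF that]])
   fix F assume "cox_form e (Bs ! l + D1) F" "!!p. p : cone ==> g l p = F p"
   thus ?thesis by (intro exI[of _ F]) simp
  qed
  hence "EX G. ALL l:{..<length Bs}. cox_form e (Bs ! l + D1) (G l) & (ALL p:cone. g l p = G l p)" by (intro bchoice) simp
  then obtain G where G: "ALL l:{..<length Bs}. cox_form e (Bs ! l + D1) (G l) & (ALL p:cone. g l p = G l p)" ..
  have "EX w. (ALL k<length As. cox_form e (As ! k + D1) (w k)) & (ALL l<length Bs. ALL p:cone. G l p = (SUM k<length As. M l k p * w k p))"
   by (rule sur) (use G in simp)
  then obtain w where w: "ALL k<length As. cox_form e (As ! k + D1) (w k)"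
   "ALL l<length Bs. ALL p:cone. G l p = (SUM k<length As. M l k p * w k p)" by (elim exE conjE) (rule that)
  show "EX w. (ALL k<length As. reg e (As ! k + D1) cone (w k)) & (ALL l<length Bs. ALL p:cone. g l p = (SUM k<length As. M l k p * w k p))"
   using w G by (intro exI[of _ w]) (simp add: reg_form)
 qed
 moreover have "cohomology_zero e 1 (twist e D2 E)"
 proof (rule K2.H1_zeroI[folded One_nat_def])
  show "noH1 e (As ! k + D2)" if "k < length As" for k
   unfolding A2[OF that] by (auto intro!: noH1_I)
  fix g :: "nat => 'k cox => 'k" assume g: "!!l. l < length Bs ==> reg e (Bs ! l + D2) cone (g l)"
  have "g l p = 0" if "l < length Bs" "p : cone" for l and p :: "'k cox"
   by (rule exps_empty_reg[OF _ g[OF that(1)] that(2)]) (simp add: B2[OF that(1)] exps_empty)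
  thus "EX w. (ALL k<length As. reg e (As ! k + D2) cone (w k)) & (ALL l<length Bs. ALL p:cone. g l p = (SUM k<length As. M l k p * w k p))"
   by (intro exI[of _ "%k p. 0"]) (simp add: reg_0)
 qed
 moreover have "cohomology_zero e 2 (twist e D2 E)"
 proof (rule K2.H2_zeroI[folded numeral_2_eq_2])
  show "~ negexp e (As ! k + D2) x" if "k < length As" for k x
   unfolding A2[OF that] by (auto dest!: no_negexp[THEN notE, rotated])
  show "noH1 e (Bs ! l + D2)" if "l < length Bs" for l unfolding B2[OF that] by (rule noH1_I) simp
 qed (rule C.local_lift[OF surj])
 ultimately show ?thesis using H0 unfolding ulrich_def D1_def D2_def by blast
qed

lemma rat_half_eq:
 "rat_of_int x = rat_of_int r / 2 * (3 * rat_of_int y + rat_of_int z) ==> 2 * x = r * (3 * y + z)"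
proof -
 assume "rat_of_int x = rat_of_int r / 2 * (3 * rat_of_int y + rat_of_int z)"
 hence "rat_of_int (2 * x) = rat_of_int (r * (3 * y + z))" by simp
 thus ?thesis by (simp only: of_int_eq_iff)
qed

theorem theorem1p2:
  fixes e :: nat and a b :: int
  assumes "very_ample TYPE('k::{alg_closed_field, field_char_0}) e (a, b)"
  shows "(\<forall>(\<gamma>::nat) (\<delta>::nat) (\<tau>::nat) (r::int) (\<alpha>::int) (\<beta>::int) S T \<phi> (E :: ('k, 'm) msheaf) q.
            0 < \<gamma> \<and> \<gamma> < \<delta> + \<tau> \<and>
            S = split_bundle e (replicate \<gamma> (a - 1, b - int e - 1)) \<and>
            T = split_bundle e (replicate \<delta> (a - 1, b - int e) @ replicate \<tau> (a, b - 1)) \<and>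
            is_mor e S T \<phi> \<and> injective_mor e S \<phi> \<and> is_cokernel e S T \<phi> E q \<and>
            r = int \<delta> + int \<tau> - int \<gamma> \<and>
            \<alpha> = int \<tau> + r * (a - 1) \<and>
            \<beta> = r * (b - 1) + int \<delta> - int e * (r - int \<tau>) \<longrightarrow>
            has_c1 e E (\<alpha>, \<beta>) \<and>
            (rat_of_int (intersection e (\<alpha>, \<beta>) (a, b)) =
               rat_of_int r / 2 * (3 * rat_of_int (intersection e (a, b) (a, b))
                                   + rat_of_int (intersection e (a, b) (canonical e))) \<longrightarrow>
             (ulrich e (a, b) E \<longleftrightarrow> cohomology_zero e 2 (twist e (- ((a, b) + (a, b))) E))))
       \<and> (\<forall>(lam::nat) (\<mu>::nat) (\<nu>::nat) (r::int) (\<alpha>::int) (\<beta>::int) S T \<psi> (E :: ('k, 'n) msheaf) j.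
            0 < \<nu> \<and> \<nu> < lam + \<mu> \<and>
            S = split_bundle e (replicate lam (2 * a - 1, 2 * b - 2)
                                @ replicate \<mu> (2 * a - 2, 2 * b - 1 - int e)) \<and>
            T = split_bundle e (replicate \<nu> (2 * a - 1, 2 * b - 1)) \<and>
            is_mor e S T \<psi> \<and> surjective_mor e S T \<psi> \<and> is_kernel e S T \<psi> E j \<and>
            r = int lam + int \<mu> - int \<nu> \<and>
            \<alpha> = r * (2 * a - 1) - int \<mu> \<and>
            \<beta> = r * (2 * b - 1 - int e) - int lam - int e * (int \<mu> - r) \<longrightarrow>
            has_c1 e E (\<alpha>, \<beta>) \<and>
            (rat_of_int (intersection e (\<alpha>, \<beta>) (a, b)) =
               rat_of_int r / 2 * (3 * rat_of_int (intersection e (a, b) (a, b))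
                                   + rat_of_int (intersection e (a, b) (canonical e))) \<longrightarrow>
             (ulrich e (a, b) E \<longleftrightarrow> cohomology_zero e 0 (twist e (- (a, b)) E))))"
proof -
 \<comment> \<open>Very ampleness enters the argument through these two inequalities.\<close>
 note ab = very_ample_pos[OF assms]
 show ?thesis
 proof (intro conjI allI impI; elim conjE)
  fix \<gamma> \<delta> \<tau> :: nat and r \<alpha> \<beta> :: int and S T \<phi> and E :: "('k, 'm) msheaf" and q
  assume S: "S = split_bundle e (replicate \<gamma> (a - 1, b - int e - 1))"
   and T: "T = split_bundle e (replicate \<delta> (a - 1, b - int e) @ replicate \<tau> (a, b - 1))"
   and m: "is_mor e S T \<phi>" "injective_mor e S \<phi>" "is_cokernel e S T \<phi> E q"
   and r: "r = int \<delta> + int \<tau> - int \<gamma>" "\<alpha> = int \<tau> + r * (a - 1)" "\<beta> = r * (b - 1) + int \<delta> - int e * (r - int \<tau>)"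
  have c: "(\<alpha>, \<beta>) = sum_list (replicate \<delta> (a - 1, b - int e) @ replicate \<tau> (a, b - 1))
    - sum_list (replicate \<gamma> (a - 1, b - int e - 1))"
   by (simp add: sum_list_replicate_pair r algebra_simps)
  show "has_c1 e E (\<alpha>, \<beta>)" unfolding has_c1_def
   using m[unfolded S T] c by blast
  assume "rat_of_int (intersection e (\<alpha>, \<beta>) (a, b)) = rat_of_int r / 2 *
   (3 * rat_of_int (intersection e (a, b) (a, b)) + rat_of_int (intersection e (a, b) (canonical e)))"
  hence "2 * intersection e (\<alpha>, \<beta>) (a, b) = r * (3 * intersection e (a, b) (a, b) + intersection e (a, b) (canonical e))"
   by (rule rat_half_eq)
  \<comment> \<open>Expanded, the condition on c1 becomes linear in the three multiplicities: the
    doubled equality of dimensions required by \<open>card_exps_blocks\<close>.\<close>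
  hence num: "int \<delta> * (a * (2 * b - 2 - int e * (a - 1))) + int \<tau> * ((a - 1) * (2 * b - int e * a)) =
   int \<gamma> * (a * (2 * b - int e * (a - 1)))"
   unfolding intersection_def canonical_def r by (simp add: algebra_simps)
  show "ulrich e (a, b) E \<longleftrightarrow> cohomology_zero e 2 (twist e (- ((a, b) + (a, b))) E)"
  proof
   assume "ulrich e (a, b) E"
   thus "cohomology_zero e 2 (twist e (- ((a, b) + (a, b))) E)" unfolding ulrich_def by blast
  next
   assume "cohomology_zero e 2 (twist e (- ((a, b) + (a, b))) E)"
   thus "ulrich e (a, b) E" by (rule ulrich_cokernel[OF ab refl refl m[unfolded S T] num])
  qed
 next
  fix lam \<mu> \<nu> :: nat and r \<alpha> \<beta> :: int and S T \<psi> and E :: "('k, 'n) msheaf" and j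
  assume S: "S = split_bundle e (replicate lam (2 * a - 1, 2 * b - 2) @ replicate \<mu> (2 * a - 2, 2 * b - 1 - int e))"
   and T: "T = split_bundle e (replicate \<nu> (2 * a - 1, 2 * b - 1))"
   and m: "is_mor e S T \<psi>" "surjective_mor e S T \<psi>" "is_kernel e S T \<psi> E j"
   and r: "r = int lam + int \<mu> - int \<nu>" "\<alpha> = r * (2 * a - 1) - int \<mu>"
    "\<beta> = r * (2 * b - 1 - int e) - int lam - int e * (int \<mu> - r)"
  have c: "(\<alpha>, \<beta>) = sum_list (replicate lam (2 * a - 1, 2 * b - 2) @ replicate \<mu> (2 * a - 2, 2 * b - 1 - int e))
    - sum_list (replicate \<nu> (2 * a - 1, 2 * b - 1))"
   by (simp add: sum_list_replicate_pair r algebra_simps)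
  show "has_c1 e E (\<alpha>, \<beta>)" unfolding has_c1_def
   using m[unfolded S T] c by blast
  assume "rat_of_int (intersection e (\<alpha>, \<beta>) (a, b)) = rat_of_int r / 2 *
   (3 * rat_of_int (intersection e (a, b) (a, b)) + rat_of_int (intersection e (a, b) (canonical e)))"
  hence "2 * intersection e (\<alpha>, \<beta>) (a, b) = r * (3 * intersection e (a, b) (a, b) + intersection e (a, b) (canonical e))"
   by (rule rat_half_eq)
  hence num: "int lam * (a * (2 * b - 2 - int e * (a - 1))) + int \<mu> * ((a - 1) * (2 * b - int e * a)) =
   int \<nu> * (a * (2 * b - int e * (a - 1)))"
   unfolding intersection_def canonical_def r by (simp add: algebra_simps)
  show "ulrich e (a, b) E \<longleftrightarrow> cohomology_zero e 0 (twist e (- (a, b)) E)"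
  proof
   assume "ulrich e (a, b) E"
   thus "cohomology_zero e 0 (twist e (- (a, b)) E)" unfolding ulrich_def by blast
  next
   assume "cohomology_zero e 0 (twist e (- (a, b)) E)"
   thus "ulrich e (a, b) E" by (rule ulrich_kernel[OF ab refl refl m[unfolded S T] num])
  qed
 qed
qed

end
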